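(* Let $(S)$ be a connected Hopf SDSE in the abelian, fundamental case (i.e. $(S)$ is an extended fundamental, abelian SDSE). Then the Lie algebra $\mathfrak g_{(S)}$ is of the form $$\mathfrak g_m\triangleleft(\mathfrak g_{m-1}\triangleleft(\cdots\mathfrak g_2\triangleleft(\mathfrak g_1\triangleleft\mathfrak g_0)\cdots)),$$ where $\mathfrak g_0$ is the Lie algebra associated to the restriction of $(S)$ to the non-extension vertices, and, for $j\ge1$, $\mathfrak g_j$ is an abelian $\big(\mathfrak g_{j-1}\triangleleft(\cdots\mathfrak g_2\triangleleft(\mathfrak g_1\triangleleft\mathfrak g_0)\cdots)\big)$-module having a basis $(h^{(j)}(k))_{k\ge1}$. Here $\mathfrak g_0$ has the following form, which is that of the Lie algebra of any Hopf SDSE of abelian fundamental type with no extension vertices: for some $M,N$ and some $\upsilon^{(1)},\ldots,\upsilon^{(N)}\in K^M$, $$\mathfrak g_0\approx W\triangleleft\Big(\big(V_{\upsilon^{(1)}}\oplus\cdots\oplus V_{\upsilon^{(N)}}\big)\triangleleft\mathfrak g_{ab}\Big),$$ where $W$ is a direct sum of modules $W_\nu$ and $W'_{\nu,\mu}$.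
   Context: **SDSE.** $K$ is a field of characteristic zero, $I$ a finite non-empty set. $\mathcal H_I$ is the (Connes-Kreimer) polynomial algebra generated by the (isomorphism classes of non-planar) rooted trees with vertices decorated by $I$, graded by the number of vertices, with completion $\widehat{\mathcal H_I}=\prod_n\mathcal H_I(n)$. Its coproduct is the algebra morphism with $\Delta(t)=t\otimes1+1\otimes t+\sum_cP^c(t)\otimes R^c(t)$ for each tree $t$, where $c$ runs over non-empty sets of edges such that every path from the root to a leaf meets at most one edge of $c$; after deleting the edges of $c$, $R^c(t)$ is the component of the root and $P^c(t)$ the product of the other components. $B_i^+$ grafts the trees of a forest on a common root decorated by $i$. The SDSE (system of combinatorial Dyson-Schwinger equations) $(S)$ associated to non-constant series $F_i\in K[[h_j,j\in I]]$ (here always with $F_i(0)=1$) is the system $X_i=B_i^+(F_i(X_j,j\in I))$, $i\in I$, which has a unique solution in $\widehat{\mathcal H_I}^{\,I}$; $X_i(n)$ is the degree $n$ component of $X_i$ and $\mathcal H_{(S)}$ the subalgebra generated by the $X_i(n)$. $(S)$ is Hopf if $\mathcal H_{(S)}$ is a Hopf subalgebra of $\mathcal H_I$; then $\mathfrak g_{(S)}=\mathrm{Prim}(\mathcal H_{(S)}^* )$ is the Lie algebra of primitive elements of the graded dual of $\mathcal H_{(S)}$. The graph of $(S)$ has vertex set $I$ and an edge $i\to j$ iff $\partial F_i/\partial h_j\neq0$; $(S)$ is connected if this graph is connected. A descendant of $i$ is a vertex $j$ such that there is an oriented path from $i$ to $j$. **Operations.** A change of variables replaces $(F_i(h_j,j\in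 I))_i$ by $(F_i(\lambda_jh_j,j\in I))_i$, $\lambda_j\in K-\{0\}$. The restriction of $(S)$ to $I'\subseteq I$ is the SDSE associated to the series $F_i$, $i\in I'$, in which $h_j$ is replaced by $0$ for all $j\notin I'$. A dilatation of $(F_i)_{i\in I}$ is a system $(F'_x)_{x\in J}$, $J$ finite with a partition $J=\bigcup_{i\in I}J_i$ into non-empty sets, with $F'_x=F_i(\sum_{y\in J_j}h_y,j\in I)$ for $x\in J_i$. An extension of a Hopf SDSE $(F_i)_{i\in I}$ is a system $(F_i)_{i\in I\cup\{0\}}$, $0\notin I$, with $F_0=1+\sum_{i\in I}a^{(0)}_ih_i$ and $F_i=F_j$ whenever $a^{(0)}_i\ne0$ and $a^{(0)}_j\ne0$. A vertex $i$ of a Hopf SDSE $(S)$ is an extension vertex if, denoting by $J$ the set of descendants of $i$, the restriction of $(S)$ to $J\cup\{i\}$ is an extension of the restriction of $(S)$ to $J$; the other vertices are the non-extension vertices. **Fundamental abelian SDSE**: up to a change of variables, a dilatation of a basic system of the following form (all such systems are Hopf). The index set is a disjoint union $I_0\cup I_1\cup J_1$ with $I_0\ne\emptyset$ ($I_1,J_1$ possibly empty), all series are non-constant, and (with $(1+h)^a=\sum_k\frac{a(a-1)\cdots(a-k+1)}{k!}h^k$): (1) for $i\in I_0$, $F_i=1+h_i$; (2) for $i\in I_1$ there are $\nu_i\in K$ and scalars $(a^{(i)}_j)_{j\in I_0}$, with $\nu_i\ne1$ or $a^{(i)}_j\neq0$ for some $j\in I_0$, such that $F_i=\frac1{\nu_i}\prod_{j\in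 I_0}(1+h_j)^{\nu_ia^{(i)}_j}+1-\frac1{\nu_i}$ if $\nu_i\ne0$, and $F_i=1+\sum_{j\in I_0}a^{(i)}_j\ln(1+h_j)$ if $\nu_i=0$; (3) for $i\in J_1$ there are $\nu_i\in K-\{0\}$ and scalars $(a^{(i)}_j)_{j\in I_0\cup I_1}$ such that $I_1^{(i)}=\{j\in I_1:a^{(i)}_j\neq0\}\ne\emptyset$, $\nu_j=1$ for $j\in I_1^{(i)}$, $F_j=F_k$ for $j,k\in I_1^{(i)}$, and, with $b^{(i)}_t=a^{(j)}_t$ for any $j\in I_1^{(i)}$ and all $t\in I_0$, $F_i=\frac1{\nu_i}\prod_{j\in I_0}(1+h_j)^{b^{(i)}_j}+\sum_{j\in I_1^{(i)}}a^{(i)}_jh_j+1-\frac1{\nu_i}$. An extended fundamental, abelian SDSE is one obtained from a fundamental abelian SDSE by a finite number (possibly $0$) of extensions. **Lie algebras and modules.** $\mathfrak a\triangleleft\mathfrak b$ denotes the semi-direct product of a Lie algebra $\mathfrak b$ with a $\mathfrak b$-module $\mathfrak a$, the latter considered as an abelian ideal; $[b,a]=b.a$ for $b\in\mathfrak b$, $a\in\mathfrak a$. $\mathfrak g_{ab}$ is the abelian Lie algebra with basis $(e^{(i)}(k))_{1\le i\le M,k\ge1}$. For $\upsilon\in K^M$, $V_\upsilon$ is the $\mathfrak g_{ab}$-module with basis $(f(k))_{k\ge1}$ and $e^{(i)}(k).f(l)=\upsilon_if(k+l)$; the basis of $V_{\upsilon^{(j)}}$ is denoted $(f^{(j)}(k))_{k\ge1}$.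 Over $\big(\bigoplus_{j=1}^NV_{\upsilon^{(j)}}\big)\triangleleft\mathfrak g_{ab}$, the following modules have a basis $(g(k))_{k\ge1}$: - $W_\nu$, $\nu\in K^M$: $e^{(i)}(k).g(1)=\nu_ig(k+1)$; $e^{(i)}(k).g(l)=0$ if $l\ge2$; $f^{(j)}(k).g(l)=0$. - $W'_{\nu,\mu}$, $\nu\in K^M$, $\mu\in K^N$ with $\mu_j(\nu_i-\upsilon^{(j)}_i)=0$ for all $i,j$: $e^{(i)}(k).g(l)=\nu_ig(k+l)$; $f^{(j)}(k).g(1)=\mu_jg(k+1)$; $f^{(j)}(k).g(l)=0$ if $l\ge2$. *)

theory Defs
  imports
    "HOL-Library.Multiset"
    "HOL-Library.Poly_Mapping"
    "HOL-Library.Product_Plus"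
    "HOL-Library.Function_Algebras"
    "HOL-Library.Sublist"
    "HOL-Computational_Algebra.Formal_Power_Series"
begin

section \<open>Formal power series in several variables\<close>

text \<open>Monomials in the variables \<open>'v\<close> are multisets over \<open>'v\<close>. The type serves twice: for the series
  \<open>F\<^sub>i\<close>, with the index type as variables, and for the completion of the Connes-Kreimer algebra,
  with rooted trees as variables (a monomial is then a forest).\<close>

typedef ('v, 'a) mfps = "UNIV :: ('v multiset \<Rightarrow> 'a) set"
  morphisms mcoeff Abs_mfps by simp

lemmas mcoeff_Abs_mfps [simp] = Abs_mfps_inverse [OF UNIV_I]

lemma mfps_eqI: "(\<And>m. mcoeff f m = mcoeff g m) \<Longrightarrow> f = g"
  by (simp add: mcoeff_inject [symmetric] fun_eq_iff)

definition msplits :: "'v multiset \<Rightarrow> ('v multiset \<times> 'v multiset) set"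
  where "msplits m = {(a, b). a + b = m}"

lemma finite_msplits [simp, intro]: "finite (msplits m)"
proof (induction m)
  case empty
  have "msplits {#} = {({#}, {#} :: 'a multiset)}"
    by (auto simp: msplits_def)
  then show ?case by simp
next
  case (add x m)
  have "msplits (add_mset x m) \<subseteq>
      (\<lambda>(a, b). (add_mset x a, b)) ` msplits m \<union> (\<lambda>(a, b). (a, add_mset x b)) ` msplits m"
  proof
    fix p assume "p \<in> msplits (add_mset x m)"
    then obtain a b where p: "p = (a, b)" and ab: "a + b = add_mset x m"
      by (auto simp: msplits_def)
    have "x \<in># a + b"
      using ab by simp
    then consider "x \<in># a" | "x \<in># b" by auto
    then show "p \<in> (\<lambda>(a, b). (add_mset x a, b)) ` msplits m \<union> (\<lambda>(a, b). (a, add_mset x b)) ` msplits m"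
    proof cases
      case 1
      then obtain a' where "a = add_mset x a'" by (meson multi_member_split)
      then show ?thesis using ab p by (force simp: msplits_def)
    next
      case 2
      then obtain b' where "b = add_mset x b'" by (meson multi_member_split)
      then show ?thesis using ab p by (force simp: msplits_def)
    qed
  qed
  then show ?case
    using add.IH by (meson finite_UnI finite_imageI finite_subset)
qed

lemma msplits_empty_left:
  fixes m :: "'v multiset"
  shows "(\<Sum>(a, b)\<in>msplits m. (if a = {#} then (1::'a::comm_ring_1) else 0) * f b) = f m"
proof -
  have "(\<Sum>(a, b)\<in>msplits m. (if a = {#} then (1::'a) else 0) * f b)
      = (\<Sum>(a, b)\<in>{({#} :: 'v multiset, m)}. (if a = {#} then (1::'a) else 0) * f b)"
    by (rule sum.mono_neutral_right [OF finite_msplits])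
       (auto simp: msplits_def split: if_splits)
  then show ?thesis by simp
qed

instantiation mfps :: (type, comm_ring_1) comm_ring_1
begin

definition zero_mfps :: "('a, 'b) mfps" where "0 = Abs_mfps (\<lambda>_. 0)"
definition one_mfps :: "('a, 'b) mfps" where "1 = Abs_mfps (\<lambda>m. if m = {#} then 1 else 0)"
definition plus_mfps :: "('a, 'b) mfps \<Rightarrow> ('a, 'b) mfps \<Rightarrow> ('a, 'b) mfps"
  where "f + g = Abs_mfps (\<lambda>m. mcoeff f m + mcoeff g m)"
definition minus_mfps :: "('a, 'b) mfps \<Rightarrow> ('a, 'b) mfps \<Rightarrow> ('a, 'b) mfps"
  where "f - g = Abs_mfps (\<lambda>m. mcoeff f m - mcoeff g m)"
definition uminus_mfps :: "('a, 'b) mfps \<Rightarrow> ('a, 'b) mfps"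
  where "- f = Abs_mfps (\<lambda>m. - mcoeff f m)"
definition times_mfps :: "('a, 'b) mfps \<Rightarrow> ('a, 'b) mfps \<Rightarrow> ('a, 'b) mfps"
  where "f * g = Abs_mfps (\<lambda>m. \<Sum>(a, b)\<in>msplits m. mcoeff f a * mcoeff g b)"

instance
proof
  fix f g h :: "('a, 'b) mfps"
  show "f * g * h = f * (g * h)"
  proof (rule mfps_eqI)
    fix m
    let ?t = "\<lambda>a b c. mcoeff f a * (mcoeff g b * mcoeff h c)"
    have "mcoeff (f * g * h) m
        = (\<Sum>p\<in>msplits m. \<Sum>q\<in>msplits (fst p). ?t (fst q) (snd q) (snd p))"
      by (simp add: times_mfps_def sum_distrib_right case_prod_beta mult.assoc)
    also have "\<dots> = (\<Sum>(p, q)\<in>(SIGMA p:msplits m. msplits (fst p)). ?t (fst q) (snd q) (snd p))"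
      by (rule sum.Sigma) auto
    also have "\<dots> = (\<Sum>(p, q)\<in>(SIGMA p:msplits m. msplits (snd p)). ?t (fst p) (fst q) (snd q))"
      by (rule sum.reindex_bij_witness
          [of _ "\<lambda>(p, q). ((fst p + fst q, snd q), (fst p, fst q))"
             "\<lambda>(p, q). ((fst q, snd q + snd p), (snd q, snd p))"])
         (auto simp: msplits_def add.assoc)
    also have "\<dots> = (\<Sum>p\<in>msplits m. \<Sum>q\<in>msplits (snd p). ?t (fst p) (fst q) (snd q))"
      by (rule sum.Sigma [symmetric]) auto
    also have "\<dots> = mcoeff (f * (g * h)) m"
      by (simp add: times_mfps_def sum_distrib_left case_prod_beta)
    finally show "mcoeff (f * g * h) m = mcoeff (f * (g * h)) m" .
  qed
  show "f * g = g * f"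
  proof (rule mfps_eqI)
    fix m
    show "mcoeff (f * g) m = mcoeff (g * f) m"
      unfolding times_mfps_def mcoeff_Abs_mfps
      by (rule sum.reindex_bij_witness [of _ prod.swap prod.swap])
         (auto simp: msplits_def mult.commute add.commute)
  qed
  show "1 * f = f"
    by (rule mfps_eqI) (simp add: times_mfps_def one_mfps_def msplits_empty_left)
  show "(f + g) * h = f * h + g * h"
    by (rule mfps_eqI)
       (simp add: times_mfps_def plus_mfps_def algebra_simps sum.distrib case_prod_beta)
  show "f + g + h = f + (g + h)" "f + g = g + f" "0 + f = f" "- f + f = 0" "f - g = f + - g"
    by (auto intro!: mfps_eqI
        simp: plus_mfps_def zero_mfps_def uminus_mfps_def minus_mfps_def algebra_simps)
  show "(0 :: ('a, 'b) mfps) \<noteq> 1"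
  proof
    assume "(0 :: ('a, 'b) mfps) = 1"
    then have "mcoeff (0 :: ('a, 'b) mfps) {#} = mcoeff 1 {#}" by simp
    then show False by (simp add: zero_mfps_def one_mfps_def)
  qed
qed

end

definition mconst :: "'a::comm_ring_1 \<Rightarrow> ('v, 'a) mfps"
  where "mconst c = Abs_mfps (\<lambda>m. if m = {#} then c else 0)"

text \<open>\<open>muni f j\<close> is the univariate series \<open>f\<close> in the variable \<open>h\<^sub>j\<close>.\<close>

definition muni :: "'a::comm_ring_1 fps \<Rightarrow> 'v \<Rightarrow> ('v, 'a) mfps"
  where "muni f j = Abs_mfps (\<lambda>m. if set_mset m \<subseteq> {j} then fps_nth f (size m) else 0)"

definition mvar :: "'v \<Rightarrow> ('v, 'a::comm_ring_1) mfps"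
  where "mvar j = muni fps_X j"

definition mderiv :: "'v \<Rightarrow> ('v, 'a::comm_ring_1) mfps \<Rightarrow> ('v, 'a) mfps"
  where "mderiv j f = Abs_mfps (\<lambda>m. of_nat (Suc (count m j)) * mcoeff f (add_mset j m))"

text \<open>Substitution of \<open>X j\<close> for the variable \<open>h\<^sub>j\<close>. For each monomial \<open>p\<close> the sum over \<open>m\<close> has only
  finitely many non-zero terms whenever \<open>f\<close> involves finitely many variables and the series
  \<open>X j\<close> have zero constant term, which is the case in all uses below.\<close>

definition msubst :: "('v, 'a::comm_ring_1) mfps \<Rightarrow> ('v \<Rightarrow> ('w, 'a) mfps) \<Rightarrow> ('w, 'a) mfps"
  where "msubst f X =
    Abs_mfps (\<lambda>p. Sum_any (\<lambda>m. mcoeff f m * mcoeff (prod_mset (image_mset X m)) p))"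

definition series_in :: "'v set \<Rightarrow> ('v, 'a::comm_ring_1) mfps \<Rightarrow> bool"
  where "series_in I f \<longleftrightarrow> (\<forall>m. mcoeff f m \<noteq> 0 \<longrightarrow> set_mset m \<subseteq> I)"

definition nonconstant :: "('v, 'a::comm_ring_1) mfps \<Rightarrow> bool"
  where "nonconstant f \<longleftrightarrow> (\<forall>c. f \<noteq> mconst c)"


section \<open>The Connes-Kreimer Hopf algebra of decorated rooted trees\<close>

datatype (decorations: 'i) rtree = Node 'i "'i rtree multiset"

type_synonym 'i forest = "'i rtree multiset"

primrec nverts :: "'i rtree \<Rightarrow> nat"
  where "nverts (Node i ts) = Suc (sum_mset (image_mset nverts ts))"

definition weight :: "'i forest \<Rightarrow> nat"
  where "weight p = sum_mset (image_mset nverts p)"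

definition forests_on :: "'i set \<Rightarrow> 'i forest set"
  where "forests_on I = {p. \<forall>t\<in>#p. decorations t \<subseteq> I}"

text \<open>Polynomials in the rooted trees are finitely supported functions on forests, with the
  convolution product of \<^typ>\<open>'a \<Rightarrow>\<^sub>0 'b\<close>; since \<open>H \<otimes> H\<close> has the pairs of forests as a basis,
  it is rendered in the same way over pairs.\<close>

type_synonym ('i, 'k) ck = "'i forest \<Rightarrow>\<^sub>0 'k"
type_synonym ('i, 'k) ck2 = "('i forest \<times> 'i forest) \<Rightarrow>\<^sub>0 'k"

definition pm_scale :: "'k::comm_ring_1 \<Rightarrow> ('a \<Rightarrow>\<^sub>0 'k) \<Rightarrow> ('a \<Rightarrow>\<^sub>0 'k)"
  where "pm_scale c x = Poly_Mapping.map ((*) c) x"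

definition ck_on :: "'i set \<Rightarrow> ('i, 'k::field_char_0) ck set"
  where "ck_on I = {x. Poly_Mapping.keys x \<subseteq> forests_on I}"

definition ck_hat_on :: "'i set \<Rightarrow> ('i rtree, 'k::field_char_0) mfps set"
  where "ck_hat_on I = {x. \<forall>p. mcoeff x p \<noteq> 0 \<longrightarrow> p \<in> forests_on I}"

text \<open>The homogeneous component of degree \<open>n\<close>; finitely supported if \<open>x \<in> ck_hat_on I\<close> with
  \<open>I\<close> finite.\<close>

definition hcomp :: "nat \<Rightarrow> ('i rtree, 'k::field_char_0) mfps \<Rightarrow> ('i, 'k) ck"
  where "hcomp n x = Abs_poly_mapping (\<lambda>p. if weight p = n then mcoeff x p else 0)"

definition homogeneous :: "nat \<Rightarrow> ('i, 'k::field_char_0) ck \<Rightarrow> bool"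
  where "homogeneous n x \<longleftrightarrow> (\<forall>p\<in>Poly_Mapping.keys x. weight p = n)"

definition Bplus :: "'i \<Rightarrow> ('i rtree, 'k::field_char_0) mfps \<Rightarrow> ('i rtree, 'k) mfps"
  where "Bplus i x = Abs_mfps (\<lambda>q. Sum_any (\<lambda>p. if q = {#Node i p#} then mcoeff x p else 0))"


subsection \<open>Admissible cuts\<close>

text \<open>To speak about the individual edges of a tree we choose a planar representative; the
  coproduct does not depend on this choice. A vertex is addressed by its position, the list of child
  numbers leading to it from the root, and an edge by the position of its lower end.\<close>

datatype 'i ptree = PNode 'i "'i ptree list"

primrec unplanar :: "'i ptree \<Rightarrow> 'i rtree"
  where "unplanar (PNode i ts) = Node i (mset (map unplanar ts))"

fun subtree_at :: "'i ptree \<Rightarrow> nat list \<Rightarrow> 'i ptree option" where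
  "subtree_at t [] = Some t"
| "subtree_at (PNode i ts) (k # p) = (if k < length ts then subtree_at (ts ! k) p else None)"

definition positions :: "'i ptree \<Rightarrow> nat list set"
  where "positions t = {p. subtree_at t p \<noteq> None}"

definition edges :: "'i ptree \<Rightarrow> nat list set"
  where "edges t = positions t - {[]}"

definition leaves :: "'i ptree \<Rightarrow> nat list set"
  where "leaves t = {p \<in> positions t. \<forall>k. p @ [k] \<notin> positions t}"

text \<open>The edges on the path from the root to the leaf \<open>l\<close> are the \<open>e \<in> edges t\<close> with
  \<open>prefix e l\<close>.\<close>

definition admissible_cuts :: "'i ptree \<Rightarrow> nat list set set"
  where "admissible_cuts t =
    {c. c \<noteq> {} \<and> c \<subseteq> edges t \<and> (\<forall>l\<in>leaves t. card {e \<in> c. prefix e l} \<le> 1)}"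

text \<open>The component of the root after deletion of the edges in \<open>c\<close>.\<close>

function root_component :: "nat list set \<Rightarrow> 'i ptree \<Rightarrow> 'i rtree" where
  "root_component c (PNode i ts) = Node i (mset
    (map (\<lambda>k. root_component {p. k # p \<in> c} (ts ! k)) (filter (\<lambda>k. [k] \<notin> c) [0..<length ts])))"
  by pat_completeness auto
termination
proof (relation "Wellfounded.measure (\<lambda>(c, t). size t)", simp)
  fix c :: "nat list set" and i :: 'i and ts :: "'i ptree list" and k
  assume "k \<in> set (filter (\<lambda>k. [k] \<notin> c) [0..<length ts])"
  then have "ts ! k \<in> set ts" by simp
  then show "(({p. k # p \<in> c}, ts ! k), c, PNode i ts) \<in> Wellfounded.measure (\<lambda>(c, t). size t)"
    by (simp add: size_list_estimation' less_Suc_eq_le)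
qed

definition Rcut :: "nat list set \<Rightarrow> 'i ptree \<Rightarrow> 'i rtree"
  where "Rcut c t = root_component c t"

definition Pcut :: "nat list set \<Rightarrow> 'i ptree \<Rightarrow> 'i forest"
  where "Pcut c t =
    image_mset (\<lambda>e. root_component {p. e @ p \<in> c} (the (subtree_at t e))) (mset_set c)"


subsection \<open>Hopf algebra structure\<close>

definition coprod_tree :: "'i rtree \<Rightarrow> ('i, 'k::field_char_0) ck2"
  where "coprod_tree t =
    (let s = (SOME s. unplanar s = t) in
       Poly_Mapping.single ({#t#}, {#}) 1 + Poly_Mapping.single ({#}, {#t#}) 1
       + (\<Sum>c\<in>admissible_cuts s. Poly_Mapping.single (Pcut c s, {#Rcut c s#}) 1))"

definition coprod :: "('i, 'k::field_char_0) ck \<Rightarrow> ('i, 'k) ck2"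
  where "coprod x = (\<Sum>p\<in>Poly_Mapping.keys x.
    pm_scale (Poly_Mapping.lookup x p) (prod_mset (image_mset coprod_tree p)))"

definition counit :: "('i, 'k::field_char_0) ck \<Rightarrow> 'k"
  where "counit x = Poly_Mapping.lookup x {#}"

definition tens :: "('i, 'k::field_char_0) ck \<Rightarrow> ('i, 'k) ck \<Rightarrow> ('i, 'k) ck2"
  where "tens x y = (\<Sum>p\<in>Poly_Mapping.keys x. \<Sum>q\<in>Poly_Mapping.keys y.
    Poly_Mapping.single (p, q) (Poly_Mapping.lookup x p * Poly_Mapping.lookup y q))"

definition tensor_square :: "('i, 'k::field_char_0) ck set \<Rightarrow> ('i, 'k) ck2 set"
  where "tensor_square A = {\<Sum>(x, y)\<leftarrow>ps. tens x y | ps. set ps \<subseteq> A \<times> A}"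

text \<open>The linear map \<open>m \<circ> (S \<otimes> T)\<close>.\<close>

definition mult_tensor ::
  "(('i, 'k::field_char_0) ck \<Rightarrow> ('i, 'k) ck) \<Rightarrow> (('i, 'k) ck \<Rightarrow> ('i, 'k) ck) \<Rightarrow> ('i, 'k) ck2 \<Rightarrow> ('i, 'k) ck"
  where "mult_tensor S T z = (\<Sum>(p, q)\<in>Poly_Mapping.keys z.
    pm_scale (Poly_Mapping.lookup z (p, q))
      (S (Poly_Mapping.single p 1) * T (Poly_Mapping.single q 1)))"

definition is_antipode :: "(('i, 'k::field_char_0) ck \<Rightarrow> ('i, 'k) ck) \<Rightarrow> bool"
  where "is_antipode S \<longleftrightarrow> Vector_Spaces.linear pm_scale pm_scale S \<and>
    (\<forall>x. mult_tensor S id (coprod x) = pm_scale (counit x) 1 \<and>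
         mult_tensor id S (coprod x) = pm_scale (counit x) 1)"

definition subalgebra :: "('i, 'k::field_char_0) ck set \<Rightarrow> bool"
  where "subalgebra A \<longleftrightarrow>
    1 \<in> A \<and> (\<forall>x\<in>A. \<forall>y\<in>A. x + y \<in> A \<and> x * y \<in> A) \<and> (\<forall>c. \<forall>x\<in>A. pm_scale c x \<in> A)"

text \<open>The antipode of the Hopf algebra on \<open>I\<close> is the restriction of the one on all decorations.\<close>

definition hopf_subalgebra_on :: "'i set \<Rightarrow> ('i, 'k::field_char_0) ck set \<Rightarrow> bool"
  where "hopf_subalgebra_on I A \<longleftrightarrow>
    A \<subseteq> ck_on I \<and> subalgebra A \<and> coprod ` A \<subseteq> tensor_square A \<and>
    (\<exists>S. is_antipode S \<and> S ` A \<subseteq> A)"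


section \<open>Systems of combinatorial Dyson-Schwinger equations\<close>

text \<open>A system is an index set \<open>I\<close> with a family \<open>F\<close>, of which only the values on \<open>I\<close> matter.\<close>

definition sdse :: "'i set \<Rightarrow> ('i \<Rightarrow> ('i, 'k::field_char_0) mfps) \<Rightarrow> bool"
  where "sdse I F \<longleftrightarrow> finite I \<and> I \<noteq> {} \<and>
    (\<forall>i\<in>I. series_in I (F i) \<and> mcoeff (F i) {#} = 1 \<and> nonconstant (F i))"

text \<open>The unique solution, set to 0 outside \<open>I\<close>.\<close>

definition sdse_solution ::
  "'i set \<Rightarrow> ('i \<Rightarrow> ('i, 'k::field_char_0) mfps) \<Rightarrow> 'i \<Rightarrow> ('i rtree, 'k) mfps"
  where "sdse_solution I F = (THE X.
    (\<forall>i\<in>I. X i \<in> ck_hat_on I \<and> X i = Bplus i (msubst (F i) X)) \<and> (\<forall>i. i \<notin> I \<longrightarrow> X i = 0))"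

definition sdse_algebra ::
  "'i set \<Rightarrow> ('i \<Rightarrow> ('i, 'k::field_char_0) mfps) \<Rightarrow> ('i, 'k) ck set"
  where "sdse_algebra I F =
    \<Inter>{A. subalgebra A \<and> (\<forall>i\<in>I. \<forall>n. hcomp n (sdse_solution I F i) \<in> A)}"

definition hopf_sdse :: "'i set \<Rightarrow> ('i \<Rightarrow> ('i, 'k::field_char_0) mfps) \<Rightarrow> bool"
  where "hopf_sdse I F \<longleftrightarrow> sdse I F \<and> hopf_subalgebra_on I (sdse_algebra I F)"

definition sdse_graph :: "'i set \<Rightarrow> ('i \<Rightarrow> ('i, 'k::field_char_0) mfps) \<Rightarrow> ('i \<times> 'i) set"
  where "sdse_graph I F = {(i, j). i \<in> I \<and> j \<in> I \<and> mderiv j (F i) \<noteq> 0}"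

text \<open>Connectedness of the underlying unoriented graph.\<close>

definition connected_sdse :: "'i set \<Rightarrow> ('i \<Rightarrow> ('i, 'k::field_char_0) mfps) \<Rightarrow> bool"
  where "connected_sdse I F \<longleftrightarrow>
    (\<forall>i\<in>I. \<forall>j\<in>I. (i, j) \<in> (sdse_graph I F \<union> (sdse_graph I F)\<inverse>)\<^sup>*)"

text \<open>Paths are of positive length: a vertex is its own descendant only if it lies on a cycle.\<close>

definition descendants :: "'i set \<Rightarrow> ('i \<Rightarrow> ('i, 'k::field_char_0) mfps) \<Rightarrow> 'i \<Rightarrow> 'i set"
  where "descendants I F i = {j. (i, j) \<in> (sdse_graph I F)\<^sup>+}"


subsection \<open>Operations\<close>

definition change_of_variables ::
  "('i \<Rightarrow> 'k) \<Rightarrow> ('i \<Rightarrow> ('i, 'k::field_char_0) mfps) \<Rightarrow> 'i \<Rightarrow> ('i, 'k) mfps"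
  where "change_of_variables l F i = msubst (F i) (\<lambda>j. mconst (l j) * mvar j)"

definition restrict_sdse ::
  "'i set \<Rightarrow> ('i \<Rightarrow> ('i, 'k::field_char_0) mfps) \<Rightarrow> 'i \<Rightarrow> ('i, 'k) mfps"
  where "restrict_sdse I' F i = msubst (F i) (\<lambda>j. if j \<in> I' then mvar j else 0)"

text \<open>The partition of \<open>J\<close> is given by the map \<open>r\<close> sending the elements of the block \<open>J\<^sub>i\<close> to \<open>i\<close>.\<close>

definition dilate_sdse ::
  "'j set \<Rightarrow> ('j \<Rightarrow> 'i) \<Rightarrow> ('i \<Rightarrow> ('i, 'k::field_char_0) mfps) \<Rightarrow> 'j \<Rightarrow> ('j, 'k) mfps"
  where "dilate_sdse J r F x = msubst (F (r x)) (\<lambda>j. \<Sum>y\<in>{y \<in> J. r y = j}. mvar y)"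

definition is_extension ::
  "'i set \<Rightarrow> ('i \<Rightarrow> ('i, 'k::field_char_0) mfps) \<Rightarrow> 'i \<Rightarrow> ('i \<Rightarrow> ('i, 'k) mfps) \<Rightarrow> bool"
  where "is_extension I F z F' \<longleftrightarrow> hopf_sdse I F \<and> z \<notin> I \<and> sdse (insert z I) F' \<and>
    (\<forall>i\<in>I. F' i = F i) \<and>
    (\<exists>a. F' z = 1 + (\<Sum>i\<in>I. mconst (a i) * mvar i) \<and>
         (\<forall>i\<in>I. \<forall>j\<in>I. a i \<noteq> 0 \<and> a j \<noteq> 0 \<longrightarrow> F i = F j))"

definition extension_vertex :: "'i set \<Rightarrow> ('i \<Rightarrow> ('i, 'k::field_char_0) mfps) \<Rightarrow> 'i \<Rightarrow> bool"
  where "extension_vertex I F i \<longleftrightarrow> i \<in> I \<and>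
    (let J = descendants I F i
     in is_extension J (restrict_sdse J F) i (restrict_sdse (insert i J) F))"

definition nonextension_vertices :: "'i set \<Rightarrow> ('i \<Rightarrow> ('i, 'k::field_char_0) mfps) \<Rightarrow> 'i set"
  where "nonextension_vertices I F = {i \<in> I. \<not> extension_vertex I F i}"


subsection \<open>Fundamental abelian systems\<close>

definition basic_abelian ::
  "'i set \<Rightarrow> 'i set \<Rightarrow> 'i set \<Rightarrow> ('i \<Rightarrow> ('i, 'k::field_char_0) mfps) \<Rightarrow> bool"
  where "basic_abelian I0 I1 J1 F \<longleftrightarrow>
    sdse (I0 \<union> I1 \<union> J1) F \<and> I0 \<noteq> {} \<and> I0 \<inter> I1 = {} \<and> I0 \<inter> J1 = {} \<and> I1 \<inter> J1 = {} \<and>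
    (\<exists>\<nu> :: 'i \<Rightarrow> 'k. \<exists>a :: 'i \<Rightarrow> 'i \<Rightarrow> 'k.
      (\<forall>i\<in>I0. F i = 1 + mvar i) \<and>
      (\<forall>i\<in>I1. (\<nu> i \<noteq> 1 \<or> (\<exists>j\<in>I0. a i j \<noteq> 0)) \<and>
        F i = (if \<nu> i \<noteq> 0
          then mconst (1 / \<nu> i) * (\<Prod>j\<in>I0. muni (fps_binomial (\<nu> i * a i j)) j)
            + 1 - mconst (1 / \<nu> i)
          else 1 + (\<Sum>j\<in>I0. mconst (a i j) * muni (fps_ln 1) j))) \<and>
      (\<forall>i\<in>J1. \<nu> i \<noteq> 0 \<and>
        (let I1i = {j \<in> I1. a i j \<noteq> 0} in
          I1i \<noteq> {} \<and> (\<forall>j\<in>I1i. \<nu> j = 1) \<and> (\<forall>j\<in>I1i. \<forall>k\<in>I1i. F j = F k) \<and>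
          (\<forall>s\<in>I1i. F i = mconst (1 / \<nu> i) * (\<Prod>j\<in>I0. muni (fps_binomial (a s j)) j)
            + (\<Sum>j\<in>I1i. mconst (a i j) * mvar j) + 1 - mconst (1 / \<nu> i)))))"

text \<open>The index set of the basic system can be taken in the type of \<open>I\<close>: replace every index of
  the basic system by an element of the corresponding block of the partition of \<open>I\<close>.\<close>

definition fundamental_abelian :: "'i set \<Rightarrow> ('i \<Rightarrow> ('i, 'k::field_char_0) mfps) \<Rightarrow> bool"
  where "fundamental_abelian I F \<longleftrightarrow> finite I \<and>
    (\<exists>(I0 :: 'i set) I1 J1 G r l. basic_abelian I0 I1 J1 G \<and> r ` I = I0 \<union> I1 \<union> J1 \<and>
      (\<forall>x\<in>I. l x \<noteq> 0) \<and> (\<forall>x\<in>I. F x = change_of_variables l (dilate_sdse I r G) x))"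

inductive extended_fundamental_abelian ::
  "'i set \<Rightarrow> ('i \<Rightarrow> ('i, 'k::field_char_0) mfps) \<Rightarrow> bool" where
  fundamental: "fundamental_abelian I F \<Longrightarrow> extended_fundamental_abelian I F"
| extension: "extended_fundamental_abelian I F \<Longrightarrow> is_extension I F z F' \<Longrightarrow>
    extended_fundamental_abelian (insert z I) F'"


section \<open>Lie algebras and modules\<close>

text \<open>The underlying vector space is a subspace, the carrier, of a vector space on the whole type.\<close>

record ('k, 'v) lie =
  lcar :: "'v set"
  lscale :: "'k \<Rightarrow> 'v \<Rightarrow> 'v"
  lbr :: "'v \<Rightarrow> 'v \<Rightarrow> 'v"

record ('k, 'l, 'v) lmodule =
  mcar :: "'v set"
  mscale :: "'k \<Rightarrow> 'v \<Rightarrow> 'v"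
  mact :: "'l \<Rightarrow> 'v \<Rightarrow> 'v"

definition lie_algebra :: "('k::field, 'v::ab_group_add) lie \<Rightarrow> bool"
  where "lie_algebra L \<longleftrightarrow>
    vector_space (lscale L) \<and> module.subspace (lscale L) (lcar L) \<and>
    (\<forall>x\<in>lcar L. \<forall>y\<in>lcar L. lbr L x y \<in> lcar L) \<and>
    (\<forall>x\<in>lcar L. \<forall>y\<in>lcar L. \<forall>z\<in>lcar L.
      lbr L (x + y) z = lbr L x z + lbr L y z \<and> lbr L z (x + y) = lbr L z x + lbr L z y) \<and>
    (\<forall>c. \<forall>x\<in>lcar L. \<forall>y\<in>lcar L.
      lbr L (lscale L c x) y = lscale L c (lbr L x y) \<and>
      lbr L x (lscale L c y) = lscale L c (lbr L x y)) \<and>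
    (\<forall>x\<in>lcar L. lbr L x x = 0) \<and>
    (\<forall>x\<in>lcar L. \<forall>y\<in>lcar L. \<forall>z\<in>lcar L.
      lbr L x (lbr L y z) + lbr L y (lbr L z x) + lbr L z (lbr L x y) = 0)"

definition lie_iso ::
  "('k::field, 'v::ab_group_add) lie \<Rightarrow> ('k, 'w::ab_group_add) lie \<Rightarrow> bool"
  where "lie_iso L L' \<longleftrightarrow> lie_algebra L \<and> lie_algebra L' \<and>
    (\<exists>f. bij_betw f (lcar L) (lcar L') \<and>
      (\<forall>x\<in>lcar L. \<forall>y\<in>lcar L. f (x + y) = f x + f y \<and> f (lbr L x y) = lbr L' (f x) (f y)) \<and>
      (\<forall>c. \<forall>x\<in>lcar L. f (lscale L c x) = lscale L' c (f x)))"

definition lie_module ::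
  "('k::field, 'l::ab_group_add) lie \<Rightarrow> ('k, 'l, 'v::ab_group_add) lmodule \<Rightarrow> bool"
  where "lie_module L V \<longleftrightarrow> lie_algebra L \<and>
    vector_space (mscale V) \<and> module.subspace (mscale V) (mcar V) \<and>
    (\<forall>x\<in>lcar L. \<forall>u\<in>mcar V. mact V x u \<in> mcar V) \<and>
    (\<forall>x\<in>lcar L. \<forall>u\<in>mcar V. \<forall>v\<in>mcar V. mact V x (u + v) = mact V x u + mact V x v) \<and>
    (\<forall>x\<in>lcar L. \<forall>y\<in>lcar L. \<forall>u\<in>mcar V. mact V (x + y) u = mact V x u + mact V y u) \<and>
    (\<forall>c. \<forall>x\<in>lcar L. \<forall>u\<in>mcar V.
      mact V (lscale L c x) u = mscale V c (mact V x u) \<and>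
      mact V x (mscale V c u) = mscale V c (mact V x u)) \<and>
    (\<forall>x\<in>lcar L. \<forall>y\<in>lcar L. \<forall>u\<in>mcar V.
      mact V (lbr L x y) u = mact V x (mact V y u) - mact V y (mact V x u))"

definition has_nat_basis :: "('k::field, 'l, 'v::ab_group_add) lmodule \<Rightarrow> bool"
  where "has_nat_basis V \<longleftrightarrow> (\<exists>h :: nat \<Rightarrow> 'v.
    inj_on h {1..} \<and> \<not> module.dependent (mscale V) (h ` {1..}) \<and>
    module.span (mscale V) (h ` {1..}) = mcar V)"

definition semidirect ::
  "('k::field, 'l::ab_group_add, 'v::ab_group_add) lmodule \<Rightarrow> ('k, 'l) lie \<Rightarrow> ('k, 'v \<times> 'l) lie"
  where "semidirect V L = \<lparr>lcar = mcar V \<times> lcar L,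
    lscale = (\<lambda>c (u, x). (mscale V c u, lscale L c x)),
    lbr = (\<lambda>(u, x) (v, y). (mact V x v - mact V y u, lbr L x y))\<rparr>"

definition direct_sum_module ::
  "nat set \<Rightarrow> (nat \<Rightarrow> ('k::field, 'l, 'v::ab_group_add) lmodule) \<Rightarrow> ('k, 'l, nat \<Rightarrow> 'v) lmodule"
  where "direct_sum_module P V =
    \<lparr>mcar = {u. (\<forall>p\<in>P. u p \<in> mcar (V p)) \<and> (\<forall>p. p \<notin> P \<longrightarrow> u p = 0) \<and> finite {p. u p \<noteq> 0}},
     mscale = (\<lambda>c u p. mscale (V p) c (u p)),
     mact = (\<lambda>x u p. mact (V p) x (u p))\<rparr>"


subsection \<open>The Lie algebra of a system\<close>

text \<open>Linear forms on a subspace \<open>H\<close> are represented by functions vanishing outside \<open>H\<close>.\<close>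

definition graded_dual :: "('i, 'k::field_char_0) ck set \<Rightarrow> (('i, 'k) ck \<Rightarrow> 'k) set"
  where "graded_dual H = {f. (\<forall>x. x \<notin> H \<longrightarrow> f x = 0) \<and>
    (\<forall>x\<in>H. \<forall>y\<in>H. f (x + y) = f x + f y) \<and> (\<forall>c. \<forall>x\<in>H. f (pm_scale c x) = c * f x) \<and>
    (\<exists>N. \<forall>n\<ge>N. \<forall>x\<in>H. homogeneous n x \<longrightarrow> f x = 0)}"

text \<open>The product of the graded dual, \<open>(f \<otimes> g) \<circ> \<Delta>\<close>. As \<open>f\<close> and \<open>g\<close> are only given on \<open>H\<close>, it is
  computed from a decomposition of \<open>\<Delta> x\<close> in \<open>H \<otimes> H\<close>; the value does not depend on it.\<close>

definition dual_mult ::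
  "('i, 'k::field_char_0) ck set \<Rightarrow> (('i, 'k) ck \<Rightarrow> 'k) \<Rightarrow> (('i, 'k) ck \<Rightarrow> 'k) \<Rightarrow> ('i, 'k) ck \<Rightarrow> 'k"
  where "dual_mult H f g x = (if x \<in> H then
    (THE c. \<exists>ps. set ps \<subseteq> H \<times> H \<and> coprod x = (\<Sum>(y, z)\<leftarrow>ps. tens y z) \<and>
       c = (\<Sum>(y, z)\<leftarrow>ps. f y * g z)) else 0)"

text \<open>The coproduct of the graded dual is \<open>f \<mapsto> (x \<otimes> y \<mapsto> f (x * y))\<close> and its unit is the counit,
  which gives the condition for \<open>f\<close> to be primitive.\<close>

definition dual_primitives :: "('i, 'k::field_char_0) ck set \<Rightarrow> (('i, 'k) ck \<Rightarrow> 'k) set"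
  where "dual_primitives H =
    {f \<in> graded_dual H. \<forall>x\<in>H. \<forall>y\<in>H. f (x * y) = f x * counit y + counit x * f y}"

definition sdse_lie ::
  "'i set \<Rightarrow> ('i \<Rightarrow> ('i, 'k::field_char_0) mfps) \<Rightarrow> ('k, ('i, 'k) ck \<Rightarrow> 'k) lie"
  where "sdse_lie I F = (let H = sdse_algebra I F in
    \<lparr>lcar = dual_primitives H,
     lscale = (\<lambda>c f x. c * f x),
     lbr = (\<lambda>f g. dual_mult H f g - dual_mult H g f)\<rparr>)"


subsection \<open>The Lie algebras and modules of the abelian case\<close>

definition free_on :: "'a set \<Rightarrow> ('a \<Rightarrow>\<^sub>0 'k::field) set"
  where "free_on B = {x. Poly_Mapping.keys x \<subseteq> B}"

text \<open>Bilinear extension of a map given on basis elements.\<close>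

definition bilin :: "('a \<Rightarrow> 'b \<Rightarrow> ('c \<Rightarrow>\<^sub>0 'k)) \<Rightarrow> ('a \<Rightarrow>\<^sub>0 'k::field) \<Rightarrow> ('b \<Rightarrow>\<^sub>0 'k) \<Rightarrow> ('c \<Rightarrow>\<^sub>0 'k)"
  where "bilin b x y = (\<Sum>p\<in>Poly_Mapping.keys x. \<Sum>q\<in>Poly_Mapping.keys y.
    pm_scale (Poly_Mapping.lookup x p * Poly_Mapping.lookup y q) (b p q))"

text \<open>The basis element \<open>e\<^sup>(\<^sup>i\<^sup>)(k)\<close> is \<open>Poly_Mapping.single (i, k) 1\<close>; the elements
  \<open>f(k)\<close> and \<open>g(k)\<close> are \<open>Poly_Mapping.single k 1\<close>.\<close>

definition g_ab :: "nat \<Rightarrow> ('k::field, (nat \<times> nat) \<Rightarrow>\<^sub>0 'k) lie"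
  where "g_ab M = \<lparr>lcar = free_on ({1..M} \<times> {1..}), lscale = pm_scale, lbr = (\<lambda>_ _. 0)\<rparr>"

definition V_mod :: "(nat \<Rightarrow> 'k::field) \<Rightarrow> ('k, (nat \<times> nat) \<Rightarrow>\<^sub>0 'k, nat \<Rightarrow>\<^sub>0 'k) lmodule"
  where "V_mod \<upsilon> = \<lparr>mcar = free_on {1..}, mscale = pm_scale,
    mact = bilin (\<lambda>(i, k) l. Poly_Mapping.single (k + l) (\<upsilon> i))\<rparr>"

type_synonym 'k vg = "(nat \<Rightarrow> (nat \<Rightarrow>\<^sub>0 'k)) \<times> ((nat \<times> nat) \<Rightarrow>\<^sub>0 'k)"

definition V_gab :: "nat \<Rightarrow> nat \<Rightarrow> (nat \<Rightarrow> nat \<Rightarrow> 'k::field) \<Rightarrow> ('k, 'k vg) lie"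
  where "V_gab M N \<upsilon> = semidirect (direct_sum_module {1..N} (\<lambda>j. V_mod (\<upsilon> j))) (g_ab M)"

definition W_mod :: "(nat \<Rightarrow> 'k::field) \<Rightarrow> ('k, 'k vg, nat \<Rightarrow>\<^sub>0 'k) lmodule"
  where "W_mod \<nu> = \<lparr>mcar = free_on {1..}, mscale = pm_scale,
    mact = (\<lambda>(v, x). bilin (\<lambda>(i, k) l. if l = 1 then Poly_Mapping.single (k + 1) (\<nu> i) else 0) x)\<rparr>"

definition W'_mod :: "nat \<Rightarrow> (nat \<Rightarrow> 'k::field) \<Rightarrow> (nat \<Rightarrow> 'k) \<Rightarrow> ('k, 'k vg, nat \<Rightarrow>\<^sub>0 'k) lmodule"
  where "W'_mod N \<nu> \<mu> = \<lparr>mcar = free_on {1..}, mscale = pm_scale,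
    mact = (\<lambda>(v, x) u. bilin (\<lambda>(i, k) l. Poly_Mapping.single (k + l) (\<nu> i)) x u +
      (\<Sum>j\<in>{1..N}.
        bilin (\<lambda>k l. if l = 1 then Poly_Mapping.single (k + 1) (\<mu> j) else 0) (v j) u))\<rparr>"

definition abelian_form :: "('k::field, 'v::ab_group_add) lie \<Rightarrow> bool"
  where "abelian_form L \<longleftrightarrow> (\<exists>M N Q (\<upsilon> :: nat \<Rightarrow> nat \<Rightarrow> 'k) U.
    (\<forall>p\<in>{1..Q}. (\<exists>\<nu>. U p = W_mod \<nu>) \<or>
      (\<exists>\<nu> \<mu>. (\<forall>i\<in>{1..M}. \<forall>j\<in>{1..N}. \<mu> j * (\<nu> i - \<upsilon> j i) = 0) \<and> U p = W'_mod N \<nu> \<mu>)) \<and>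
    lie_iso L (semidirect (direct_sum_module {1..Q} U) (V_gab M N \<upsilon>)))"

end

theory Submission
  imports Defs
begin

text \<open>Let \<open>f\<^sub>i(k)\<close> be the basis of the Lie algebra dual to the generators \<open>X\<^sub>i(k)\<close>. In a Hopf system,
  \<open>f\<^sub>j(l) \<star> f\<^sub>i(k)\<close> is a multiple of \<open>f\<^sub>i(k + l)\<close> up to products, and the coefficient can be read off
  one ladder of \<open>X\<^sub>i(k)\<close>: it is the sum of the relative coefficients of the trees obtained by grafting
  a tree with root \<open>j\<close> on this ladder. So it does not depend on \<open>l\<close>, and for a fundamental abelian
  system it is constant for \<open>k \<ge> 2\<close> if the ladder runs through \<open>I\<^sub>0\<close>. Rescaling the basis and
  subtracting from each \<open>f\<^sub>x(k)\<close>, \<open>x \<in> I\<^sub>0\<close> after dilatation, a representative of its block gives the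
  normal form. If no edge ends at \<open>z\<close>, nothing can be grafted with root \<open>z\<close>, so that
  the \<open>f\<^sub>z(k)\<close> span an abelian ideal; the extension vertices lie on no cycle and can
  therefore be split off one after the other in this way.\<close>

section \<open>Taylor coefficients\<close>

text \<open>A form on \<open>H\<close> with prescribed values on the generators has to respect all
  relations among them. Here it is obtained by restriction: f_i(k) reads, on arbitrary forests, the
  coefficient of one ladder, divided by the nonzero value which this coefficient has in X_i(k). It
  vanishes on every forest that is not a single tree, which makes it primitive. Since the coproduct
  maps \<open>H\<close> into its tensor square, the dual product may be evaluated on coproducts of
  trees, where only cuts of one edge count. The Jacobi identity is read off the structure constants:
  \<open>module_constants\<close> says that for each i the span of the f_i(k) is a representation,
  in other words that \<open>star\<close> is a pre-Lie product. This must persist under extensions.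
  The variables of an extension series belong to vertices with one common series, and these vertices
  need equal constants; hence the next vertex of a ladder is a function of the series. The
  fundamental core of an extended system may itself contain extension vertices, so g_0 may belong to
  a smaller set, whose closure under descendants is delicate for the edges from J_1 to I_1.\<close>

definition fact_mset :: "'a multiset \<Rightarrow> 'k::field_char_0"
  where "fact_mset m = (\<Prod>x\<in>set_mset m. fact (count m x))"

lemma fact_mset_superset:
  "finite A \<Longrightarrow> set_mset m \<subseteq> A \<Longrightarrow> fact_mset m = (\<Prod>x\<in>A. fact (count m x))"
  unfolding fact_mset_def by (rule prod.mono_neutral_left) (auto simp: not_in_iff)

lemma fact_mset_empty [simp]: "fact_mset {#} = 1"
  by (simp add: fact_mset_def)

lemma fact_mset_nonzero [simp]: "fact_mset m \<noteq> 0"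
  by (simp add: fact_mset_def)

lemma fact_mset_add_mset:
  "fact_mset (add_mset x m) = (of_nat (Suc (count m x)) * fact_mset m :: 'k::field_char_0)"
proof -
  let ?A = "insert x (set_mset m)"
  have "fact_mset (add_mset x m) = (\<Prod>y\<in>?A. fact (count (add_mset x m) y) :: 'k)"
    by (rule fact_mset_superset) auto
  also have "\<dots> = fact (Suc (count m x)) * (\<Prod>y\<in>?A - {x}. fact (count (add_mset x m) y))"
    by (subst prod.remove [of _ x]) auto
  also have "(\<Prod>y\<in>?A - {x}. fact (count (add_mset x m) y) :: 'k) = (\<Prod>y\<in>?A - {x}. fact (count m y))"
    by (rule prod.cong) auto
  also have "fact (Suc (count m x)) * \<dots> = of_nat (Suc (count m x)) * (\<Prod>y\<in>?A. fact (count m y) :: 'k)"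
    by (subst (2) prod.remove [of _ x]) (auto simp: algebra_simps)
  also have "(\<Prod>y\<in>?A. fact (count m y) :: 'k) = fact_mset m"
    by (rule fact_mset_superset [symmetric]) auto
  finally show ?thesis .
qed

text \<open>The value at \<open>0\<close> of the iterated partial derivative along \<open>m\<close>. In contrast to the coefficients
  it is compatible with linear substitutions without combinatorial factors.\<close>

definition taylor :: "('v, 'k::field_char_0) mfps \<Rightarrow> 'v multiset \<Rightarrow> 'k"
  where "taylor f m = mcoeff f m * fact_mset m"

lemma mcoeff_taylor: "mcoeff f m = taylor f m / fact_mset m"
  by (simp add: taylor_def)

lemma taylor_eq_0_iff [simp]: "taylor f m = 0 \<longleftrightarrow> mcoeff f m = 0"
  by (simp add: taylor_def)

lemma mcoeff_zero [simp]: "mcoeff 0 m = 0"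
  by (simp add: zero_mfps_def)

lemma mcoeff_one: "mcoeff 1 m = (if m = {#} then 1 else 0)"
  by (simp add: one_mfps_def)

lemma mcoeff_add [simp]: "mcoeff (f + g) m = mcoeff f m + mcoeff g m"
  by (simp add: plus_mfps_def)

lemma mcoeff_diff [simp]: "mcoeff (f - g) m = mcoeff f m - mcoeff g m"
  by (simp add: minus_mfps_def)

lemma mcoeff_sum: "mcoeff (sum f A) m = (\<Sum>x\<in>A. mcoeff (f x) m)"
  by (induction A rule: infinite_finite_induct) auto

lemma mcoeff_mvar: "mcoeff (mvar j) m = (if m = {#j#} then 1 else 0)"
proof (cases "size m = 1")
  case True
  then obtain x where "m = {#x#}" using size_1_singleton_mset by blast
  then show ?thesis by (simp add: mvar_def muni_def)
next
  case False
  then have "m \<noteq> {#j#}" by auto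
  with False show ?thesis by (simp add: mvar_def muni_def fps_X_def)
qed

lemma mcoeff_mconst: "mcoeff (mconst c) m = (if m = {#} then c else 0)"
  by (simp add: mconst_def)

lemma mcoeff_times: "mcoeff (f * g) m = (\<Sum>(a, b)\<in>msplits m. mcoeff f a * mcoeff g b)"
  by (simp add: times_mfps_def)

lemma mcoeff_mconst_mult [simp]: "mcoeff (mconst c * f) m = c * mcoeff f m"
proof -
  have "mcoeff (mconst c * f) m =
      (\<Sum>(a, b)\<in>msplits m. (if a = {#} then 1 else 0) * (c * mcoeff f b))"
    unfolding mcoeff_times mcoeff_mconst by (rule sum.cong) auto
  then show ?thesis by (simp add: msplits_empty_left)
qed

lemma mcoeff_mderiv: "mcoeff (mderiv j f) m = of_nat (Suc (count m j)) * mcoeff f (add_mset j m)"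
  by (simp add: mderiv_def)

text \<open>In characteristic zero the factor \<open>Suc (count m j)\<close> is invertible, so the
  derivative detects every monomial that contains \<open>j\<close>.\<close>

lemma mderiv_eq_0_iff:
  fixes f :: "('v, 'k::field_char_0) mfps"
  shows "mderiv j f = 0 \<longleftrightarrow> (\<forall>m. j \<in># m \<longrightarrow> mcoeff f m = 0)"
proof
  assume L: "mderiv j f = 0"
  show "\<forall>m. j \<in># m \<longrightarrow> mcoeff f m = 0"
  proof (intro allI impI)
    fix m assume "j \<in># m"
    then obtain m' where m: "m = add_mset j m'" by (meson multi_member_split)
    have "mcoeff (mderiv j f) m' = 0" by (simp add: L)
    then show "mcoeff f m = 0" by (simp add: mcoeff_mderiv m del: of_nat_Suc)
  qed
qed (simp add: mfps_eqI mcoeff_mderiv)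

lemma series_inD: "series_in I f \<Longrightarrow> mcoeff f m \<noteq> 0 \<Longrightarrow> set_mset m \<subseteq> I"
  by (auto simp: series_in_def)

text \<open>The link between the graph of a system and its series: a set that contains all end
  points of edges leaving a vertex contains all variables of its series.\<close>

lemma series_in_subset:
  fixes f :: "('v, 'k::field_char_0) mfps"
  assumes "series_in I f" "\<And>k. k \<in> I \<Longrightarrow> mderiv k f \<noteq> 0 \<Longrightarrow> k \<in> J"
  shows "series_in J f"
  unfolding series_in_def
proof (intro allI impI subsetI)
  fix m k assume "mcoeff f m \<noteq> 0" "k \<in># m"
  then show "k \<in> J"
    using assms(1) assms(2) [of k] by (auto simp: series_in_def mderiv_eq_0_iff)
qed

subsection \<open>Linear substitutions\<close>

text \<open>\<open>X j\<close> is a linear combination of variables \<open>y\<close> with \<open>\<rho> y = j\<close>, with coefficient \<open>x y\<close>.\<close>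

definition linear_subst :: "('w \<Rightarrow> 'v) \<Rightarrow> ('w \<Rightarrow> 'k) \<Rightarrow> ('v \<Rightarrow> ('w, 'k::field_char_0) mfps) \<Rightarrow> bool"
  where "linear_subst \<rho> x X \<longleftrightarrow>
    (\<forall>j m. mcoeff (X j) m = (\<Sum>y\<in>set_mset m. if m = {#y#} \<and> \<rho> y = j then x y else 0))"

lemma linear_substI:
  assumes "\<And>j y. mcoeff (X j) {#y#} = (if \<rho> y = j then x y else 0)"
    and "\<And>j m. size m \<noteq> 1 \<Longrightarrow> mcoeff (X j) m = 0"
  shows "linear_subst \<rho> x X"
  unfolding linear_subst_def
proof (intro allI)
  fix j m
  show "mcoeff (X j) m = (\<Sum>y\<in>set_mset m. if m = {#y#} \<and> \<rho> y = j then x y else 0)"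
  proof (cases "size m = 1")
    case True
    then obtain y where "m = {#y#}" using size_1_singleton_mset by blast
    then show ?thesis using assms(1) by simp
  next
    case False
    then have "\<And>y. m \<noteq> {#y#}" by auto
    with False show ?thesis using assms(2) by simp
  qed
qed

text \<open>Expanding the product distributes the variables of \<open>p\<close> over the factors,
  which forces \<open>m\<close> to be the image of \<open>p\<close> and happens in m!/p! ways. In
  the induction the new factor \<open>X j\<close> takes one \<open>y\<close> in the fibre over
  \<open>j\<close>; the multiplicities of these \<open>y\<close> add up to the multiplicity of
  \<open>j\<close> in the image, which is the factor that \<open>fact_mset\<close> gains.\<close>

lemma linear_subst_prod:
  fixes X :: "'v \<Rightarrow> ('w, 'k::field_char_0) mfps"
  assumes "linear_subst \<rho> x X"
  shows "mcoeff (prod_mset (image_mset X m)) p =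
    (if image_mset \<rho> p = m then fact_mset m / fact_mset p * prod_mset (image_mset x p) else 0)"
proof (induction m arbitrary: p)
  case empty
  then show ?case by (auto simp: mcoeff_one)
next
  case (add j m)
  let ?Y = "{y \<in> set_mset p. \<rho> y = j}"
  have "mcoeff (prod_mset (image_mset X (add_mset j m))) p =
      (\<Sum>(a, b)\<in>msplits p. mcoeff (X j) a * mcoeff (prod_mset (image_mset X m)) b)"
    by (simp add: mcoeff_times)
  also have "\<dots> = (\<Sum>(a, b)\<in>(\<lambda>y. ({#y#}, p - {#y#})) ` ?Y.
      mcoeff (X j) a * mcoeff (prod_mset (image_mset X m)) b)"
  proof (rule sum.mono_neutral_right)
    show "(\<lambda>y. ({#y#}, p - {#y#})) ` ?Y \<subseteq> msplits p" by (auto simp: msplits_def)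
    show "\<forall>i\<in>msplits p - (\<lambda>y. ({#y#}, p - {#y#})) ` ?Y.
        (case i of (a, b) \<Rightarrow> mcoeff (X j) a * mcoeff (prod_mset (image_mset X m)) b) = 0"
    proof (safe, rule ccontr)
      fix a b assume ab: "(a, b) \<in> msplits p" "(a, b) \<notin> (\<lambda>y. ({#y#}, p - {#y#})) ` ?Y"
        and nz: "mcoeff (X j) a * mcoeff (prod_mset (image_mset X m)) b \<noteq> 0"
      then have "mcoeff (X j) a \<noteq> 0" by auto
      then have "(\<Sum>y\<in>set_mset a. if a = {#y#} \<and> \<rho> y = j then x y else 0) \<noteq> 0"
        using assms by (simp add: linear_subst_def)
      then obtain y where "a = {#y#}" "\<rho> y = j"
        by (rule sum.not_neutral_contains_not_neutral) (auto split: if_splits)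
      with ab show False by (auto simp: msplits_def image_iff)
    qed
  qed simp
  also have "\<dots> = (\<Sum>y\<in>?Y. mcoeff (X j) {#y#} * mcoeff (prod_mset (image_mset X m)) (p - {#y#}))"
    by (subst sum.reindex) (auto simp: inj_on_def)
  also have "\<dots> = (\<Sum>y\<in>?Y. if image_mset \<rho> p = add_mset j m
      then of_nat (count p y) * (fact_mset m / fact_mset p * prod_mset (image_mset x p)) else 0)"
  proof (rule sum.cong [OF refl])
    fix y assume "y \<in> ?Y"
    then have y: "y \<in># p" "\<rho> y = j" by auto
    from y(1) obtain p' where p: "p = add_mset y p'" by (meson multi_member_split)
    have "mcoeff (X j) {#y#} = x y" using assms y by (simp add: linear_subst_def)
    moreover have "fact_mset m / fact_mset p' =
        of_nat (count p y) * (fact_mset m / fact_mset p :: 'k)"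
      unfolding p fact_mset_add_mset by (simp del: of_nat_Suc)
    ultimately show "mcoeff (X j) {#y#} * mcoeff (prod_mset (image_mset X m)) (p - {#y#}) =
        (if image_mset \<rho> p = add_mset j m
         then of_nat (count p y) * (fact_mset m / fact_mset p * prod_mset (image_mset x p)) else 0)"
      using y(2) by (simp add: p add.IH [of p'] mult_ac)
  qed
  also have "\<dots> = (if image_mset \<rho> p = add_mset j m
      then (\<Sum>y\<in>?Y. of_nat (count p y)) * (fact_mset m / fact_mset p * prod_mset (image_mset x p)) else 0)"
    by (cases "image_mset \<rho> p = add_mset j m") (simp_all only: sum_distrib_right if_True if_False sum.neutral_const refl)
  also have "(\<Sum>y\<in>?Y. of_nat (count p y) :: 'k) = of_nat (count (image_mset \<rho> p) j)"
    by (simp add: count_image_mset vimage_def Int_def conj_commute)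
  also have "(if image_mset \<rho> p = add_mset j m then of_nat (count (image_mset \<rho> p) j) *
        (fact_mset m / fact_mset p * prod_mset (image_mset x p)) else 0)
      = (if image_mset \<rho> p = add_mset j m
         then fact_mset (add_mset j m) / fact_mset p * prod_mset (image_mset x p) else 0)"
    by (simp add: fact_mset_add_mset)
  finally show ?case .
qed

text \<open>One formula for all substitutions that occur: change of variables, restriction and
  dilatation, and also the insertion of the solution into \<open>F i\<close>, where the variables
  are trees and \<open>\<rho>\<close> is \<open>tree_root\<close>.\<close>

lemma taylor_msubst_linear:
  fixes X :: "'v \<Rightarrow> ('w, 'k::field_char_0) mfps"
  assumes "linear_subst \<rho> x X"
  shows "taylor (msubst f X) p = taylor f (image_mset \<rho> p) * prod_mset (image_mset x p)"
proof -
  have "mcoeff (msubst f X) p =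
      Sum_any (\<lambda>m. mcoeff f m * mcoeff (prod_mset (image_mset X m)) p)"
    by (simp add: msubst_def)
  also have "\<dots> = (\<Sum>m\<in>{image_mset \<rho> p}. mcoeff f m * mcoeff (prod_mset (image_mset X m)) p)"
    by (rule Sum_any.expand_superset) (auto simp: linear_subst_prod [OF assms] split: if_splits)
  finally have "mcoeff (msubst f X) p =
      mcoeff f (image_mset \<rho> p) * (fact_mset (image_mset \<rho> p) / fact_mset p * prod_mset (image_mset x p))"
    unfolding linear_subst_prod [OF assms] by simp
  then show ?thesis unfolding taylor_def by simp
qed

lemma linear_subst_restrict:
  "linear_subst (\<lambda>y. y) (\<lambda>j. if j \<in> J then 1 else 0) (\<lambda>j. if j \<in> J then mvar j else 0)"
  by (rule linear_substI) (auto simp: mcoeff_mvar)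

lemma linear_subst_scale: "linear_subst (\<lambda>y. y) l (\<lambda>j. mconst (l j) * mvar j)"
  by (rule linear_substI) (auto simp: mcoeff_mvar)

lemma linear_subst_dilate:
  assumes "finite J"
  shows "linear_subst r (\<lambda>y. if y \<in> J then 1 else 0) (\<lambda>j. \<Sum>y\<in>{y \<in> J. r y = j}. mvar y)"
  using assms by (intro linear_substI) (auto simp: mcoeff_sum mcoeff_mvar intro!: sum.neutral)

lemma prod_mset_indicator:
  "(\<Prod>j\<in>#m. if j \<in> J then 1 else (0::'k::field_char_0)) = (if set_mset m \<subseteq> J then 1 else 0)"
  by (induction m) auto

lemma taylor_inject: "(\<And>m. taylor f m = taylor g m) \<Longrightarrow> f = g"
  by (rule mfps_eqI) (simp add: taylor_def)

lemma restrict_sdse_eq: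
  assumes "series_in J (F i)"
  shows "restrict_sdse J F i = F i"
proof (rule taylor_inject)
  fix m
  have "taylor (F i) m = 0" if "\<not> set_mset m \<subseteq> J"
    using series_inD [OF assms, of m] that by auto
  then show "taylor (restrict_sdse J F i) m = taylor (F i) m"
    by (simp add: restrict_sdse_def taylor_msubst_linear [OF linear_subst_restrict]
        prod_mset_indicator del: taylor_eq_0_iff)
qed

lemma taylor_dilate_change:
  assumes "finite J" "set_mset p \<subseteq> J"
  shows "taylor (change_of_variables l (dilate_sdse J r G) x) p =
    taylor (G (r x)) (image_mset r p) * prod_mset (image_mset l p)"
  using assms(2)
  by (simp add: change_of_variables_def dilate_sdse_def taylor_msubst_linear [OF linear_subst_scale]
      taylor_msubst_linear [OF linear_subst_dilate [OF assms(1)]] prod_mset_indicator)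

section \<open>Linear functionals on finitely supported functions\<close>

lemma lookup_pm_scale [simp]:
  "Poly_Mapping.lookup (pm_scale c x) k = c * Poly_Mapping.lookup x k"
  by (simp add: pm_scale_def map.rep_eq when_def)

lemma keys_pm_scale: "Poly_Mapping.keys (pm_scale c x) \<subseteq> Poly_Mapping.keys x"
  by (auto simp: in_keys_iff)

lemma pm_scale_0_right [simp]: "pm_scale c 0 = 0"
  by (rule poly_mapping_eqI) simp

lemma pm_scale_single: "pm_scale c (Poly_Mapping.single a b) = Poly_Mapping.single a (c * b)"
  by (rule poly_mapping_eqI) (simp add: lookup_single when_def)

lemma pm_scale_add: "pm_scale c (x + y) = pm_scale c x + pm_scale c y"
  by (rule poly_mapping_eqI) (simp add: lookup_add algebra_simps)

lemma pm_scale_pm_scale: "pm_scale c (pm_scale d x) = pm_scale (c * d) x"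
  by (rule poly_mapping_eqI) (simp add: algebra_simps)

lemma pm_scale_1 [simp]: "pm_scale 1 x = x"
  by (rule poly_mapping_eqI) simp

lemma pm_scale_add_left: "pm_scale (c + d) x = pm_scale c x + pm_scale d x"
  by (rule poly_mapping_eqI) (simp add: lookup_add algebra_simps)

lemma vector_space_pm_scale: "vector_space (pm_scale :: 'k::field \<Rightarrow> _)"
  by (unfold_locales) (simp_all add: pm_scale_add pm_scale_add_left pm_scale_pm_scale)

lemma poly_mapping_sum_singles:
  "x = (\<Sum>p\<in>Poly_Mapping.keys x. Poly_Mapping.single p (Poly_Mapping.lookup x p))"
proof (rule poly_mapping_eqI)
  fix k
  show "Poly_Mapping.lookup x k =
      Poly_Mapping.lookup (\<Sum>p\<in>Poly_Mapping.keys x. Poly_Mapping.single p (Poly_Mapping.lookup x p)) k"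
    by (simp add: lookup_sum lookup_single when_def in_keys_iff)
qed

text \<open>The linear extension of a weight on the basis. Products, tensors and coproducts are
  handled through such functionals; single coefficients are the case of an indicator weight, see
  \<open>lookup_eq_lin\<close>.\<close>

definition lin :: "('a \<Rightarrow> 'k) \<Rightarrow> ('a \<Rightarrow>\<^sub>0 'k::comm_ring_1) \<Rightarrow> 'k"
  where "lin w x = (\<Sum>p\<in>Poly_Mapping.keys x. Poly_Mapping.lookup x p * w p)"

lemma lin_superset:
  "finite A \<Longrightarrow> Poly_Mapping.keys x \<subseteq> A \<Longrightarrow> lin w x = (\<Sum>p\<in>A. Poly_Mapping.lookup x p * w p)"
  unfolding lin_def by (rule sum.mono_neutral_left) (auto simp: in_keys_iff)

lemma lin_add [simp]: "lin w (x + y) = lin w x + lin w y"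
proof -
  let ?A = "Poly_Mapping.keys x \<union> Poly_Mapping.keys y"
  have "lin w (x + y) = (\<Sum>p\<in>?A. Poly_Mapping.lookup (x + y) p * w p)"
    using keys_add [of x y] by (intro lin_superset) auto
  also have "\<dots> = (\<Sum>p\<in>?A. Poly_Mapping.lookup x p * w p) + (\<Sum>p\<in>?A. Poly_Mapping.lookup y p * w p)"
    by (simp add: lookup_add algebra_simps sum.distrib)
  also have "\<dots> = lin w x + lin w y"
    by (simp add: lin_superset [of ?A])
  finally show ?thesis .
qed

lemma lin_zero [simp]: "lin w 0 = 0"
  by (simp add: lin_def)

lemma lin_single [simp]: "lin w (Poly_Mapping.single p c) = c * w p"
  by (cases "c = 0") (simp_all add: lin_def)

lemma lin_sum [simp]: "lin w (sum f A) = (\<Sum>a\<in>A. lin w (f a))"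
  by (induction A rule: infinite_finite_induct) simp_all

lemma lin_sum_list: "lin w (sum_list xs) = (\<Sum>x\<leftarrow>xs. lin w x)"
  by (induction xs) simp_all

lemma lin_scale [simp]: "lin w (pm_scale c x) = c * lin w x"
proof -
  have "lin w (pm_scale c x) = (\<Sum>p\<in>Poly_Mapping.keys x. Poly_Mapping.lookup (pm_scale c x) p * w p)"
    by (intro lin_superset) (auto simp: keys_pm_scale)
  then show ?thesis by (simp add: lin_def sum_distrib_left mult.assoc)
qed

lemma lin_cong: "(\<And>p. p \<in> Poly_Mapping.keys x \<Longrightarrow> w p = w' p) \<Longrightarrow> lin w x = lin w' x"
  by (simp add: lin_def)

lemma lin_mult:
  fixes x y :: "'a::comm_monoid_add \<Rightarrow>\<^sub>0 'k::comm_ring_1"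
  shows "lin w (x * y) = lin (\<lambda>p. lin (\<lambda>q. w (p + q)) y) x"
proof -
  have "x * y = (\<Sum>p\<in>Poly_Mapping.keys x. \<Sum>q\<in>Poly_Mapping.keys y.
      Poly_Mapping.single (p + q) (Poly_Mapping.lookup x p * Poly_Mapping.lookup y q))"
    by (subst poly_mapping_sum_singles [of x], subst poly_mapping_sum_singles [of y])
       (simp only: sum_product mult_single)
  then show ?thesis
    by (simp add: lin_def [of _ x] lin_def [of _ y] sum_distrib_left mult.assoc)
qed

lemma lin_tens:
  "lin (\<lambda>(p, q). v p * w q) (tens x y) = lin v x * lin w y"
proof -
  have "lin (\<lambda>(p, q). v p * w q) (tens x y) = (\<Sum>p\<in>Poly_Mapping.keys x. \<Sum>q\<in>Poly_Mapping.keys y.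
      Poly_Mapping.lookup x p * v p * (Poly_Mapping.lookup y q * w q))"
    unfolding tens_def by (simp add: algebra_simps)
  then show ?thesis by (simp add: lin_def sum_product)
qed

lemma lin_coprod:
  "lin w (coprod x) = lin (\<lambda>p. lin w (prod_mset (image_mset coprod_tree p))) x"
  by (simp add: coprod_def lin_def [of _ x])

lemma lookup_eq_lin: "Poly_Mapping.lookup x p = lin (\<lambda>q. if q = p then 1 else 0) x"
  by (simp add: lin_def if_distrib [of "(*) _"] sum.delta' in_keys_iff cong: if_cong)

lemma counit_eq_lin: "counit x = lin (\<lambda>q. if q = {#} then 1 else 0) x"
  unfolding counit_def by (rule lookup_eq_lin)

section \<open>The solution of a system\<close>

primrec tree_root :: "'i rtree \<Rightarrow> 'i" where "tree_root (Node i ts) = i"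

text \<open>The coefficient of the tree in the solution. The monomial of the roots of the children
  has its factorials inside \<open>taylor\<close>; what remains is the symmetry factor of the
  multiset of children themselves.\<close>

primrec tree_coeff :: "('i \<Rightarrow> ('i, 'k::field_char_0) mfps) \<Rightarrow> 'i rtree \<Rightarrow> 'k"
  where "tree_coeff F (Node i ts) = taylor (F i) (image_mset tree_root ts) / fact_mset ts
    * prod_mset (image_mset (tree_coeff F) ts)"

section \<open>Finiteness of the sets of trees and forests of bounded weight\<close>

lemma nverts_pos [simp]: "0 < nverts t"
  by (cases t) simp

lemma nverts_nonzero [simp]: "nverts t \<noteq> 0"
  using nverts_pos [of t] by simp

lemma weight_empty [simp]: "weight {#} = 0"
  by (simp add: weight_def)

lemma weight_add_mset [simp]: "weight (add_mset t p) = nverts t + weight p"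
  by (simp add: weight_def)

lemma weight_union [simp]: "weight (p + q) = weight p + weight q"
  by (simp add: weight_def)

lemma weight_eq_0_iff [simp]: "weight p = 0 \<longleftrightarrow> p = {#}"
  by (cases p) auto

lemma nverts_Node: "nverts (Node i ts) = Suc (weight ts)"
  by (simp add: weight_def)

lemma size_le_weight: "size p \<le> weight p"
proof (induction p)
  case (add t p)
  then show ?case using nverts_pos [of t] by (simp del: nverts_pos)
qed simp

lemma nverts_le_weight: "t \<in># p \<Longrightarrow> nverts t \<le> weight p"
  by (metis insert_DiffM le_add1 weight_add_mset)

lemma root_in_decorations [simp]: "tree_root t \<in> decorations t"
  by (cases t) simp

lemma finite_multisets_bounded:
  assumes "finite A"
  shows "finite {p. set_mset p \<subseteq> A \<and> size p \<le> n}"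
proof -
  have "{p. set_mset p \<subseteq> A \<and> size p \<le> n} = (\<Union>k\<in>{..n}. multisets_of_size A k)"
    by (auto simp: multisets_of_size_def)
  then show ?thesis using assms by auto
qed

lemma finite_trees:
  assumes "finite I"
  shows "finite {t. nverts t \<le> n \<and> decorations t \<subseteq> I}"
proof (induction n)
  case 0
  have "{t. nverts t \<le> 0 \<and> decorations t \<subseteq> I} = {}"
    by auto
  then show ?case by (metis finite.emptyI)
next
  case (Suc n)
  let ?A = "{t. nverts t \<le> n \<and> decorations t \<subseteq> I}"
  have "{t. nverts t \<le> Suc n \<and> decorations t \<subseteq> I}
      \<subseteq> (\<lambda>(i, p). Node i p) ` (I \<times> {p. set_mset p \<subseteq> ?A \<and> size p \<le> n})"
  proof
    fix t assume t: "t \<in> {t. nverts t \<le> Suc n \<and> decorations t \<subseteq> I}"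
    obtain i p where tt: "t = Node i p" by (cases t)
    with t have p: "weight p \<le> n" "i \<in> I" "\<And>u. u \<in># p \<Longrightarrow> decorations u \<subseteq> I"
      by (auto simp: nverts_Node simp del: nverts.simps)
    then have "p \<in> {p. set_mset p \<subseteq> ?A \<and> size p \<le> n}"
      using size_le_weight [of p] nverts_le_weight [of _ p] by fastforce
    then show "t \<in> (\<lambda>(i, p). Node i p) ` (I \<times> {p. set_mset p \<subseteq> ?A \<and> size p \<le> n})"
      using p(2) tt by force
  qed
  then show ?case
    by (rule finite_subset) (intro finite_imageI finite_cartesian_product assms finite_multisets_bounded Suc.IH)
qed

lemma finite_forests:
  assumes "finite I"
  shows "finite {p. weight p \<le> n \<and> p \<in> forests_on I}"
proof -
  have "{p. weight p \<le> n \<and> p \<in> forests_on I}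
      \<subseteq> {p. set_mset p \<subseteq> {t. nverts t \<le> n \<and> decorations t \<subseteq> I} \<and> size p \<le> n}"
    using size_le_weight nverts_le_weight by (force simp: forests_on_def intro: order_trans)
  then show ?thesis
    using finite_multisets_bounded [OF finite_trees [OF assms]] by (rule finite_subset)
qed

text \<open>Written as a sum over the elements of \<open>q\<close> to match
  \<open>linear_subst\<close> literally, with the trees as variables lying over their roots.\<close>

definition solution_series ::
  "'i set \<Rightarrow> ('i \<Rightarrow> ('i, 'k::field_char_0) mfps) \<Rightarrow> 'i \<Rightarrow> ('i rtree, 'k) mfps"
  where "solution_series I F i = Abs_mfps (\<lambda>q. \<Sum>t\<in>set_mset q.
    if q = {#t#} \<and> tree_root t = i then (if decorations t \<subseteq> I then tree_coeff F t else 0) else 0)"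

lemma linear_subst_solution:
  "linear_subst tree_root (\<lambda>t. if decorations t \<subseteq> I then tree_coeff F t else 0) (solution_series I F)"
  by (simp add: linear_subst_def solution_series_def)

lemma mcoeff_Bplus_Node:
  "mcoeff (Bplus i x) {#Node j p#} = (if j = i then mcoeff x p else 0)"
proof -
  have "mcoeff (Bplus i x) {#Node j p#} =
      Sum_any (\<lambda>q. if {#Node j p#} = {#Node i q#} then mcoeff x q else 0)"
    by (simp add: Bplus_def)
  also have "\<dots> = (\<Sum>q\<in>{p}. if {#Node j p#} = {#Node i q#} then mcoeff x q else 0)"
    by (rule Sum_any.expand_superset) auto
  finally show ?thesis by simp
qed

lemma mcoeff_Bplus_other: "size q \<noteq> 1 \<Longrightarrow> mcoeff (Bplus i x) q = 0"
proof -
  assume "size q \<noteq> 1"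
  then have "q \<noteq> {#Node i p#}" for p by auto
  then show ?thesis by (simp add: Bplus_def)
qed

lemma mfps_eqI_trees:
  assumes "\<And>j p. mcoeff f {#Node j p#} = mcoeff g {#Node j p#}"
    and "\<And>q. size q \<noteq> 1 \<Longrightarrow> mcoeff f q = mcoeff g q"
  shows "f = g"
proof (rule mfps_eqI)
  fix q
  show "mcoeff f q = mcoeff g q"
  proof (cases "size q = 1")
    case True
    then obtain t where "q = {#t#}" using size_1_singleton_mset by blast
    then show ?thesis using assms(1) by (cases t) simp
  qed (rule assms(2))
qed

lemma mcoeff_linear_subst_single:
  "linear_subst \<rho> x X \<Longrightarrow> mcoeff (X j) {#y#} = (if \<rho> y = j then x y else 0)"
  by (simp add: linear_subst_def)

lemma mcoeff_linear_subst_other: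
  "linear_subst \<rho> x X \<Longrightarrow> size q \<noteq> 1 \<Longrightarrow> mcoeff (X j) q = 0"
  unfolding linear_subst_def by (auto intro!: sum.neutral)

text \<open>By the formula for linear substitutions the coefficient of \<open>p\<close> in F_i(X) is
  the Taylor coefficient at the roots of \<open>p\<close>, divided by \<open>fact_mset p\<close>,
  times the coefficients of the trees: exactly the recursion that defines
  \<open>tree_coeff\<close>.\<close>

lemma solution_fixpoint:
  assumes "i \<in> I"
  shows "solution_series I F i = Bplus i (msubst (F i) (solution_series I F))" (is "?X i = _")
proof (rule mfps_eqI_trees)
  fix j p
  let ?x = "\<lambda>t. if decorations t \<subseteq> I then tree_coeff F t else 0"
  have prod: "prod_mset (image_mset ?x p) =
      (if \<Union> (decorations ` set_mset p) \<subseteq> I then prod_mset (image_mset (tree_coeff F) p) else 0)"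
    by (induction p) auto
  show "mcoeff (?X i) {#Node j p#} = mcoeff (Bplus i (msubst (F i) ?X)) {#Node j p#}"
    unfolding mcoeff_linear_subst_single [OF linear_subst_solution] mcoeff_Bplus_Node
      mcoeff_taylor [of "msubst _ _"] taylor_msubst_linear [OF linear_subst_solution] prod
    using assms by auto
qed (simp add: mcoeff_linear_subst_other [OF linear_subst_solution] mcoeff_Bplus_other)

text \<open>Every solution lies in the image of \<open>Bplus\<close>, so it is supported on single
  trees and is itself a linear substitution. Its coefficients then obey the recursion of
  \<open>tree_coeff\<close>, and induction on the tree identifies them.\<close>

lemma solution_unique:
  assumes F: "\<And>i. i \<in> I \<Longrightarrow> series_in I (F i)"
    and X: "\<And>i. i \<in> I \<Longrightarrow> X i \<in> ck_hat_on I" "\<And>i. i \<in> I \<Longrightarrow> X i = Bplus i (msubst (F i) X)"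
      "\<And>i. i \<notin> I \<Longrightarrow> X i = 0"
    and i: "i \<in> I"
  shows "X i = solution_series I F i"
proof -
  define x where "x t = mcoeff (X (tree_root t)) {#t#}" for t
  have lX: "linear_subst tree_root x X"
  proof (rule linear_substI)
    fix j t
    show "mcoeff (X j) {#t#} = (if tree_root t = j then x t else 0)"
      using X(2,3) by (cases t; cases "j \<in> I") (auto simp: x_def, metis mcoeff_Bplus_Node)
    show "mcoeff (X j) m = 0" if "size m \<noteq> 1" for m
      using X(2,3) that mcoeff_Bplus_other by (metis mcoeff_zero)
  qed
  have "x t = (if decorations t \<subseteq> I then tree_coeff F t else 0)" for t
  proof (induction t)
    case (Node j p)
    show ?case
    proof (cases "decorations (Node j p) \<subseteq> I")
      case True
      then have "j \<in> I" by simp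
      have "x (Node j p) = mcoeff (msubst (F j) X) p"
        unfolding x_def using X(2) [OF \<open>j \<in> I\<close>] mcoeff_Bplus_Node by (metis tree_root.simps)
      also have "\<dots> = taylor (F j) (image_mset tree_root p) / fact_mset p * prod_mset (image_mset x p)"
        by (simp add: mcoeff_taylor [of "msubst _ _"] taylor_msubst_linear [OF lX])
      also have "image_mset x p = image_mset (tree_coeff F) p"
        using Node True by (intro image_mset_cong) (auto simp: SUP_le_iff)
      finally show ?thesis using True by simp
    next
      case False
      have "x (Node j p) = 0"
      proof (cases "j \<in> I")
        case True
        then have "X j \<in> ck_hat_on I" by (rule X)
        then show ?thesis using False by (force simp: ck_hat_on_def forests_on_def x_def)
      qed (simp add: x_def X)
      then show ?thesis using False by (simp only: if_False)
    qed
  qed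
  then have x: "x = (\<lambda>t. if decorations t \<subseteq> I then tree_coeff F t else 0)" by blast
  show ?thesis
    by (rule mfps_eqI) (use lX linear_subst_solution [of I F] in \<open>simp add: linear_subst_def x\<close>)
qed

lemma sdseD:
  assumes "sdse I F"
  shows "finite I" "I \<noteq> {}" "\<And>i. i \<in> I \<Longrightarrow> series_in I (F i)" "\<And>i. i \<in> I \<Longrightarrow> mcoeff (F i) {#} = 1"
    "\<And>i. i \<in> I \<Longrightarrow> nonconstant (F i)"
  using assms by (auto simp: sdse_def)

lemma solution_in_hat: "solution_series I F i \<in> ck_hat_on I"
  unfolding ck_hat_on_def
proof safe
  fix q assume nz: "mcoeff (solution_series I F i) q \<noteq> 0"
  then have "size q = 1" using mcoeff_linear_subst_other [OF linear_subst_solution] by metis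
  then obtain t where "q = {#t#}" using size_1_singleton_mset by blast
  with nz show "q \<in> forests_on I"
    by (auto simp: mcoeff_linear_subst_single [OF linear_subst_solution] forests_on_def split: if_splits)
qed

lemma solution_series_outside:
  assumes "i \<notin> I"
  shows "solution_series I F i = 0"
proof (rule mfps_eqI_trees)
  fix j p
  show "mcoeff (solution_series I F i) {#Node j p#} = mcoeff 0 {#Node j p#}"
    using assms by (cases "j = i") (simp_all add: mcoeff_linear_subst_single [OF linear_subst_solution])
next
  fix q :: "'a rtree multiset" assume "size q \<noteq> 1"
  from mcoeff_linear_subst_other [OF linear_subst_solution this]
  show "mcoeff (solution_series I F i) q = mcoeff 0 q"
    by (simp only: mcoeff_zero)
qed

lemma sdse_solution_eq:
  assumes "sdse I F"
  shows "sdse_solution I F = solution_series I F"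
  unfolding sdse_solution_def
proof (rule the_equality)
  show "(\<forall>i\<in>I. solution_series I F i \<in> ck_hat_on I \<and>
      solution_series I F i = Bplus i (msubst (F i) (solution_series I F))) \<and>
      (\<forall>i. i \<notin> I \<longrightarrow> solution_series I F i = 0)"
    by (intro conjI ballI allI impI solution_in_hat solution_fixpoint solution_series_outside)
next
  fix X assume X: "(\<forall>i\<in>I. X i \<in> ck_hat_on I \<and> X i = Bplus i (msubst (F i) X)) \<and>
      (\<forall>i. i \<notin> I \<longrightarrow> X i = 0)"
  show "X = solution_series I F"
  proof
    fix i
    show "X i = solution_series I F i"
    proof (cases "i \<in> I")
      case True
      show ?thesis
        by (rule solution_unique [OF sdseD(3) [OF assms] _ _ _ True]) (use X in blast)+
    next
      case False
      then show ?thesis using X solution_series_outside [of i I F] by simp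
    qed
  qed
qed

section \<open>The homogeneous components of the solution\<close>

definition generator :: "'i set \<Rightarrow> ('i \<Rightarrow> ('i, 'k::field_char_0) mfps) \<Rightarrow> 'i \<Rightarrow> nat \<Rightarrow> ('i, 'k) ck"
  where "generator I F i n = hcomp n (sdse_solution I F i)"

lemma lookup_hcomp:
  assumes "finite I" "x \<in> ck_hat_on I"
  shows "Poly_Mapping.lookup (hcomp n x) p = (if weight p = n then mcoeff x p else 0)"
proof -
  have "finite {p. (if weight p = n then mcoeff x p else 0) \<noteq> 0}"
    by (rule finite_subset [OF _ finite_forests [OF assms(1), of n]])
       (use assms(2) in \<open>auto simp: ck_hat_on_def split: if_splits\<close>)
  then show ?thesis by (simp add: hcomp_def)
qed

lemma lookup_generator_single:
  assumes "sdse I F"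
  shows "Poly_Mapping.lookup (generator I F i n) {#t#} =
    (if nverts t = n \<and> tree_root t = i \<and> decorations t \<subseteq> I then tree_coeff F t else 0)"
  unfolding generator_def sdse_solution_eq [OF assms]
    lookup_hcomp [OF sdseD(1) [OF assms] solution_in_hat]
    mcoeff_linear_subst_single [OF linear_subst_solution]
  by simp

lemma lookup_generator_other:
  assumes "sdse I F" "size p \<noteq> 1"
  shows "Poly_Mapping.lookup (generator I F i n) p = 0"
  unfolding generator_def sdse_solution_eq [OF assms(1)]
    lookup_hcomp [OF sdseD(1) [OF assms(1)] solution_in_hat]
    mcoeff_linear_subst_other [OF linear_subst_solution assms(2)]
  by simp

definition solution_trees :: "'i set \<Rightarrow> 'i \<Rightarrow> nat \<Rightarrow> 'i rtree set"
  where "solution_trees I i n = {t. nverts t = n \<and> tree_root t = i \<and> decorations t \<subseteq> I}"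

lemma finite_solution_trees: "finite I \<Longrightarrow> finite (solution_trees I i n)"
  by (rule finite_subset [OF _ finite_trees [of I n]]) (auto simp: solution_trees_def)

lemma lin_generator:
  assumes "sdse I F"
  shows "lin w (generator I F i n) = (\<Sum>t\<in>solution_trees I i n. tree_coeff F t * w {#t#})"
proof -
  let ?A = "(\<lambda>t. {#t#}) ` solution_trees I i n"
  have "Poly_Mapping.keys (generator I F i n) \<subseteq> ?A"
  proof
    fix p assume p: "p \<in> Poly_Mapping.keys (generator I F i n)"
    then have "size p = 1" using lookup_generator_other [OF assms] by (auto simp: in_keys_iff)
    then obtain t where "p = {#t#}" using size_1_singleton_mset by blast
    then show "p \<in> ?A" using p
      by (auto simp: in_keys_iff lookup_generator_single [OF assms] solution_trees_def split: if_splits)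
  qed
  then have "lin w (generator I F i n) = (\<Sum>p\<in>?A. Poly_Mapping.lookup (generator I F i n) p * w p)"
    by (intro lin_superset) (simp_all add: finite_solution_trees sdseD(1) [OF assms])
  also have "\<dots> = (\<Sum>t\<in>solution_trees I i n. Poly_Mapping.lookup (generator I F i n) {#t#} * w {#t#})"
    by (subst sum.reindex) (auto simp: inj_on_def)
  finally show ?thesis by (simp add: lookup_generator_single [OF assms] solution_trees_def)
qed

subsection \<open>The algebra of a system\<close>

lemma subalgebra_Inter: "(\<And>A. A \<in> \<A> \<Longrightarrow> subalgebra A) \<Longrightarrow> subalgebra (\<Inter>\<A>)"
  unfolding subalgebra_def by blast

lemma subalgebra_sdse_algebra: "subalgebra (sdse_algebra I F)"
  unfolding sdse_algebra_def by (rule subalgebra_Inter) blast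

lemma generator_in_algebra: "i \<in> I \<Longrightarrow> generator I F i n \<in> sdse_algebra I F"
  unfolding sdse_algebra_def generator_def by blast

lemma sdse_algebra_subset:
  assumes "subalgebra A" "\<And>i n. i \<in> I \<Longrightarrow> generator I F i n \<in> A"
  shows "sdse_algebra I F \<subseteq> A"
  using assms unfolding sdse_algebra_def generator_def by blast

lemma sdse_algebra_induct [consumes 1, case_names one gen add mult scale]:
  assumes "x \<in> sdse_algebra I F"
    and "P 1" "\<And>i n. i \<in> I \<Longrightarrow> P (generator I F i n)"
    and "\<And>x y. x \<in> sdse_algebra I F \<Longrightarrow> y \<in> sdse_algebra I F \<Longrightarrow> P x \<Longrightarrow> P y \<Longrightarrow> P (x + y)"
    and "\<And>x y. x \<in> sdse_algebra I F \<Longrightarrow> y \<in> sdse_algebra I F \<Longrightarrow> P x \<Longrightarrow> P y \<Longrightarrow> P (x * y)"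
    and "\<And>c x. x \<in> sdse_algebra I F \<Longrightarrow> P x \<Longrightarrow> P (pm_scale c x)"
  shows "P x"
proof -
  have "sdse_algebra I F \<subseteq> {x \<in> sdse_algebra I F. P x}"
    using assms(2-) subalgebra_sdse_algebra [of I F] generator_in_algebra [of _ I F]
    by (intro sdse_algebra_subset) (simp_all add: subalgebra_def)
  then show ?thesis using assms(1) by blast
qed

lemma sdse_cong:
  assumes "\<And>i. i \<in> I \<Longrightarrow> F i = G i"
  shows "sdse I F \<longleftrightarrow> sdse I G"
  using assms by (simp add: sdse_def)

lemma sdse_algebra_cong:
  assumes "\<And>i. i \<in> I \<Longrightarrow> F i = G i"
  shows "sdse_algebra I F = sdse_algebra I G"
proof -
  have "sdse_solution I F = sdse_solution I G"
    using assms by (simp add: sdse_solution_def)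
  then show ?thesis by (simp add: sdse_algebra_def)
qed

lemma sdse_lie_cong: "(\<And>i. i \<in> I \<Longrightarrow> F i = G i) \<Longrightarrow> sdse_lie I F = sdse_lie I G"
  using sdse_algebra_cong [of I F G] by (simp add: sdse_lie_def)

lemma hopf_sdse_cong: "(\<And>i. i \<in> I \<Longrightarrow> F i = G i) \<Longrightarrow> hopf_sdse I F \<longleftrightarrow> hopf_sdse I G"
  using sdse_algebra_cong [of I F G] sdse_cong [of I F G] by (simp add: hopf_sdse_def)

section \<open>Cuts of planar trees\<close>

lemma unplanar_surj: "\<exists>s. unplanar s = t"
proof (induction t)
  case (Node i ts)
  then obtain f where f: "\<And>t. t \<in># ts \<Longrightarrow> unplanar (f t) = t" by metis
  obtain xs where xs: "mset xs = ts" using ex_mset by blast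
  have "map unplanar (map f xs) = xs" using f xs by (auto intro!: map_idI)
  then have "unplanar (PNode i (map f xs)) = Node i ts"
    using xs by (simp only: unplanar.simps)
  then show ?case by blast
qed

lemma positions_PNode:
  "positions (PNode i ts) = insert [] (\<Union>k<length ts. (#) k ` positions (ts ! k))"
proof (rule set_eqI)
  fix p
  show "p \<in> positions (PNode i ts) \<longleftrightarrow> p \<in> insert [] (\<Union>k<length ts. (#) k ` positions (ts ! k))"
    by (cases p) (auto simp: positions_def)
qed

lemma Nil_in_positions [simp]: "[] \<in> positions s"
  by (simp add: positions_def)

lemma edges_PNode: "edges (PNode i ts) = (\<Union>k<length ts. (#) k ` positions (ts ! k))"
  by (auto simp: edges_def positions_PNode)

lemma positions_edges: "positions s = insert [] (edges s)"
  by (auto simp: edges_def)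

lemma finite_positions [simp]: "finite (positions s)"
  by (induction s) (auto simp: positions_PNode)

lemma finite_edges [simp]: "finite (edges s)"
  by (simp add: edges_def)

lemma finite_admissible_cuts [simp]: "finite (admissible_cuts s)"
  by (rule finite_subset [of _ "Pow (edges s)"]) (auto simp: admissible_cuts_def)

text \<open>The induction scheme for statements about cuts: an edge is either a root edge
  \<open>[k]\<close> or an edge of the k-th subtree, and there \<open>c\<close> becomes
  \<open>{p. k # p \<in> c}\<close>.\<close>

lemma sum_edges_PNode:
  assumes "c \<subseteq> edges (PNode i ts)"
  shows "sum g c = (\<Sum>k<length ts. (if [k] \<in> c then g [k] else 0) +
    (\<Sum>e\<in>{p. k # p \<in> c} \<inter> edges (ts ! k). g (k # e)))"
proof -
  let ?c = "\<lambda>k. {p. k # p \<in> c}"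
  have c: "c = (\<Union>k<length ts. (#) k ` (?c k \<inter> positions (ts ! k)))"
  proof (rule set_eqI, rule iffI)
    fix x assume x: "x \<in> c"
    then obtain k p where kp: "k < length ts" "x = k # p" "p \<in> positions (ts ! k)"
      using assms by (auto simp: edges_PNode)
    have "x \<in> (#) k ` (?c k \<inter> positions (ts ! k))"
      using x kp by simp
    with kp(1) show "x \<in> (\<Union>k<length ts. (#) k ` (?c k \<inter> positions (ts ! k)))" by blast
  qed auto
  have "sum g c = sum g (\<Union>k<length ts. (#) k ` (?c k \<inter> positions (ts ! k)))"
    by (rule arg_cong [OF c])
  also have "\<dots> = (\<Sum>k<length ts. sum g ((#) k ` (?c k \<inter> positions (ts ! k))))"
    by (rule sum.UNION_disjoint) auto
  also have "\<dots> = (\<Sum>k<length ts. \<Sum>p\<in>?c k \<inter> positions (ts ! k). g (k # p))"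
    by (simp add: sum.reindex)
  also have "\<dots> = (\<Sum>k<length ts. (if [k] \<in> c then g [k] else 0) +
      (\<Sum>e\<in>?c k \<inter> edges (ts ! k). g (k # e)))"
  proof (rule sum.cong [OF refl])
    fix k
    \<comment> \<open>The empty position of the k-th subtree is its root, the lower end of the edge
      \<open>[k]\<close> of the whole tree.\<close>
    have "?c k \<inter> positions (ts ! k) = (if [k] \<in> c then insert [] (?c k \<inter> edges (ts ! k)) else ?c k \<inter> edges (ts ! k))"
      by (auto simp: positions_edges)
    then show "(\<Sum>p\<in>?c k \<inter> positions (ts ! k). g (k # p)) = (if [k] \<in> c then g [k] else 0) +
        (\<Sum>e\<in>?c k \<inter> edges (ts ! k). g (k # e))"
      by (simp add: edges_def)
  qed
  finally show ?thesis .
qed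

declare root_component.simps [simp del] unplanar.simps [simp del]

lemma root_component_PNode:
  "root_component c (PNode i ts) = Node i
    (image_mset (\<lambda>k. root_component {p. k # p \<in> c} (ts ! k)) (mset_set {k. k < length ts \<and> [k] \<notin> c}))"
proof -
  have "mset (filter (\<lambda>k. [k] \<notin> c) [0..<length ts]) = mset_set {k. k < length ts \<and> [k] \<notin> c}"
    by (simp add: mset_filter mset_upt filter_mset_mset_set)
  then show ?thesis by (simp add: root_component.simps mset_map del: mset_filter)
qed

lemma unplanar_PNode:
  "unplanar (PNode i ts) = Node i (image_mset (\<lambda>k. unplanar (ts ! k)) (mset_set {k. k < length ts}))"
proof -
  have "map unplanar ts = map (\<lambda>k. unplanar (ts ! k)) [0..<length ts]"
    by (rule nth_equalityI) auto
  then have "mset (map unplanar ts) = mset (map (\<lambda>k. unplanar (ts ! k)) [0..<length ts])"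
    by (rule arg_cong)
  also have "\<dots> = image_mset (\<lambda>k. unplanar (ts ! k)) (mset_set {k. k < length ts})"
    by (simp add: atLeast0LessThan lessThan_def)
  finally show ?thesis by (simp only: unplanar.simps)
qed

text \<open>The set \<open>{[]}\<close> is what remains of a single cut edge when seen from its
  lower end; the root of a tree is not an edge of it, so nothing is cut.\<close>

lemma root_component_trivial:
  assumes "c \<subseteq> {[]}"
  shows "root_component c s = unplanar s"
  using assms
proof (induction s arbitrary: c)
  case (PNode i ts)
  have "[k] \<notin> c" "{p. k # p \<in> c} = {}" for k using PNode.prems by auto
  with PNode.IH [of _ "{}"] show ?case
    by (auto simp: root_component_PNode unplanar_PNode intro!: image_mset_cong)
qed

text \<open>Stated for arbitrary \<open>c\<close> and summed over \<open>c \<inter> edges s\<close>: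
  on passing to the k-th subtree, \<open>c\<close> turns into a set that contains \<open>[]\<close>
  whenever \<open>[k]\<close> is cut, and this element has to be ignored.\<close>

lemma nverts_components:
  "nverts (root_component c s)
    + (\<Sum>e\<in>c \<inter> edges s. nverts (root_component {p. e @ p \<in> c} (the (subtree_at s e))))
    = nverts (unplanar s)"
proof (induction s arbitrary: c)
  case (PNode i ts)
  let ?n = "length ts" and ?c = "\<lambda>k. {p. k # p \<in> c}"
  let ?g = "\<lambda>s c e. nverts (root_component {p. e @ p \<in> c} (the (subtree_at s e)))"
  have "(\<Sum>e\<in>c \<inter> edges (PNode i ts). ?g (PNode i ts) c e) =
      (\<Sum>k<?n. (if [k] \<in> c \<inter> edges (PNode i ts) then ?g (PNode i ts) c [k] else 0) +
        (\<Sum>e\<in>{p. k # p \<in> c \<inter> edges (PNode i ts)} \<inter> edges (ts ! k). ?g (PNode i ts) c (k # e)))"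
    by (rule sum_edges_PNode) auto
  also have "\<dots> = (\<Sum>k<?n. (if [k] \<in> c then nverts (root_component (?c k) (ts ! k)) else 0) +
        (\<Sum>e\<in>?c k \<inter> edges (ts ! k). ?g (ts ! k) (?c k) e))"
  proof (rule sum.cong [OF refl], rule arg_cong2 [where f = "(+)"])
    fix k assume k: "k \<in> {..<?n}"
    show "(if [k] \<in> c \<inter> edges (PNode i ts) then ?g (PNode i ts) c [k] else 0) =
        (if [k] \<in> c then nverts (root_component (?c k) (ts ! k)) else 0)"
      using k Nil_in_positions [of "ts ! k"] by (force simp: edges_PNode)
    show "(\<Sum>e\<in>{p. k # p \<in> c \<inter> edges (PNode i ts)} \<inter> edges (ts ! k). ?g (PNode i ts) c (k # e)) =
        (\<Sum>e\<in>?c k \<inter> edges (ts ! k). ?g (ts ! k) (?c k) e)"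
      using k by (intro sum.cong) (auto simp: edges_PNode positions_edges)
  qed
  also have "nverts (root_component c (PNode i ts)) + \<dots> = Suc (\<Sum>k<?n. nverts (unplanar (ts ! k)))"
  proof -
    have "nverts (root_component c (PNode i ts)) =
        Suc (\<Sum>k | k < ?n \<and> [k] \<notin> c. nverts (root_component (?c k) (ts ! k)))"
      by (simp add: root_component_PNode sum_unfold_sum_mset image_mset.compositionality comp_def)
    also have "(\<Sum>k | k < ?n \<and> [k] \<notin> c. nverts (root_component (?c k) (ts ! k))) =
        (\<Sum>k<?n. if [k] \<notin> c then nverts (root_component (?c k) (ts ! k)) else 0)"
      by (subst sum.inter_filter [symmetric]) (auto intro!: sum.cong)
    finally have "nverts (root_component c (PNode i ts)) + (\<Sum>k<?n. (if [k] \<in> c then nverts (root_component (?c k) (ts ! k)) else 0) +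
        (\<Sum>e\<in>?c k \<inter> edges (ts ! k). ?g (ts ! k) (?c k) e)) =
      Suc (\<Sum>k<?n. nverts (root_component (?c k) (ts ! k)) + (\<Sum>e\<in>?c k \<inter> edges (ts ! k). ?g (ts ! k) (?c k) e))"
      by (simp add: sum.distrib [symmetric]) (auto intro!: sum.cong)
    also have "\<dots> = Suc (\<Sum>k<?n. nverts (unplanar (ts ! k)))"
    proof (intro arg_cong [where f = Suc] sum.cong refl)
      fix k assume "k \<in> {..<?n}"
      then show "nverts (root_component (?c k) (ts ! k)) + (\<Sum>e\<in>?c k \<inter> edges (ts ! k). ?g (ts ! k) (?c k) e) =
          nverts (unplanar (ts ! k))"
        using PNode.IH [of "ts ! k" "?c k"] by simp
    qed
    finally show ?thesis .
  qed
  also have "\<dots> = nverts (unplanar (PNode i ts))"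
    unfolding unplanar_PNode
    by (simp add: sum_unfold_sum_mset image_mset.compositionality comp_def lessThan_def)
  finally show ?case .
qed

lemma decorations_root_component: "decorations (root_component c s) \<subseteq> decorations (unplanar s)"
proof (induction s arbitrary: c)
  case (PNode i ts)
  have "decorations (root_component c (ts ! k)) \<subseteq> decorations (unplanar (ts ! k))"
    if "k < length ts" for k c
    using PNode that by simp
  then show ?case by (fastforce simp: root_component_PNode unplanar_PNode)
qed

lemma decorations_subtree:
  "subtree_at s e = Some u \<Longrightarrow> decorations (unplanar u) \<subseteq> decorations (unplanar s)"
proof (induction s e rule: subtree_at.induct)
  case (2 i ts k p)
  then show ?case by (fastforce simp: unplanar_PNode split: if_splits)
qed auto

section \<open>Admissible cuts: degrees, decorations and the counit axioms\<close>

lemma admissible_cutsD: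
  assumes "c \<in> admissible_cuts s"
  shows "c \<noteq> {}" "c \<subseteq> edges s" "finite c"
  using assms finite_subset [OF _ finite_edges] by (auto simp: admissible_cuts_def)

lemma size_Pcut [simp]: "size (Pcut c s) = card c"
  by (simp add: Pcut_def)

lemma weight_cut:
  assumes "c \<in> admissible_cuts s"
  shows "weight (Pcut c s) + nverts (Rcut c s) = nverts (unplanar s)"
proof -
  have "weight (Pcut c s) =
      (\<Sum>e\<in>c. nverts (root_component {p. e @ p \<in> c} (the (subtree_at s e))))"
    by (simp add: weight_def Pcut_def sum_unfold_sum_mset image_mset.compositionality comp_def)
  moreover have "c \<inter> edges s = c" using admissible_cutsD [OF assms] by auto
  ultimately show ?thesis using nverts_components [of c s] by (simp add: Rcut_def)
qed

lemma decorations_Rcut: "decorations (Rcut c s) \<subseteq> decorations (unplanar s)"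
  by (simp add: Rcut_def decorations_root_component)

lemma decorations_Pcut:
  assumes "c \<in> admissible_cuts s" "t \<in># Pcut c s"
  shows "decorations t \<subseteq> decorations (unplanar s)"
proof -
  obtain e where e: "e \<in> c" "t = root_component {p. e @ p \<in> c} (the (subtree_at s e))"
    using assms admissible_cutsD(3) [OF assms(1)] by (auto simp: Pcut_def)
  then have "e \<in> positions s" using admissible_cutsD(2) [OF assms(1)] by (auto simp: edges_def)
  then obtain u where "subtree_at s e = Some u" by (auto simp: positions_def)
  then show ?thesis
    using e decorations_root_component decorations_subtree by fastforce
qed

text \<open>Hides the choice of the planar representative. The same \<open>s\<close> serves for all
  weights, so that different functionals can be evaluated on one set of cuts.\<close>

lemma lin_coprod_tree:
  fixes t :: "'i rtree"
  shows "\<exists>s. unplanar s = t \<and> (\<forall>w. lin w (coprod_tree t :: ('i, 'k::field_char_0) ck2) =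
    w ({#t#}, {#}) + w ({#}, {#t#}) + (\<Sum>c\<in>admissible_cuts s. w (Pcut c s, {#Rcut c s#})))"
proof (intro exI conjI allI)
  let ?s = "SOME s. unplanar s = t"
  show "unplanar ?s = t" using unplanar_surj by (rule someI_ex)
  show "lin w (coprod_tree t :: ('i, 'k) ck2) = w ({#t#}, {#}) + w ({#}, {#t#})
      + (\<Sum>c\<in>admissible_cuts ?s. w (Pcut c ?s, {#Rcut c ?s#}))" for w
    by (simp add: coprod_tree_def Let_def)
qed

lemma lin_coprod_tree_left:
  "lin (\<lambda>(p, q). w p * (if q = {#} then 1 else 0)) (coprod_tree t) = (w {#t#} :: 'k::field_char_0)"
proof -
  obtain s where s: "unplanar s = t" "\<And>w. lin w (coprod_tree t :: (_, 'k) ck2) = w ({#t#}, {#}) + w ({#}, {#t#})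
      + (\<Sum>c\<in>admissible_cuts s. w (Pcut c s, {#Rcut c s#}))"
    using lin_coprod_tree [of t, where 'k = 'k] by blast
  show ?thesis unfolding s(2) by simp
qed

lemma lin_coprod_tree_right:
  "lin (\<lambda>(p, q). (if p = {#} then 1 else 0) * w q) (coprod_tree t) = (w {#t#} :: 'k::field_char_0)"
proof -
  obtain s where s: "unplanar s = t" "\<And>w. lin w (coprod_tree t :: (_, 'k) ck2) = w ({#t#}, {#}) + w ({#}, {#t#})
      + (\<Sum>c\<in>admissible_cuts s. w (Pcut c s, {#Rcut c s#}))"
    using lin_coprod_tree [of t, where 'k = 'k] by blast
  have "Pcut c s \<noteq> {#}" if "c \<in> admissible_cuts s" for c
    using admissible_cutsD(1,3) [OF that] size_Pcut [of c s] by (metis card_0_eq size_empty)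
  then show ?thesis unfolding s(2) by simp
qed

abbreviation coprod_forest :: "'i forest \<Rightarrow> ('i, 'k::field_char_0) ck2"
  where "coprod_forest p \<equiv> prod_mset (image_mset coprod_tree p)"

text \<open>One counit axiom, tested against an arbitrary weight. For a tree, all cuts drop out
  because the trunk is never empty; for a forest the coproduct is multiplicative, and the induction
  replaces \<open>w\<close> by its translates, whence the arbitrary weight.\<close>

lemma lin_coprod_forest_left:
  "lin (\<lambda>(p, q). w p * (if q = {#} then 1 else 0)) (coprod_forest r) = (w r :: 'k::field_char_0)"
proof (induction r arbitrary: w)
  case empty
  then show ?case by (simp add: single_one [symmetric] zero_prod_def del: single_one)
next
  case (add t r)
  have "lin (\<lambda>(p, q). w p * (if q = {#} then 1 else 0)) (coprod_forest (add_mset t r)) =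
      lin (\<lambda>(p, q). lin (\<lambda>(p', q'). w (p + p') * (if q = {#} \<and> q' = {#} then 1 else 0)) (coprod_forest r))
        (coprod_tree t)"
    by (simp add: lin_mult case_prod_unfold)
  also have "\<dots> = lin (\<lambda>(p, q). w (p + r) * (if q = {#} then 1 else 0)) (coprod_tree t)"
  proof (rule lin_cong, safe)
    fix p q
    show "lin (\<lambda>(p', q'). w (p + p') * (if q = {#} \<and> q' = {#} then 1 else 0)) (coprod_forest r) =
        w (p + r) * (if q = {#} then 1 else 0)"
      using add.IH [of "\<lambda>p'. w (p + p')"] by (cases "q = {#}") (simp_all add: lin_def)
  qed
  also have "\<dots> = w (add_mset t r)"
    by (simp add: lin_coprod_tree_left [of "\<lambda>p. w (p + r)"])
  finally show ?case .
qed

lemma lin_coprod_forest_right: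
  "lin (\<lambda>(p, q). (if p = {#} then 1 else 0) * w q) (coprod_forest r) = (w r :: 'k::field_char_0)"
proof (induction r arbitrary: w)
  case empty
  then show ?case by (simp add: single_one [symmetric] zero_prod_def del: single_one)
next
  case (add t r)
  have "lin (\<lambda>(p, q). (if p = {#} then 1 else 0) * w q) (coprod_forest (add_mset t r)) =
      lin (\<lambda>(p, q). lin (\<lambda>(p', q'). (if p = {#} \<and> p' = {#} then 1 else 0) * w (q + q')) (coprod_forest r))
        (coprod_tree t)"
    by (simp add: lin_mult case_prod_unfold)
  also have "\<dots> = lin (\<lambda>(p, q). (if p = {#} then 1 else 0) * w (q + r)) (coprod_tree t)"
  proof (rule lin_cong, safe)
    fix p q
    show "lin (\<lambda>(p', q'). (if p = {#} \<and> p' = {#} then 1 else 0) * w (q + q')) (coprod_forest r) =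
        (if p = {#} then 1 else 0) * w (q + r)"
      using add.IH [of "\<lambda>q'. w (q + q')"] by (cases "p = {#}") (simp_all add: lin_def)
  qed
  also have "\<dots> = w (add_mset t r)"
    by (simp add: lin_coprod_tree_right [of "\<lambda>p. w (p + r)"])
  finally show ?case .
qed

lemma keys_coprod_tree:
  assumes "(p, q) \<in> Poly_Mapping.keys (coprod_tree t :: ('i, 'k::field_char_0) ck2)"
  shows "weight p + weight q = nverts t" "\<Union> (decorations ` set_mset (p + q)) \<subseteq> decorations t"
proof -
  obtain s where s: "unplanar s = t" "\<And>w. lin w (coprod_tree t :: ('i, 'k) ck2) = w ({#t#}, {#}) + w ({#}, {#t#})
      + (\<Sum>c\<in>admissible_cuts s. w (Pcut c s, {#Rcut c s#}))"
    using lin_coprod_tree [of t, where 'k = 'k] by blast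
  have "Poly_Mapping.lookup (coprod_tree t :: ('i, 'k) ck2) (p, q) \<noteq> 0"
    using assms by (simp add: in_keys_iff)
  then have "(p, q) = ({#t#}, {#}) \<or> (p, q) = ({#}, {#t#}) \<or>
      (\<exists>c\<in>admissible_cuts s. (p, q) = (Pcut c s, {#Rcut c s#}))"
    unfolding lookup_eq_lin s(2)
  proof (rule contrapos_np)
    assume neg: "\<not> ((p, q) = ({#t#}, {#}) \<or> (p, q) = ({#}, {#t#}) \<or>
      (\<exists>c\<in>admissible_cuts s. (p, q) = (Pcut c s, {#Rcut c s#})))"
    have "(\<Sum>c\<in>admissible_cuts s. if (Pcut c s, {#Rcut c s#}) = (p, q) then 1 else (0::'k)) = 0"
      using neg by (intro sum.neutral) auto
    then show "(if ({#t#}, {#}) = (p, q) then 1 else 0) + (if ({#}, {#t#}) = (p, q) then 1 else 0) +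
      (\<Sum>c\<in>admissible_cuts s. if (Pcut c s, {#Rcut c s#}) = (p, q) then 1 else (0::'k)) = 0"
      using neg by auto
  qed
  then show "weight p + weight q = nverts t" "\<Union> (decorations ` set_mset (p + q)) \<subseteq> decorations t"
    using weight_cut decorations_Rcut decorations_Pcut s(1) by (fastforce simp: weight_def)+
qed

lemma keys_coprod_forest:
  "(p, q) \<in> Poly_Mapping.keys (coprod_forest r :: ('i, 'k::field_char_0) ck2) \<Longrightarrow>
    weight p + weight q = weight r \<and>
    \<Union> (decorations ` set_mset (p + q)) \<subseteq> \<Union> (decorations ` set_mset r)"
proof (induction r arbitrary: p q)
  case empty
  then show ?case by (auto simp: zero_prod_def)
next
  case (add t r)
  from add.prems have "(p, q) \<in> Poly_Mapping.keys (coprod_tree t * coprod_forest r :: ('i, 'k) ck2)"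
    by simp
  then obtain a b where ab: "(p, q) = a + b" "a \<in> Poly_Mapping.keys (coprod_tree t :: ('i, 'k) ck2)"
    "b \<in> Poly_Mapping.keys (coprod_forest r :: ('i, 'k) ck2)"
    using subsetD [OF keys_mult] by blast
  obtain p1 q1 p2 q2 where "a = (p1, q1)" "b = (p2, q2)" by (cases a, cases b)
  with ab have 1: "(p1, q1) \<in> Poly_Mapping.keys (coprod_tree t :: ('i, 'k) ck2)"
    and 2: "(p2, q2) \<in> Poly_Mapping.keys (coprod_forest r :: ('i, 'k) ck2)"
    and pq: "p = p1 + p2" "q = q1 + q2"
    by simp_all
  show ?case
    using keys_coprod_tree [OF 1] add.IH [OF 2] unfolding pq by auto
qed

subsection \<open>Cuts of a single edge\<close>

text \<open>The pruned forest has one tree for each cut edge, so a weight \<open>v\<close>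
  concentrated on single trees kills all cuts but those of one edge. The term with empty pruned part
  dies by \<open>v\<close>, the one with empty trunk by \<open>w\<close>.\<close>

lemma lin_coprod_tree_single_edge:
  fixes t :: "'i rtree" and v w :: "'i forest \<Rightarrow> 'k::field_char_0"
  assumes v: "\<And>p. size p \<noteq> 1 \<Longrightarrow> v p = 0" and w: "w {#} = 0"
  shows "\<exists>s. unplanar s = t \<and> lin (\<lambda>(p, q). v p * w q) (coprod_tree t) =
    (\<Sum>e\<in>edges s. v {#unplanar (the (subtree_at s e))#} * w {#root_component {e} s#})"
proof -
  obtain s where s: "unplanar s = t" "\<And>w. lin w (coprod_tree t :: (_, 'k) ck2) = w ({#t#}, {#}) + w ({#}, {#t#})
      + (\<Sum>c\<in>admissible_cuts s. w (Pcut c s, {#Rcut c s#}))"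
    using lin_coprod_tree [of t, where 'k = 'k] by blast
  have adm: "{e} \<in> admissible_cuts s" if "e \<in> edges s" for e
  proof -
    have "card {e' \<in> {e}. prefix e' l} \<le> card {e}" for l by (rule card_mono) auto
    then show ?thesis using that by (auto simp: admissible_cuts_def)
  qed
  have "lin (\<lambda>(p, q). v p * w q) (coprod_tree t) =
      (\<Sum>c\<in>admissible_cuts s. v (Pcut c s) * w {#Rcut c s#})"
    unfolding s(2) using v [of "{#}"] w by simp
  also have "\<dots> = (\<Sum>c\<in>(\<lambda>e. {e}) ` edges s. v (Pcut c s) * w {#Rcut c s#})"
  proof (rule sum.mono_neutral_right)
    show "\<forall>c\<in>admissible_cuts s - (\<lambda>e. {e}) ` edges s. v (Pcut c s) * w {#Rcut c s#} = 0"
    proof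
      fix c assume c: "c \<in> admissible_cuts s - (\<lambda>e. {e}) ` edges s"
      have "card c \<noteq> 1"
      proof
        assume "card c = 1"
        then obtain e where "c = {e}" by (rule card_1_singletonE)
        with c admissible_cutsD(2) [of c s] show False by auto
      qed
      then have "v (Pcut c s) = 0" by (intro v) simp
      then show "v (Pcut c s) * w {#Rcut c s#} = 0" by simp
    qed
  qed (use adm in auto)
  also have "\<dots> = (\<Sum>e\<in>edges s. v (Pcut {e} s) * w {#Rcut {e} s#})"
    by (subst sum.reindex) (auto simp: inj_on_def)
  also have "\<dots> = (\<Sum>e\<in>edges s. v {#unplanar (the (subtree_at s e))#} * w {#root_component {e} s#})"
  proof (rule sum.cong [OF refl])
    fix e
    have "root_component {p. e @ p \<in> {e}} (the (subtree_at s e)) = unplanar (the (subtree_at s e))"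
      by (rule root_component_trivial) auto
    then show "v (Pcut {e} s) * w {#Rcut {e} s#} =
        v {#unplanar (the (subtree_at s e))#} * w {#root_component {e} s#}"
      by (simp add: Pcut_def Rcut_def)
  qed
  finally show ?thesis using s(1) by blast
qed

text \<open>The trees without ramification; \<open>ladder js\<close> is the forest of the children of the root of the
  ladder with decorations \<open>i # js\<close>.\<close>

primrec ladder :: "'i list \<Rightarrow> 'i forest" where
  "ladder [] = {#}"
| "ladder (j # js) = {#Node j (ladder js)#}"

primrec children :: "'i rtree \<Rightarrow> 'i forest" where "children (Node i ts) = ts"

text \<open>The number of edges of \<open>t\<close> whose cut separates \<open>u\<close> from the ladder \<open>Node i (ladder js)\<close>.\<close>

primrec ladder_cuts :: "'i list \<Rightarrow> 'i \<Rightarrow> 'i rtree \<Rightarrow> 'i rtree \<Rightarrow> nat" where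
  "ladder_cuts [] i u t = (if t = Node i {#u#} then 1 else 0)"
| "ladder_cuts (j # js) i u t =
    (if t = Node i (add_mset u (ladder (j # js))) then count (add_mset u (ladder (j # js))) u else 0) +
    (\<Sum>t'\<in>set_mset (children t). if t = Node i {#t'#} then ladder_cuts js j u t' else 0)"

lemma count_image_mset_set:
  "finite A \<Longrightarrow> count (image_mset f (mset_set A)) x = (\<Sum>a\<in>A. if f a = x then 1 else 0)"
  by (induction A rule: finite_induct) auto

lemma sum_count_children:
  fixes n :: nat
  shows "(\<Sum>k<n. if P \<and> f k = x \<and> Q then 1 else 0) =
    (if P \<and> Q then count (image_mset f (mset_set {k. k < n})) x else (0::nat))"
  by (cases P; cases Q) (simp_all add: count_image_mset_set lessThan_def)

lemma root_component_root_edge: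
  assumes "k < length ts"
  shows "root_component {[k]} (PNode i ts) =
    Node i (image_mset (\<lambda>k. unplanar (ts ! k)) (mset_set {k. k < length ts}) - {#unplanar (ts ! k)#})"
proof -
  let ?K = "{k. k < length ts}"
  have K: "{k'. k' < length ts \<and> [k'] \<notin> {[k]}} = ?K - {k}" by auto
  have "mset_set (?K - {k}) = mset_set ?K - {#k#}"
    using assms by (subst mset_set_Diff) auto
  moreover have "image_mset (\<lambda>k. unplanar (ts ! k)) (mset_set ?K - {#k#}) =
      image_mset (\<lambda>k. unplanar (ts ! k)) (mset_set ?K) - {#unplanar (ts ! k)#}"
    using assms by (subst image_mset_Diff) auto
  moreover have "image_mset (\<lambda>k'. root_component {p. k' # p \<in> {[k]}} (ts ! k')) (mset_set (?K - {k})) =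
      image_mset (\<lambda>k. unplanar (ts ! k)) (mset_set (?K - {k}))"
    by (intro image_mset_cong root_component_trivial) auto
  ultimately show ?thesis unfolding root_component_PNode K by (simp only:)
qed

lemma root_component_inner_edge:
  assumes "k < length ts" "e \<noteq> []"
  shows "root_component {k # e} (PNode i ts) =
    Node i (add_mset (root_component {e} (ts ! k))
      (image_mset (\<lambda>k. unplanar (ts ! k)) (mset_set {k. k < length ts}) - {#unplanar (ts ! k)#}))"
proof -
  let ?K = "{k. k < length ts}"
  let ?f = "\<lambda>k'. root_component {p. k' # p \<in> {k # e}} (ts ! k')"
  have K: "{k'. k' < length ts \<and> [k'] \<notin> {k # e}} = ?K" using assms by auto
  have mK: "mset_set ?K = add_mset k (mset_set (?K - {k}))"
    using assms by (subst mset_set.remove [of _ k]) auto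
  have "image_mset ?f (mset_set (?K - {k})) = image_mset (\<lambda>k. unplanar (ts ! k)) (mset_set (?K - {k}))"
    by (intro image_mset_cong root_component_trivial) auto
  then show ?thesis unfolding root_component_PNode K mK by simp
qed

lemma sum_all_edges_PNode:
  "sum g (edges (PNode i ts)) = (\<Sum>k<length ts. g [k] + (\<Sum>e\<in>edges (ts ! k). g (k # e)))"
proof -
  have "sum g (edges (PNode i ts)) = (\<Sum>k<length ts. (if [k] \<in> edges (PNode i ts) then g [k] else 0) +
    (\<Sum>e\<in>{p. k # p \<in> edges (PNode i ts)} \<inter> edges (ts ! k). g (k # e)))"
    by (rule sum_edges_PNode [OF order_refl])
  also have "\<dots> = (\<Sum>k<length ts. g [k] + (\<Sum>e\<in>edges (ts ! k). g (k # e)))"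
  proof (rule sum.cong [OF refl])
    fix k assume "k \<in> {..<length ts}"
    then have "[k] \<in> edges (PNode i ts)" "{p. k # p \<in> edges (PNode i ts)} \<inter> edges (ts ! k) = edges (ts ! k)"
      using Nil_in_positions [of "ts ! k"] by (auto simp: edges_PNode positions_edges)
    then show "(if [k] \<in> edges (PNode i ts) then g [k] else 0) +
        (\<Sum>e\<in>{p. k # p \<in> edges (PNode i ts)} \<inter> edges (ts ! k). g (k # e)) =
        g [k] + (\<Sum>e\<in>edges (ts ! k). g (k # e))" by simp
  qed
  finally show ?thesis .
qed

text \<open>Cutting an edge leaves an unramified trunk in two ways only: it is a root edge with
  \<open>u\<close> above it, or an inner edge and the root has just one child. A root edge counts
  once for every occurrence of \<open>u\<close> among the children, hence twice if \<open>u\<close>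
  equals the branch that stays.\<close>

lemma ladder_cuts_planar:
  "(\<Sum>e\<in>edges s. if unplanar (the (subtree_at s e)) = u \<and> root_component {e} s = Node i (ladder js)
    then 1 else 0) = ladder_cuts js i u (unplanar s)"
proof (induction js arbitrary: i s)
  case (Nil i s)
  obtain i' ts where s: "s = PNode i' ts" by (cases s)
  let ?u = "\<lambda>k. unplanar (ts ! k)"
  let ?q = "image_mset ?u (mset_set {k. k < length ts})"
  have mem: "?u k \<in># ?q" if "k < length ts" for k using that by auto
  have "(\<Sum>e\<in>edges s. if unplanar (the (subtree_at s e)) = u \<and> root_component {e} s = Node i (ladder [])
      then 1 else 0 :: nat) = (\<Sum>k<length ts. (if ?u k = u \<and> i' = i \<and> ?q = {#u#} then 1 else 0) + 0)"
    unfolding s sum_all_edges_PNode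
  proof (rule sum.cong [OF refl], rule arg_cong2 [where f = "(+)"])
    fix k assume k: "k \<in> {..<length ts}"
    then have k': "k < length ts" by simp
    obtain q' where q': "?q = add_mset (?u k) q'" using mem [OF k'] by (meson multi_member_split)
    show "(if unplanar (the (subtree_at (PNode i' ts) [k])) = u \<and>
          root_component {[k]} (PNode i' ts) = Node i (ladder []) then 1 else 0) =
        (if ?u k = u \<and> i' = i \<and> ?q = {#u#} then 1 else 0 :: nat)"
      unfolding root_component_root_edge [OF k'] q' using k' by auto
    show "(\<Sum>e\<in>edges (ts ! k). if unplanar (the (subtree_at (PNode i' ts) (k # e))) = u \<and>
          root_component {k # e} (PNode i' ts) = Node i (ladder []) then 1 else 0 :: nat) = 0"
      by (intro sum.neutral ballI) (use k' in \<open>auto simp: root_component_inner_edge edges_def\<close>)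
  qed
  also have "\<dots> = (if i' = i \<and> ?q = {#u#} then count ?q u else 0)"
    using sum_count_children [of True ?u u "i' = i \<and> ?q = {#u#}" "length ts"] by simp
  also have "\<dots> = ladder_cuts [] i u (unplanar s)"
    by (auto simp: s unplanar_PNode)
  finally show ?case .
next
  case (Cons j js i s)
  obtain i' ts where s: "s = PNode i' ts" by (cases s)
  let ?u = "\<lambda>k. unplanar (ts ! k)"
  let ?q = "image_mset ?u (mset_set {k. k < length ts})"
  let ?l = "Node j (ladder js)"
  have mem: "?u k \<in># ?q" if "k < length ts" for k using that by auto
  have "(\<Sum>e\<in>edges s. if unplanar (the (subtree_at s e)) = u \<and> root_component {e} s = Node i (ladder (j # js))
      then 1 else 0 :: nat) = (\<Sum>k<length ts. (if ?u k = u \<and> i' = i \<and> ?q = {#u, ?l#} then 1 else 0) +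
        (if i' = i \<and> ?q = {#?u k#} then ladder_cuts js j u (?u k) else 0))"
    unfolding s sum_all_edges_PNode
  proof (rule sum.cong [OF refl], rule arg_cong2 [where f = "(+)"])
    fix k assume k: "k \<in> {..<length ts}"
    then have k': "k < length ts" by simp
    obtain q' where q': "?q = add_mset (?u k) q'" using mem [OF k'] by (meson multi_member_split)
    show "(if unplanar (the (subtree_at (PNode i' ts) [k])) = u \<and>
          root_component {[k]} (PNode i' ts) = Node i (ladder (j # js)) then 1 else 0) =
        (if ?u k = u \<and> i' = i \<and> ?q = {#u, ?l#} then 1 else 0 :: nat)"
      unfolding root_component_root_edge [OF k'] q' using k' by auto
    have "(\<Sum>e\<in>edges (ts ! k). if unplanar (the (subtree_at (PNode i' ts) (k # e))) = u \<and>
          root_component {k # e} (PNode i' ts) = Node i (ladder (j # js)) then 1 else 0 :: nat) =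
        (\<Sum>e\<in>edges (ts ! k). if i' = i \<and> ?q = {#?u k#} then
          (if unplanar (the (subtree_at (ts ! k) e)) = u \<and> root_component {e} (ts ! k) = ?l then 1 else 0) else 0)"
    proof (rule sum.cong [OF refl])
      fix e assume "e \<in> edges (ts ! k)"
      then have e: "e \<noteq> []" by (simp add: edges_def)
      show "(if unplanar (the (subtree_at (PNode i' ts) (k # e))) = u \<and>
          root_component {k # e} (PNode i' ts) = Node i (ladder (j # js)) then 1 else 0 :: nat) =
        (if i' = i \<and> ?q = {#?u k#} then
          (if unplanar (the (subtree_at (ts ! k) e)) = u \<and> root_component {e} (ts ! k) = ?l then 1 else 0) else 0)"
        unfolding root_component_inner_edge [OF k' e] q' using k' by auto
    qed
    also have "\<dots> = (if i' = i \<and> ?q = {#?u k#} then ladder_cuts js j u (?u k) else 0)"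
      unfolding Cons.IH [symmetric] by (cases "i' = i \<and> ?q = {#?u k#}") (simp_all only: if_True if_False simp_thms sum.neutral_const)
    finally show "(\<Sum>e\<in>edges (ts ! k). if unplanar (the (subtree_at (PNode i' ts) (k # e))) = u \<and>
          root_component {k # e} (PNode i' ts) = Node i (ladder (j # js)) then 1 else 0 :: nat) =
        (if i' = i \<and> ?q = {#?u k#} then ladder_cuts js j u (?u k) else 0)" .
  qed
  also have "\<dots> = (\<Sum>k<length ts. if ?u k = u \<and> i' = i \<and> ?q = {#u, ?l#} then 1 else 0) +
      (\<Sum>k<length ts. if i' = i \<and> ?q = {#?u k#} then ladder_cuts js j u (?u k) else 0)"
    by (rule sum.distrib)
  also have "(\<Sum>k<length ts. if ?u k = u \<and> i' = i \<and> ?q = {#u, ?l#} then 1 else 0) =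
      (if i' = i \<and> ?q = {#u, ?l#} then count ?q u else 0)"
    using sum_count_children [of True ?u u "i' = i \<and> ?q = {#u, ?l#}" "length ts"] by (simp only: simp_thms)
  \<comment> \<open>Both sides are nonzero only if the root has a single child; then the sum over
    positions and the sum over the set of children have one and the same term.\<close>
  also have "(\<Sum>k<length ts. if i' = i \<and> ?q = {#?u k#} then ladder_cuts js j u (?u k) else 0) =
      (\<Sum>t'\<in>set_mset ?q. if i' = i \<and> ?q = {#t'#} then ladder_cuts js j u t' else 0)"
  proof (cases "\<exists>t'. ?q = {#t'#}")
    case True
    then obtain t' where t': "?q = {#t'#}" by blast
    then have "length ts = 1"
      by (metis One_nat_def card_Collect_less_nat size_image_mset size_mset_set size_single)
    then have K: "{..<length ts} = {0}" "{k. k < length ts} = {0}" by auto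
    show ?thesis unfolding K by simp
  next
    case False
    then show ?thesis by simp
  qed
  also have "(if i' = i \<and> ?q = {#u, ?l#} then count ?q u else 0) +
      (\<Sum>t'\<in>set_mset ?q. if i' = i \<and> ?q = {#t'#} then ladder_cuts js j u t' else 0) =
      ladder_cuts (j # js) i u (unplanar s)"
    unfolding s unplanar_PNode ladder_cuts.simps ladder.simps children.simps rtree.inject by auto
  finally show ?case .
qed

lemma lin_coprod_tree_ladder:
  "lin (\<lambda>(p, q). (if p = {#u#} then 1 else 0) * (if q = {#Node i (ladder js)#} then 1 else 0))
    (coprod_tree t) = (of_nat (ladder_cuts js i u t) :: 'k::field_char_0)"
proof -
  let ?v = "\<lambda>p. if p = {#u#} then 1 else (0::'k)" and
    ?w = "\<lambda>q. if q = {#Node i (ladder js)#} then 1 else (0::'k)"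
  have "\<exists>s. unplanar s = t \<and> lin (\<lambda>(p, q). ?v p * ?w q) (coprod_tree t) =
    (\<Sum>e\<in>edges s. ?v {#unplanar (the (subtree_at s e))#} * ?w {#root_component {e} s#})"
    by (rule lin_coprod_tree_single_edge) auto
  then obtain s where s: "unplanar s = t" "lin (\<lambda>(p, q). ?v p * ?w q) (coprod_tree t) =
    (\<Sum>e\<in>edges s. ?v {#unplanar (the (subtree_at s e))#} * ?w {#root_component {e} s#})"
    by blast
  have "(\<Sum>e\<in>edges s. ?v {#unplanar (the (subtree_at s e))#} * ?w {#root_component {e} s#}) =
    of_nat (\<Sum>e\<in>edges s. if unplanar (the (subtree_at s e)) = u \<and> root_component {e} s = Node i (ladder js)
      then 1 else 0)"
    by (simp only: of_nat_sum) (rule sum.cong, auto)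
  then show ?thesis using s ladder_cuts_planar [of s u i js] by simp
qed

lemma ladder_cuts_nonzeroD:
  assumes "ladder_cuts js i u t \<noteq> 0"
  shows "tree_root t = i"
  using assms by (cases js) (auto split: if_splits elim!: sum.not_neutral_contains_not_neutral)

text \<open>\<open>ladder_coeff F i js\<close> is the coefficient of the ladder \<open>Node i (ladder js)\<close> in the solution, and
  \<open>ladder_graft F i js j\<close> is the sum of the relative coefficients of the graftings of a tree with
  root \<open>j\<close> on this ladder.\<close>

primrec ladder_coeff :: "('i \<Rightarrow> ('i, 'k::field_char_0) mfps) \<Rightarrow> 'i list \<Rightarrow> 'i \<Rightarrow> 'k" where
  "ladder_coeff F [] i = 1"
| "ladder_coeff F (j # js) i = taylor (F i) {#j#} * ladder_coeff F js j"

primrec ladder_graft :: "('i \<Rightarrow> ('i, 'k::field_char_0) mfps) \<Rightarrow> 'i list \<Rightarrow> 'i \<Rightarrow> 'i \<Rightarrow> 'k" where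
  "ladder_graft F [] i k = taylor (F i) {#k#}"
| "ladder_graft F (j # js) i k =
    taylor (F i) {#k, j#} * ladder_coeff F js j + taylor (F i) {#j#} * ladder_graft F js j k"

lemma tree_coeff_ladder:
  assumes "\<And>x. x \<in> insert i (set js) \<Longrightarrow> mcoeff (F x) {#} = 1"
  shows "tree_coeff F (Node i (ladder js)) = ladder_coeff F js i"
  using assms by (induction js arbitrary: i) (simp_all add: taylor_def fact_mset_add_mset)

lemma fact_mset_ladder [simp]: "fact_mset (ladder js) = 1"
  by (cases js) (simp_all add: fact_mset_add_mset)

lemma decorations_ladder: "\<Union> (decorations ` set_mset (ladder js)) = set js"
  by (induction js) auto

lemma weight_ladder [simp]: "weight (ladder js) = length js"
  by (induction js) (simp_all add: nverts_Node del: nverts.simps)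

text \<open>A ladder has at most one branch at its root, so the symmetry factor of the grafted tree
  is the number of edges whose cut removes \<open>u\<close>. The two cancel, and it makes no
  difference whether \<open>u\<close> equals that branch.\<close>

lemma count_tree_coeff_graft:
  assumes "\<And>x. x \<in> insert i (set js) \<Longrightarrow> mcoeff (F x) {#} = 1"
  shows "tree_coeff F (Node i (add_mset u (ladder js))) * of_nat (count (add_mset u (ladder js)) u) =
    taylor (F i) (add_mset (tree_root u) (image_mset tree_root (ladder js))) *
      (prod_mset (image_mset (tree_coeff F) (ladder js))) * tree_coeff F u"
  by (simp add: fact_mset_add_mset del: of_nat_Suc)

text \<open>The trees that contribute are the graftings of \<open>u\<close> on a vertex of the
  ladder. The coefficient of \<open>u\<close> splits off, and the other factor sees \<open>u\<close>
  only through its root: this is why the structure constants do not depend on the degree of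
  \<open>u\<close>. In the induction, \<open>u\<close> sits either at the root, giving a second
  derivative, or on the rest of the ladder.\<close>

lemma sum_ladder_cuts:
  fixes F :: "'i \<Rightarrow> ('i, 'k::field_char_0) mfps"
  assumes I: "finite I" "i \<in> I" "set js \<subseteq> I" "decorations u \<subseteq> I"
    and F: "\<And>x. x \<in> I \<Longrightarrow> mcoeff (F x) {#} = 1"
  shows "(\<Sum>t\<in>solution_trees I i n. tree_coeff F t * of_nat (ladder_cuts js i u t)) =
    (if n = nverts u + Suc (length js) then ladder_graft F js i (tree_root u) * tree_coeff F u else 0)"
  using I
proof (induction js arbitrary: i n)
  case Nil
  let ?T = "solution_trees I i n"
  have "(\<Sum>t\<in>?T. tree_coeff F t * of_nat (ladder_cuts [] i u t)) =
      (\<Sum>t\<in>?T. if t = Node i {#u#} then tree_coeff F t else 0)"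
    by (rule sum.cong) auto
  also have "\<dots> = (if Node i {#u#} \<in> ?T then tree_coeff F (Node i {#u#}) else 0)"
    using Nil finite_solution_trees by (subst sum.delta) auto
  also have "Node i {#u#} \<in> ?T \<longleftrightarrow> n = nverts u + 1"
    using Nil by (auto simp: solution_trees_def)
  finally show ?case by (simp add: taylor_def fact_mset_add_mset)
next
  case (Cons j js)
  let ?T = "solution_trees I i n"
  let ?l = "ladder (j # js)"
  let ?t = "Node i (add_mset u ?l)"
  have split: "(\<Sum>t\<in>?T. tree_coeff F t * of_nat (ladder_cuts (j # js) i u t)) =
      (\<Sum>t\<in>?T. if t = ?t then tree_coeff F ?t * of_nat (count (add_mset u ?l) u) else 0) +
      (\<Sum>t\<in>?T. tree_coeff F t *
        (\<Sum>t'\<in>set_mset (children t). if t = Node i {#t'#} then of_nat (ladder_cuts js j u t') else 0))"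
    unfolding sum.distrib [symmetric]
    by (rule sum.cong) (auto simp: algebra_simps of_nat_sum if_distrib [of of_nat] cong: if_cong)
  have first: "(\<Sum>t\<in>?T. if t = ?t then tree_coeff F ?t * of_nat (count (add_mset u ?l) u) else 0) =
      (if ?t \<in> ?T then tree_coeff F ?t * of_nat (count (add_mset u ?l) u) else 0)"
    using Cons finite_solution_trees by (subst sum.delta) auto
  have coeff: "tree_coeff F ?t * of_nat (count (add_mset u ?l) u) =
      taylor (F i) {#tree_root u, j#} * ladder_coeff F js j * tree_coeff F u"
  proof (subst count_tree_coeff_graft)
    show "mcoeff (F x) {#} = 1" if "x \<in> insert i (set (j # js))" for x
      using that Cons.prems F by auto
    have "tree_coeff F (Node j (ladder js)) = ladder_coeff F js j"
      using Cons.prems F by (intro tree_coeff_ladder) auto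
    then show "taylor (F i) (add_mset (tree_root u) (image_mset tree_root ?l)) *
        prod_mset (image_mset (tree_coeff F) ?l) * tree_coeff F u =
        taylor (F i) {#tree_root u, j#} * ladder_coeff F js j * tree_coeff F u"
      by (simp del: tree_coeff.simps)
  qed
  have mem: "?t \<in> ?T \<longleftrightarrow> n = nverts u + Suc (length (j # js))"
  proof -
    have "nverts ?t = nverts u + Suc (length (j # js))"
      unfolding nverts_Node weight_add_mset weight_ladder by simp
    moreover have "decorations ?t \<subseteq> I"
      using Cons.prems decorations_ladder [of "j # js"] by simp
    moreover have "tree_root ?t = i" by (simp only: tree_root.simps)
    ultimately show ?thesis unfolding solution_trees_def by blast
  qed
  have "(\<Sum>t\<in>?T. tree_coeff F t *
        (\<Sum>t'\<in>set_mset (children t). if t = Node i {#t'#} then of_nat (ladder_cuts js j u t') else 0)) =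
      (\<Sum>t\<in>(\<lambda>t'. Node i {#t'#}) ` solution_trees I j (n - 1). tree_coeff F t *
        (\<Sum>t'\<in>set_mset (children t). if t = Node i {#t'#} then of_nat (ladder_cuts js j u t') else 0))"
  proof (rule sum.mono_neutral_right)
    show "finite ?T" using Cons.prems finite_solution_trees by simp
    show "(\<lambda>t'. Node i {#t'#}) ` solution_trees I j (n - 1) \<subseteq> ?T"
    proof safe
      fix t' assume t': "t' \<in> solution_trees I j (n - 1)"
      then have "n - 1 = nverts t'" by (simp add: solution_trees_def)
      \<comment> \<open>The truncated difference \<open>n - 1\<close> is harmless, as
        \<open>t'\<close> has at least one vertex.\<close>
      with nverts_nonzero [of t'] have "n = Suc (nverts t')" by linarith
      then show "Node i {#t'#} \<in> ?T" using t' Cons.prems by (simp add: solution_trees_def)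
    qed
    show "\<forall>t\<in>?T - (\<lambda>t'. Node i {#t'#}) ` solution_trees I j (n - 1). tree_coeff F t *
        (\<Sum>t'\<in>set_mset (children t). if t = Node i {#t'#} then of_nat (ladder_cuts js j u t') else 0) = 0"
    proof
      fix t assume t: "t \<in> ?T - (\<lambda>t'. Node i {#t'#}) ` solution_trees I j (n - 1)"
      have "ladder_cuts js j u t' = 0" if "t = Node i {#t'#}" for t'
      proof (rule ccontr)
        assume "ladder_cuts js j u t' \<noteq> 0"
        then have "tree_root t' = j" by (rule ladder_cuts_nonzeroD)
        then show False using t that by (auto simp: solution_trees_def)
      qed
      then have "(\<Sum>t'\<in>set_mset (children t).
          if t = Node i {#t'#} then of_nat (ladder_cuts js j u t') else (0::'k)) = 0"
        by (intro sum.neutral) auto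
      then show "tree_coeff F t *
        (\<Sum>t'\<in>set_mset (children t). if t = Node i {#t'#} then of_nat (ladder_cuts js j u t') else 0) = 0"
        by simp
    qed
  qed
  also have "\<dots> = (\<Sum>t'\<in>solution_trees I j (n - 1).
      taylor (F i) {#j#} * (tree_coeff F t' * of_nat (ladder_cuts js j u t')))"
    by (subst sum.reindex) (auto simp: inj_on_def solution_trees_def fact_mset_add_mset intro!: sum.cong)
  also have "\<dots> = taylor (F i) {#j#} *
      (if n = nverts u + Suc (length (j # js)) then ladder_graft F js j (tree_root u) * tree_coeff F u else 0)"
    using Cons.IH [of j "n - 1"] Cons.prems by (auto simp: sum_distrib_left [symmetric])
  finally have second: "(\<Sum>t\<in>?T. tree_coeff F t *
        (\<Sum>t'\<in>set_mset (children t). if t = Node i {#t'#} then of_nat (ladder_cuts js j u t') else 0)) =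
      taylor (F i) {#j#} *
      (if n = nverts u + Suc (length (j # js)) then ladder_graft F js j (tree_root u) * tree_coeff F u else 0)" .
  show ?case unfolding split first second unfolding coeff mem by (simp add: algebra_simps)
qed

section \<open>Restriction to a set of vertices closed under descendants\<close>

text \<open>For \<open>A = forests_on J\<close> this is the projection that sends every tree with a
  decoration outside \<open>J\<close> to 0; for pairs of such forests it acts on both tensor
  factors.\<close>

definition restrict_pm :: "'a set \<Rightarrow> ('a \<Rightarrow>\<^sub>0 'k::comm_ring_1) \<Rightarrow> ('a \<Rightarrow>\<^sub>0 'k)"
  where "restrict_pm A x = Poly_Mapping.mapp (\<lambda>k v. v when k \<in> A) x"

lemma lookup_restrict_pm [simp]:
  "Poly_Mapping.lookup (restrict_pm A x) k = (if k \<in> A then Poly_Mapping.lookup x k else 0)"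
  by (auto simp: restrict_pm_def lookup_mapp when_def in_keys_iff)

lemma restrict_pm_add: "restrict_pm A (x + y) = restrict_pm A x + restrict_pm A y"
  by (rule poly_mapping_eqI) (simp add: lookup_add)

lemma restrict_pm_zero [simp]: "restrict_pm A 0 = 0"
  by (rule poly_mapping_eqI) simp

lemma restrict_pm_scale: "restrict_pm A (pm_scale c x) = pm_scale c (restrict_pm A x)"
  by (rule poly_mapping_eqI) simp

lemma restrict_pm_sum: "restrict_pm A (sum f B) = (\<Sum>b\<in>B. restrict_pm A (f b))"
  by (induction B rule: infinite_finite_induct) (simp_all add: restrict_pm_add)

lemma restrict_pm_sum_list: "restrict_pm A (sum_list xs) = (\<Sum>x\<leftarrow>xs. restrict_pm A x)"
  by (induction xs) (simp_all add: restrict_pm_add)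

lemma restrict_pm_single: "restrict_pm A (Poly_Mapping.single p c) = (if p \<in> A then Poly_Mapping.single p c else 0)"
  by (rule poly_mapping_eqI) (simp add: lookup_single when_def)

text \<open>The condition on \<open>A\<close> makes the span of the basis elements outside
  \<open>A\<close> an ideal.\<close>

lemma restrict_pm_mult:
  fixes x y :: "'a::comm_monoid_add \<Rightarrow>\<^sub>0 'k::comm_ring_1"
  assumes "\<And>p q. p + q \<in> A \<longleftrightarrow> p \<in> A \<and> q \<in> A"
  shows "restrict_pm A (x * y) = restrict_pm A x * restrict_pm A y"
proof -
  let ?s = "\<lambda>x p. Poly_Mapping.single p (Poly_Mapping.lookup x p)"
  have r: "restrict_pm A z = (\<Sum>p\<in>Poly_Mapping.keys z. restrict_pm A (?s z p))" for z :: "'a \<Rightarrow>\<^sub>0 'k"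
    by (subst poly_mapping_sum_singles [of z]) (simp only: restrict_pm_sum)
  have "x * y = (\<Sum>p\<in>Poly_Mapping.keys x. \<Sum>q\<in>Poly_Mapping.keys y. ?s x p * ?s y q)"
    by (subst poly_mapping_sum_singles [of x], subst poly_mapping_sum_singles [of y])
       (simp only: sum_product)
  then have "restrict_pm A (x * y) =
      (\<Sum>p\<in>Poly_Mapping.keys x. \<Sum>q\<in>Poly_Mapping.keys y. restrict_pm A (?s x p) * restrict_pm A (?s y q))"
    by (simp add: restrict_pm_sum mult_single restrict_pm_single assms if_distrib cong: if_cong)
       (auto intro!: sum.cong simp: mult_single)
  also have "\<dots> = restrict_pm A x * restrict_pm A y"
    by (simp only: r [of x] r [of y] sum_product)
  finally show ?thesis .
qed

section \<open>The Hopf algebra on a subset of the decorations\<close>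

lemma forests_on_iff: "p \<in> forests_on J \<longleftrightarrow> \<Union> (decorations ` set_mset p) \<subseteq> J"
  by (auto simp: forests_on_def)

lemma union_in_forests_on: "p + q \<in> forests_on J \<longleftrightarrow> p \<in> forests_on J \<and> q \<in> forests_on J"
  by (auto simp: forests_on_def)

lemma ck_on_iff: "x \<in> ck_on J \<longleftrightarrow> restrict_pm (forests_on J) x = x"
  by (auto simp: ck_on_def poly_mapping_eq_iff fun_eq_iff in_keys_iff subset_iff)

lemma restrict_in_ck_on: "restrict_pm (forests_on J) x \<in> ck_on J"
  by (auto simp: ck_on_def in_keys_iff split: if_splits)

lemma empty_in_forests_on [simp]: "{#} \<in> forests_on J"
  by (simp add: forests_on_def)

lemma subalgebra_ck_on: "subalgebra (ck_on J)"
  unfolding subalgebra_def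
  by (auto simp: ck_on_iff restrict_pm_add restrict_pm_mult union_in_forests_on restrict_pm_scale)
     (simp add: single_one [symmetric] restrict_pm_single del: single_one)

lemma lookup_tens [simp]:
  fixes x y :: "('i, 'k::field_char_0) ck"
  shows "Poly_Mapping.lookup (tens x y) (p, q) = Poly_Mapping.lookup x p * Poly_Mapping.lookup y q"
proof -
  have "(\<lambda>r. if r = (p, q) then 1 else 0) =
      (\<lambda>(a, b). (if a = p then 1 else 0) * (if b = q then 1 else (0::'k)))"
    by auto
  then show ?thesis unfolding lookup_eq_lin by (simp only: lin_tens)
qed

lemma restrict_tens: "restrict_pm (A \<times> B) (tens x y) = tens (restrict_pm A x) (restrict_pm B y)"
proof (rule poly_mapping_eqI)
  fix k show "Poly_Mapping.lookup (restrict_pm (A \<times> B) (tens x y)) k =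
      Poly_Mapping.lookup (tens (restrict_pm A x) (restrict_pm B y)) k"
    by (cases k) auto
qed

lemma restrict_coprod:
  fixes x :: "('i, 'k::field_char_0) ck"
  assumes "x \<in> ck_on J"
  shows "restrict_pm (forests_on J \<times> forests_on J) (coprod x) = coprod x"
proof (rule poly_mapping_eqI)
  fix k :: "'i forest \<times> 'i forest"
  obtain a b where k: "k = (a, b)" by (cases k)
  have "(a, b) \<in> forests_on J \<times> forests_on J" if nz: "Poly_Mapping.lookup (coprod x) (a, b) \<noteq> 0"
  proof -
    have "lin (\<lambda>p. Poly_Mapping.lookup (coprod_forest p) (a, b)) x \<noteq> 0"
      using nz unfolding lookup_eq_lin lin_coprod .
    then obtain p where "p \<in> Poly_Mapping.keys x" "Poly_Mapping.lookup (coprod_forest p :: ('i, 'k) ck2) (a, b) \<noteq> 0"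
      unfolding lin_def by (metis (no_types, lifting) mult_zero_right sum.neutral)
    then have "p \<in> forests_on J" "(a, b) \<in> Poly_Mapping.keys (coprod_forest p :: ('i, 'k) ck2)"
      using assms by (auto simp: ck_on_def in_keys_iff)
    then show ?thesis
      using keys_coprod_forest [of a b p] by (fastforce simp: forests_on_def)
  qed
  then show "Poly_Mapping.lookup (restrict_pm (forests_on J \<times> forests_on J) (coprod x)) k =
      Poly_Mapping.lookup (coprod x) k"
    by (auto simp: k)
qed

lemma tree_coeff_nonzero_decorations:
  assumes "\<And>j. j \<in> J \<Longrightarrow> series_in J (F j)"
  shows "tree_root t \<in> J \<Longrightarrow> tree_coeff F t \<noteq> 0 \<Longrightarrow> decorations t \<subseteq> J"
proof (induction t)
  case (Node i ts)
  from Node.prems have i: "i \<in> J" and "mcoeff (F i) (image_mset tree_root ts) \<noteq> 0"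
    and ts: "\<And>t. t \<in># ts \<Longrightarrow> tree_coeff F t \<noteq> 0" by auto
  then have "set_mset (image_mset tree_root ts) \<subseteq> J"
    using assms by (blast dest: series_inD)
  then have "decorations t \<subseteq> J" if "t \<in># ts" for t
    using Node.IH [OF that] ts [OF that] that by auto
  then show ?case using i by auto
qed

lemma poly_mapping_eqI_trees:
  assumes "\<And>t. Poly_Mapping.lookup x {#t#} = Poly_Mapping.lookup y {#t#}"
    and "\<And>p. size p \<noteq> 1 \<Longrightarrow> Poly_Mapping.lookup x p = Poly_Mapping.lookup y p"
  shows "x = y"
proof (rule poly_mapping_eqI)
  fix p
  show "Poly_Mapping.lookup x p = Poly_Mapping.lookup y p"
  proof (cases "size p = 1")
    case True
    then obtain t where "p = {#t#}" using size_1_singleton_mset by blast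
    then show ?thesis using assms(1) by simp
  qed (rule assms(2))
qed

text \<open>No edge leaves \<open>J\<close>: the restriction to \<open>J\<close> is then given by
  the unchanged series \<open>F j\<close>, and its solution is part of the solution on
  \<open>I\<close>.\<close>

locale hereditary_subsystem =
  fixes I J :: "'i set" and F :: "'i \<Rightarrow> ('i, 'k::field_char_0) mfps"
  assumes sdse: "sdse I F" and subset: "J \<subseteq> I" and nonempty: "J \<noteq> {}"
    and series_in: "\<And>j. j \<in> J \<Longrightarrow> series_in J (F j)"
begin

lemma sdse_sub: "sdse J F"
  using sdse subset nonempty series_in finite_subset unfolding sdse_def by blast

lemma restrict_generator:
  "restrict_pm (forests_on J) (generator I F i n) = (if i \<in> J then generator J F i n else 0)"
proof (rule poly_mapping_eqI_trees)
  fix t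
  have "\<not> decorations t \<subseteq> J" if "tree_root t \<notin> J" using root_in_decorations that by blast
  then show "Poly_Mapping.lookup (restrict_pm (forests_on J) (generator I F i n)) {#t#} =
      Poly_Mapping.lookup (if i \<in> J then generator J F i n else 0) {#t#}"
    using subset by (auto simp: lookup_generator_single [OF sdse] lookup_generator_single [OF sdse_sub]
        forests_on_def)
next
  fix p :: "'i forest" assume p: "size p \<noteq> 1"
  show "Poly_Mapping.lookup (restrict_pm (forests_on J) (generator I F i n)) p =
      Poly_Mapping.lookup (if i \<in> J then generator J F i n else 0) p"
    using lookup_generator_other [OF sdse p] lookup_generator_other [OF sdse_sub p]
    by (cases "i \<in> J") simp_all
qed

lemma generator_sub:
  assumes "i \<in> J"
  shows "generator J F i n = generator I F i n"
proof -
  have "generator I F i n \<in> ck_on J"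
    unfolding ck_on_def
  proof safe
    fix p assume p: "p \<in> Poly_Mapping.keys (generator I F i n)"
    then have "size p = 1" using lookup_generator_other [OF sdse] by (auto simp: in_keys_iff)
    then obtain t where t: "p = {#t#}" using size_1_singleton_mset by blast
    then show "p \<in> forests_on J"
      using p assms tree_coeff_nonzero_decorations [of J F t] series_in
      by (auto simp: in_keys_iff lookup_generator_single [OF sdse] forests_on_def split: if_splits)
  qed
  then show ?thesis using restrict_generator [of i n] assms by (simp add: ck_on_iff)
qed

lemma restrict_sdse_algebra:
  assumes "x \<in> sdse_algebra I F"
  shows "restrict_pm (forests_on J) x \<in> sdse_algebra J F"
  using assms
proof (induction rule: sdse_algebra_induct)
  case one
  have "restrict_pm (forests_on J) 1 = (1 :: ('i, 'k) ck)"
    by (simp add: single_one [symmetric] restrict_pm_single del: single_one)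
  then show ?case using subalgebra_sdse_algebra [of J F] by (simp add: subalgebra_def)
next
  case (gen i n)
  have "pm_scale 0 (1 :: ('i, 'k) ck) \<in> sdse_algebra J F"
    using subalgebra_sdse_algebra [of J F] by (simp add: subalgebra_def del: pm_scale_1)
  moreover have "pm_scale 0 (1 :: ('i, 'k) ck) = 0" by (rule poly_mapping_eqI) simp
  ultimately show ?case by (simp add: restrict_generator generator_in_algebra)
qed (use subalgebra_sdse_algebra [of J F] in
  \<open>auto simp: subalgebra_def restrict_pm_add restrict_pm_mult union_in_forests_on restrict_pm_scale\<close>)

text \<open>The generators for \<open>J\<close> are generators for \<open>I\<close> and have
  decorations in \<open>J\<close>. Conversely the projection maps the algebra of \<open>I\<close> to
  that of \<open>J\<close>, killing the generators outside \<open>J\<close>, and fixes every element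
  of \<open>ck_on J\<close>.\<close>

lemma sdse_algebra_sub: "sdse_algebra J F = sdse_algebra I F \<inter> ck_on J"
proof
  have "subalgebra (sdse_algebra I F \<inter> ck_on J)"
    using subalgebra_sdse_algebra [of I F] subalgebra_ck_on [of J] by (auto simp: subalgebra_def)
  moreover have "generator J F i n \<in> sdse_algebra I F \<inter> ck_on J" if "i \<in> J" for i n
    using that generator_in_algebra [of i I F n] subset restrict_in_ck_on [of J "generator I F i n"]
    by (auto simp: generator_sub restrict_generator)
  ultimately show "sdse_algebra J F \<subseteq> sdse_algebra I F \<inter> ck_on J"
    by (rule sdse_algebra_subset)
  show "sdse_algebra I F \<inter> ck_on J \<subseteq> sdse_algebra J F"
    using restrict_sdse_algebra by (metis IntE ck_on_iff subsetI)
qed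

text \<open>Decompose the coproduct over the large algebra and project both tensor factors; the
  coproduct itself is fixed by this, since cuts create no new decorations.\<close>

lemma coprod_sub:
  assumes "coprod ` sdse_algebra I F \<subseteq> tensor_square (sdse_algebra I F)"
  shows "coprod ` sdse_algebra J F \<subseteq> tensor_square (sdse_algebra J F)"
proof safe
  fix x assume x: "x \<in> sdse_algebra J F"
  let ?r = "restrict_pm (forests_on J)"
  from x assms obtain ps where ps: "set ps \<subseteq> sdse_algebra I F \<times> sdse_algebra I F"
    "coprod x = (\<Sum>(y, z)\<leftarrow>ps. tens y z)"
    by (auto simp: sdse_algebra_sub tensor_square_def)
  have "coprod x = restrict_pm (forests_on J \<times> forests_on J) (coprod x)"
    using x by (simp add: sdse_algebra_sub restrict_coprod)
  also have "\<dots> = (\<Sum>(y, z)\<leftarrow>map (map_prod ?r ?r) ps. tens y z)"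
    unfolding ps(2) by (simp add: restrict_pm_sum_list comp_def case_prod_unfold restrict_tens)
  finally have "coprod x = (\<Sum>(y, z)\<leftarrow>map (map_prod ?r ?r) ps. tens y z)" .
  moreover have "set (map (map_prod ?r ?r) ps) \<subseteq> sdse_algebra J F \<times> sdse_algebra J F"
    using ps(1) restrict_sdse_algebra by auto
  ultimately show "coprod x \<in> tensor_square (sdse_algebra J F)"
    unfolding tensor_square_def by blast
qed

end

text \<open>By the counit axiom, p \<otimes> 1 is the only term of the coproduct of a forest p with
  trivial right factor, with coefficient 1. The antipode equation thus expresses S(p) through
  products S(a) b with a of smaller weight and decorations in \<open>J\<close>; induct on the
  weight.\<close>

lemma antipode_ck_on:
  fixes S :: "('i, 'k::field_char_0) ck \<Rightarrow> ('i, 'k) ck"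
  assumes S: "is_antipode S" and x: "x \<in> ck_on J"
  shows "S x \<in> ck_on J"
proof -
  interpret S: Vector_Spaces.linear pm_scale pm_scale S using S by (simp add: is_antipode_def)
  note sub = subalgebra_ck_on [of J, where 'b = 'k, unfolded subalgebra_def]
  have neg: "pm_scale (- 1) y = - y" for y :: "('i, 'k) ck" by (rule poly_mapping_eqI) simp
  have aux: "e = b + - d" if "a = b" "a = c + d" "c = e" for a b c d e :: "('i, 'k) ck"
    using that by (simp add: algebra_simps)
  have scale: "pm_scale c y \<in> ck_on J" if "y \<in> ck_on J" for c and y :: "('i, 'k) ck"
    using sub that by blast
  have zero: "(0 :: ('i, 'k) ck) \<in> ck_on J" by (simp add: ck_on_def)
  have sum: "sum f A \<in> ck_on J" if "\<And>a. a \<in> A \<Longrightarrow> f a \<in> ck_on J" for f :: "_ \<Rightarrow> ('i, 'k) ck" and A :: "'z set"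
    using that sub zero by (induction A rule: infinite_finite_induct) auto
  have forest: "S (Poly_Mapping.single p 1) \<in> ck_on J" if "p \<in> forests_on J" for p
    using that
  proof (induction "weight p" arbitrary: p rule: less_induct)
    case less
    let ?z = "coprod (Poly_Mapping.single p 1) :: ('i, 'k) ck2"
    let ?f = "\<lambda>(a, b). pm_scale (Poly_Mapping.lookup ?z (a, b))
      (S (Poly_Mapping.single a 1) * id (Poly_Mapping.single b 1))"
    have z: "?z = coprod_forest p" by (simp add: coprod_def)
    have left: "Poly_Mapping.lookup ?z (a, {#}) = (if a = p then 1 else 0)" for a
    proof -
      have E: "(\<lambda>q. if q = (a, {#}) then 1 else (0::'k)) =
          (\<lambda>(c, b). (if c = a then 1 else 0) * (if b = {#} then 1 else 0))" by auto
      show ?thesis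
        unfolding z lookup_eq_lin E lin_coprod_forest_left [of "\<lambda>c. if c = a then 1 else (0::'k)" p]
        by auto
    qed
    have mem: "(p, {#}) \<in> Poly_Mapping.keys ?z" by (simp add: in_keys_iff left)
    have "sum ?f (Poly_Mapping.keys ?z) = pm_scale (counit (Poly_Mapping.single p 1)) 1"
      using S unfolding is_antipode_def mult_tensor_def by blast
    moreover have "sum ?f (Poly_Mapping.keys ?z) =
        ?f (p, {#}) + sum ?f (Poly_Mapping.keys ?z - {(p, {#})})"
      using mem by (subst sum.remove [of _ "(p, {#})"]) auto
    moreover have "?f (p, {#}) = S (Poly_Mapping.single p 1)"
      using single_one [where 'a = "'i forest" and 'b = 'k] by (simp add: left)
    ultimately have eq: "S (Poly_Mapping.single p 1) =
        pm_scale (counit (Poly_Mapping.single p 1)) 1 + pm_scale (- 1) (sum ?f (Poly_Mapping.keys ?z - {(p, {#})}))"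
      unfolding neg by (rule aux)
    have "sum ?f (Poly_Mapping.keys ?z - {(p, {#})}) \<in> ck_on J"
    proof (rule sum)
      fix y assume y: "y \<in> Poly_Mapping.keys ?z - {(p, {#})}"
      obtain a b where ab': "y = (a, b)" by (cases y)
      with y have ab: "(a, b) \<in> Poly_Mapping.keys ?z" "(a, b) \<noteq> (p, {#})" by auto
      from ab(1,2) have "b \<noteq> {#}" by (auto simp: in_keys_iff left split: if_splits)
      have key: "weight a + weight b = weight p" "\<Union> (decorations ` set_mset (a + b)) \<subseteq> \<Union> (decorations ` set_mset p)"
        using keys_coprod_forest [of a b p, where 'k = 'k] ab(1) unfolding z by blast+
      have "a + b \<in> forests_on J"
        using key(2) less.prems unfolding forests_on_iff by (rule order_trans)
      with key(1) have w: "weight a + weight b = weight p" "a \<in> forests_on J" "b \<in> forests_on J"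
        by (simp_all add: union_in_forests_on)
      with \<open>b \<noteq> {#}\<close> have "weight a < weight p" using weight_eq_0_iff [of b] by linarith
      then have "S (Poly_Mapping.single a 1) \<in> ck_on J" using w(2) by (rule less.hyps)
      moreover have "Poly_Mapping.single b (1::'k) \<in> ck_on J" using w(3) by (simp add: ck_on_def)
      ultimately show "?f y \<in> ck_on J" unfolding ab' using sub by simp
    qed
    then show ?case unfolding eq using sub by blast
  qed
  have "S x = S (\<Sum>p\<in>Poly_Mapping.keys x. pm_scale (Poly_Mapping.lookup x p) (Poly_Mapping.single p 1))"
    unfolding pm_scale_single mult_1_right by (rule arg_cong [OF poly_mapping_sum_singles])
  also have "\<dots> = (\<Sum>p\<in>Poly_Mapping.keys x. pm_scale (Poly_Mapping.lookup x p) (S (Poly_Mapping.single p 1)))"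
    by (simp only: S.sum S.scale)
  also have "\<dots> \<in> ck_on J"
    using x by (intro sum scale forest) (auto simp: ck_on_def)
  finally show ?thesis .
qed

text \<open>Supplies the Hopf condition contained in \<open>is_extension\<close>, and makes the Lie
  algebra of every stage of the chain accessible.\<close>

lemma hopf_sdse_hereditary:
  assumes "hopf_sdse I F" "J \<subseteq> I" "J \<noteq> {}" "\<And>j. j \<in> J \<Longrightarrow> series_in J (F j)"
  shows "hopf_sdse J F"
proof -
  interpret hereditary_subsystem I J F
    using assms by unfold_locales (simp_all add: hopf_sdse_def)
  obtain S where S: "is_antipode S" "S ` sdse_algebra I F \<subseteq> sdse_algebra I F"
    using assms(1) by (auto simp: hopf_sdse_def hopf_subalgebra_on_def)
  have "S ` sdse_algebra J F \<subseteq> sdse_algebra J F"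
    using S antipode_ck_on [OF S(1)] by (auto simp: sdse_algebra_sub)
  then show ?thesis
    using sdse_sub coprod_sub S(1) assms(1) subalgebra_sdse_algebra [of J F]
    unfolding hopf_sdse_def hopf_subalgebra_on_def by (auto simp: sdse_algebra_sub)
qed

declare One_nat_def [simp del]

section \<open>Lie algebras given by structure constants\<close>

text \<open>The map of a \<open>lie_iso\<close> separated from the claim that both sides are Lie
  algebras, so that this claim can be transported along it.\<close>

definition lie_bij ::
  "('v \<Rightarrow> 'w) \<Rightarrow> ('k::field, 'v::ab_group_add) lie \<Rightarrow> ('k, 'w::ab_group_add) lie \<Rightarrow> bool"
  where "lie_bij f L L' \<longleftrightarrow> bij_betw f (lcar L) (lcar L') \<and>
      (\<forall>x\<in>lcar L. \<forall>y\<in>lcar L. f (x + y) = f x + f y \<and> f (lbr L x y) = lbr L' (f x) (f y)) \<and>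
      (\<forall>c. \<forall>x\<in>lcar L. f (lscale L c x) = lscale L' c (f x))"

lemma lie_iso_iff: "lie_iso L L' \<longleftrightarrow> lie_algebra L \<and> lie_algebra L' \<and> (\<exists>f. lie_bij f L L')"
  by (simp add: lie_iso_def lie_bij_def)

lemma lie_algebraD:
  assumes "lie_algebra L"
  shows "vector_space (lscale L)" "module.subspace (lscale L) (lcar L)"
    "\<And>x y. x \<in> lcar L \<Longrightarrow> y \<in> lcar L \<Longrightarrow> lbr L x y \<in> lcar L"
    "0 \<in> lcar L" "\<And>x y. x \<in> lcar L \<Longrightarrow> y \<in> lcar L \<Longrightarrow> x + y \<in> lcar L"
    "\<And>c x. x \<in> lcar L \<Longrightarrow> lscale L c x \<in> lcar L"
proof -
  show v: "vector_space (lscale L)" and s: "module.subspace (lscale L) (lcar L)"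
    and "\<And>x y. x \<in> lcar L \<Longrightarrow> y \<in> lcar L \<Longrightarrow> lbr L x y \<in> lcar L"
    using assms by (auto simp: lie_algebra_def)
  interpret vector_space "lscale L" by (rule v)
  show "0 \<in> lcar L" "\<And>x y. x \<in> lcar L \<Longrightarrow> y \<in> lcar L \<Longrightarrow> x + y \<in> lcar L"
    "\<And>c x. x \<in> lcar L \<Longrightarrow> lscale L c x \<in> lcar L"
    using s by (auto simp: subspace_def)
qed

text \<open>The Lie axioms are identities and may be checked after applying the injective map
  \<open>f\<close>; for this all brackets must lie in the carrier, where \<open>f\<close> is
  additive.\<close>

lemma lie_algebra_transport:
  assumes L': "lie_algebra L'" and f: "lie_bij f L L'"
    and v: "vector_space (lscale L)" and s: "module.subspace (lscale L) (lcar L)"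
    and br: "\<And>x y. x \<in> lcar L \<Longrightarrow> y \<in> lcar L \<Longrightarrow> lbr L x y \<in> lcar L"
  shows "lie_algebra L"
proof -
  interpret vector_space "lscale L" by (rule v)
  have z: "0 \<in> lcar L" and pl: "\<And>x y. x \<in> lcar L \<Longrightarrow> y \<in> lcar L \<Longrightarrow> x + y \<in> lcar L"
    and sc: "\<And>c x. x \<in> lcar L \<Longrightarrow> lscale L c x \<in> lcar L"
    using s by (auto simp: subspace_def)
  have fm: "\<And>x. x \<in> lcar L \<Longrightarrow> f x \<in> lcar L'"
    and fa: "\<And>x y. x \<in> lcar L \<Longrightarrow> y \<in> lcar L \<Longrightarrow> f (x + y) = f x + f y"
    and fb: "\<And>x y. x \<in> lcar L \<Longrightarrow> y \<in> lcar L \<Longrightarrow> f (lbr L x y) = lbr L' (f x) (f y)"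
    and fs: "\<And>c x. x \<in> lcar L \<Longrightarrow> f (lscale L c x) = lscale L' c (f x)"
    and fi: "\<And>x y. x \<in> lcar L \<Longrightarrow> y \<in> lcar L \<Longrightarrow> f x = f y \<Longrightarrow> x = y"
    using f by (auto simp: lie_bij_def bij_betw_def inj_on_def)
  have f0: "f 0 = 0"
  proof -
    have "f 0 + f 0 = f 0 + 0" using fa [OF z z] by simp
    then show ?thesis by (simp only: add_left_cancel)
  qed
  note L'_ax = L'[unfolded lie_algebra_def]
  show ?thesis
    unfolding lie_algebra_def
  proof (intro conjI ballI allI v s br)
    fix x y u assume xyz: "x \<in> lcar L" "y \<in> lcar L" "u \<in> lcar L"
    show "lbr L (x + y) u = lbr L x u + lbr L y u" "lbr L u (x + y) = lbr L u x + lbr L u y"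
      by (rule fi; use xyz fm L'_ax in \<open>simp add: fa fb pl br\<close>)+
    have "f (lbr L x (lbr L y u) + lbr L y (lbr L u x) + lbr L u (lbr L x y)) = f 0"
      using xyz fm L'_ax by (simp add: fa fb pl br f0)
    then show "lbr L x (lbr L y u) + lbr L y (lbr L u x) + lbr L u (lbr L x y) = 0"
      by (rule fi [rotated 2]) (use xyz in \<open>simp_all add: br pl z\<close>)
  next
    fix c x y assume xy: "x \<in> lcar L" "y \<in> lcar L"
    show "lbr L (lscale L c x) y = lscale L c (lbr L x y)"
      "lbr L x (lscale L c y) = lscale L c (lbr L x y)"
      by (rule fi; use xy fm L'_ax in \<open>simp add: fs fb sc br\<close>)+
  next
    fix x assume x: "x \<in> lcar L"
    have "f (lbr L x x) = f 0" using x fm L'_ax by (simp add: fb f0)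
    then show "lbr L x x = 0" by (rule fi [rotated 2]) (use x in \<open>simp_all add: br z\<close>)
  qed
qed

lemma lie_bij_inv:
  assumes L: "lie_algebra L" and f: "lie_bij f L L'"
  shows "lie_bij (inv_into (lcar L) f) L' L"
    and "\<And>x y. x \<in> lcar L' \<Longrightarrow> y \<in> lcar L' \<Longrightarrow> lbr L' x y \<in> lcar L'"
proof -
  let ?g = "inv_into (lcar L) f"
  have fa: "\<And>x y. x \<in> lcar L \<Longrightarrow> y \<in> lcar L \<Longrightarrow> f (x + y) = f x + f y"
    and fb: "\<And>x y. x \<in> lcar L \<Longrightarrow> y \<in> lcar L \<Longrightarrow> f (lbr L x y) = lbr L' (f x) (f y)"
    and fs: "\<And>c x. x \<in> lcar L \<Longrightarrow> f (lscale L c x) = lscale L' c (f x)"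
    and bij: "bij_betw f (lcar L) (lcar L')"
    using f by (auto simp: lie_bij_def)
  have fm: "f x \<in> lcar L'" if "x \<in> lcar L" for x using bij that by (auto simp: bij_betw_def)
  have gf: "?g (f x) = x" if "x \<in> lcar L" for x using bij that by (simp add: bij_betw_def)
  have ex: "\<exists>a\<in>lcar L. x = f a" if "x \<in> lcar L'" for x using bij that by (auto simp: bij_betw_def)
  show "lbr L' x y \<in> lcar L'" if xy: "x \<in> lcar L'" "y \<in> lcar L'" for x y
  proof -
    obtain a b where "a \<in> lcar L" "b \<in> lcar L" "x = f a" "y = f b" using ex xy by blast
    then show ?thesis using fm lie_algebraD(3) [OF L] by (simp add: fb [symmetric])
  qed
  show "lie_bij ?g L' L"
    unfolding lie_bij_def
  proof (intro conjI ballI allI)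
    show "bij_betw ?g (lcar L') (lcar L)" using bij by (rule bij_betw_inv_into)
    fix x y assume "x \<in> lcar L'" "y \<in> lcar L'"
    then obtain a b where "a \<in> lcar L" "b \<in> lcar L" "x = f a" "y = f b" using ex by blast
    then show "?g (x + y) = ?g x + ?g y" "?g (lbr L' x y) = lbr L (?g x) (?g y)"
      using lie_algebraD(3,5) [OF L] by (simp_all add: gf fa [symmetric] fb [symmetric])
  next
    fix c x assume "x \<in> lcar L'"
    then obtain a where "a \<in> lcar L" "x = f a" using ex by blast
    then show "?g (lscale L' c x) = lscale L c (?g x)"
      using lie_algebraD(6) [OF L] by (simp add: gf fs [symmetric])
  qed
qed

text \<open>Transport in the other direction, along the inverse map; the image inherits closure
  under the bracket.\<close>

lemma lie_iso_codomain:
  assumes "lie_algebra L" "lie_bij f L L'" "vector_space (lscale L')"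
    "module.subspace (lscale L') (lcar L')"
  shows "lie_iso L L'"
  using assms lie_algebra_transport [OF assms(1) lie_bij_inv(1) [OF assms(1,2)] assms(3,4)]
    lie_bij_inv(2) [OF assms(1,2)]
  by (auto simp: lie_iso_iff)

lemma lie_iso_sym: "lie_iso L L' \<Longrightarrow> lie_iso L' L"
  using lie_bij_inv(1) by (auto simp: lie_iso_iff)

lemma lie_bij_trans:
  assumes "lie_bij f L L'" "lie_bij g L' L''" shows "lie_bij (g \<circ> f) L L''"
proof -
  have "f x \<in> lcar L'" if "x \<in> lcar L" for x
    using assms(1) that by (auto simp: lie_bij_def bij_betw_def)
  then show ?thesis using assms bij_betw_trans unfolding lie_bij_def by (metis comp_apply)
qed

lemma lie_iso_trans: "lie_iso L L' \<Longrightarrow> lie_iso L' L'' \<Longrightarrow> lie_iso L L''"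
  unfolding lie_iso_iff using lie_bij_trans by blast

lemma lie_iso_refl: "lie_algebra L \<Longrightarrow> lie_iso L L"
  unfolding lie_iso_iff by (intro conjI exI [of _ id]) (auto simp: lie_bij_def bij_betw_def)

lemma vector_space_prod_scale:
  assumes "vector_space s" "vector_space t"
  shows "vector_space (\<lambda>c (u, x). (s c u, t c x))"
proof -
  interpret s: vector_space s by fact
  interpret t: vector_space t by fact
  show ?thesis
    by unfold_locales (auto simp: plus_prod_def s.scale_right_distrib s.scale_left_distrib
        t.scale_right_distrib t.scale_left_distrib)
qed

lemma subspace_prod_scale:
  assumes "vector_space s" "vector_space t" "module.subspace s A" "module.subspace t B"
  shows "module.subspace (\<lambda>c (u, x). (s c u, t c x)) (A \<times> B)"
proof -
  interpret s: vector_space s by fact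
  interpret t: vector_space t by fact
  interpret p: vector_space "\<lambda>c (u, x). (s c u, t c x)" by (rule vector_space_prod_scale) fact+
  show ?thesis using assms(3,4)
    by (auto simp: p.subspace_def s.subspace_def t.subspace_def plus_prod_def zero_prod_def)
qed

subsection \<open>Bilinear maps\<close>

lemma lin_fun_add: "lin (\<lambda>p. v p + w p) x = lin v x + lin w x"
  by (simp add: lin_def algebra_simps sum.distrib)

lemma lin_fun_mult: "lin (\<lambda>p. c * w p) x = c * lin w x"
  by (simp add: lin_def algebra_simps sum_distrib_left)

lemma lin_fun_mult_right: "lin (\<lambda>p. w p * c) x = lin w x * c"
  by (simp add: lin_def algebra_simps sum_distrib_left)

lemma lin_fun_sum: "lin (\<lambda>p. \<Sum>a\<in>A. w a p) x = (\<Sum>a\<in>A. lin (w a) x)"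
proof -
  have "lin (\<lambda>p. \<Sum>a\<in>A. w a p) x = (\<Sum>p\<in>Poly_Mapping.keys x. \<Sum>a\<in>A. Poly_Mapping.lookup x p * w a p)"
    by (simp add: lin_def sum_distrib_left)
  also have "\<dots> = (\<Sum>a\<in>A. lin (w a) x)"
    unfolding lin_def by (rule sum.swap)
  finally show ?thesis .
qed

lemma lookup_bilin:
  "Poly_Mapping.lookup (bilin b x y) r = lin (\<lambda>p. lin (\<lambda>q. Poly_Mapping.lookup (b p q) r) y) x"
  by (simp add: bilin_def lookup_sum lin_def sum_distrib_left mult.assoc)

lemma bilin_add_left: "bilin b (x + x') y = bilin b x y + bilin b x' y"
  by (rule poly_mapping_eqI) (simp add: lookup_bilin lookup_add)

lemma bilin_add_right: "bilin b x (y + y') = bilin b x y + bilin b x y'"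
  by (rule poly_mapping_eqI) (simp add: lookup_bilin lookup_add lin_fun_add)

lemma bilin_scale_left: "bilin b (pm_scale c x) y = pm_scale c (bilin b x y)"
  by (rule poly_mapping_eqI) (simp add: lookup_bilin)

lemma bilin_scale_right: "bilin b x (pm_scale c y) = pm_scale c (bilin b x y)"
  by (rule poly_mapping_eqI) (simp add: lookup_bilin lin_fun_mult)

lemma free_on_iff: "x \<in> free_on B \<longleftrightarrow> (\<forall>p. p \<notin> B \<longrightarrow> Poly_Mapping.lookup x p = 0)"
  by (auto simp: free_on_def in_keys_iff)

lemma subspace_free_on: "module.subspace pm_scale (free_on B :: ('a \<Rightarrow>\<^sub>0 'k::field) set)"
proof -
  interpret vector_space "pm_scale :: 'k \<Rightarrow> ('a \<Rightarrow>\<^sub>0 'k) \<Rightarrow> _" by (rule vector_space_pm_scale)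
  show ?thesis by (auto simp: subspace_def free_on_iff lookup_add)
qed

lemma free_on_add: "x \<in> free_on B \<Longrightarrow> y \<in> free_on B \<Longrightarrow> x + y \<in> free_on B"
  by (auto simp: free_on_iff lookup_add)

lemma free_on_diff: "x \<in> free_on B \<Longrightarrow> y \<in> free_on B \<Longrightarrow> x - y \<in> free_on B"
  by (auto simp: free_on_iff lookup_minus)

lemma free_on_scale: "x \<in> free_on B \<Longrightarrow> pm_scale c x \<in> free_on B"
  by (auto simp: free_on_iff)

lemma free_on_zero [simp]: "0 \<in> free_on B"
  by (simp add: free_on_iff)

text \<open>The degree-additive action of the elements \<open>e\<^sup>(\<^sup>j\<^sup>)(l)\<close>, \<open>j \<in> I\<close>, on a module with basis \<open>u(k)\<close>,
  with structure constants \<open>g k j\<close>: \<open>e\<^sup>(\<^sup>j\<^sup>)(l). u(k) = g k j u(k + l)\<close>, on coefficients.\<close>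

definition conv :: "'i set \<Rightarrow> (nat \<Rightarrow> 'i \<Rightarrow> 'k) \<Rightarrow> ('i \<times> nat \<Rightarrow> 'k) \<Rightarrow> (nat \<Rightarrow> 'k) \<Rightarrow> nat \<Rightarrow> 'k::comm_ring_1"
  where "conv I g c u n = (\<Sum>k\<le>n. \<Sum>j\<in>I. g k j * c (j, n - k) * u k)"

definition act :: "(nat \<Rightarrow> 'i \<Rightarrow> 'k) \<Rightarrow> ('i \<times> nat \<Rightarrow>\<^sub>0 'k) \<Rightarrow> (nat \<Rightarrow>\<^sub>0 'k) \<Rightarrow> (nat \<Rightarrow>\<^sub>0 'k::field)"
  where "act g = bilin (\<lambda>(j, l) k. Poly_Mapping.single (l + k) (g k j))"

lemma keys_free_on: "x \<in> free_on B \<Longrightarrow> Poly_Mapping.keys x \<subseteq> B"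
  by (simp add: free_on_def)

lemma conv_lin:
  assumes "finite I" "c \<in> free_on (I \<times> UNIV)"
  shows "conv I g (Poly_Mapping.lookup c) (Poly_Mapping.lookup u) n =
    lin (\<lambda>(j, l). lin (\<lambda>k. if l + k = n then g k j else 0) u) c"
proof -
  let ?c = "Poly_Mapping.lookup c" and ?u = "Poly_Mapping.lookup u"
  \<comment> \<open>Ranges that contain both the supports and \<open>{..n}\<close>: the sums can be
    interchanged over them, and the solution \<open>n - k\<close> of l + k = n stays inside.\<close>
  let ?K = "{..n} \<union> Poly_Mapping.keys u"
  let ?L = "{..n} \<union> snd ` Poly_Mapping.keys c"
  have fin: "finite ?K" "finite ?L" by auto
  have sub: "Poly_Mapping.keys c \<subseteq> I \<times> ?L"
    using keys_free_on [OF assms(2)] by force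
  have "lin (\<lambda>(j, l). lin (\<lambda>k. if l + k = n then g k j else 0) u) c =
      (\<Sum>(j, l)\<in>I \<times> ?L. \<Sum>k\<in>?K. ?c (j, l) * (?u k * (if l + k = n then g k j else 0)))"
    using assms(1) fin sub
    by (simp add: lin_superset [of "I \<times> ?L"] lin_superset [of ?K u] case_prod_unfold sum_distrib_left)
  also have "\<dots> = (\<Sum>j\<in>I. \<Sum>l\<in>?L. \<Sum>k\<in>?K. ?c (j, l) * (?u k * (if l + k = n then g k j else 0)))"
    by (rule sum.cartesian_product [symmetric])
  also have "\<dots> = (\<Sum>j\<in>I. \<Sum>k\<in>?K. \<Sum>l\<in>?L. ?c (j, l) * (?u k * (if l + k = n then g k j else 0)))"
    by (intro sum.cong refl sum.swap)
  also have "\<dots> = (\<Sum>j\<in>I. \<Sum>k\<in>?K. if k \<le> n then g k j * ?c (j, n - k) * ?u k else 0)"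
  proof (intro sum.cong refl)
    fix j k
    have "(\<Sum>l\<in>?L. ?c (j, l) * (?u k * (if l + k = n then g k j else 0))) =
        (\<Sum>l\<in>?L. if l = n - k then (if k \<le> n then g k j * ?c (j, l) * ?u k else 0) else 0)"
      by (intro sum.cong refl) (auto simp: algebra_simps)
    then show "(\<Sum>l\<in>?L. ?c (j, l) * (?u k * (if l + k = n then g k j else 0))) =
        (if k \<le> n then g k j * ?c (j, n - k) * ?u k else 0)"
      using fin by (simp add: sum.delta)
  qed
  also have "\<dots> = (\<Sum>j\<in>I. \<Sum>k\<le>n. g k j * ?c (j, n - k) * ?u k)"
    using fin by (intro sum.cong refl sum.mono_neutral_cong_right) auto
  also have "\<dots> = conv I g ?c ?u n"
    unfolding conv_def by (rule sum.swap)
  finally show ?thesis by simp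
qed

lemma lookup_act:
  assumes "finite I" "c \<in> free_on (I \<times> UNIV)"
  shows "Poly_Mapping.lookup (act g c u) n = conv I g (Poly_Mapping.lookup c) (Poly_Mapping.lookup u) n"
  unfolding conv_lin [OF assms] act_def lookup_bilin
  by (simp add: case_prod_unfold lookup_single when_def)

text \<open>The product with f_j(l) \<star> f_i(k) = \<open>g k i j\<close> f_i(k + l). Left
  multiplication preserves each row, that is the span of the f_i(k) for fixed i, so the axioms can
  be checked row by row.\<close>

definition star :: "(nat \<Rightarrow> 'i \<Rightarrow> 'i \<Rightarrow> 'k) \<Rightarrow> ('i \<times> nat \<Rightarrow>\<^sub>0 'k) \<Rightarrow> ('i \<times> nat \<Rightarrow>\<^sub>0 'k) \<Rightarrow> ('i \<times> nat \<Rightarrow>\<^sub>0 'k::field)"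
  where "star g = bilin (\<lambda>(j, l) (i, k). Poly_Mapping.single (i, l + k) (g k i j))"

definition row :: "'i \<Rightarrow> ('i \<times> nat \<Rightarrow>\<^sub>0 'k) \<Rightarrow> nat \<Rightarrow>\<^sub>0 'k::zero"
  where "row i d = Poly_Mapping.map_key (\<lambda>k. (i, k)) d"

lemma lookup_row [simp]: "Poly_Mapping.lookup (row i d) k = Poly_Mapping.lookup d (i, k)"
  unfolding row_def by (subst map_key.rep_eq) (auto simp: inj_on_def)

lemma lin_row: "lin (\<lambda>(i', k). if i' = i then w k else 0) d = lin w (row i d)"
proof -
  have "lin (\<lambda>(i', k). if i' = i then w k else 0) d =
      (\<Sum>p\<in>(\<lambda>k. (i, k)) ` Poly_Mapping.keys (row i d). Poly_Mapping.lookup d p * (case p of (i', k) \<Rightarrow> if i' = i then w k else 0))"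
    unfolding lin_def by (rule sum.mono_neutral_right) (auto simp: in_keys_iff)
  then show ?thesis by (simp add: sum.reindex inj_on_def lin_def)
qed

lemma lookup_star:
  assumes "finite I" "c \<in> free_on (I \<times> UNIV)"
  shows "Poly_Mapping.lookup (star g c d) (i, n) =
    conv I (\<lambda>k. g k i) (Poly_Mapping.lookup c) (\<lambda>k. Poly_Mapping.lookup d (i, k)) n"
proof -
  have "Poly_Mapping.lookup (star g c d) (i, n) =
      lin (\<lambda>(j, l). lin (\<lambda>(i', k). if i' = i then (if l + k = n then g k i j else 0) else 0) d) c"
    unfolding star_def lookup_bilin
    by (intro lin_cong) (auto simp: lookup_single when_def intro!: lin_cong)
  also have "\<dots> = lin (\<lambda>(j, l). lin (\<lambda>k. if l + k = n then g k i j else 0) (row i d)) c"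
    by (simp add: lin_row)
  also have "\<dots> = conv I (\<lambda>k. g k i) (Poly_Mapping.lookup c) (Poly_Mapping.lookup (row i d)) n"
    using assms by (simp add: conv_lin)
  also have "Poly_Mapping.lookup (row i d) = (\<lambda>k. Poly_Mapping.lookup d (i, k))" by auto
  finally show ?thesis .
qed

lemma conv_diff_right: "conv I g c (\<lambda>k. u k - v k) n = conv I g c u n - conv I g c v n"
  by (simp add: conv_def algebra_simps sum_subtractf)

lemma conv_0 [simp]: "conv I g c u 0 = (\<Sum>j\<in>I. g 0 j * c (j, 0) * u 0)"
  by (simp add: conv_def)

subsection \<open>The Jacobi identity\<close>

definition triples :: "nat \<Rightarrow> (nat \<times> nat \<times> nat) set"
  where "triples n = {(a, b, k). a + b + k = n}"

lemma sum_triples_1: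
  "(\<Sum>m\<le>n. \<Sum>k\<le>m. G (n - m) (m - k) k) = (\<Sum>(a, b, k)\<in>triples n. G a b k)"
proof -
  have "(\<Sum>m\<le>n. \<Sum>k\<le>m. G (n - m) (m - k) k) =
      (\<Sum>(m, k)\<in>(SIGMA m:{..n}. {..m}). G (n - m) (m - k) k)"
    by (rule sum.Sigma) auto
  also have "\<dots> = (\<Sum>(a, b, k)\<in>triples n. G a b k)"
    by (rule sum.reindex_bij_witness [of _ "\<lambda>(a, b, k). (b + k, k)" "\<lambda>(m, k). (n - m, m - k, k)"])
       (auto simp: triples_def)
  finally show ?thesis .
qed

lemma sum_triples_2:
  "(\<Sum>k\<le>n. \<Sum>b\<le>n - k. G (n - k - b) b k) = (\<Sum>(a, b, k)\<in>triples n. G a b k)"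
proof -
  have "(\<Sum>k\<le>n. \<Sum>b\<le>n - k. G (n - k - b) b k) =
      (\<Sum>(k, b)\<in>(SIGMA k:{..n}. {..n - k}). G (n - k - b) b k)"
    by (rule sum.Sigma) auto
  also have "\<dots> = (\<Sum>(a, b, k)\<in>triples n. G a b k)"
    by (rule sum.reindex_bij_witness [of _ "\<lambda>(a, b, k). (k, b)" "\<lambda>(k, b). (n - k - b, b, k)"])
       (auto simp: triples_def)
  finally show ?thesis .
qed

lemma sum_triples_swap:
  "(\<Sum>(a, b, k)\<in>triples n. G a b k) = (\<Sum>(a, b, k)\<in>triples n. G b a k)"
  by (rule sum.reindex_bij_witness [of _ "\<lambda>(a, b, k). (b, a, k)" "\<lambda>(a, b, k). (b, a, k)"])
     (auto simp: triples_def)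

lemma conv_conv:
  "conv I g c (conv I g d u) n =
    (\<Sum>(a, b, k)\<in>triples n. \<Sum>p\<in>I. \<Sum>q\<in>I. g (k + b) p * g k q * (c (p, a) * d (q, b) * u k))"
proof -
  have "conv I g c (conv I g d u) n =
      (\<Sum>m\<le>n. \<Sum>p\<in>I. \<Sum>k\<le>m. \<Sum>q\<in>I. g m p * g k q * (c (p, n - m) * d (q, m - k) * u k))"
    by (simp add: conv_def sum_distrib_left mult_ac)
  also have "\<dots> = (\<Sum>m\<le>n. \<Sum>k\<le>m. \<Sum>p\<in>I. \<Sum>q\<in>I. g m p * g k q * (c (p, n - m) * d (q, m - k) * u k))"
    by (intro sum.cong refl sum.swap)
  also have "\<dots> = (\<Sum>m\<le>n. \<Sum>k\<le>m. \<Sum>p\<in>I. \<Sum>q\<in>I. g (k + (m - k)) p * g k q * (c (p, n - m) * d (q, m - k) * u k))"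
    by (intro sum.cong refl) simp
  also have "\<dots> = (\<Sum>(a, b, k)\<in>triples n. \<Sum>p\<in>I. \<Sum>q\<in>I. g (k + b) p * g k q * (c (p, a) * d (q, b) * u k))"
    by (rule sum_triples_1)
  finally show ?thesis .
qed

lemma conv_star:
  "conv I g (\<lambda>(q, m). conv I (\<lambda>b. l b q) c (\<lambda>b. d (q, b)) m) u n =
    (\<Sum>(a, b, k)\<in>triples n. \<Sum>p\<in>I. \<Sum>q\<in>I. g k q * l b q p * (c (p, a) * d (q, b) * u k))"
proof -
  have "conv I g (\<lambda>(q, m). conv I (\<lambda>b. l b q) c (\<lambda>b. d (q, b)) m) u n =
      (\<Sum>k\<le>n. \<Sum>q\<in>I. \<Sum>b\<le>n - k. \<Sum>p\<in>I. g k q * l b q p * (c (p, n - k - b) * d (q, b) * u k))"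
    by (simp add: conv_def sum_distrib_left sum_distrib_right mult_ac)
  also have "\<dots> = (\<Sum>k\<le>n. \<Sum>b\<le>n - k. \<Sum>q\<in>I. \<Sum>p\<in>I. g k q * l b q p * (c (p, n - k - b) * d (q, b) * u k))"
    by (intro sum.cong refl sum.swap)
  also have "\<dots> = (\<Sum>k\<le>n. \<Sum>b\<le>n - k. \<Sum>p\<in>I. \<Sum>q\<in>I. g k q * l b q p * (c (p, n - k - b) * d (q, b) * u k))"
    by (intro sum.cong refl sum.swap)
  also have "\<dots> = (\<Sum>(a, b, k)\<in>triples n. \<Sum>p\<in>I. \<Sum>q\<in>I. g k q * l b q p * (c (p, a) * d (q, b) * u k))"
    by (rule sum_triples_2)
  finally show ?thesis .
qed

text \<open>The structure constants \<open>g\<close> define a module over the Lie algebra with structure constants \<open>l\<close>.\<close>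

definition module_constants :: "'i set \<Rightarrow> (nat \<Rightarrow> 'i \<Rightarrow> 'i \<Rightarrow> 'k::field) \<Rightarrow> (nat \<Rightarrow> 'i \<Rightarrow> 'k) \<Rightarrow> bool"
  where "module_constants I l g \<longleftrightarrow> (\<forall>p\<in>I. \<forall>q\<in>I. \<forall>a b k. 0 < a \<longrightarrow> 0 < b \<longrightarrow> 0 < k \<longrightarrow>
    g k q * (g (k + b) p - l b q p) = g k p * (g (k + a) q - l a p q))"

text \<open>Compare coefficients of e_p(a) e_q(b) u(k). Acting twice gives
  \<open>g (k + b) p * g k q\<close>, acting by the product gives \<open>g k q * l b q p\<close>.
  After antisymmetrization under exchange of (p, a) with (q, b) the difference is the identity in
  \<open>module_constants\<close>.\<close>

lemma conv_bracket:
  assumes M: "module_constants I l g"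
    and zero: "\<And>j. c (j, 0) = 0" "\<And>j. d (j, 0) = 0" "u 0 = 0"
  shows "conv I g (\<lambda>(q, m). conv I (\<lambda>b. l b q) c (\<lambda>b. d (q, b)) m - conv I (\<lambda>b. l b q) d (\<lambda>b. c (q, b)) m) u n
    = conv I g c (conv I g d u) n - conv I g d (conv I g c u) n"
proof -
  let ?t = "\<lambda>a b k p q. c (p, a) * d (q, b) * u k"
  have swap: "(\<Sum>(a, b, k)\<in>triples n. \<Sum>p\<in>I. \<Sum>q\<in>I. G a b k p q) =
      (\<Sum>(a, b, k)\<in>triples n. \<Sum>p\<in>I. \<Sum>q\<in>I. G b a k q p)" for G :: "nat \<Rightarrow> nat \<Rightarrow> nat \<Rightarrow> 'a \<Rightarrow> 'a \<Rightarrow> 'b"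
  proof -
    have "(\<Sum>(a, b, k)\<in>triples n. \<Sum>p\<in>I. \<Sum>q\<in>I. G a b k p q) =
        (\<Sum>(a, b, k)\<in>triples n. \<Sum>p\<in>I. \<Sum>q\<in>I. G b a k p q)"
      by (rule sum_triples_swap)
    also have "\<dots> = (\<Sum>(a, b, k)\<in>triples n. \<Sum>p\<in>I. \<Sum>q\<in>I. G b a k q p)"
      by (intro sum.cong refl) (auto intro: sum.swap)
    finally show ?thesis .
  qed
  have "conv I g (\<lambda>(q, m). conv I (\<lambda>b. l b q) c (\<lambda>b. d (q, b)) m - conv I (\<lambda>b. l b q) d (\<lambda>b. c (q, b)) m) u n
      = conv I g (\<lambda>(q, m). conv I (\<lambda>b. l b q) c (\<lambda>b. d (q, b)) m) u n
      - conv I g (\<lambda>(q, m). conv I (\<lambda>b. l b q) d (\<lambda>b. c (q, b)) m) u n"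
    by (simp add: conv_def [of I g] algebra_simps sum_subtractf)
  also have "conv I g (\<lambda>(q, m). conv I (\<lambda>b. l b q) d (\<lambda>b. c (q, b)) m) u n =
      (\<Sum>(a, b, k)\<in>triples n. \<Sum>p\<in>I. \<Sum>q\<in>I. g k p * l a p q * ?t a b k p q)"
    unfolding conv_star by (subst swap) (simp add: mult_ac)
  also have "conv I g d (conv I g c u) n =
      (\<Sum>(a, b, k)\<in>triples n. \<Sum>p\<in>I. \<Sum>q\<in>I. g (k + a) q * g k p * ?t a b k p q)"
    unfolding conv_conv by (subst swap) (simp add: mult_ac)
  moreover have "(\<Sum>(a, b, k)\<in>triples n. \<Sum>p\<in>I. \<Sum>q\<in>I. g k q * l b q p * ?t a b k p q) -
      (\<Sum>(a, b, k)\<in>triples n. \<Sum>p\<in>I. \<Sum>q\<in>I. g k p * l a p q * ?t a b k p q) =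
      (\<Sum>(a, b, k)\<in>triples n. \<Sum>p\<in>I. \<Sum>q\<in>I. g (k + b) p * g k q * ?t a b k p q) -
      (\<Sum>(a, b, k)\<in>triples n. \<Sum>p\<in>I. \<Sum>q\<in>I. g (k + a) q * g k p * ?t a b k p q)"
    unfolding sum_subtractf [symmetric] case_prod_unfold
  proof (intro sum.cong refl)
    fix x p q assume "x \<in> triples n" and p: "p \<in> I" and q: "q \<in> I"
    obtain a b k where x: "x = (a, b, k)" by (cases x)
    show "g (snd (snd x)) q * l (fst (snd x)) q p * ?t (fst x) (fst (snd x)) (snd (snd x)) p q -
        g (snd (snd x)) p * l (fst x) p q * ?t (fst x) (fst (snd x)) (snd (snd x)) p q =
        g (snd (snd x) + fst (snd x)) p * g (snd (snd x)) q * ?t (fst x) (fst (snd x)) (snd (snd x)) p q -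
        g (snd (snd x) + fst x) q * g (snd (snd x)) p * ?t (fst x) (fst (snd x)) (snd (snd x)) p q"
    proof (cases "0 < a \<and> 0 < b \<and> 0 < k")
      case True
      then have "g k q * (g (k + b) p - l b q p) = g k p * (g (k + a) q - l a p q)"
        using M p q unfolding module_constants_def by blast
      then have "g k q * l b q p - g k p * l a p q = g (k + b) p * g k q - g (k + a) q * g k p"
        by (simp add: algebra_simps)
      then have "(g k q * l b q p - g k p * l a p q) * ?t a b k p q =
          (g (k + b) p * g k q - g (k + a) q * g k p) * ?t a b k p q" by simp
      then show ?thesis by (simp add: x left_diff_distrib)
    next
      case False
      \<comment> \<open>The identity for the constants is assumed in positive degrees; in degree 0
        the coefficients vanish instead.\<close>
      then have "?t a b k p q = 0" using zero by auto
      then show ?thesis by (simp only: x fst_conv snd_conv mult_zero_right)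
    qed
  qed
  ultimately show ?thesis by (simp only: conv_star conv_conv)
qed

section \<open>The Lie algebra with given structure constants\<close>

definition lam_lie :: "'i set \<Rightarrow> (nat \<Rightarrow> 'i \<Rightarrow> 'i \<Rightarrow> 'k::field) \<Rightarrow> ('k, 'i \<times> nat \<Rightarrow>\<^sub>0 'k) lie"
  where "lam_lie I l = \<lparr>lcar = free_on (I \<times> {1..}), lscale = pm_scale,
    lbr = (\<lambda>c d. star l c d - star l d c)\<rparr>"

lemma lam_lie_simps [simp]:
  "lcar (lam_lie I l) = free_on (I \<times> {1..})" "lscale (lam_lie I l) = pm_scale"
  "lbr (lam_lie I l) c d = star l c d - star l d c"
  by (simp_all add: lam_lie_def)

lemma free_on_lookup_0:
  fixes c :: "'i \<times> nat \<Rightarrow>\<^sub>0 'k::field"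
  shows "c \<in> free_on (I \<times> {1..}) \<Longrightarrow> Poly_Mapping.lookup c (j, 0) = 0"
  "c \<in> free_on (I \<times> {1..}) \<Longrightarrow> j \<notin> I \<Longrightarrow> Poly_Mapping.lookup c (j, k) = 0"
  "c \<in> free_on (I \<times> {1..}) \<Longrightarrow> c \<in> free_on (I \<times> UNIV)"
  by (auto simp: free_on_iff)

lemma star_in_free_on:
  fixes c d :: "'i \<times> nat \<Rightarrow>\<^sub>0 'k::field"
  assumes "finite I" "c \<in> free_on (I \<times> {1..})" "d \<in> free_on (I \<times> {1..})"
  shows "star l c d \<in> free_on (I \<times> {1..})"
  unfolding free_on_iff
proof (intro allI impI)
  fix r :: "'i \<times> nat" assume r: "r \<notin> I \<times> {1..}"
  obtain i n where rr: "r = (i, n)" by (cases r)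
  with r have "i \<notin> I \<or> n = 0" by auto
  then show "Poly_Mapping.lookup (star l c d) r = 0"
    unfolding rr using assms by (auto simp: lookup_star [OF assms(1) free_on_lookup_0(3)] free_on_lookup_0 conv_def)
qed

lemma lookup_lam_bracket:
  assumes "finite I" "c \<in> free_on (I \<times> {1..})" "d \<in> free_on (I \<times> {1..})"
  shows "Poly_Mapping.lookup (star l c d - star l d c) (i, n) =
    conv I (\<lambda>k. l k i) (Poly_Mapping.lookup c) (\<lambda>k. Poly_Mapping.lookup d (i, k)) n -
    conv I (\<lambda>k. l k i) (Poly_Mapping.lookup d) (\<lambda>k. Poly_Mapping.lookup c (i, k)) n"
  using assms by (simp add: lookup_minus lookup_star [OF assms(1) free_on_lookup_0(3)])

lemma conv_lam_bracket:
  assumes "finite I" "c \<in> free_on (I \<times> {1..})" "d \<in> free_on (I \<times> {1..})" "u 0 = 0"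
    and "module_constants I l g"
  shows "conv I g (Poly_Mapping.lookup (star l c d - star l d c)) u n =
    conv I g (Poly_Mapping.lookup c) (conv I g (Poly_Mapping.lookup d) u) n -
    conv I g (Poly_Mapping.lookup d) (conv I g (Poly_Mapping.lookup c) u) n"
proof -
  have E: "Poly_Mapping.lookup (star l c d - star l d c) = (\<lambda>(q, m).
    conv I (\<lambda>b. l b q) (Poly_Mapping.lookup c) (\<lambda>b. Poly_Mapping.lookup d (q, b)) m -
    conv I (\<lambda>b. l b q) (Poly_Mapping.lookup d) (\<lambda>b. Poly_Mapping.lookup c (q, b)) m)"
    using assms by (auto simp: lookup_lam_bracket)
  show ?thesis
    unfolding E by (rule conv_bracket [where c = "Poly_Mapping.lookup c" and d = "Poly_Mapping.lookup d"])
      (simp_all add: assms(4,5) free_on_lookup_0(1) [OF assms(2)] free_on_lookup_0(1) [OF assms(3)])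
qed

text \<open>The condition on all rows says that \<open>star\<close> is left-symmetric in positive
  degrees. Writing \<open>?R c\<close> for left multiplication by \<open>c\<close> on row i, the
  bracket acts as a commutator, and the twelve terms of the Jacobi sum cancel in pairs.\<close>

lemma lie_algebra_lam_lie:
  assumes fin: "finite I" and M: "\<And>i. i \<in> I \<Longrightarrow> module_constants I l (\<lambda>k. l k i)"
  shows "lie_algebra (lam_lie I l)"
  unfolding lie_algebra_def lam_lie_simps
proof (intro conjI ballI allI vector_space_pm_scale subspace_free_on)
  let ?A = "free_on (I \<times> {1..})"
  fix x y z :: "'a \<times> nat \<Rightarrow>\<^sub>0 'b" assume xyz: "x \<in> ?A" "y \<in> ?A" "z \<in> ?A"
  show "star l (x + y) z - star l z (x + y) = star l x z - star l z x + (star l y z - star l z y)"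
    "star l z (x + y) - star l (x + y) z = star l z x - star l x z + (star l z y - star l y z)"
    by (simp_all add: star_def bilin_add_left bilin_add_right)
  let ?br = "\<lambda>c d. star l c d - star l d c"
  have cl: "?br c d \<in> ?A" if "c \<in> ?A" "d \<in> ?A" for c d
    using that fin by (intro free_on_diff star_in_free_on)
  show "?br x (?br y z) + ?br y (?br z x) + ?br z (?br x y) = 0"
  proof (rule poly_mapping_eqI)
    fix r :: "'a \<times> nat"
    obtain i n where r: "r = (i, n)" by (cases r)
    show "Poly_Mapping.lookup (?br x (?br y z) + ?br y (?br z x) + ?br z (?br x y)) r = Poly_Mapping.lookup 0 r"
    proof (cases "i \<in> I")
      case True
      let ?R = "\<lambda>c. conv I (\<lambda>k. l k i) (Poly_Mapping.lookup c)"
      let ?r = "\<lambda>c k. Poly_Mapping.lookup c (i, k)"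
      have "Poly_Mapping.lookup (?br c (?br d e)) (i, n) =
          ?R c (?R d (?r e)) n - ?R c (?R e (?r d)) n - (?R d (?R e (?r c)) n - ?R e (?R d (?r c)) n)"
        if "c \<in> ?A" "d \<in> ?A" "e \<in> ?A" for c d e
      proof -
        have "?r (?br d e) = (\<lambda>k. ?R d (?r e) k - ?R e (?r d) k)"
          using that fin by (intro ext) (rule lookup_lam_bracket)
        then show ?thesis
          using that fin M [OF True]
          by (simp add: lookup_lam_bracket cl conv_diff_right conv_lam_bracket free_on_lookup_0(1))
      qed
      then show ?thesis using xyz by (simp add: r lookup_add)
    next
      case False
      have "Poly_Mapping.lookup (?br c d) (i, n) = 0" if "c \<in> ?A" "d \<in> ?A" for c d
        using cl [OF that] False by (rule free_on_lookup_0(2))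
      then show ?thesis using xyz cl by (simp add: r lookup_add)
    qed
  qed
qed (use fin in \<open>auto simp: star_def [symmetric] intro!: free_on_diff star_in_free_on\<close>,
  auto simp: star_def bilin_scale_left bilin_scale_right poly_mapping_eq_iff fun_eq_iff lookup_minus algebra_simps)

subsection \<open>Modules given by structure constants\<close>

text \<open>The action is pulled back along a coordinate map \<open>\<phi>\<close>, because in the
  chain the acting Lie algebra consists of linear forms and is known only up to such a map.\<close>

definition coord_module ::
  "('v \<Rightarrow> 'i \<times> nat \<Rightarrow>\<^sub>0 'k) \<Rightarrow> (nat \<Rightarrow> 'i \<Rightarrow> 'k::field) \<Rightarrow> ('k, 'v, nat \<Rightarrow>\<^sub>0 'k) lmodule"
  where "coord_module \<phi> g = \<lparr>mcar = free_on {1..}, mscale = pm_scale, mact = (\<lambda>f. act g (\<phi> f))\<rparr>"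

lemma act_in_free_on:
  assumes "finite I" "c \<in> free_on (I \<times> {1..})"
  shows "act g c u \<in> free_on {1..}"
proof -
  have "Poly_Mapping.lookup (act g c u) 0 = 0"
    by (simp add: lookup_act [OF assms(1) free_on_lookup_0(3) [OF assms(2)]]
        free_on_lookup_0(1) [OF assms(2)])
  then show ?thesis by (auto simp: free_on_iff not_le One_nat_def)
qed

lemma lookup_free_on_0 [simp]: "u \<in> free_on {1..} \<Longrightarrow> Poly_Mapping.lookup u (0::nat) = 0"
  by (simp add: free_on_iff)

lemma lie_module_coord:
  assumes L: "lie_algebra L" and \<phi>: "lie_bij \<phi> L (lam_lie I l)" and I: "finite I"
    and M: "module_constants I l g"
  shows "lie_module L (coord_module \<phi> g)"
proof -
  have \<phi>m: "\<phi> x \<in> free_on (I \<times> {1..})" if "x \<in> lcar L" for x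
    using \<phi> that by (auto simp: lie_bij_def bij_betw_def)
  have br: "act g (\<phi> (lbr L x y)) u = act g (\<phi> x) (act g (\<phi> y) u) - act g (\<phi> y) (act g (\<phi> x) u)"
    if xyu: "x \<in> lcar L" "y \<in> lcar L" "u \<in> free_on {1..}" for x y u
  proof (rule poly_mapping_eqI)
    fix n
    note x = \<phi>m [OF xyu(1)] and y = \<phi>m [OF xyu(2)]
    have b: "\<phi> (lbr L x y) = star l (\<phi> x) (\<phi> y) - star l (\<phi> y) (\<phi> x)"
      using \<phi> xyu by (simp add: lie_bij_def)
    have "\<phi> (lbr L x y) \<in> free_on (I \<times> {1..})"
      using xyu lie_algebraD(3) [OF L] by (intro \<phi>m) auto
    then have "Poly_Mapping.lookup (act g (\<phi> (lbr L x y)) u) n =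
        conv I g (Poly_Mapping.lookup (\<phi> (lbr L x y))) (Poly_Mapping.lookup u) n"
      using I by (intro lookup_act free_on_lookup_0(3))
    also have "\<dots> = conv I g (Poly_Mapping.lookup (\<phi> x)) (conv I g (Poly_Mapping.lookup (\<phi> y)) (Poly_Mapping.lookup u)) n -
        conv I g (Poly_Mapping.lookup (\<phi> y)) (conv I g (Poly_Mapping.lookup (\<phi> x)) (Poly_Mapping.lookup u)) n"
      unfolding b using I x y M xyu(3) by (intro conv_lam_bracket) auto
    also have "\<dots> = Poly_Mapping.lookup (act g (\<phi> x) (act g (\<phi> y) u) - act g (\<phi> y) (act g (\<phi> x) u)) n"
    proof -
      have a: "Poly_Mapping.lookup (act g c v) = conv I g (Poly_Mapping.lookup c) (Poly_Mapping.lookup v)"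
        if "c \<in> free_on (I \<times> {1..})" for c v
        using I that by (intro ext lookup_act free_on_lookup_0(3))
      show ?thesis by (simp add: lookup_minus a x y)
    qed
    finally show "Poly_Mapping.lookup (act g (\<phi> (lbr L x y)) u) n =
        Poly_Mapping.lookup (act g (\<phi> x) (act g (\<phi> y) u) - act g (\<phi> y) (act g (\<phi> x) u)) n" .
  qed
  have add: "\<phi> (x + y) = \<phi> x + \<phi> y" if "x \<in> lcar L" "y \<in> lcar L" for x y
    using \<phi> that by (simp add: lie_bij_def)
  have scale: "\<phi> (lscale L c x) = pm_scale c (\<phi> x)" if "x \<in> lcar L" for c x
    using \<phi> that by (simp add: lie_bij_def)
  show ?thesis
    unfolding lie_module_def coord_module_def lmodule.simps
  proof (intro conjI ballI allI L vector_space_pm_scale subspace_free_on)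
    show "act g (\<phi> x) u \<in> free_on {1..}" if "x \<in> lcar L" for x u
      using I \<phi>m [OF that] by (rule act_in_free_on)
  qed (simp_all add: add scale br act_def [symmetric], simp_all add: act_def bilin_add_left bilin_add_right
      bilin_scale_left bilin_scale_right)
qed

lemma has_nat_basis_free_on:
  assumes V: "mcar V = free_on {1..}" "mscale V = (pm_scale :: 'k::field \<Rightarrow> (nat \<Rightarrow>\<^sub>0 'k) \<Rightarrow> _)"
  shows "has_nat_basis V"
proof -
  interpret vector_space "pm_scale :: 'k \<Rightarrow> (nat \<Rightarrow>\<^sub>0 'k) \<Rightarrow> _" by (rule vector_space_pm_scale)
  define h where "h k = Poly_Mapping.single k (1::'k)" for k :: nat
  have inj: "inj h"
  proof (rule injI)
    fix x y assume "h x = h y"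
    then have "Poly_Mapping.lookup (h x) y = 1" by (simp add: h_def)
    then show "x = y" by (simp add: h_def lookup_single when_def split: if_splits)
  qed
  have "\<not> dependent (h ` {1..})"
  proof
    assume "dependent (h ` {1..})"
    then obtain T u v where T: "finite T" "T \<subseteq> h ` {1..}" "(\<Sum>w\<in>T. pm_scale (u w) w) = 0" "v \<in> T" "u v \<noteq> 0"
      unfolding dependent_explicit by blast
    then obtain k where v: "v = h k" by auto
    have "0 = Poly_Mapping.lookup (\<Sum>w\<in>T. pm_scale (u w) w) k" by (simp add: T(3))
    also have "\<dots> = (\<Sum>w\<in>T. if w = v then u v else 0)"
      unfolding lookup_sum
    proof (rule sum.cong [OF refl])
      fix w assume "w \<in> T"
      then obtain k' where "w = h k'" using T(2) by auto
      then show "Poly_Mapping.lookup (pm_scale (u w) w) k = (if w = v then u v else 0)"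
        using inj by (auto simp: v h_def lookup_single when_def inj_def)
    qed
    also have "\<dots> = u v" using T by simp
    finally show False using T(5) by simp
  qed
  moreover have "span (h ` {1..}) = free_on {1..}"
  proof
    show "span (h ` {1..}) \<subseteq> free_on {1..}"
      by (rule span_minimal) (auto simp: h_def free_on_iff lookup_single when_def subspace_free_on)
    show "free_on {1..} \<subseteq> span (h ` {1..})"
    proof
      fix x :: "nat \<Rightarrow>\<^sub>0 'k" assume x: "x \<in> free_on {1..}"
      have "(\<Sum>p\<in>Poly_Mapping.keys x. pm_scale (Poly_Mapping.lookup x p) (h p)) \<in> span (h ` {1..})"
        using keys_free_on [OF x] by (intro span_sum span_scale span_base) auto
      also have "(\<Sum>p\<in>Poly_Mapping.keys x. pm_scale (Poly_Mapping.lookup x p) (h p)) = x"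
        unfolding h_def pm_scale_single mult_1_right by (rule poly_mapping_sum_singles [symmetric])
      finally show "x \<in> span (h ` {1..})" .
    qed
  qed
  ultimately show ?thesis
    unfolding has_nat_basis_def V using inj by (intro exI [of _ h]) (auto intro: inj_on_subset)
qed

section \<open>Splitting off one vertex as an abelian ideal\<close>

definition col :: "'i \<Rightarrow> (nat \<Rightarrow>\<^sub>0 'k) \<Rightarrow> ('i \<times> nat \<Rightarrow>\<^sub>0 'k::comm_ring_1)"
  where "col z u = (\<Sum>k\<in>Poly_Mapping.keys u. Poly_Mapping.single (z, k) (Poly_Mapping.lookup u k))"

lemma lookup_col [simp]: "Poly_Mapping.lookup (col z u) (i, k) = (if i = z then Poly_Mapping.lookup u k else 0)"
  by (auto simp: col_def lookup_sum lookup_single when_def in_keys_iff intro!: sum.neutral)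

lemma poly_mapping_eqI_pair:
  "(\<And>i k. Poly_Mapping.lookup x (i, k) = Poly_Mapping.lookup y (i, k)) \<Longrightarrow> x = y"
  by (rule poly_mapping_eqI) auto

lemma free_onI_pair:
  "(\<And>i k. (i, k) \<notin> B \<Longrightarrow> Poly_Mapping.lookup x (i, k) = 0) \<Longrightarrow> x \<in> free_on B"
  by (auto simp: free_on_iff)

text \<open>As all constants with last index \<open>z\<close> vanish, left multiplication by row
  \<open>z\<close> is zero. The other rows form a subalgebra, while row \<open>z\<close> is an
  ideal, abelian because the condition includes \<open>j = z\<close>, on which they act by the
  constants of \<open>z\<close>.\<close>

lemma lam_lie_insert:
  assumes L: "lie_algebra L" and \<phi>: "lie_bij \<phi> L (lam_lie S l)" and S: "finite S" "z \<notin> S"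
    and M: "\<And>i. i \<in> insert z S \<Longrightarrow> module_constants (insert z S) l (\<lambda>k. l k i)"
    and zero: "\<And>j k. j \<in> insert z S \<Longrightarrow> 0 < k \<Longrightarrow> l k j z = 0"
  defines "V \<equiv> coord_module \<phi> (\<lambda>k. l k z)"
  shows "lie_module L V" "has_nat_basis V" "lie_iso (lam_lie (insert z S) l) (semidirect V L)"
proof -
  have "module_constants S l (\<lambda>k. l k z)"
    using M [of z] unfolding module_constants_def by (metis insertI1 insertI2)
  then show mod: "lie_module L V"
    unfolding V_def by (rule lie_module_coord [OF L \<phi> S(1)])
  show "has_nat_basis V" by (rule has_nat_basis_free_on) (simp_all add: V_def coord_module_def)
  have \<phi>m: "\<phi> x \<in> free_on (S \<times> {1..})" if "x \<in> lcar L" for x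
    using \<phi> that by (auto simp: lie_bij_def bij_betw_def)
  have \<phi>onto: "\<exists>x\<in>lcar L. c = \<phi> x" if "c \<in> free_on (S \<times> {1..})" for c
    using \<phi> that by (auto simp: lie_bij_def bij_betw_def)
  have \<phi>inj: "x = y" if "x \<in> lcar L" "y \<in> lcar L" "\<phi> x = \<phi> y" for x y
    using \<phi> that by (auto simp: lie_bij_def bij_betw_def inj_on_def)
  have \<phi>add: "\<phi> (x + y) = \<phi> x + \<phi> y" if "x \<in> lcar L" "y \<in> lcar L" for x y
    using \<phi> that by (simp add: lie_bij_def)
  have \<phi>br: "\<phi> (lbr L x y) = star l (\<phi> x) (\<phi> y) - star l (\<phi> y) (\<phi> x)" if "x \<in> lcar L" "y \<in> lcar L" for x y
    using \<phi> that by (simp add: lie_bij_def)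
  have \<phi>scale: "\<phi> (lscale L c x) = pm_scale c (\<phi> x)" if "x \<in> lcar L" for c x
    using \<phi> that by (simp add: lie_bij_def)
  define P where "P = semidirect V L"
  have P: "lcar P = free_on {1..} \<times> lcar L"
    "\<And>c u x. lscale P c (u, x) = (pm_scale c u, lscale L c x)"
    "\<And>u x v y. lbr P (u, x) (v, y) = (act (\<lambda>k. l k z) (\<phi> x) v - act (\<lambda>k. l k z) (\<phi> y) u, lbr L x y)"
    by (simp_all add: P_def semidirect_def V_def coord_module_def)
  define \<psi> where "\<psi> = (\<lambda>(u, x). col z u + \<phi> x)"
  have \<phi>z: "Poly_Mapping.lookup (\<phi> x) (z, k) = 0" if "x \<in> lcar L" for x k
    using \<phi>m [OF that] S(2) by (rule free_on_lookup_0(2))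
  have lookup_z: "Poly_Mapping.lookup (\<psi> (u, x)) (z, k) = Poly_Mapping.lookup u k" if "x \<in> lcar L" for u x k
    using \<phi>z [OF that] by (simp add: \<psi>_def lookup_add)
  have lookup_i: "Poly_Mapping.lookup (\<psi> (u, x)) (i, k) = Poly_Mapping.lookup (\<phi> x) (i, k)" if "i \<noteq> z" for u x i k
    using that by (simp add: \<psi>_def lookup_add)
  have \<psi>m: "\<psi> (u, x) \<in> free_on (insert z S \<times> {1..})" if "u \<in> free_on {1..}" "x \<in> lcar L" for u x
  proof (rule free_onI_pair)
    fix i and k :: nat assume p: "(i, k) \<notin> insert z S \<times> {1..}"
    then show "Poly_Mapping.lookup (\<psi> (u, x)) (i, k) = 0"
      using that \<phi>m [OF that(2)] by (cases "i = z") (auto simp: lookup_z lookup_i free_on_iff)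
  qed
  have bij: "bij_betw \<psi> (lcar P) (lcar (lam_lie (insert z S) l))"
    unfolding bij_betw_def
  proof
    show "inj_on \<psi> (lcar P)"
    proof (rule inj_onI)
      fix a b assume "a \<in> lcar P" "b \<in> lcar P" and eq: "\<psi> a = \<psi> b"
      then obtain u x v y where ab: "a = (u, x)" "b = (v, y)" "x \<in> lcar L" "y \<in> lcar L"
        by (auto simp: P)
      have "u = v" using eq lookup_z [OF ab(3), of u] lookup_z [OF ab(4), of v]
        unfolding ab by (intro poly_mapping_eqI) metis
      moreover have "\<phi> x = \<phi> y"
        using eq \<phi>z ab(3,4) unfolding ab by (intro poly_mapping_eqI_pair) (metis lookup_i)
      ultimately show "a = b" using \<phi>inj ab by simp
    qed
    show "\<psi> ` lcar P = lcar (lam_lie (insert z S) l)"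
    proof
      show "\<psi> ` lcar P \<subseteq> lcar (lam_lie (insert z S) l)" using \<psi>m by (auto simp: P)
      show "lcar (lam_lie (insert z S) l) \<subseteq> \<psi> ` lcar P"
      proof
        fix c assume "c \<in> lcar (lam_lie (insert z S) l)"
        then have c: "c \<in> free_on (insert z S \<times> {1..})" by simp
        have "restrict_pm (S \<times> {1..}) c \<in> free_on (S \<times> {1..})" by (auto simp: free_on_iff)
        then obtain x where x: "x \<in> lcar L" "restrict_pm (S \<times> {1..}) c = \<phi> x" using \<phi>onto by blast
        have "row z c \<in> free_on {1..}" using c by (auto simp: free_on_iff)
        moreover have "c = \<psi> (row z c, x)"
        proof (rule poly_mapping_eqI_pair)
          fix i k
          show "Poly_Mapping.lookup c (i, k) = Poly_Mapping.lookup (\<psi> (row z c, x)) (i, k)"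
            using c by (cases "i = z") (auto simp: lookup_z [OF x(1)] lookup_i x(2) [symmetric] free_on_iff)
        qed
        ultimately show "c \<in> \<psi> ` lcar P" using x(1) by (auto simp: P)
      qed
    qed
  qed
  have \<psi>br: "\<psi> (lbr P a b) = lbr (lam_lie (insert z S) l) (\<psi> a) (\<psi> b)" if "a \<in> lcar P" "b \<in> lcar P" for a b
  proof -
    obtain u x v y where ab: "a = (u, x)" "b = (v, y)" and x: "x \<in> lcar L" and y: "y \<in> lcar L"
      and u: "u \<in> free_on {1..}" and v: "v \<in> free_on {1..}"
      using \<open>a \<in> lcar P\<close> \<open>b \<in> lcar P\<close> by (auto simp: P)
    have xy: "lbr L x y \<in> lcar L" using x y lie_algebraD(3) [OF L] by blast
    have conv: "conv (insert z S) (\<lambda>k. l k i) (Poly_Mapping.lookup (\<psi> (u, x))) w n =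
        conv S (\<lambda>k. l k i) (Poly_Mapping.lookup (\<phi> x)) w n"
      if "i \<in> insert z S" "w 0 = 0" "x \<in> lcar L" for i w n u x
      unfolding conv_def
    proof (rule sum.cong [OF refl])
      fix k
      have "(\<Sum>j\<in>S. l k i j * Poly_Mapping.lookup (\<psi> (u, x)) (j, n - k) * w k) =
          (\<Sum>j\<in>S. l k i j * Poly_Mapping.lookup (\<phi> x) (j, n - k) * w k)"
        using S(2) by (intro sum.cong refl) (metis lookup_i)
      \<comment> \<open>For positive \<open>k\<close> the constant vanishes, for
        \<open>k = 0\<close> the coefficient \<open>w 0\<close> does.\<close>
      moreover have "l k i z * w k = 0" using zero [OF that(1), of k] that(2) by (cases k) auto
      ultimately show "(\<Sum>j\<in>insert z S. l k i j * Poly_Mapping.lookup (\<psi> (u, x)) (j, n - k) * w k) =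
          (\<Sum>j\<in>S. l k i j * Poly_Mapping.lookup (\<phi> x) (j, n - k) * w k)"
        using S by auto
    qed
    have fin: "finite (insert z S)" using S by simp
    show ?thesis
    proof (rule poly_mapping_eqI_pair)
      fix i n
      have R: "Poly_Mapping.lookup (lbr (lam_lie (insert z S) l) (\<psi> a) (\<psi> b)) (i, n) =
          conv (insert z S) (\<lambda>k. l k i) (Poly_Mapping.lookup (\<psi> (u, x))) (\<lambda>k. Poly_Mapping.lookup (\<psi> (v, y)) (i, k)) n -
          conv (insert z S) (\<lambda>k. l k i) (Poly_Mapping.lookup (\<psi> (v, y))) (\<lambda>k. Poly_Mapping.lookup (\<psi> (u, x)) (i, k)) n"
        unfolding lam_lie_simps ab by (rule lookup_lam_bracket [OF fin \<psi>m [OF u x] \<psi>m [OF v y]])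
      consider "i = z" | "i \<in> S" "i \<noteq> z" | "i \<notin> S" "i \<noteq> z" by blast
      then show "Poly_Mapping.lookup (\<psi> (lbr P a b)) (i, n) =
          Poly_Mapping.lookup (lbr (lam_lie (insert z S) l) (\<psi> a) (\<psi> b)) (i, n)"
      proof cases
        case 1
        have act: "Poly_Mapping.lookup (act (\<lambda>k. l k z) (\<phi> w) t) n =
            conv S (\<lambda>k. l k z) (Poly_Mapping.lookup (\<phi> w)) (Poly_Mapping.lookup t) n" if "w \<in> lcar L" for w t
          using S(1) free_on_lookup_0(3) [OF \<phi>m [OF that]] by (rule lookup_act)
        show ?thesis
          unfolding R unfolding 1 lookup_z [OF x] lookup_z [OF y]
          using conv [of z "Poly_Mapping.lookup v" x u n] conv [of z "Poly_Mapping.lookup u" y v n] u v x y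
          by (simp add: ab P lookup_z [OF xy] lookup_minus act)
      next
        case 2
        have z: "Poly_Mapping.lookup (\<phi> w) (i, 0) = 0" if "w \<in> lcar L" for w
          using free_on_lookup_0(1) [OF \<phi>m [OF that]] .
        show ?thesis
          unfolding R lookup_i [OF 2(2)]
          using conv [of i "\<lambda>k. Poly_Mapping.lookup (\<phi> y) (i, k)" x u n]
            conv [of i "\<lambda>k. Poly_Mapping.lookup (\<phi> x) (i, k)" y v n] 2 z [OF x] z [OF y] x y
          by (simp add: ab P lookup_i \<phi>br lookup_lam_bracket [OF S(1) \<phi>m [OF x] \<phi>m [OF y]])
      next
        case 3
        then have "Poly_Mapping.lookup (\<phi> (lbr L x y)) (i, n) = 0"
          using free_on_lookup_0(2) [OF \<phi>m [OF xy]] by blast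
        moreover have "lbr (lam_lie (insert z S) l) (\<psi> a) (\<psi> b) \<in> free_on (insert z S \<times> {1..})"
          unfolding lam_lie_simps ab
          by (intro free_on_diff star_in_free_on fin \<psi>m u v x y)
        then have "Poly_Mapping.lookup (lbr (lam_lie (insert z S) l) (\<psi> a) (\<psi> b)) (i, n) = 0"
          by (rule free_on_lookup_0(2)) (use 3 in simp)
        ultimately show ?thesis by (simp only: ab P lookup_i [OF 3(2)])
      qed
    qed
  qed
  have lb: "lie_bij \<psi> P (lam_lie (insert z S) l)"
    unfolding lie_bij_def
  proof (intro conjI ballI allI bij \<psi>br)
    fix a b assume "a \<in> lcar P" "b \<in> lcar P"
    then obtain u x v y where ab: "a = (u, x)" "b = (v, y)" and x: "x \<in> lcar L" and y: "y \<in> lcar L"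
      by (auto simp: P)
    have "col z (u + v) = col z u + col z v" by (rule poly_mapping_eqI_pair) (simp add: lookup_add)
    then show "\<psi> (a + b) = \<psi> a + \<psi> b"
      by (simp add: ab \<psi>_def \<phi>add [OF x y])
  next
    fix c a assume "a \<in> lcar P"
    then obtain u x where ab: "a = (u, x)" and x: "x \<in> lcar L" by (auto simp: P)
    have "col z (pm_scale c u) = pm_scale c (col z u)" by (rule poly_mapping_eqI_pair) simp
    then show "\<psi> (lscale P c a) = lscale (lam_lie (insert z S) l) c (\<psi> a)"
      by (simp add: ab P \<psi>_def \<phi>scale [OF x] pm_scale_add)
  qed
  have lam: "lie_algebra (lam_lie (insert z S) l)"
    using S M by (intro lie_algebra_lam_lie) auto
  have "lie_algebra P"
  proof (rule lie_algebra_transport [OF lam lb])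
    have s: "lscale P = (\<lambda>c (u, x). (pm_scale c u, lscale L c x))"
      by (auto simp: P fun_eq_iff)
    show "vector_space (lscale P)" unfolding s
      by (intro vector_space_prod_scale vector_space_pm_scale lie_algebraD(1) L)
    show "module.subspace (lscale P) (lcar P)" unfolding s P(1)
      by (intro subspace_prod_scale vector_space_pm_scale lie_algebraD(1,2) L subspace_free_on)
    fix a b assume "a \<in> lcar P" "b \<in> lcar P"
    then show "lbr P a b \<in> lcar P"
      using lie_algebraD(3) [OF L] act_in_free_on [OF S(1) \<phi>m]
      by (auto simp: P intro!: free_on_diff)
  qed
  then have "lie_iso P (lam_lie (insert z S) l)" using lam lb by (auto simp: lie_iso_iff)
  then show "lie_iso (lam_lie (insert z S) l) (semidirect V L)"
    unfolding P_def by (rule lie_iso_sym)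
qed

section \<open>The Lie algebra of a system in coordinates\<close>

text \<open>The decorations of a ladder below \<open>i\<close>, found by iterating a choice
  \<open>nx\<close> of out-neighbours. If the linear coefficients along \<open>nx\<close> are
  nonzero, so is the coefficient of the ladder in the solution.\<close>

primrec walk :: "('i \<Rightarrow> 'i) \<Rightarrow> nat \<Rightarrow> 'i \<Rightarrow> 'i list" where
  "walk nx 0 i = []"
| "walk nx (Suc k) i = nx i # walk nx k (nx i)"

lemma length_walk [simp]: "length (walk nx k i) = k"
  by (induction k arbitrary: i) simp_all

text \<open>The structure constants: \<open>f\<^sub>j(l) \<star> f\<^sub>i(k) = lambda F nx k i j f\<^sub>i(k + l)\<close> for the basis
  \<open>f\<^sub>i(k)\<close> dual to the generators.\<close>

definition lambda :: "('i \<Rightarrow> ('i, 'k::field_char_0) mfps) \<Rightarrow> ('i \<Rightarrow> 'i) \<Rightarrow> nat \<Rightarrow> 'i \<Rightarrow> 'i \<Rightarrow> 'k"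
  where "lambda F nx k i j =
    ladder_graft F (walk nx (k - 1) i) i j / ladder_coeff F (walk nx (k - 1) i) i"

lemma lambda_1: "lambda F nx 1 i j = taylor (F i) {#j#}"
  by (simp add: lambda_def)

text \<open>Division by the coefficient of the ladder makes the recursion additive: one term for
  grafting at the root, one for grafting on the shorter ladder.\<close>

lemma lambda_Suc:
  assumes "0 < k" "taylor (F i) {#nx i#} \<noteq> 0" "ladder_coeff F (walk nx (k - 1) (nx i)) (nx i) \<noteq> 0"
  shows "lambda F nx (Suc k) i j =
    taylor (F i) {#j, nx i#} / taylor (F i) {#nx i#} + lambda F nx k (nx i) j"
proof -
  obtain k' where "k = Suc k'" using assms(1) by (cases k) auto
  then show ?thesis using assms by (simp add: lambda_def field_simps del: taylor_eq_0_iff)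
qed

lemma lin_swap: "lin (\<lambda>x. lin (\<lambda>y. f x y) Y) X = lin (\<lambda>y. lin (\<lambda>x. f x y) X) Y"
  unfolding lin_def sum_distrib_left by (subst sum.swap) (simp add: mult.left_commute)

lemma lin_product: "lin f X * lin g Y = lin (\<lambda>x. lin (\<lambda>y. f x * g y) Y) X"
  by (simp only: lin_fun_mult lin_fun_mult_right)

text \<open>The assumption \<open>coprod\<close> makes the dual product computable from tensors of
  elements of \<open>H\<close>; \<open>nx\<close> yields ladders with invertible
  coefficients.\<close>

locale walk_system =
  fixes I :: "'i set" and F :: "'i \<Rightarrow> ('i, 'k::field_char_0) mfps" and nx :: "'i \<Rightarrow> 'i"
  assumes sdse: "sdse I F"
    and coprod: "coprod ` sdse_algebra I F \<subseteq> tensor_square (sdse_algebra I F)"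
    and nx: "\<And>i. i \<in> I \<Longrightarrow> nx i \<in> I" "\<And>i. i \<in> I \<Longrightarrow> taylor (F i) {#nx i#} \<noteq> 0"
begin

abbreviation "H \<equiv> sdse_algebra I F"
abbreviation "X \<equiv> generator I F"
abbreviation "lam \<equiv> lambda F nx"

lemma finite_I: "finite I" using sdse by (rule sdseD)

lemma set_walk: "i \<in> I \<Longrightarrow> set (walk nx k i) \<subseteq> I"
  by (induction k arbitrary: i) (auto simp: nx(1))

lemma ladder_coeff_nonzero: "i \<in> I \<Longrightarrow> ladder_coeff F (walk nx k i) i \<noteq> 0"
  by (induction k arbitrary: i) (auto simp: nx simp del: taylor_eq_0_iff)

text \<open>The ladder with \<open>k\<close> vertices starting at \<open>i\<close>. The root is not
  part of the walk, whence \<open>k - 1\<close>.\<close>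

definition ltree :: "'i \<Rightarrow> nat \<Rightarrow> 'i rtree"
  where "ltree i k = Node i (ladder (walk nx (k - 1) i))"

definition lcoeff :: "'i \<Rightarrow> nat \<Rightarrow> 'k"
  where "lcoeff i k = ladder_coeff F (walk nx (k - 1) i) i"

lemma lcoeff_nonzero: "i \<in> I \<Longrightarrow> lcoeff i k \<noteq> 0"
  by (simp add: lcoeff_def ladder_coeff_nonzero)

lemma ltree:
  assumes "i \<in> I" "1 \<le> k"
  shows "tree_root (ltree i k) = i" "nverts (ltree i k) = k" "decorations (ltree i k) \<subseteq> I"
    "tree_coeff F (ltree i k) = lcoeff i k"
proof -
  show "tree_root (ltree i k) = i" by (simp add: ltree_def)
  show "nverts (ltree i k) = k"
    using assms(2) unfolding ltree_def nverts_Node by simp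
  show "decorations (ltree i k) \<subseteq> I"
    using assms(1) set_walk [OF assms(1), of "k - 1"] decorations_ladder [of "walk nx (k - 1) i"]
    by (simp add: ltree_def)
  show "tree_coeff F (ltree i k) = lcoeff i k"
    unfolding ltree_def lcoeff_def
    using assms(1) set_walk [OF assms(1), of "k - 1"] sdseD(4) [OF sdse]
    by (intro tree_coeff_ladder) auto
qed

text \<open>Extends the sum of the c(j, l) f_j(l) from \<open>H\<close> to all forests: f_j(l) reads
  the coefficient of one ladder with root j and l vertices, normalized by its coefficient in X_j(l).
  Being concentrated on single trees it is a derivation over the counit, and its values on the
  generators are the coordinates \<open>c\<close>.\<close>

definition dual_weight :: "('i \<times> nat \<Rightarrow>\<^sub>0 'k) \<Rightarrow> 'i forest \<Rightarrow> 'k"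
  where "dual_weight c p = lin (\<lambda>(j, l). if p = {#ltree j l#} then 1 / lcoeff j l else 0) c"

abbreviation "A \<equiv> free_on (I \<times> {1::nat..}) :: ('i \<times> nat \<Rightarrow>\<^sub>0 'k) set"

lemma dual_weight_size: "size p \<noteq> 1 \<Longrightarrow> dual_weight c p = 0"
proof -
  assume "size p \<noteq> 1"
  then have "p \<noteq> {#t#}" for t by auto
  then show ?thesis by (simp add: dual_weight_def lin_def)
qed

lemma lin_unit:
  assumes "c \<in> A" "i \<in> I" "1 \<le> n"
  shows "lin (\<lambda>(j, l). if j = i \<and> l = n then x else 0) c = Poly_Mapping.lookup c (i, n) * x"
proof -
  have "lin (\<lambda>(j, l). if j = i \<and> l = n then x else 0) c = lin (\<lambda>p. (if p = (i, n) then 1 else 0) * x) c"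
    by (rule lin_cong) (simp add: case_prod_unfold prod_eq_iff)
  then show ?thesis by (simp add: lin_fun_mult_right lookup_eq_lin [symmetric])
qed

lemma A_keys: "c \<in> A \<Longrightarrow> (j, l) \<in> Poly_Mapping.keys c \<Longrightarrow> j \<in> I \<and> 1 \<le> l"
  using keys_free_on by fastforce

lemma dual_weight_generator:
  assumes "c \<in> A" "i \<in> I" "1 \<le> n"
  shows "lin (dual_weight c) (X i n) = Poly_Mapping.lookup c (i, n)"
proof -
  let ?T = "solution_trees I i n"
  have "lin (dual_weight c) (X i n) =
      (\<Sum>t\<in>?T. tree_coeff F t * lin (\<lambda>(j, l). if {#t#} = {#ltree j l#} then 1 / lcoeff j l else 0) c)"
    by (simp add: lin_generator [OF sdse] dual_weight_def)
  also have "\<dots> = lin (\<lambda>p. \<Sum>t\<in>?T. tree_coeff F t * (case p of (j, l) \<Rightarrow> if {#t#} = {#ltree j l#} then 1 / lcoeff j l else 0)) c"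
    by (simp only: lin_fun_sum lin_fun_mult)
  also have "\<dots> = lin (\<lambda>(j, l). if j = i \<and> l = n then 1 else 0) c"
  proof (rule lin_cong)
    fix p assume p: "p \<in> Poly_Mapping.keys c"
    obtain j l where jl: "p = (j, l)" by (cases p)
    have j: "j \<in> I" "1 \<le> l" using A_keys [OF assms(1)] p jl by auto
    have "(\<Sum>t\<in>?T. tree_coeff F t * (case p of (j, l) \<Rightarrow> if {#t#} = {#ltree j l#} then 1 / lcoeff j l else 0)) =
        (\<Sum>t\<in>?T. if t = ltree j l then tree_coeff F t * (1 / lcoeff j l) else 0)"
      by (rule sum.cong) (auto simp: jl)
    also have "\<dots> = (if ltree j l \<in> ?T then tree_coeff F (ltree j l) * (1 / lcoeff j l) else 0)"
      using finite_solution_trees [OF finite_I] by simp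
    also have "ltree j l \<in> ?T \<longleftrightarrow> j = i \<and> l = n"
      using ltree [OF j] by (auto simp: solution_trees_def)
    finally show "(\<Sum>t\<in>?T. tree_coeff F t * (case p of (j, l) \<Rightarrow> if {#t#} = {#ltree j l#} then 1 / lcoeff j l else 0)) =
        (case p of (j, l) \<Rightarrow> if j = i \<and> l = n then 1 else 0)"
      using ltree(4) [OF j] lcoeff_nonzero [OF j(1), of l] unfolding jl prod.case
      by (cases "j = i \<and> l = n") simp_all
  qed
  also have "\<dots> = Poly_Mapping.lookup c (i, n)" using lin_unit [OF assms, of 1] by simp
  finally show ?thesis .
qed

lemma dual_weight_union:
  "dual_weight c (p + q) = dual_weight c p * (if q = {#} then 1 else 0) + (if p = {#} then 1 else 0) * dual_weight c q"
proof (cases "p = {#} \<or> q = {#}")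
  case True
  then show ?thesis using dual_weight_size [of "{#}" c] by auto
next
  case False
  then have "0 < size p" "0 < size q" by (auto simp: nonempty_has_size)
  then have "dual_weight c (p + q) = 0" by (intro dual_weight_size) simp
  then show ?thesis using False by auto
qed

lemma dual_weight_derivation:
  "lin (dual_weight c) (x * y) = lin (dual_weight c) x * counit y + counit x * lin (dual_weight c) y"
  unfolding lin_mult dual_weight_union
  by (simp add: lin_fun_add lin_fun_mult lin_fun_mult_right counit_eq_lin)

lemma finite_degree: "\<exists>N. \<forall>(j, l)\<in>Poly_Mapping.keys (c :: 'i \<times> nat \<Rightarrow>\<^sub>0 'k). l < N"
proof -
  have "finite (snd ` Poly_Mapping.keys c)" by simp
  then obtain N where "\<forall>l\<in>snd ` Poly_Mapping.keys c. l < N"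
    using finite_nat_set_iff_bounded by blast
  then show ?thesis by (intro exI [of _ N]) auto
qed

lemma dual_weight_degree:
  assumes "c \<in> A" "\<forall>(j, l)\<in>Poly_Mapping.keys c. l < N" "N \<le> weight p"
  shows "dual_weight c p = 0"
proof -
  have "p \<noteq> {#ltree j l#}" if "(j, l) \<in> Poly_Mapping.keys c" for j l
  proof -
    have "j \<in> I" "1 \<le> l" using A_keys [OF assms(1) that] by auto
    then have "nverts (ltree j l) = l" by (rule ltree)
    moreover have "l < N" using assms(2) that by auto
    ultimately show ?thesis using assms(3) by auto
  qed
  then show ?thesis by (auto simp: dual_weight_def lin_def intro!: sum.neutral)
qed

definition to_form :: "('i \<times> nat \<Rightarrow>\<^sub>0 'k) \<Rightarrow> ('i, 'k) ck \<Rightarrow> 'k"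
  where "to_form c x = (if x \<in> H then lin (dual_weight c) x else 0)"

lemma H_closed: "1 \<in> H" "x \<in> H \<Longrightarrow> y \<in> H \<Longrightarrow> x + y \<in> H" "x \<in> H \<Longrightarrow> y \<in> H \<Longrightarrow> x * y \<in> H"
  "x \<in> H \<Longrightarrow> pm_scale c x \<in> H"
  using subalgebra_sdse_algebra [of I F] by (auto simp: subalgebra_def)

lemma to_form_primitive:
  assumes "c \<in> A"
  shows "to_form c \<in> dual_primitives H"
proof -
  obtain N where N: "\<forall>(j, l)\<in>Poly_Mapping.keys c. l < N" using finite_degree by blast
  have "lin (dual_weight c) x = 0" if "n \<ge> N" "homogeneous n x" for n x
    using that dual_weight_degree [OF assms N] by (auto simp: lin_def homogeneous_def intro!: sum.neutral)
  then have "\<exists>N. \<forall>n\<ge>N. \<forall>x\<in>H. homogeneous n x \<longrightarrow> lin (dual_weight c) x = 0" by blast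
  then show ?thesis
    by (auto simp: dual_primitives_def graded_dual_def to_form_def H_closed dual_weight_derivation)
qed

definition from_form :: "(('i, 'k) ck \<Rightarrow> 'k) \<Rightarrow> 'i \<times> nat \<Rightarrow>\<^sub>0 'k"
  where "from_form f = Abs_poly_mapping (\<lambda>(i, n). if i \<in> I \<and> 1 \<le> n then f (X i n) else 0)"

lemma homogeneous_generator: "homogeneous n (X i n)"
  unfolding homogeneous_def
proof
  fix p assume p: "p \<in> Poly_Mapping.keys (X i n)"
  then have "size p = 1" using lookup_generator_other [OF sdse] by (auto simp: in_keys_iff)
  then obtain t where "p = {#t#}" using size_1_singleton_mset by blast
  with p show "weight p = n"
    by (auto simp: in_keys_iff lookup_generator_single [OF sdse] split: if_splits)
qed

lemma lookup_from_form:
  assumes "f \<in> dual_primitives H"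
  shows "Poly_Mapping.lookup (from_form f) (i, n) = (if i \<in> I \<and> 1 \<le> n then f (X i n) else 0)"
proof -
  obtain N where N: "\<And>n x. n \<ge> N \<Longrightarrow> x \<in> H \<Longrightarrow> homogeneous n x \<Longrightarrow> f x = 0"
    using assms unfolding dual_primitives_def graded_dual_def by blast
  have "finite {p. (case p of (i, n) \<Rightarrow> if i \<in> I \<and> 1 \<le> n then f (X i n) else 0) \<noteq> 0}"
  proof (rule finite_subset)
    show "{p. (case p of (i, n) \<Rightarrow> if i \<in> I \<and> 1 \<le> n then f (X i n) else 0) \<noteq> 0} \<subseteq> I \<times> {..<N}"
      using N [OF _ generator_in_algebra homogeneous_generator]
      by (auto split: if_splits) (meson leI)
  qed (simp add: finite_I)
  then show ?thesis unfolding from_form_def by simp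
qed

lemma from_form_in_A: "f \<in> dual_primitives H \<Longrightarrow> from_form f \<in> A"
  by (rule free_onI_pair) (auto simp: lookup_from_form)

lemma generator_0: "X i 0 = 0"
  by (rule poly_mapping_eqI_trees)
     (simp_all add: lookup_generator_single [OF sdse] lookup_generator_other [OF sdse])

text \<open>A primitive form is a derivation over the counit: it vanishes at 1, and its value on a
  product follows from those on the factors. So the generators determine it.\<close>

lemma primitive_eqI:
  assumes "f \<in> dual_primitives H" "g \<in> dual_primitives H"
    and eq: "\<And>i n. i \<in> I \<Longrightarrow> 1 \<le> n \<Longrightarrow> f (X i n) = g (X i n)"
  shows "f = g"
proof
  fix x
  have add: "h (x + y) = h x + h y" "h (x * y) = h x * counit y + counit x * h y" "h (pm_scale c x) = c * h x"
    if "h \<in> dual_primitives H" "x \<in> H" "y \<in> H" for h x y c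
    using that by (auto simp: dual_primitives_def graded_dual_def)
  have one: "h 1 = 0" if "h \<in> dual_primitives H" for h
    using add(2) [OF that H_closed(1) H_closed(1)] by (simp add: counit_def)
  have "f x = g x" if "x \<in> H"
    using that
  proof (induction rule: sdse_algebra_induct)
    case (gen i n)
    show ?case
    proof (cases n)
      case 0
      have "h 0 = 0" if h: "h \<in> dual_primitives H" for h
      proof -
        have "pm_scale 0 (1 :: ('i, 'k) ck) = 0" by (rule poly_mapping_eqI) simp
        then show ?thesis using add(3) [OF h H_closed(1) H_closed(1), of 0] by simp
      qed
      from this [OF assms(1)] this [OF assms(2)] show ?thesis by (simp add: 0 generator_0)
    next
      case (Suc n')
      then show ?thesis using eq gen by simp
    qed
  qed (simp_all add: add(1,2) [OF assms(1)] add(1,2) [OF assms(2)] add(3) [OF assms(1) _ H_closed(1)]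
      add(3) [OF assms(2) _ H_closed(1)] one [OF assms(1)] one [OF assms(2)])
  moreover have "f x = g x" if "x \<notin> H"
    using that assms by (simp add: dual_primitives_def graded_dual_def)
  ultimately show "f x = g x" by blast
qed

lemma to_form_generator:
  "c \<in> A \<Longrightarrow> i \<in> I \<Longrightarrow> 1 \<le> n \<Longrightarrow> to_form c (X i n) = Poly_Mapping.lookup c (i, n)"
  by (simp add: to_form_def generator_in_algebra dual_weight_generator)

lemma to_form_from_form: "f \<in> dual_primitives H \<Longrightarrow> to_form (from_form f) = f"
  by (rule primitive_eqI)
     (simp_all add: to_form_primitive from_form_in_A to_form_generator lookup_from_form)

lemma from_form_to_form: "c \<in> A \<Longrightarrow> from_form (to_form c) = c"
  by (rule poly_mapping_eqI_pair)
     (auto simp: lookup_from_form to_form_primitive to_form_generator free_on_iff)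

subsection \<open>The bracket\<close>

definition pair_weight :: "('i \<times> nat \<Rightarrow>\<^sub>0 'k) \<Rightarrow> ('i \<times> nat \<Rightarrow>\<^sub>0 'k) \<Rightarrow> ('i, 'k) ck2 \<Rightarrow> 'k"
  where "pair_weight c d = lin (\<lambda>(p, q). dual_weight c p * dual_weight d q)"

text \<open>The value does not depend on the decomposition, because \<open>to_form\<close> is the
  restriction of a functional defined on all forests and the product of two such functionals can be
  applied to the coproduct itself.\<close>

lemma dual_mult_to_form:
  assumes "x \<in> H"
  shows "dual_mult H (to_form c) (to_form d) x = pair_weight c d (coprod x)"
proof -
  have val: "(\<Sum>(y, z)\<leftarrow>ps. to_form c y * to_form d z) = pair_weight c d (coprod x)"
    if "set ps \<subseteq> H \<times> H" "coprod x = (\<Sum>(y, z)\<leftarrow>ps. tens y z)" for ps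
  proof -
    have "(\<Sum>(y, z)\<leftarrow>ps. to_form c y * to_form d z) = (\<Sum>(y, z)\<leftarrow>ps. pair_weight c d (tens y z))"
      using that(1) by (intro arg_cong [where f = sum_list] map_cong) (auto simp: to_form_def pair_weight_def lin_tens)
    then show ?thesis
      by (simp add: that(2) pair_weight_def lin_sum_list case_prod_unfold comp_def)
  qed
  obtain ps where ps: "set ps \<subseteq> H \<times> H" "coprod x = (\<Sum>(y, z)\<leftarrow>ps. tens y z)"
    using coprod assms by (auto simp: tensor_square_def)
  have "(THE c'. \<exists>ps. set ps \<subseteq> H \<times> H \<and> coprod x = (\<Sum>(y, z)\<leftarrow>ps. tens y z) \<and>
       c' = (\<Sum>(y, z)\<leftarrow>ps. to_form c y * to_form d z)) = pair_weight c d (coprod x)"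
  proof (rule the_equality)
    show "\<exists>ps. set ps \<subseteq> H \<times> H \<and> coprod x = (\<Sum>(y, z)\<leftarrow>ps. tens y z) \<and>
       pair_weight c d (coprod x) = (\<Sum>(y, z)\<leftarrow>ps. to_form c y * to_form d z)"
      using ps val by metis
  qed (use val in blast)
  then show ?thesis using assms by (simp add: dual_mult_def)
qed

lemma pair_weight_forest_union:
  "pair_weight c d (coprod_forest (p + q)) =
    pair_weight c d (coprod_forest p) * (if q = {#} then 1 else 0) + dual_weight c p * dual_weight d q +
    dual_weight d p * dual_weight c q + (if p = {#} then 1 else 0) * pair_weight c d (coprod_forest q)"
proof -
  let ?e = "\<lambda>p. if p = {#} then 1 else (0::'k)"
  let ?L = "\<lambda>v w p. lin (\<lambda>(a, b). v a * w b) (coprod_forest p :: ('i, 'k) ck2)"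
  have ex: "dual_weight c (a + a') * dual_weight d (b + b') =
      (dual_weight c a * dual_weight d b) * (?e a' * ?e b') + (dual_weight c a * ?e b) * (?e a' * dual_weight d b') +
      (?e a * dual_weight d b) * (dual_weight c a' * ?e b') + (?e a * ?e b) * (dual_weight c a' * dual_weight d b')" for a a' b b'
    by (simp only: dual_weight_union) (simp only: algebra_simps)
  have "pair_weight c d (coprod_forest (p + q)) =
      lin (\<lambda>u. lin (\<lambda>v. dual_weight c (fst u + fst v) * dual_weight d (snd u + snd v)) (coprod_forest q)) (coprod_forest p)"
    by (simp add: pair_weight_def lin_mult case_prod_unfold)
  also have "\<dots> = ?L (dual_weight c) (dual_weight d) p * ?L ?e ?e q + ?L (dual_weight c) ?e p * ?L ?e (dual_weight d) q +
      ?L ?e (dual_weight d) p * ?L (dual_weight c) ?e q + ?L ?e ?e p * ?L (dual_weight c) (dual_weight d) q"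
    unfolding ex by (simp only: lin_fun_add lin_fun_mult lin_fun_mult_right case_prod_unfold)
  finally show ?thesis
    by (simp only: lin_coprod_forest_left lin_coprod_forest_right pair_weight_def)
qed

lemma pair_weight_coprod: "pair_weight c d (coprod x) = lin (\<lambda>p. pair_weight c d (coprod_forest p)) x"
  by (simp only: pair_weight_def lin_coprod)

text \<open>The two mixed terms prevent the product of two primitive forms from being primitive.
  They are symmetric in \<open>c\<close> and \<open>d\<close>, so they cancel in the
  commutator.\<close>

lemma pair_weight_mult:
  "pair_weight c d (coprod (x * y)) = pair_weight c d (coprod x) * counit y +
    lin (dual_weight c) x * lin (dual_weight d) y + lin (dual_weight d) x * lin (dual_weight c) y +
    counit x * pair_weight c d (coprod y)"
  unfolding pair_weight_coprod lin_mult pair_weight_forest_union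
  by (simp only: lin_fun_add lin_fun_mult lin_fun_mult_right counit_eq_lin)

lemma pair_weight_degree:
  assumes "c \<in> A" "\<forall>(j, l)\<in>Poly_Mapping.keys c. l < N" "d \<in> A" "\<forall>(j, l)\<in>Poly_Mapping.keys d. l < N"
    and "N + N \<le> weight p"
  shows "pair_weight c d (coprod_forest p) = 0"
proof -
  have "dual_weight c a * dual_weight d b = 0"
    if "(a, b) \<in> Poly_Mapping.keys (coprod_forest p :: ('i, 'k) ck2)" for a b
  proof -
    have "weight a + weight b = weight p" using keys_coprod_forest [OF that] by blast
    \<comment> \<open>The coproduct is graded: in total weight at least 2N one of the two tensor
      factors has weight at least N, where its form vanishes.\<close>
    then have "N \<le> weight a \<or> N \<le> weight b" using assms(5) by linarith
    then show ?thesis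
      using dual_weight_degree [OF assms(1,2)] dual_weight_degree [OF assms(3,4)] by auto
  qed
  then show ?thesis unfolding pair_weight_def lin_def by (intro sum.neutral) auto
qed

lemma bracket_primitive:
  assumes "c \<in> A" "d \<in> A"
  shows "dual_mult H (to_form c) (to_form d) - dual_mult H (to_form d) (to_form c) \<in> dual_primitives H"
    (is "?b \<in> _")
proof -
  have b: "?b x = pair_weight c d (coprod x) - pair_weight d c (coprod x)" if "x \<in> H" for x
    using that by (simp add: dual_mult_to_form)
  have b0: "?b x = 0" if "x \<notin> H" for x using that by (simp add: dual_mult_def)
  obtain N1 N2 where "\<forall>(j, l)\<in>Poly_Mapping.keys c. l < N1" "\<forall>(j, l)\<in>Poly_Mapping.keys d. l < N2"
    using finite_degree by metis
  then have N: "\<forall>(j, l)\<in>Poly_Mapping.keys c. l < max N1 N2" "\<forall>(j, l)\<in>Poly_Mapping.keys d. l < max N1 N2"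
    by fastforce+
  let ?N = "max N1 N2 + max N1 N2"
  have deg: "?b x = 0" if x: "x \<in> H" and n: "n \<ge> ?N" "homogeneous n x" for n x
  proof -
    have "pair_weight c d (coprod x) = 0"
      unfolding pair_weight_coprod lin_def
      using n pair_weight_degree [OF assms(1) N(1) assms(2) N(2)] by (intro sum.neutral) (auto simp: homogeneous_def)
    moreover have "pair_weight d c (coprod x) = 0"
      unfolding pair_weight_coprod lin_def
      using n pair_weight_degree [OF assms(2) N(2) assms(1) N(1)] by (intro sum.neutral) (auto simp: homogeneous_def)
    ultimately show ?thesis unfolding b [OF x] by simp
  qed
  have "?b \<in> graded_dual H"
    unfolding graded_dual_def mem_Collect_eq
  proof (intro conjI allI impI ballI)
    show "?b x = 0" if "x \<notin> H" for x using that by (rule b0)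
    show "?b (x + y) = ?b x + ?b y" if "x \<in> H" "y \<in> H" for x y
      using that by (simp only: b H_closed) (simp add: pair_weight_coprod)
    show "?b (pm_scale e x) = e * ?b x" if "x \<in> H" for e x
      using that by (simp only: b H_closed) (simp add: pair_weight_coprod algebra_simps)
    show "\<exists>N. \<forall>n\<ge>N. \<forall>x\<in>H. homogeneous n x \<longrightarrow> ?b x = 0"
      using deg by blast
  qed
  moreover have "?b (x * y) = ?b x * counit y + counit x * ?b y" if "x \<in> H" "y \<in> H" for x y
    using that by (simp only: b H_closed pair_weight_mult) (simp add: algebra_simps)
  ultimately show ?thesis by (simp only: dual_primitives_def mem_Collect_eq) blast
qed

text \<open>Both forms are concentrated on ladders, so only the edges that separate one ladder from
  another count, and \<open>sum_ladder_cuts\<close> evaluates them. Its result carries the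
  coefficient of the pruned ladder; dividing by the two normalizations leaves
  \<open>lam\<close>.\<close>

lemma pair_weight_generator:
  assumes c: "c \<in> A" and d: "d \<in> A" and i: "i \<in> I"
  shows "pair_weight c d (coprod (X i n)) = Poly_Mapping.lookup (star lam c d) (i, n)"
proof -
  let ?T = "solution_trees I i n"
  let ?d = "\<lambda>u p. if p = {#u#} then 1 else (0::'k)"
  have dw: "dual_weight e = (\<lambda>p. lin (\<lambda>x. ?d (ltree (fst x) (snd x)) p * (1 / lcoeff (fst x) (snd x))) e)" for e
    unfolding dual_weight_def by (intro ext lin_cong) auto
  have val: "(\<Sum>t\<in>?T. tree_coeff F t * lin (\<lambda>(p, q). ?d (ltree j l) p * ?d (ltree i' k) q) (coprod_tree t :: ('i, 'k) ck2)) =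
      (if i' = i \<and> l + k = n then lam k i j * lcoeff i k * lcoeff j l else 0)"
    if j: "j \<in> I" "1 \<le> l" and k: "i' \<in> I" "1 \<le> k" for j l i' k
  proof -
    have "(\<Sum>t\<in>?T. tree_coeff F t * lin (\<lambda>(p, q). ?d (ltree j l) p * ?d (ltree i' k) q) (coprod_tree t :: ('i, 'k) ck2)) =
        (\<Sum>t\<in>?T. tree_coeff F t * of_nat (ladder_cuts (walk nx (k - 1) i') i' (ltree j l) t))"
      unfolding ltree_def [of i'] lin_coprod_tree_ladder ..
    also have "\<dots> = (if i' = i \<and> l + k = n then lam k i j * lcoeff i k * lcoeff j l else 0)"
    proof (cases "i' = i")
      case True
      have "(\<Sum>t\<in>?T. tree_coeff F t * of_nat (ladder_cuts (walk nx (k - 1) i) i (ltree j l) t)) =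
          (if n = nverts (ltree j l) + Suc (length (walk nx (k - 1) i))
           then ladder_graft F (walk nx (k - 1) i) i (tree_root (ltree j l)) * tree_coeff F (ltree j l) else 0)"
        using i set_walk [OF i] finite_I ltree(3) [OF j] sdseD(4) [OF sdse] by (intro sum_ladder_cuts) auto
      also have "n = nverts (ltree j l) + Suc (length (walk nx (k - 1) i)) \<longleftrightarrow> l + k = n"
        using ltree(2) [OF j] k by auto
      also have "ladder_graft F (walk nx (k - 1) i) i (tree_root (ltree j l)) * tree_coeff F (ltree j l) =
          lam k i j * lcoeff i k * lcoeff j l"
        using ltree [OF j] lcoeff_nonzero [OF i, of k] by (simp add: lambda_def lcoeff_def)
      finally show ?thesis using True by simp
    next
      case False
      \<comment> \<open>The trunk contains the root of the tree, which is decorated by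
        \<open>i\<close>.\<close>
      have "ladder_cuts (walk nx (k - 1) i') i' (ltree j l) t = 0" if "t \<in> ?T" for t
        using ladder_cuts_nonzeroD [of "walk nx (k - 1) i'" i' "ltree j l" t] that False
        by (auto simp: solution_trees_def)
      then show ?thesis using False by simp
    qed
    finally show ?thesis .
  qed
  have "pair_weight c d (coprod (X i n)) = (\<Sum>t\<in>?T. tree_coeff F t * pair_weight c d (coprod_tree t))"
    unfolding pair_weight_coprod by (simp add: lin_generator [OF sdse])
  also have "\<dots> = (\<Sum>t\<in>?T. tree_coeff F t * lin (\<lambda>x. lin (\<lambda>y.
      lin (\<lambda>(p, q). ?d (ltree (fst x) (snd x)) p * ?d (ltree (fst y) (snd y)) q) (coprod_tree t :: ('i, 'k) ck2)
        * (1 / (lcoeff (fst x) (snd x) * lcoeff (fst y) (snd y)))) d) c)"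
  proof (intro sum.cong refl arg_cong [where f = "(*) _"])
    fix t
    let ?z = "coprod_tree t :: ('i, 'k) ck2"
    have "pair_weight c d ?z = lin (\<lambda>z. lin (\<lambda>x. lin (\<lambda>y. ?d (ltree (fst x) (snd x)) (fst z) * ?d (ltree (fst y) (snd y)) (snd z)
        * (1 / (lcoeff (fst x) (snd x) * lcoeff (fst y) (snd y)))) d) c) ?z"
      unfolding pair_weight_def dw case_prod_unfold lin_product
      by (simp add: mult_ac)
    also have "\<dots> = lin (\<lambda>x. lin (\<lambda>z. lin (\<lambda>y. ?d (ltree (fst x) (snd x)) (fst z) * ?d (ltree (fst y) (snd y)) (snd z)
        * (1 / (lcoeff (fst x) (snd x) * lcoeff (fst y) (snd y)))) d) ?z) c"
      by (rule lin_swap)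
    also have "\<dots> = lin (\<lambda>x. lin (\<lambda>y. lin (\<lambda>z. ?d (ltree (fst x) (snd x)) (fst z) * ?d (ltree (fst y) (snd y)) (snd z)
        * (1 / (lcoeff (fst x) (snd x) * lcoeff (fst y) (snd y)))) ?z) d) c"
      by (intro lin_cong lin_swap)
    finally show "pair_weight c d ?z = lin (\<lambda>x. lin (\<lambda>y.
      lin (\<lambda>(p, q). ?d (ltree (fst x) (snd x)) p * ?d (ltree (fst y) (snd y)) q) ?z
        * (1 / (lcoeff (fst x) (snd x) * lcoeff (fst y) (snd y)))) d) c"
      by (simp only: lin_fun_mult_right case_prod_unfold)
  qed
  also have "\<dots> = lin (\<lambda>x. lin (\<lambda>y. (\<Sum>t\<in>?T. tree_coeff F t *
      lin (\<lambda>(p, q). ?d (ltree (fst x) (snd x)) p * ?d (ltree (fst y) (snd y)) q) (coprod_tree t :: ('i, 'k) ck2))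
        * (1 / (lcoeff (fst x) (snd x) * lcoeff (fst y) (snd y)))) d) c"
    by (simp only: sum_distrib_right lin_fun_sum mult.assoc lin_fun_mult)
  also have "\<dots> = lin (\<lambda>x. lin (\<lambda>y. if fst y = i \<and> snd x + snd y = n then lam (snd y) i (fst x) else 0) d) c"
  proof (intro lin_cong)
    fix x y assume x: "x \<in> Poly_Mapping.keys c" and y: "y \<in> Poly_Mapping.keys d"
    then have xy: "fst x \<in> I" "1 \<le> snd x" "fst y \<in> I" "1 \<le> snd y"
      using A_keys [OF c, of "fst x" "snd x"] A_keys [OF d, of "fst y" "snd y"] by auto
    show "(\<Sum>t\<in>?T. tree_coeff F t *
      lin (\<lambda>(p, q). ?d (ltree (fst x) (snd x)) p * ?d (ltree (fst y) (snd y)) q) (coprod_tree t :: ('i, 'k) ck2))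
        * (1 / (lcoeff (fst x) (snd x) * lcoeff (fst y) (snd y))) =
      (if fst y = i \<and> snd x + snd y = n then lam (snd y) i (fst x) else 0)"
      unfolding val [OF xy] using lcoeff_nonzero [OF xy(1), of "snd x"] lcoeff_nonzero [OF xy(3), of "snd y"] by auto
  qed
  also have "\<dots> = Poly_Mapping.lookup (star lam c d) (i, n)"
    unfolding star_def lookup_bilin
    by (intro lin_cong) (auto simp: lookup_single when_def case_prod_unfold)
  finally show ?thesis .
qed

lemma sdse_lie_simps:
  "lcar (sdse_lie I F) = dual_primitives H" "lscale (sdse_lie I F) = (\<lambda>c f x. c * f x)"
  "lbr (sdse_lie I F) = (\<lambda>f g. dual_mult H f g - dual_mult H g f)"
  by (simp_all add: sdse_lie_def Let_def)

lemma vector_space_fun: "vector_space (\<lambda>c (f :: 'z \<Rightarrow> 'k) x. c * f x)"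
  by unfold_locales (auto simp: fun_eq_iff algebra_simps)

lemma subspace_dual_primitives: "module.subspace (\<lambda>c f x. c * f x) (dual_primitives H)"
proof -
  interpret vector_space "\<lambda>c (f :: ('i, 'k) ck \<Rightarrow> 'k) x. c * f x" by (rule vector_space_fun)
  have "f + g \<in> dual_primitives H" if fg: "f \<in> dual_primitives H" "g \<in> dual_primitives H" for f g
  proof -
    obtain N1 where "\<forall>n\<ge>N1. \<forall>x\<in>H. homogeneous n x \<longrightarrow> f x = 0"
      using fg unfolding dual_primitives_def graded_dual_def by blast
    moreover obtain N2 where "\<forall>n\<ge>N2. \<forall>x\<in>H. homogeneous n x \<longrightarrow> g x = 0"
      using fg unfolding dual_primitives_def graded_dual_def by blast
    ultimately have "\<exists>N. \<forall>n\<ge>N. \<forall>x\<in>H. homogeneous n x \<longrightarrow> f x + g x = 0"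
      by (intro exI [of _ "max N1 N2"]) auto
    then show ?thesis using fg
      by (simp add: dual_primitives_def graded_dual_def algebra_simps)
  qed
  moreover have "(\<lambda>x. e * f x) \<in> dual_primitives H" if f: "f \<in> dual_primitives H" for e f
  proof -
    obtain N where "\<forall>n\<ge>N. \<forall>x\<in>H. homogeneous n x \<longrightarrow> f x = 0"
      using f unfolding dual_primitives_def graded_dual_def by blast
    then have "\<exists>N. \<forall>n\<ge>N. \<forall>x\<in>H. homogeneous n x \<longrightarrow> e * f x = 0"
      by (intro exI [of _ N]) auto
    then show ?thesis using f
      by (simp add: dual_primitives_def graded_dual_def algebra_simps)
  qed
  moreover have "0 \<in> dual_primitives H"
    by (auto simp: dual_primitives_def graded_dual_def)
  ultimately show ?thesis by (simp add: subspace_def)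
qed

lemma lie_bij_from_form: "lie_bij from_form (sdse_lie I F) (lam_lie I lam)"
  unfolding lie_bij_def sdse_lie_simps lam_lie_simps
proof (intro conjI ballI allI)
  interpret vector_space "\<lambda>c (f :: ('i, 'k) ck \<Rightarrow> 'k) x. c * f x" by (rule vector_space_fun)
  note sub = subspace_dual_primitives [unfolded subspace_def]
  show "bij_betw from_form (dual_primitives H) A"
    by (rule bij_betw_byWitness [where f' = to_form])
       (auto simp: to_form_from_form from_form_to_form to_form_primitive from_form_in_A)
  fix f g assume f: "f \<in> dual_primitives H" and g: "g \<in> dual_primitives H"
  have "f + g \<in> dual_primitives H" using f g sub by blast
  then show "from_form (f + g) = from_form f + from_form g"
    using f g by (intro poly_mapping_eqI_pair) (simp add: lookup_from_form lookup_add)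
  let ?b = "dual_mult H f g - dual_mult H g f"
  have fg: "to_form (from_form f) = f" "to_form (from_form g) = g" "from_form f \<in> A" "from_form g \<in> A"
    using f g by (simp_all add: to_form_from_form from_form_in_A)
  have b: "?b \<in> dual_primitives H"
    using bracket_primitive [OF fg(3,4)] by (simp add: fg)
  have mem: "star lam (from_form f) (from_form g) - star lam (from_form g) (from_form f) \<in> A"
    using fg by (intro free_on_diff star_in_free_on finite_I)
  show "from_form ?b = star lam (from_form f) (from_form g) - star lam (from_form g) (from_form f)"
  proof (rule poly_mapping_eqI_pair)
    fix i n
    show "Poly_Mapping.lookup (from_form ?b) (i, n) =
        Poly_Mapping.lookup (star lam (from_form f) (from_form g) - star lam (from_form g) (from_form f)) (i, n)"
    proof (cases "i \<in> I \<and> 1 \<le> n")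
      case True
      then have x: "X i n \<in> H" by (intro generator_in_algebra) simp
      have "?b (X i n) = pair_weight (from_form f) (from_form g) (coprod (X i n)) -
          pair_weight (from_form g) (from_form f) (coprod (X i n))"
        using dual_mult_to_form [OF x, of "from_form f" "from_form g"]
          dual_mult_to_form [OF x, of "from_form g" "from_form f"] by (simp add: fg)
      then show ?thesis using True fg
        by (simp only: lookup_from_form [OF b] if_True simp_thms pair_weight_generator lookup_minus)
    next
      case False
      then show ?thesis using mem by (auto simp: lookup_from_form [OF b] free_on_iff)
    qed
  qed
next
  interpret vector_space "\<lambda>c (f :: ('i, 'k) ck \<Rightarrow> 'k) x. c * f x" by (rule vector_space_fun)
  fix e f assume f: "f \<in> dual_primitives H"
  then have "(\<lambda>x. e * f x) \<in> dual_primitives H"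
    using subspace_dual_primitives by (simp add: subspace_def)
  then show "from_form (\<lambda>x. e * f x) = pm_scale e (from_form f)"
    using f by (intro poly_mapping_eqI_pair) (simp add: lookup_from_form)
qed

lemma bracket_closed:
  assumes "f \<in> lcar (sdse_lie I F)" "g \<in> lcar (sdse_lie I F)"
  shows "lbr (sdse_lie I F) f g \<in> lcar (sdse_lie I F)"
  using assms bracket_primitive [OF from_form_in_A from_form_in_A, of f g]
  by (simp add: sdse_lie_simps to_form_from_form)

text \<open>The Lie axioms hold in coordinates, by the identities between the structure constants,
  and are carried over to the forms.\<close>

lemma lie_algebra_sdse_lie:
  assumes "\<And>i. i \<in> I \<Longrightarrow> module_constants I lam (\<lambda>k. lam k i)"
  shows "lie_algebra (sdse_lie I F)"
proof (rule lie_algebra_transport [OF _ lie_bij_from_form])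
  show "lie_algebra (lam_lie I lam)"
    by (rule lie_algebra_lam_lie [OF finite_I assms])
  show "vector_space (lscale (sdse_lie I F))"
    unfolding sdse_lie_simps by (rule vector_space_fun)
  show "module.subspace (lscale (sdse_lie I F)) (lcar (sdse_lie I F))"
    unfolding sdse_lie_simps by (rule subspace_dual_primitives)
  show "lbr (sdse_lie I F) x y \<in> lcar (sdse_lie I F)"
    if "x \<in> lcar (sdse_lie I F)" "y \<in> lcar (sdse_lie I F)" for x y
    using that by (rule bracket_closed)
qed

end

section \<open>Fundamental abelian systems\<close>

lemma mcoeff_muni: "mcoeff (muni f j) m = (if set_mset m \<subseteq> {j} then fps_nth f (size m) else 0)"
  by (simp add: muni_def)

lemma mcoeff_prod_muni:
  fixes f :: "'v \<Rightarrow> 'k::field_char_0 fps"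
  assumes "finite A"
  shows "mcoeff (\<Prod>j\<in>A. muni (f j) j) m =
    (if set_mset m \<subseteq> A then \<Prod>j\<in>A. fps_nth (f j) (count m j) else 0)"
  using assms
proof (induction A arbitrary: m rule: finite_induct)
  case empty
  then show ?case by (simp add: mcoeff_one)
next
  case (insert x A)
  let ?P = "\<Prod>j\<in>A. muni (f j) j"
  \<comment> \<open>The only splitting with a nonzero contribution: all occurrences of
    \<open>x\<close> on one side, everything else on the other.\<close>
  let ?u = "replicate_mset (count m x) x" and ?v = "filter_mset (\<lambda>y. y \<noteq> x) m"
  have uv: "?u + ?v = m"
    by (rule multiset_eqI) simp
  have "mcoeff (\<Prod>j\<in>insert x A. muni (f j) j) m =
      (\<Sum>(u, v)\<in>msplits m. mcoeff (muni (f x) x) u * mcoeff ?P v)"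
    using insert by (simp add: mcoeff_times)
  also have "\<dots> = (\<Sum>(u, v)\<in>{(?u, ?v)}. mcoeff (muni (f x) x) u * mcoeff ?P v)"
  proof (rule sum.mono_neutral_right)
    show "{(?u, ?v)} \<subseteq> msplits m" using uv by (simp add: msplits_def)
    show "\<forall>i\<in>msplits m - {(?u, ?v)}. (case i of (u, v) \<Rightarrow> mcoeff (muni (f x) x) u * mcoeff ?P v) = 0"
    proof
      fix i assume i: "i \<in> msplits m - {(?u, ?v)}"
      obtain u v where uv': "i = (u, v)" by (cases i)
      with i have m: "u + v = m" and ne: "(u, v) \<noteq> (?u, ?v)" by (auto simp: msplits_def)
      have "\<not> (set_mset u \<subseteq> {x} \<and> set_mset v \<subseteq> A)"
      proof
        assume H: "set_mset u \<subseteq> {x} \<and> set_mset v \<subseteq> A"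
        then have "count v x = 0" using insert.hyps by (meson not_in_iff subsetD)
        then have "count u x = count m x" using m by (metis add.right_neutral count_union)
        moreover have "count u y = 0" if "y \<noteq> x" for y
          using H that by (metis not_in_iff singletonD subsetD)
        ultimately have "u = ?u" by (intro multiset_eqI) simp
        moreover from this have "v = ?v" using m uv by (metis add_left_cancel)
        ultimately show False using ne by simp
      qed
      then show "(case i of (u, v) \<Rightarrow> mcoeff (muni (f x) x) u * mcoeff ?P v) = 0"
        using insert.IH by (auto simp: uv' mcoeff_muni)
    qed
  qed simp
  also have "\<dots> = fps_nth (f x) (count m x) * mcoeff ?P ?v"
    by (simp add: mcoeff_muni set_mset_replicate_mset_subset)
  also have "mcoeff ?P ?v = (if set_mset m \<subseteq> insert x A then \<Prod>j\<in>A. fps_nth (f j) (count m j) else 0)"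
    using insert.hyps unfolding insert.IH by (auto intro!: prod.cong)
  finally show ?case using insert.hyps by simp
qed

lemma fact_mset_pair: "fact_mset {#p, q#} = (if p = q then 2 else (1::'k::field_char_0))"
  by (simp add: fact_mset_add_mset)

lemma fact_mset_single [simp]: "fact_mset {#p#} = 1"
  by (simp add: fact_mset_add_mset)

lemma gbinomial_2: "a gchoose 2 = a * (a - 1) / (2 :: 'k::field_char_0)"
  by (simp add: gbinomial_prod_rev numeral_2_eq_2)

text \<open>Orders one and two suffice for the structure constants: grafting on a ladder produces
  vertices with at most two children. The diagonal term comes from c(c - 1) = c^2 - c.\<close>

lemma taylor_prod_binomial:
  fixes c :: "'v \<Rightarrow> 'k::field_char_0"
  assumes A: "finite A" "p \<in> A"
  shows "taylor (\<Prod>j\<in>A. muni (fps_binomial (c j)) j) {#p#} = c p"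
    and "q \<in> A \<Longrightarrow> taylor (\<Prod>j\<in>A. muni (fps_binomial (c j)) j) {#p, q#} = c p * c q - (if p = q then c p else 0)"
proof -
  have "(\<Prod>j\<in>A. c j gchoose count {#p#} j) = (\<Prod>j\<in>{p}. c j gchoose count {#p#} j)"
    using A by (intro prod.mono_neutral_right) auto
  then show "taylor (\<Prod>j\<in>A. muni (fps_binomial (c j)) j) {#p#} = c p"
    using A by (simp add: taylor_def mcoeff_prod_muni)
  assume q: "q \<in> A"
  have "(\<Prod>j\<in>A. c j gchoose count {#p, q#} j) = (\<Prod>j\<in>{p, q}. c j gchoose count {#p, q#} j)"
    using A q by (intro prod.mono_neutral_right) auto
  then show "taylor (\<Prod>j\<in>A. muni (fps_binomial (c j)) j) {#p, q#} = c p * c q - (if p = q then c p else 0)"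
    using A q by (cases "p = q") (simp_all add: taylor_def mcoeff_prod_muni fact_mset_pair gbinomial_2
        numeral_2_eq_2 [symmetric] algebra_simps)
qed

lemma mcoeff_sum_ln:
  "mcoeff (\<Sum>j\<in>A. mconst (a j) * muni (fps_ln 1) j) m =
    (\<Sum>j\<in>A. a j * (if set_mset m \<subseteq> {j} then fps_nth (fps_ln 1) (size m) else (0::'k::field_char_0)))"
  by (simp add: mcoeff_sum mcoeff_muni)

lemma taylor_sum_ln:
  fixes a :: "'v \<Rightarrow> 'k::field_char_0"
  assumes A: "finite A" "p \<in> A"
  shows "taylor (\<Sum>j\<in>A. mconst (a j) * muni (fps_ln 1) j) {#p#} = a p"
    and "taylor (\<Sum>j\<in>A. mconst (a j) * muni (fps_ln 1) j) {#p, q#} = - (if p = q then a p else 0)"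
proof -
  have "(\<Sum>j\<in>A. a j * (if set_mset {#p#} \<subseteq> {j} then fps_nth (fps_ln 1) (size {#p#}) else 0)) =
      (\<Sum>j\<in>A. if j = p then a j else 0)"
    by (rule sum.cong) (auto simp: fps_ln_nth)
  then show "taylor (\<Sum>j\<in>A. mconst (a j) * muni (fps_ln 1) j) {#p#} = a p"
    unfolding taylor_def mcoeff_sum_ln using A by simp
  have "(\<Sum>j\<in>A. a j * (if set_mset {#p, q#} \<subseteq> {j} then fps_nth (fps_ln 1) (size {#p, q#}) else 0)) =
      (\<Sum>j\<in>A. if j = p then (if p = q then - a p / 2 else 0) else 0)"
    by (rule sum.cong) (auto simp: fps_ln_nth)
  then show "taylor (\<Sum>j\<in>A. mconst (a j) * muni (fps_ln 1) j) {#p, q#} = - (if p = q then a p else 0)"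
    unfolding taylor_def mcoeff_sum_ln using A by (simp add: fact_mset_pair)
qed

lemma taylor_mconst_mult [simp]: "taylor (mconst c * f) m = c * taylor f m"
  by (simp add: taylor_def)

lemma taylor_add: "taylor (f + g) m = taylor f m + taylor g m"
  by (simp add: taylor_def algebra_simps)

lemma taylor_diff: "taylor (f - g) m = taylor f m - taylor g m"
  by (simp add: taylor_def algebra_simps)

lemma taylor_one: "m \<noteq> {#} \<Longrightarrow> taylor 1 m = 0"
  by (simp add: taylor_def mcoeff_one)

lemma taylor_mconst: "m \<noteq> {#} \<Longrightarrow> taylor (mconst c) m = 0"
  by (simp add: taylor_def mcoeff_mconst)

lemma taylor_sum: "taylor (sum f A) m = (\<Sum>x\<in>A. taylor (f x) m)"
  by (simp add: taylor_def mcoeff_sum sum_distrib_right)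

lemma taylor_mvar: "taylor (mvar j) m = (if m = {#j#} then 1 else 0)"
  by (auto simp: taylor_def mcoeff_mvar)

lemma fps_binomial_0_nth: "0 < n \<Longrightarrow> fps_nth (fps_binomial (0::'k::field_char_0)) n = 0"
  by (cases n) (simp_all add: gbinomial_0)

lemma image_mset_eq_single:
  assumes "image_mset f p = {#c#}"
  shows "\<exists>y. p = {#y#} \<and> f y = c"
proof -
  have "size p = 1" using arg_cong [OF assms, of size] by simp
  then obtain y where "p = {#y#}" using size_1_singleton_mset by blast
  then show ?thesis using assms by auto
qed

text \<open>The data behind \<open>fundamental_abelian\<close>: \<open>G\<close> is the basic
  system, \<open>Z\<close> the index set after dilatation, \<open>r\<close> the map whose fibres are
  the blocks, \<open>l\<close> the change of variables.\<close>

locale fundamental_system =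
  fixes Z I0 I1 J1 :: "'i set" and G F :: "'i \<Rightarrow> ('i, 'k::field_char_0) mfps"
    and r :: "'i \<Rightarrow> 'i" and l \<nu> :: "'i \<Rightarrow> 'k" and a :: "'i \<Rightarrow> 'i \<Rightarrow> 'k"
  assumes sdse_G: "sdse (I0 \<union> I1 \<union> J1) G"
    and disjoint: "I0 \<inter> I1 = {}" "I0 \<inter> J1 = {}" "I1 \<inter> J1 = {}" and I0_nonempty: "I0 \<noteq> {}"
    and G0: "\<And>i. i \<in> I0 \<Longrightarrow> G i = 1 + mvar i"
    and G1: "\<And>i. i \<in> I1 \<Longrightarrow> G i = (if \<nu> i \<noteq> 0
          then mconst (1 / \<nu> i) * (\<Prod>j\<in>I0. muni (fps_binomial (\<nu> i * a i j)) j)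
            + 1 - mconst (1 / \<nu> i)
          else 1 + (\<Sum>j\<in>I0. mconst (a i j) * muni (fps_ln 1) j))"
    and \<nu>J: "\<And>i. i \<in> J1 \<Longrightarrow> \<nu> i \<noteq> 0"
    and I1i_nonempty: "\<And>i. i \<in> J1 \<Longrightarrow> {j \<in> I1. a i j \<noteq> 0} \<noteq> {}"
    and \<nu>_I1i: "\<And>i j. i \<in> J1 \<Longrightarrow> j \<in> I1 \<Longrightarrow> a i j \<noteq> 0 \<Longrightarrow> \<nu> j = 1"
    and G_I1i: "\<And>i j k. i \<in> J1 \<Longrightarrow> j \<in> I1 \<Longrightarrow> a i j \<noteq> 0 \<Longrightarrow> k \<in> I1 \<Longrightarrow> a i k \<noteq> 0 \<Longrightarrow> G j = G k"
    and GJ: "\<And>i s. i \<in> J1 \<Longrightarrow> s \<in> I1 \<Longrightarrow> a i s \<noteq> 0 \<Longrightarrow>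
        G i = mconst (1 / \<nu> i) * (\<Prod>j\<in>I0. muni (fps_binomial (a s j)) j)
            + (\<Sum>j\<in>{j \<in> I1. a i j \<noteq> 0}. mconst (a i j) * mvar j) + 1 - mconst (1 / \<nu> i)"
    and finite_Z: "finite Z" and r: "r ` Z = I0 \<union> I1 \<union> J1" and l: "\<And>x. x \<in> Z \<Longrightarrow> l x \<noteq> 0"
    and F: "\<And>x. x \<in> Z \<Longrightarrow> F x = change_of_variables l (dilate_sdse Z r G) x"
    and sdse_F: "sdse Z F"
begin

lemma finite_index: "finite I0" "finite I1" "finite J1"
  using sdseD(1) [OF sdse_G] by auto

lemma G0_taylor:
  assumes "i \<in> I0" "m \<noteq> {#}"
  shows "taylor (G i) m = (if m = {#i#} then 1 else 0)"
  using assms by (simp add: G0 taylor_add taylor_one taylor_mvar)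

lemma G1_support:
  assumes "i \<in> I1" "mcoeff (G i) m \<noteq> 0"
  shows "set_mset m \<subseteq> I0"
proof (rule ccontr)
  assume n: "\<not> set_mset m \<subseteq> I0"
  then have "m \<noteq> {#}" by auto
  have "\<not> set_mset m \<subseteq> {j}" if "j \<in> I0" for j using n that by blast
  then have "(\<Sum>j\<in>I0. a i j * (if set_mset m \<subseteq> {j} then fps_nth (fps_ln 1) (size m) else 0)) = 0"
    by (intro sum.neutral) simp
  then have "mcoeff (G i) m = 0"
    using n \<open>m \<noteq> {#}\<close> G1 [OF assms(1)] finite_index
    by (cases "\<nu> i = 0") (simp_all add: mcoeff_prod_muni mcoeff_one mcoeff_mconst mcoeff_sum_ln del: mcoeff_mconst_mult,
        simp add: mcoeff_prod_muni)
  then show False using assms by simp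
qed

text \<open>Up to order two the binomial and the logarithmic case obey one formula, the logarithm
  being the limit of the binomial series as \<nu> tends to 0. Later arguments need no distinction of
  these cases in the Taylor data.\<close>

lemma G1_taylor:
  assumes i: "i \<in> I1" and p: "p \<in> I0"
  shows "taylor (G i) {#p#} = a i p"
    and "q \<in> I0 \<Longrightarrow> taylor (G i) {#p, q#} = \<nu> i * a i p * a i q - (if p = q then a i p else 0)"
  using G1 [OF i] taylor_prod_binomial [OF finite_index(1) p, where c = "\<lambda>j. \<nu> i * a i j"]
    taylor_sum_ln [OF finite_index(1) p, where a = "a i"]
  by (cases "\<nu> i = 0"; simp add: taylor_add taylor_diff taylor_one taylor_mconst diff_divide_distrib del: taylor_eq_0_iff)+

text \<open>If all exponents vanished, the product would be 1 and the logarithmic sum 0, against the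
  requirement that the series is not constant.\<close>

lemma G1_nontrivial:
  assumes i: "i \<in> I1"
  shows "\<exists>p\<in>I0. a i p \<noteq> 0"
proof (rule ccontr)
  assume "\<not> (\<exists>p\<in>I0. a i p \<noteq> 0)"
  then have a0: "\<And>p. p \<in> I0 \<Longrightarrow> a i p = 0" by blast
  have "mcoeff (G i) m = 0" if m: "m \<noteq> {#}" for m
  proof (cases "\<nu> i = 0")
    case True
    then show ?thesis using G1 [OF i] m a0 by (simp add: mcoeff_one mcoeff_sum)
  next
    case False
    have "mcoeff (\<Prod>j\<in>I0. muni (fps_binomial (\<nu> i * a i j)) j) m = 0"
    proof (cases "set_mset m \<subseteq> I0")
      case True
      obtain p where p: "p \<in># m" using m by blast
      then have "fps_nth (fps_binomial (\<nu> i * a i p)) (count m p) = 0"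
        using True a0 [of p] by (auto simp: fps_binomial_0_nth simp del: fps_binomial_nth)
      then have "(\<Prod>j\<in>I0. fps_nth (fps_binomial (\<nu> i * a i j)) (count m j)) = 0"
        using True p finite_index(1) prod_zero by (metis (no_types, lifting) subsetD)
      then show ?thesis using finite_index(1) by (simp add: mcoeff_prod_muni del: fps_binomial_nth)
    qed (simp add: mcoeff_prod_muni finite_index)
    then show ?thesis using G1 [OF i] m False by (simp add: mcoeff_one mcoeff_mconst)
  qed
  then have "G i = mconst (mcoeff (G i) {#})"
    by (intro mfps_eqI) (simp add: mcoeff_mconst)
  then show False using sdseD(5) [OF sdse_G, of i] i by (auto simp: nonconstant_def)
qed

text \<open>An element of the set I_1^(i) of the definition of the system. The exponents b^(i) are
  taken from it; they do not depend on the choice, because all elements of this set have the same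
  series.\<close>

definition spouse :: "'i \<Rightarrow> 'i"
  where "spouse i = (SOME s. s \<in> I1 \<and> a i s \<noteq> 0)"

lemma spouse:
  assumes "i \<in> J1" shows "spouse i \<in> I1" "a i (spouse i) \<noteq> 0"
proof -
  have "\<exists>s. s \<in> I1 \<and> a i s \<noteq> 0" using I1i_nonempty [OF assms] by blast
  then have "spouse i \<in> I1 \<and> a i (spouse i) \<noteq> 0" unfolding spouse_def by (rule someI_ex)
  then show "spouse i \<in> I1" "a i (spouse i) \<noteq> 0" by auto
qed

definition b :: "'i \<Rightarrow> 'i \<Rightarrow> 'k" where "b i = a (spouse i)"

lemma b_eq:
  assumes "i \<in> J1" "s \<in> I1" "a i s \<noteq> 0" "p \<in> I0"
  shows "a s p = b i p"
  using G_I1i [OF assms(1-3) spouse [OF assms(1)]] G1_taylor(1) [OF assms(2,4)]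
    G1_taylor(1) [OF spouse(1) [OF assms(1)] assms(4)] by (simp add: b_def)

lemma GJ_taylor_expand:
  assumes "i \<in> J1" "m \<noteq> {#}"
  shows "taylor (G i) m = taylor (\<Prod>j\<in>I0. muni (fps_binomial (b i j)) j) m / \<nu> i +
    (\<Sum>j\<in>I1. if m = {#j#} then a i j else 0)"
proof -
  have "(\<Sum>j\<in>{j \<in> I1. a i j \<noteq> 0}. a i j * (if m = {#j#} then 1 else 0)) =
      (\<Sum>j\<in>I1. if m = {#j#} then a i j else 0)"
    using finite_index(2) by (intro sum.mono_neutral_cong_left) auto
  then show ?thesis
    using GJ [OF assms(1) spouse [OF assms(1)]] assms(2)
    by (simp add: b_def taylor_add taylor_diff taylor_one taylor_mconst taylor_sum taylor_mvar del: taylor_eq_0_iff)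
qed

lemma GJ_support:
  assumes i: "i \<in> J1" and m: "mcoeff (G i) m \<noteq> 0"
  shows "set_mset m \<subseteq> I0 \<or> (\<exists>j\<in>I1. a i j \<noteq> 0 \<and> m = {#j#})"
proof (rule ccontr)
  assume n: "\<not> (set_mset m \<subseteq> I0 \<or> (\<exists>j\<in>I1. a i j \<noteq> 0 \<and> m = {#j#}))"
  then have "m \<noteq> {#}" by auto
  have "(\<Sum>j\<in>I1. if m = {#j#} then a i j else 0) = 0"
    by (rule sum.neutral) (use n in auto)
  moreover have "taylor (\<Prod>j\<in>I0. muni (fps_binomial (b i j)) j) m = 0"
    using n finite_index by (simp add: mcoeff_prod_muni)
  ultimately have "taylor (G i) m = 0"
    using GJ_taylor_expand [OF i \<open>m \<noteq> {#}\<close>] by simp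
  then show False using m by simp
qed

lemma GJ_taylor:
  assumes i: "i \<in> J1"
  shows "p \<in> I0 \<Longrightarrow> taylor (G i) {#p#} = b i p / \<nu> i"
    and "j \<in> I1 \<Longrightarrow> taylor (G i) {#j#} = a i j"
    and "p \<in> I0 \<Longrightarrow> q \<in> I0 \<Longrightarrow> taylor (G i) {#p, q#} = (b i p * b i q - (if p = q then b i p else 0)) / \<nu> i"
proof -
  assume p: "p \<in> I0"
  have "(\<Sum>j\<in>I1. if {#p#} = {#j#} then a i j else 0) = 0"
    using p disjoint by (intro sum.neutral) auto
  then show "taylor (G i) {#p#} = b i p / \<nu> i"
    using GJ_taylor_expand [OF i, of "{#p#}"] taylor_prod_binomial(1) [OF finite_index(1) p, where c = "b i"] by simp
next
  assume j: "j \<in> I1"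
  then have "j \<notin> I0" using disjoint by auto
  then have "taylor (\<Prod>j\<in>I0. muni (fps_binomial (b i j)) j) {#j#} = 0"
    using finite_index by (simp add: mcoeff_prod_muni)
  then show "taylor (G i) {#j#} = a i j"
    using GJ_taylor_expand [OF i, of "{#j#}"] finite_index j by simp
next
  assume pq: "p \<in> I0" "q \<in> I0"
  then show "taylor (G i) {#p, q#} = (b i p * b i q - (if p = q then b i p else 0)) / \<nu> i"
    using GJ_taylor_expand [OF i, of "{#p, q#}"] taylor_prod_binomial(2) [OF finite_index(1) pq, where c = "b i"] by simp
qed

subsection \<open>The dilated system\<close>

definition "A0 = {x \<in> Z. r x \<in> I0}"
definition "A1 = {x \<in> Z. r x \<in> I1}"
definition "AJ = {x \<in> Z. r x \<in> J1}"

lemma Z_eq: "Z = A0 \<union> A1 \<union> AJ"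
  using r by (auto simp: A0_def A1_def AJ_def)

lemma A_disjoint: "A0 \<inter> A1 = {}" "A0 \<inter> AJ = {}" "A1 \<inter> AJ = {}"
  using disjoint by (auto simp: A0_def A1_def AJ_def)

lemma F_taylor:
  assumes "x \<in> Z" "set_mset p \<subseteq> Z"
  shows "taylor (F x) p = taylor (G (r x)) (image_mset r p) * prod_mset (image_mset l p)"
  using taylor_dilate_change [OF finite_Z assms(2), of l r G x] F [OF assms(1)] by simp

lemma F_support: "x \<in> Z \<Longrightarrow> mcoeff (F x) p \<noteq> 0 \<Longrightarrow> set_mset p \<subseteq> Z"
  using sdseD(3) [OF sdse_F] series_inD by blast

lemma F_G_support:
  assumes "x \<in> Z" "mcoeff (F x) p \<noteq> 0"
  shows "mcoeff (G (r x)) (image_mset r p) \<noteq> 0"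
proof -
  have "taylor (F x) p \<noteq> 0" using assms by simp
  then show ?thesis unfolding F_taylor [OF assms(1) F_support [OF assms]] by auto
qed

lemma F_eqI: "x \<in> Z \<Longrightarrow> y \<in> Z \<Longrightarrow> G (r x) = G (r y) \<Longrightarrow> F x = F y"
  by (simp add: F change_of_variables_def dilate_sdse_def)

lemma A0_support:
  assumes "x \<in> A0" "mcoeff (F x) p \<noteq> 0" "p \<noteq> {#}"
  shows "\<exists>y\<in>A0. p = {#y#} \<and> r y = r x"
proof -
  have x: "x \<in> Z" "r x \<in> I0" using assms by (auto simp: A0_def)
  have "taylor (G (r x)) (image_mset r p) \<noteq> 0" using F_G_support [OF x(1) assms(2)] by simp
  then have "image_mset r p = {#r x#}" using G0_taylor [OF x(2), of "image_mset r p"] assms(3) by (auto split: if_splits)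
  then obtain y where "p = {#y#}" "r y = r x" by (auto dest: image_mset_eq_single)
  then show ?thesis using F_support [OF x(1) assms(2)] x by (auto simp: A0_def)
qed

lemma A1_support:
  assumes "x \<in> A1" "mcoeff (F x) p \<noteq> 0"
  shows "set_mset p \<subseteq> A0"
proof -
  have x: "x \<in> Z" "r x \<in> I1" using assms by (auto simp: A1_def)
  show ?thesis
    using G1_support [OF x(2) F_G_support [OF x(1) assms(2)]] F_support [OF x(1) assms(2)]
    by (auto simp: A0_def)
qed

lemma AJ_support:
  assumes "x \<in> AJ" "mcoeff (F x) p \<noteq> 0"
  shows "set_mset p \<subseteq> A0 \<or> (\<exists>y\<in>A1. p = {#y#} \<and> a (r x) (r y) \<noteq> 0)"
proof -
  have x: "x \<in> Z" "r x \<in> J1" using assms by (auto simp: AJ_def)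
  have sub: "set_mset p \<subseteq> Z" by (rule F_support [OF x(1) assms(2)])
  from GJ_support [OF x(2) F_G_support [OF x(1) assms(2)]] show ?thesis
  proof
    assume "set_mset (image_mset r p) \<subseteq> I0"
    then show ?thesis using sub by (auto simp: A0_def)
  next
    assume "\<exists>j\<in>I1. a (r x) j \<noteq> 0 \<and> image_mset r p = {#j#}"
    then obtain j y where "j \<in> I1" "a (r x) j \<noteq> 0" "p = {#y#}" "r y = j"
      by (auto dest: image_mset_eq_single)
    then show ?thesis using sub by (auto simp: A1_def)
  qed
qed

lemma F0_taylor:
  assumes "x \<in> A0" "y \<in> Z"
  shows "taylor (F x) {#y#} = (if r y = r x then l y else 0)" "z \<in> Z \<Longrightarrow> taylor (F x) {#y, z#} = 0"
  using assms G0_taylor [of "r x"] F_taylor [of x "{#y#}"] F_taylor [of x "{#y, z#}"]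
  by (auto simp: A0_def simp del: taylor_eq_0_iff)

lemma F1_taylor:
  assumes "x \<in> A1" "y \<in> A0"
  shows "taylor (F x) {#y#} = a (r x) (r y) * l y"
    "z \<in> A0 \<Longrightarrow> taylor (F x) {#y, z#} =
      (\<nu> (r x) * a (r x) (r y) * a (r x) (r z) - (if r y = r z then a (r x) (r y) else 0)) * (l y * l z)"
  using assms G1_taylor [of "r x" "r y"] F_taylor [of x "{#y#}"] F_taylor [of x "{#y, z#}"]
  by (auto simp: A0_def A1_def simp del: taylor_eq_0_iff)

lemma FJ_taylor:
  assumes "x \<in> AJ"
  shows "y \<in> A0 \<Longrightarrow> taylor (F x) {#y#} = b (r x) (r y) / \<nu> (r x) * l y"
    "y \<in> A1 \<Longrightarrow> taylor (F x) {#y#} = a (r x) (r y) * l y"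
    "y \<in> A0 \<Longrightarrow> z \<in> A0 \<Longrightarrow> taylor (F x) {#y, z#} =
      (b (r x) (r y) * b (r x) (r z) - (if r y = r z then b (r x) (r y) else 0)) / \<nu> (r x) * (l y * l z)"
  using assms GJ_taylor(1) [of "r x" "r y"] GJ_taylor(2) [of "r x" "r y"] GJ_taylor(3) [of "r x" "r y" "r z"]
    F_taylor [of x "{#y#}"] F_taylor [of x "{#y, z#}"]
  by (auto simp: A0_def A1_def AJ_def simp del: taylor_eq_0_iff)

text \<open>Ladders can therefore be chosen to lie in \<open>A0\<close> from their second vertex on.
  In \<open>A0\<close> the vertex itself serves, in \<open>A1\<close> some exponent is nonzero, and
  in \<open>AJ\<close> the exponents are those of a spouse.\<close>

lemma exists_next:
  assumes "x \<in> Z"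
  shows "\<exists>y\<in>A0. taylor (F x) {#y#} \<noteq> 0"
proof -
  have pre: "\<exists>y\<in>A0. r y = p" if "p \<in> I0" for p
  proof -
    have "p \<in> r ` Z" using that r by auto
    then show ?thesis using that by (auto simp: A0_def)
  qed
  consider "x \<in> A0" | "x \<in> A1" | "x \<in> AJ" using assms Z_eq by auto
  then show ?thesis
  proof cases
    case 1
    then show ?thesis using F0_taylor(1) [OF 1 assms] l [OF assms] by (intro bexI [of _ x]) auto
  next
    case 2
    then obtain p where p: "p \<in> I0" "a (r x) p \<noteq> 0" using G1_nontrivial [of "r x"] by (auto simp: A1_def)
    then obtain y where "y \<in> A0" "r y = p" using pre by blast
    then show ?thesis using F1_taylor(1) [OF 2] p l [of y] by (intro bexI [of _ y]) (auto simp: A0_def simp del: taylor_eq_0_iff)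
  next
    case 3
    then have x: "r x \<in> J1" by (simp add: AJ_def)
    obtain p where p: "p \<in> I0" "b (r x) p \<noteq> 0" using G1_nontrivial [OF spouse(1) [OF x]] by (auto simp: b_def)
    then obtain y where "y \<in> A0" "r y = p" using pre by blast
    then show ?thesis using FJ_taylor(1) [OF 3] p l [of y] \<nu>J [OF x]
      by (intro bexI [of _ y]) (auto simp: A0_def simp del: taylor_eq_0_iff)
  qed
qed

subsection \<open>The structure constants of a fundamental abelian system\<close>

context
  fixes nx :: "'i \<Rightarrow> 'i"
  assumes nx: "\<And>x. x \<in> Z \<Longrightarrow> nx x \<in> A0" "\<And>x. x \<in> Z \<Longrightarrow> taylor (F x) {#nx x#} \<noteq> 0"
begin

abbreviation "lam \<equiv> lambda F nx"

lemma A_subset: "A0 \<subseteq> Z" "A1 \<subseteq> Z" "AJ \<subseteq> Z"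
  using Z_eq by auto

lemma lam_recursion:
  assumes "x \<in> Z" "0 < k"
  shows "lam (Suc k) x j = taylor (F x) {#j, nx x#} / taylor (F x) {#nx x#} + lam k (nx x) j"
proof -
  have "ladder_coeff F (walk nx n y) y \<noteq> 0" if "y \<in> Z" for n y
    using that
  proof (induction n arbitrary: y)
    case (Suc n)
    then show ?case using nx [OF Suc.prems] A_subset Suc.IH [of "nx y"] by auto
  qed simp
  moreover have "nx x \<in> Z" using nx [OF assms(1)] A_subset by auto
  ultimately show ?thesis using assms nx(2) [OF assms(1)] by (intro lambda_Suc)
qed

text \<open>The series of a vertex of \<open>A0\<close> is linear in the variables of its own block.
  The ladder stays in this block and there are no second derivatives, so only its last vertex
  contributes.\<close>

lemma lam_A0:
  assumes "x \<in> A0" "j \<in> Z" "0 < k"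
  shows "lam k x j = (if r j = r x then l j else 0)"
  using assms(3,1)
proof (induction k arbitrary: x rule: nat_induct_non_zero)
  case 1
  then show ?case using F0_taylor(1) [OF 1 assms(2)] by (simp add: lambda_1)
next
  case (Suc k)
  have x: "x \<in> Z" using Suc A_subset by auto
  have n: "nx x \<in> Z" using nx(1) [OF x] A_subset by auto
  have "r (nx x) = r x" using nx(2) [OF x] F0_taylor(1) [OF \<open>x \<in> A0\<close> n] by (auto split: if_splits simp del: taylor_eq_0_iff)
  then show ?case
    using lam_recursion [OF x \<open>0 < k\<close>, of j] F0_taylor(2) [OF \<open>x \<in> A0\<close> assms(2) n] Suc.IH [OF nx(1) [OF x]]
    by simp
qed

text \<open>For \<open>k \<ge> 2\<close> the second derivative contributes \<nu> a l, minus
  \<open>l j\<close> if \<open>j\<close> lies in the block of the next vertex. This correction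
  cancels against the constant of the rest of the ladder, so the result does not depend on the
  chosen next vertex.\<close>

lemma lam_A1:
  assumes x: "x \<in> A1" and j: "j \<in> Z"
  shows "lam 1 x j = (if j \<in> A0 then l j * a (r x) (r j) else 0)"
    and "2 \<le> k \<Longrightarrow> lam k x j = (if j \<in> A0 then \<nu> (r x) * l j * a (r x) (r j) else 0)"
proof -
  have xZ: "x \<in> Z" using x A_subset by auto
  have out: "taylor (F x) p = 0" if "\<not> set_mset p \<subseteq> A0" for p
    using A1_support [OF x, of p] that by auto
  show "lam 1 x j = (if j \<in> A0 then l j * a (r x) (r j) else 0)"
    using F1_taylor(1) [OF x, of j] out [of "{#j#}"] by (auto simp: lambda_1 simp del: taylor_eq_0_iff)
  assume "2 \<le> k"
  then obtain k' where k: "k = Suc k'" "0 < k'" by (cases k) auto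
  let ?n = "nx x"
  have n: "?n \<in> A0" "taylor (F x) {#?n#} \<noteq> 0" using nx xZ by auto
  have lk: "lam k x j = taylor (F x) {#j, ?n#} / taylor (F x) {#?n#} + (if r j = r ?n then l j else 0)"
    unfolding k(1) using lam_recursion [OF xZ k(2)] lam_A0 [OF n(1) j k(2)] by simp
  show "lam k x j = (if j \<in> A0 then \<nu> (r x) * l j * a (r x) (r j) else 0)"
  proof (cases "j \<in> A0")
    case True
    have nz: "a (r x) (r ?n) \<noteq> 0" "l ?n \<noteq> 0" using n(2) F1_taylor(1) [OF x n(1)] by auto
    show ?thesis
      unfolding lk F1_taylor(1) [OF x n(1)] F1_taylor(2) [OF x True n(1)]
      using nz True by (simp add: field_simps)
  next
    case False
    then have "r j \<noteq> r ?n" using j n(1) by (auto simp: A0_def)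
    then show ?thesis unfolding lk using out [of "{#j, ?n#}"] False by simp
  qed
qed

text \<open>The same cancellation; the factor 1/\<nu> is common to first and second derivatives and
  disappears for \<open>k \<ge> 2\<close>. The variables of \<open>A1\<close> occur only linearly,
  without mixed terms, so they are felt for \<open>k = 1\<close> alone.\<close>

lemma lam_AJ:
  assumes x: "x \<in> AJ" and j: "j \<in> Z"
  shows "lam 1 x j = (if j \<in> A0 then l j * b (r x) (r j) / \<nu> (r x) else if j \<in> A1 then a (r x) (r j) * l j else 0)"
    and "2 \<le> k \<Longrightarrow> lam k x j = (if j \<in> A0 then l j * b (r x) (r j) else 0)"
proof -
  have xZ: "x \<in> Z" using x A_subset by auto
  have "taylor (F x) {#j#} = 0" if "j \<notin> A0" "j \<notin> A1"
    using AJ_support [OF x, of "{#j#}"] that by auto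
  then show "lam 1 x j = (if j \<in> A0 then l j * b (r x) (r j) / \<nu> (r x) else if j \<in> A1 then a (r x) (r j) * l j else 0)"
    using FJ_taylor(1,2) [OF x, of j] by (auto simp: lambda_1 simp del: taylor_eq_0_iff)
  assume "2 \<le> k"
  then obtain k' where k: "k = Suc k'" "0 < k'" by (cases k) auto
  let ?n = "nx x"
  have n: "?n \<in> A0" "taylor (F x) {#?n#} \<noteq> 0" using nx xZ by auto
  have lk: "lam k x j = taylor (F x) {#j, ?n#} / taylor (F x) {#?n#} + (if r j = r ?n then l j else 0)"
    unfolding k(1) using lam_recursion [OF xZ k(2)] lam_A0 [OF n(1) j k(2)] by simp
  have \<nu>: "\<nu> (r x) \<noteq> 0" using x \<nu>J by (auto simp: AJ_def)
  show "lam k x j = (if j \<in> A0 then l j * b (r x) (r j) else 0)"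
  proof (cases "j \<in> A0")
    case True
    have nz: "b (r x) (r ?n) \<noteq> 0" "l ?n \<noteq> 0" using n(2) FJ_taylor(1) [OF x n(1)] by auto
    show ?thesis
      unfolding lk FJ_taylor(1) [OF x n(1)] FJ_taylor(3) [OF x True n(1)]
      using nz \<nu> True by (simp add: field_simps)
  next
    case False
    then have "r j \<noteq> r ?n" using j n(1) by (auto simp: A0_def)
    moreover have "taylor (F x) {#j, ?n#} = 0"
      using AJ_support [OF x, of "{#j, ?n#}"] False by auto
    ultimately show ?thesis unfolding lk using False by simp
  qed
qed

end

end

section \<open>The modules of the abelian case\<close>

text \<open>The structure constants detached from the series, so that the normal form also applies
  to subsets. \<open>a i\<close> stands for the exponents a^(i) on \<open>A1\<close> and for b^(i)
  on \<open>AJ\<close>; \<open>\<mu> i j\<close> is the linear coefficient of an \<open>A1\<close>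
  variable in an \<open>AJ\<close> series.\<close>

locale abelian_constants =
  fixes A0 A1 AJ :: "'i set" and lam :: "nat \<Rightarrow> 'i \<Rightarrow> 'i \<Rightarrow> 'k::field"
    and r :: "'i \<Rightarrow> 'i" and l \<nu> :: "'i \<Rightarrow> 'k" and a \<mu> :: "'i \<Rightarrow> 'i \<Rightarrow> 'k"
  assumes finite_A: "finite A0" "finite A1" "finite AJ"
    and disj: "A0 \<inter> A1 = {}" "A0 \<inter> AJ = {}" "A1 \<inter> AJ = {}"
    and l: "\<And>j. j \<in> A0 \<Longrightarrow> l j \<noteq> 0"
    and lam0: "\<And>i j k. i \<in> A0 \<Longrightarrow> j \<in> A0 \<union> A1 \<union> AJ \<Longrightarrow> 0 < k \<Longrightarrow>
      lam k i j = (if j \<in> A0 \<and> r j = r i then l j else 0)"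
    and lam1_1: "\<And>i j. i \<in> A1 \<Longrightarrow> j \<in> A0 \<union> A1 \<union> AJ \<Longrightarrow>
      lam 1 i j = (if j \<in> A0 then l j * a i (r j) else 0)"
    and lam1_2: "\<And>i j k. i \<in> A1 \<Longrightarrow> j \<in> A0 \<union> A1 \<union> AJ \<Longrightarrow> 2 \<le> k \<Longrightarrow>
      lam k i j = (if j \<in> A0 then \<nu> i * l j * a i (r j) else 0)"
    and \<nu>J: "\<And>i. i \<in> AJ \<Longrightarrow> \<nu> i \<noteq> 0"
    and lamJ_1: "\<And>i j. i \<in> AJ \<Longrightarrow> j \<in> A0 \<union> A1 \<union> AJ \<Longrightarrow>
      lam 1 i j = (if j \<in> A0 then l j * a i (r j) / \<nu> i else if j \<in> A1 then \<mu> i j else 0)"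
    and lamJ_2: "\<And>i j k. i \<in> AJ \<Longrightarrow> j \<in> A0 \<union> A1 \<union> AJ \<Longrightarrow> 2 \<le> k \<Longrightarrow>
      lam k i j = (if j \<in> A0 then l j * a i (r j) else 0)"
    and \<mu>: "\<And>i j. i \<in> AJ \<Longrightarrow> j \<in> A1 \<Longrightarrow> \<mu> i j \<noteq> 0 \<Longrightarrow> \<nu> j = 1"
      "\<And>i j x. i \<in> AJ \<Longrightarrow> j \<in> A1 \<Longrightarrow> \<mu> i j \<noteq> 0 \<Longrightarrow> x \<in> A0 \<Longrightarrow> a j (r x) = a i (r x)"
begin

abbreviation "Z \<equiv> A0 \<union> A1 \<union> AJ"

text \<open>The whole dependence on the degree of the constants with \<open>i\<close> outside and
  \<open>j\<close> inside \<open>A0\<close>: degree 1 differs from all others by the factor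
  \<open>\<nu> i\<close>.\<close>

definition kap :: "nat \<Rightarrow> 'i \<Rightarrow> 'k"
  where "kap k i = (if i \<in> A1 then (if k = 1 then 1 else \<nu> i) else (if k = 1 then 1 / \<nu> i else 1))"

lemma lam_left:
  assumes "i \<in> A1 \<union> AJ" "j \<in> A0" "0 < k"
  shows "lam k i j = kap k i * l j * a i (r j)"
proof -
  have "k = 1 \<or> 2 \<le> k" using assms(3) by linarith
  then show ?thesis
    using assms disj lam1_1 [of i j] lam1_2 [of i j k] lamJ_1 [of i j] lamJ_2 [of i j k]
    by (auto simp: kap_def)
qed

lemma kap_2: "2 \<le> k \<Longrightarrow> kap k i = kap 2 i"
  by (simp add: kap_def)

lemma lam_right_A0:
  assumes "i \<in> A0 \<union> A1" "j \<in> Z" "j \<notin> A0" "0 < k"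
  shows "lam k i j = 0"
proof -
  have "k = 1 \<or> 2 \<le> k" using assms(4) by linarith
  then show ?thesis using assms lam0 [of i j k] lam1_1 [of i j] lam1_2 [of i j k] by auto
qed

lemma lam_AJ_2: "i \<in> AJ \<Longrightarrow> j \<in> Z \<Longrightarrow> j \<notin> A0 \<Longrightarrow> 2 \<le> k \<Longrightarrow> lam k i j = 0"
  using lamJ_2 by simp

lemma lam_AJ_1: "i \<in> AJ \<Longrightarrow> j \<in> AJ \<Longrightarrow> 0 < k \<Longrightarrow> lam k i j = 0"
proof -
  assume *: "i \<in> AJ" "j \<in> AJ" "0 < k"
  then have "k = 1 \<or> 2 \<le> k" by linarith
  then show ?thesis using * disj lamJ_1 [of i j] lamJ_2 [of i j k] by auto
qed

text \<open>A vertex \<open>q\<close> outside \<open>A0\<close> is felt only by \<open>i\<close> in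
  \<open>AJ\<close>, in degree 1, with \<open>q\<close> in \<open>A1\<close> and \<mu> nonzero. Then
  \<open>\<nu> q = 1\<close> and \<open>a q = a i\<close> make the two constants of the first
  bracket equal. In the second, the degree \<open>k + d\<close> is at least 2, and \<open>p\<close>
  feels \<open>q\<close> only if it lies in \<open>AJ\<close>, in which case \<open>i\<close> does
  not feel \<open>p\<close>.\<close>

lemma module_identity_outside:
  assumes i: "i \<in> A1 \<union> AJ" and p: "p \<in> Z" and q: "q \<in> Z" "q \<notin> A0" and pos: "0 < d" "0 < e" "0 < k"
  shows "lam k i q * (lam (k + e) i p - lam e q p) = 0" "lam k i p * (lam (k + d) i q - lam d p q) = 0"
proof -
  have k2: "2 \<le> k + e" "2 \<le> k + d" using pos by linarith+
  show "lam k i q * (lam (k + e) i p - lam e q p) = 0"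
  proof (cases "lam k i q = 0")
    case False
    then have "i \<in> AJ" using lam_right_A0 [of i q k] i q pos by auto
    have "k = 1" "q \<in> A1"
      using False \<open>i \<in> AJ\<close> lam_AJ_2 [of i q k] lam_AJ_1 [of i q k] q pos by (force simp: not_le)+
    have "\<mu> i q \<noteq> 0"
      using False lamJ_1 [OF \<open>i \<in> AJ\<close> q(1)] \<open>k = 1\<close> \<open>q \<in> A1\<close> q(2) by auto
    then have mu: "\<nu> q = 1" "\<And>x. x \<in> A0 \<Longrightarrow> a q (r x) = a i (r x)" using \<mu> \<open>i \<in> AJ\<close> \<open>q \<in> A1\<close> by blast+
    have "lam (k + e) i p = lam e q p"
    proof (cases "p \<in> A0")
      case True
      have "kap e q = 1" using mu(1) \<open>q \<in> A1\<close> by (simp add: kap_def)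
      moreover have "kap (k + e) i = 1" using \<open>i \<in> AJ\<close> disj k2 by (auto simp: kap_def)
      ultimately show ?thesis
        using lam_left [of i p "k + e"] lam_left [of q p e] i \<open>q \<in> A1\<close> True pos mu(2) by simp
    next
      case False
      then show ?thesis
        using lam_AJ_2 [OF \<open>i \<in> AJ\<close> p False k2(1)] lam_right_A0 [of q p e] \<open>q \<in> A1\<close> p pos by simp
    qed
    then show ?thesis by simp
  qed simp
  have "lam (k + d) i q = 0"
    using lam_right_A0 [of i q "k + d"] lam_AJ_2 [of i q "k + d"] i q k2 pos by auto
  moreover have "lam k i p * lam d p q = 0"
  proof (cases "p \<in> A0 \<union> A1")
    case True
    then show ?thesis using lam_right_A0 [OF True q pos(1)] by simp
  next
    case False
    then have pJ: "p \<in> AJ" "p \<notin> A0" using p disj by auto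
    then have "lam k i p = 0"
      using lam_right_A0 [of i p k] lam_AJ_1 [of i p k] i p pos by auto
    then show ?thesis by simp
  qed
  ultimately show "lam k i p * (lam (k + d) i q - lam d p q) = 0" by auto
qed

text \<open>If \<open>i\<close> is in \<open>A0\<close>, both sides vanish: the outer factor forces
  the vertex into the block of \<open>i\<close>, where the constants agree. If \<open>p\<close> and
  \<open>q\<close> are in \<open>A0\<close>, the factors \<open>kap\<close> of degree at least 2 are
  equal, and what remains is symmetric in \<open>p\<close> and \<open>q\<close>.\<close>

lemma module_constants:
  assumes i: "i \<in> Z"
  shows "module_constants Z lam (\<lambda>k. lam k i)"
  unfolding module_constants_def
proof (intro ballI allI impI)
  fix p q d e k assume p: "p \<in> Z" and q: "q \<in> Z" and pos: "0 < (d::nat)" "0 < (e::nat)" "0 < (k::nat)"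
  show "lam k i q * (lam (k + e) i p - lam e q p) = lam k i p * (lam (k + d) i q - lam d p q)"
  proof (cases "i \<in> A0")
    case True
    have zero: "lam k i q * (lam (k + e) i p - lam e q p) = 0" if "p \<in> Z" "q \<in> Z" "0 < e" for p q e
      using lam0 [OF True that(1), of "k + e"] lam0 [OF True that(2), of k] lam0 [of q p e] that pos by auto
    show ?thesis unfolding zero [OF p q pos(2)] zero [OF q p pos(1)] ..
  next
    case False
    then have i1: "i \<in> A1 \<union> AJ" using i by auto
    consider "q \<notin> A0" | "p \<notin> A0" | "p \<in> A0" "q \<in> A0" by blast
    then show ?thesis
    proof cases
      case 1
      show ?thesis unfolding module_identity_outside [OF i1 p q 1 pos] ..
    next
      case 2
      show ?thesis unfolding module_identity_outside [OF i1 q p 2 pos(2,1,3)] ..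
    next
      case 3
      have "kap (k + e) i = kap 2 i" "kap (k + d) i = kap 2 i" using pos by (intro kap_2; linarith)+
      then show ?thesis
        using lam0 [of q p e] lam0 [of p q d] p q pos
        by (cases "r p = r q") (simp_all add: lam_left [OF i1] 3 algebra_simps)
    qed
  qed
qed

text \<open>Meant for the set of non-extension vertices, which contains \<open>A0\<close> but may
  miss vertices of \<open>A1\<close> and \<open>AJ\<close>.\<close>

lemma subset_constants:
  assumes "B1 \<subseteq> A1" "BJ \<subseteq> AJ"
  shows "abelian_constants A0 B1 BJ lam r l \<nu> a \<mu>"
proof
  show "finite A0" "finite B1" "finite BJ"
    using assms finite_A finite_subset by auto
  show "A0 \<inter> B1 = {}" "A0 \<inter> BJ = {}" "B1 \<inter> BJ = {}" using assms disj by auto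
  show "l j \<noteq> 0" if "j \<in> A0" for j using that by (rule l)
  show "\<nu> i \<noteq> 0" if "i \<in> BJ" for i using that assms \<nu>J by auto
  show "lam k i j = (if j \<in> A0 \<and> r j = r i then l j else 0)"
    if "i \<in> A0" "j \<in> A0 \<union> B1 \<union> BJ" "0 < k" for i j k
    using that assms by (intro lam0) auto
  show "lam 1 i j = (if j \<in> A0 then l j * a i (r j) else 0)"
    if "i \<in> B1" "j \<in> A0 \<union> B1 \<union> BJ" for i j
    using that assms by (intro lam1_1) auto
  show "lam k i j = (if j \<in> A0 then \<nu> i * l j * a i (r j) else 0)"
    if "i \<in> B1" "j \<in> A0 \<union> B1 \<union> BJ" "2 \<le> k" for i j k
    using that assms by (intro lam1_2) auto
  show "lam 1 i j = (if j \<in> A0 then l j * a i (r j) / \<nu> i else if j \<in> B1 then \<mu> i j else 0)"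
    if "i \<in> BJ" "j \<in> A0 \<union> B1 \<union> BJ" for i j
  proof -
    have "i \<in> AJ" "j \<in> Z" using that assms by auto
    moreover have "j \<in> A1 \<longleftrightarrow> j \<in> B1 \<or> (j \<in> A0 \<and> j \<in> A1)" using that assms disj by auto
    ultimately show ?thesis using lamJ_1 [of i j] disj by auto
  qed
  show "lam k i j = (if j \<in> A0 then l j * a i (r j) else 0)"
    if "i \<in> BJ" "j \<in> A0 \<union> B1 \<union> BJ" "2 \<le> k" for i j k
    using that assms by (intro lamJ_2) auto
  show "\<nu> j = 1" if "i \<in> BJ" "j \<in> B1" "\<mu> i j \<noteq> 0" for i j
    using that assms by (intro \<mu>(1) [of i j]) auto
  show "a j (r x) = a i (r x)" if "i \<in> BJ" "j \<in> B1" "\<mu> i j \<noteq> 0" "x \<in> A0" for i j x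
    using that assms by (intro \<mu>(2)) auto
qed

subsection \<open>The new basis\<close>

definition rep :: "'i \<Rightarrow> 'i" where "rep \<rho> = (SOME x. x \<in> A0 \<and> r x = \<rho>)"

lemma rep: "x \<in> A0 \<Longrightarrow> rep (r x) \<in> A0 \<and> r (rep (r x)) = r x"
  unfolding rep_def by (rule someI) simp

text \<open>\<open>R0\<close> provides the basis of the abelian algebra, \<open>VV\<close> the
  modules V and \<open>WW\<close> the modules W and W'. A vertex of \<open>A1\<close> goes to V if
  \<nu> is nonzero, as rescaling its first vector makes its constants independent of the degree, and
  to W if \<nu> is 0, as then only degree 1 is moved.\<close>

definition "R0 = rep ` r ` A0"
definition "VV = (A0 - R0) \<union> {i \<in> A1. \<nu> i \<noteq> 0}"
definition "WW = {i \<in> A1. \<nu> i = 0} \<union> AJ"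

text \<open>The scaling factors of the coordinates with respect to the new basis.\<close>

definition sc :: "'i \<Rightarrow> nat \<Rightarrow> 'k"
  where "sc i k = (if i \<in> A0 then l i else if k = 1 \<and> \<nu> i \<noteq> 0 then 1 / \<nu> i else 1)"

lemma sc_nonzero: "i \<in> Z \<Longrightarrow> sc i k \<noteq> 0"
  by (simp add: sc_def l)

definition scaled :: "(nat \<Rightarrow> 'k) \<Rightarrow> (nat \<Rightarrow>\<^sub>0 'k) \<Rightarrow> (nat \<Rightarrow>\<^sub>0 'k)"
  where "scaled s u = Poly_Mapping.mapp (\<lambda>k v. s k * v) u"

lemma lookup_scaled [simp]: "Poly_Mapping.lookup (scaled s u) k = s k * Poly_Mapping.lookup u k"
  by (auto simp: scaled_def lookup_mapp when_def in_keys_iff)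

text \<open>The coefficients with which \<open>e\<^sup>(\<^sup>m\<^sup>)\<close>, for the class \<open>m\<close> of \<open>r j\<close>, acts on the new basis element
  belonging to the vertex \<open>i\<close>.\<close>

definition gam :: "'i \<Rightarrow> nat \<Rightarrow> 'i \<Rightarrow> 'k"
  where "gam i k \<rho> = (if i \<in> A0 then (if r i = \<rho> then 1 else 0)
    else if i \<in> A1 then (if \<nu> i \<noteq> 0 then \<nu> i * a i \<rho> else if k = 1 then a i \<rho> else 0)
    else a i \<rho>)"

text \<open>Since \<open>n + k\<close> is at least 2, only the first basis vector of a row outside
  \<open>A0\<close> is rescaled; this turns the exceptional constant in degree 1 into the general
  one, unless \<nu> is 0.\<close>

lemma sc_lam:
  assumes "i \<in> Z" "j \<in> A0" "0 < k" "0 < n"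
  shows "sc i (n + k) * lam k i j = l j * gam i k (r j) * sc i k"
proof -
  have "k = 1 \<or> 2 \<le> k" "n + k \<noteq> 1" using assms(3,4) by linarith+
  then show ?thesis
    using assms disj lam0 [of i j k] lam1_1 [of i j] lam1_2 [of i j k] lamJ_1 [of i j] lamJ_2 [of i j k] \<nu>J [of i]
    by (elim UnE disjE) (auto simp: sc_def gam_def)
qed

text \<open>With E = f_x/l_x for the representative x of a block, and the elements f_j/l_j - E for
  the other j, one has f_j = l_j ((f_j/l_j - E) + E). Hence the coordinate at E is the sum over the
  whole block.\<close>

definition ecoord :: "('i \<times> nat \<Rightarrow>\<^sub>0 'k) \<Rightarrow> 'i \<Rightarrow> nat \<Rightarrow> 'k"
  where "ecoord c \<rho> n = (\<Sum>j\<in>{j \<in> A0. r j = \<rho>}. l j * Poly_Mapping.lookup c (j, n))"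

text \<open>The action of \<open>A1\<close> on the first vector of an \<open>AJ\<close> row, the
  part of W' governed by \<mu>. Rows of \<open>A1\<close> with \<nu> = 0 do not occur, since a
  nonzero \<mu> requires \<nu> = 1.\<close>

definition mpart :: "'i \<Rightarrow> ('i \<times> nat \<Rightarrow>\<^sub>0 'k) \<Rightarrow> (nat \<Rightarrow> 'k) \<Rightarrow> nat \<Rightarrow> 'k"
  where "mpart i c u n = (if i \<in> AJ then
    (\<Sum>j\<in>{j \<in> A1. \<nu> j \<noteq> 0}. \<mu> i j * (sc j (n - 1) * Poly_Mapping.lookup c (j, n - 1))) * u 1 else 0)"

text \<open>In the new coordinates \<open>A0\<close> acts only through the block sums
  \<open>ecoord\<close>, the differences inside a block acting as zero; the action of
  \<open>A1\<close> on \<open>AJ\<close> survives as \<open>mpart\<close>, and nothing else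
  acts.\<close>

lemma conv_new_basis:
  assumes c: "c \<in> free_on (Z \<times> {1..})" and d: "d \<in> free_on (Z \<times> {1..})" and i: "i \<in> Z"
  shows "sc i n * conv Z (\<lambda>k. lam k i) (Poly_Mapping.lookup c) (\<lambda>k. Poly_Mapping.lookup d (i, k)) n =
    (\<Sum>k\<le>n. \<Sum>\<rho>\<in>r ` A0. gam i k \<rho> * ecoord c \<rho> (n - k) * (sc i k * Poly_Mapping.lookup d (i, k))) +
    mpart i c (\<lambda>k. Poly_Mapping.lookup d (i, k)) n"
proof -
  let ?c = "Poly_Mapping.lookup c" and ?d = "\<lambda>k. Poly_Mapping.lookup d (i, k)"
  have c0: "?c (j, 0) = 0" for j using free_on_lookup_0(1) [OF c] .
  have d0: "?d 0 = 0" using free_on_lookup_0(1) [OF d] .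
  have finZ: "finite Z" "finite A0" "finite (A1 \<union> AJ)" using finite_A by auto
  have Z: "Z = A0 \<union> (A1 \<union> AJ)" "A0 \<inter> (A1 \<union> AJ) = {}" using disj by auto
  have left: "sc i n * (\<Sum>j\<in>A0. lam k i j * ?c (j, n - k) * ?d k) =
      (\<Sum>\<rho>\<in>r ` A0. gam i k \<rho> * ecoord c \<rho> (n - k) * (sc i k * ?d k))" if "k \<le> n" for k
  proof -
    have "sc i n * (\<Sum>j\<in>A0. lam k i j * ?c (j, n - k) * ?d k) =
        (\<Sum>j\<in>A0. gam i k (r j) * (l j * ?c (j, n - k)) * (sc i k * ?d k))"
      unfolding sum_distrib_left
    proof (rule sum.cong [OF refl])
      fix j assume j: "j \<in> A0"
      show "sc i n * (lam k i j * ?c (j, n - k) * ?d k) = gam i k (r j) * (l j * ?c (j, n - k)) * (sc i k * ?d k)"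
      proof (cases "0 < k \<and> k < n")
        case True
        then have "sc i n * lam k i j = l j * gam i k (r j) * sc i k"
          using sc_lam [OF i j, of k "n - k"] by simp
        then have "sc i n * lam k i j * (?c (j, n - k) * ?d k) = l j * gam i k (r j) * sc i k * (?c (j, n - k) * ?d k)"
          by simp
        then show ?thesis by (simp add: mult_ac)
      next
        case False
        then have "k = 0 \<or> n - k = 0" by auto
        then show ?thesis using c0 d0 by auto
      qed
    qed
    also have "\<dots> = (\<Sum>\<rho>\<in>r ` A0. \<Sum>j\<in>{j \<in> A0. r j = \<rho>}. gam i k (r j) * (l j * ?c (j, n - k)) * (sc i k * ?d k))"
      by (rule sum.image_gen [OF finZ(2)])
    also have "\<dots> = (\<Sum>\<rho>\<in>r ` A0. gam i k \<rho> * ecoord c \<rho> (n - k) * (sc i k * ?d k))"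
      unfolding ecoord_def sum_distrib_left sum_distrib_right by (intro sum.cong refl) auto
    finally show ?thesis .
  qed
  have right: "sc i n * (\<Sum>k\<le>n. \<Sum>j\<in>A1 \<union> AJ. lam k i j * ?c (j, n - k) * ?d k) = mpart i c ?d n"
  proof (cases "i \<in> AJ \<and> 1 < n")
    case False
    have "lam k i j * ?c (j, n - k) * ?d k = 0" if "k \<le> n" "j \<in> A1 \<union> AJ" for k j
    proof (cases "0 < k \<and> k < n")
      case True
      then have "lam k i j = 0 \<or> i \<in> AJ" using lam_right_A0 [of i j k] i that disj by auto
      moreover have "2 \<le> n" using True by linarith
      ultimately show ?thesis using False by auto
    next
      case F: False
      then have "k = 0 \<or> n - k = 0" by auto
      then show ?thesis using c0 d0 by auto
    qed
    then have "(\<Sum>k\<le>n. \<Sum>j\<in>A1 \<union> AJ. lam k i j * ?c (j, n - k) * ?d k) = 0"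
      by (intro sum.neutral ballI) simp
    moreover have "mpart i c ?d n = 0"
      using False c0 by (cases "n - 1 = 0") (auto simp: mpart_def)
    ultimately show ?thesis by simp
  next
    case True
    have "(\<Sum>k\<le>n. \<Sum>j\<in>A1 \<union> AJ. lam k i j * ?c (j, n - k) * ?d k) =
        (\<Sum>k\<le>n. if k = 1 then \<Sum>j\<in>A1 \<union> AJ. lam 1 i j * ?c (j, n - 1) * ?d 1 else 0)"
    proof (rule sum.cong [OF refl])
      fix k
      have "(\<Sum>j\<in>A1 \<union> AJ. lam k i j * ?c (j, n - k) * ?d k) = 0" if "k \<noteq> 1"
      proof (intro sum.neutral ballI)
        fix j assume j: "j \<in> A1 \<union> AJ"
        show "lam k i j * ?c (j, n - k) * ?d k = 0"
        proof (cases "k = 0")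
          case False
          then have "2 \<le> k" using that by linarith
          then have "lam k i j = 0" using lam_AJ_2 [of i j k] True j disj by auto
          then show ?thesis by simp
        qed (simp add: d0)
      qed
      then show "(\<Sum>j\<in>A1 \<union> AJ. lam k i j * ?c (j, n - k) * ?d k) =
          (if k = 1 then \<Sum>j\<in>A1 \<union> AJ. lam 1 i j * ?c (j, n - 1) * ?d 1 else 0)" by simp
    qed
    also have "\<dots> = (\<Sum>j\<in>A1 \<union> AJ. lam 1 i j * ?c (j, n - 1) * ?d 1)"
      using True by simp
    also have "\<dots> = (\<Sum>j\<in>{j \<in> A1. \<nu> j \<noteq> 0}. \<mu> i j * (sc j (n - 1) * ?c (j, n - 1)) * ?d 1)"
    proof (rule sum.mono_neutral_cong_right)
      show "\<forall>j\<in>A1 \<union> AJ - {j \<in> A1. \<nu> j \<noteq> 0}. lam 1 i j * ?c (j, n - 1) * ?d 1 = 0"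
      proof
        fix j assume j: "j \<in> A1 \<union> AJ - {j \<in> A1. \<nu> j \<noteq> 0}"
        then have "lam 1 i j = (if j \<in> A1 then \<mu> i j else 0)" using lamJ_1 [of i j] True disj by auto
        moreover have "\<mu> i j = 0" if "j \<in> A1" using that j \<mu>(1) [of i j] True by auto
        ultimately show "lam 1 i j * ?c (j, n - 1) * ?d 1 = 0" by auto
      qed
      fix j assume j: "j \<in> {j \<in> A1. \<nu> j \<noteq> 0}"
      then have "lam 1 i j = \<mu> i j" using lamJ_1 [of i j] True disj by auto
      \<comment> \<open>A nonzero \<mu> forces \<open>\<nu> j = 1\<close>, so the rescaling of row
        \<open>j\<close> is trivial.\<close>
      moreover have "sc j (n - 1) = 1" if "\<mu> i j \<noteq> 0" using that j \<mu>(1) [of i j] True disj by (auto simp: sc_def)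
      ultimately show "lam 1 i j * ?c (j, n - 1) * ?d 1 = \<mu> i j * (sc j (n - 1) * ?c (j, n - 1)) * ?d 1" by auto
    qed (use finZ in auto)
    finally have "(\<Sum>k\<le>n. \<Sum>j\<in>A1 \<union> AJ. lam k i j * ?c (j, n - k) * ?d k) = mpart i c ?d n"
      using True by (simp add: mpart_def sum_distrib_right)
    moreover have "sc i n = 1" using True disj by (auto simp: sc_def)
    ultimately show ?thesis by simp
  qed
  have "conv Z (\<lambda>k. lam k i) ?c ?d n = (\<Sum>k\<le>n. \<Sum>j\<in>A0. lam k i j * ?c (j, n - k) * ?d k) +
      (\<Sum>k\<le>n. \<Sum>j\<in>A1 \<union> AJ. lam k i j * ?c (j, n - k) * ?d k)"
    unfolding conv_def Z(1) sum.union_disjoint [OF finZ(2,3) Z(2)] by (rule sum.distrib)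
  then have "sc i n * conv Z (\<lambda>k. lam k i) ?c ?d n =
      (\<Sum>k\<le>n. sc i n * (\<Sum>j\<in>A0. lam k i j * ?c (j, n - k) * ?d k)) + mpart i c ?d n"
    using right by (simp add: distrib_left sum_distrib_left)
  then show ?thesis using left by simp
qed

lemma lookup_bilin_shift:
  fixes y u :: "nat \<Rightarrow>\<^sub>0 'k"
  shows "Poly_Mapping.lookup (bilin (\<lambda>k l. if l = 1 then Poly_Mapping.single (k + 1) x else 0) y u) (n :: nat) =
    (if 1 \<le> n then x * Poly_Mapping.lookup y (n - 1) * Poly_Mapping.lookup u (1::nat) else (0::'k))"
proof -
  have "Poly_Mapping.lookup (bilin (\<lambda>k l. if l = 1 then Poly_Mapping.single (k + 1) x else 0) y u) n =
      lin (\<lambda>k. lin (\<lambda>l. (if l = 1 then 1 else 0) * (if k + 1 = n then x else 0)) u) y"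
    unfolding lookup_bilin by (intro lin_cong) (simp add: lookup_single when_def)
  also have "\<dots> = lin (\<lambda>k. if k + 1 = n then Poly_Mapping.lookup u 1 * x else 0) y"
    unfolding lin_fun_mult_right lookup_eq_lin [of u, symmetric] by (intro lin_cong) simp
  also have "\<dots> = (if 1 \<le> n then x * Poly_Mapping.lookup y (n - 1) * Poly_Mapping.lookup u 1 else 0)"
  proof (cases "1 \<le> n")
    case True
    then have "k + 1 = n \<longleftrightarrow> k = n - 1" for k by linarith
    then have "lin (\<lambda>k. if k + 1 = n then Poly_Mapping.lookup u 1 * x else 0) y =
        lin (\<lambda>k. (if k = n - 1 then 1 else 0) * (Poly_Mapping.lookup u 1 * x)) y"
      by (intro lin_cong) simp
    then show ?thesis
      unfolding lin_fun_mult_right lookup_eq_lin [of y, symmetric] using True by (simp add: mult_ac)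
  next
    case False
    then show ?thesis by (simp add: lin_def)
  qed
  finally show ?thesis .
qed

lemma V_mod_act: "mact (V_mod x) = act (\<lambda>k. x)"
  by (simp add: V_mod_def act_def)

lemma W_mod_act: "mact (W_mod x) (v, y) = act (\<lambda>k m. if k = 1 then x m else 0) y"
proof -
  have "(\<lambda>(i, k) l. if l = 1 then Poly_Mapping.single (k + 1) (x i) else 0) =
      (\<lambda>(i, k :: nat) (l :: nat). Poly_Mapping.single (k + l) (if l = 1 then x i else 0))"
    by (auto simp: fun_eq_iff)
  then show ?thesis unfolding W_mod_def act_def by simp
qed

lemma W'_mod_act: "mact (W'_mod N x y) (v, z) u = act (\<lambda>k. x) z u +
    (\<Sum>j\<in>{1..N}. bilin (\<lambda>k l. if l = 1 then Poly_Mapping.single (k + 1) (y j) else 0) (v j) u)"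
  by (simp add: W'_mod_def act_def)

lemma gam_constant: "i \<in> VV \<union> AJ \<Longrightarrow> gam i k x = gam i 1 x"
  using disj by (auto simp: gam_def VV_def)

lemma Z_split: "Z = R0 \<union> VV \<union> WW" "VV \<inter> WW = {}" "R0 \<inter> VV = {}" "R0 \<inter> WW = {}"
  using rep disj by (auto simp: R0_def VV_def WW_def)

lemma R0_class: "x \<in> A0 \<Longrightarrow> {j \<in> A0. r j = r x} \<inter> R0 = {rep (r x)}"
  using rep by (force simp: R0_def)

section \<open>The isomorphism with the normal form, for enumerations of the three index
  sets\<close>

context
  fixes e v w :: "nat \<Rightarrow> 'i" and M N Q :: nat
  assumes e: "bij_betw e {1..M} (r ` A0)" and v: "bij_betw v {1..N} VV" and w: "bij_betw w {1..Q} WW"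
begin

text \<open>The factor \<open>\<nu> (w p)\<close> in the last parameter compensates the rescaling of
  the first vector of the \<open>AJ\<close> row by its inverse. Differences inside a block of
  \<open>A0\<close> act as zero, whence the case distinction on \<open>v j\<close>.\<close>

definition Umod :: "nat \<Rightarrow> ('k, 'k vg, nat \<Rightarrow>\<^sub>0 'k) lmodule"
  where "Umod p = (if p \<in> {1..Q} \<and> w p \<in> AJ
    then W'_mod N (\<lambda>m. gam (w p) 1 (e m)) (\<lambda>j. if v j \<in> A1 then \<nu> (w p) * \<mu> (w p) (v j) else 0)
    else W_mod (\<lambda>m. a (w p) (e m)))"

definition ups :: "nat \<Rightarrow> nat \<Rightarrow> 'k" where "ups j m = gam (v j) 1 (e m)"

definition target :: "('k, (nat \<Rightarrow> nat \<Rightarrow>\<^sub>0 'k) \<times> 'k vg) lie"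
  where "target = semidirect (direct_sum_module {1..Q} Umod) (V_gab M N ups)"

lemma mscale_Umod [simp]: "mscale (Umod p) = pm_scale"
  by (simp add: Umod_def W_mod_def W'_mod_def)

lemma mcar_Umod [simp]: "mcar (Umod p) = free_on {1..}"
  by (simp add: Umod_def W_mod_def W'_mod_def)

definition Epart :: "('i \<times> nat \<Rightarrow>\<^sub>0 'k) \<Rightarrow> nat \<times> nat \<Rightarrow>\<^sub>0 'k"
  where "Epart c = (\<Sum>m\<in>{1..M}. col m (\<Sum>j\<in>{j \<in> A0. r j = e m}. pm_scale (l j) (row j c)))"

definition Vpart :: "('i \<times> nat \<Rightarrow>\<^sub>0 'k) \<Rightarrow> nat \<Rightarrow> nat \<Rightarrow>\<^sub>0 'k"
  where "Vpart c j = (if j \<in> {1..N} then scaled (sc (v j)) (row (v j) c) else 0)"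

definition Wpart :: "('i \<times> nat \<Rightarrow>\<^sub>0 'k) \<Rightarrow> nat \<Rightarrow> nat \<Rightarrow>\<^sub>0 'k"
  where "Wpart c p = (if p \<in> {1..Q} then scaled (sc (w p)) (row (w p) c) else 0)"

lemma lookup_Epart: "Poly_Mapping.lookup (Epart c) (m, n) = (if m \<in> {1..M} then ecoord c (e m) n else 0)"
  by (simp add: Epart_def lookup_sum ecoord_def)

lemma lookup_act_Epart:
  "Poly_Mapping.lookup (act g (Epart c) u) n =
    (\<Sum>k\<le>n. \<Sum>m\<in>{1..M}. g k m * ecoord c (e m) (n - k) * Poly_Mapping.lookup u k)"
proof -
  have "Epart c \<in> free_on ({1..M} \<times> UNIV)" by (rule free_onI_pair) (auto simp: lookup_Epart)
  then show ?thesis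
    by (subst lookup_act [of "{1..M}"]) (auto simp: conv_def lookup_Epart intro!: sum.cong)
qed

lemma lookup_act_gam:
  "Poly_Mapping.lookup (act (\<lambda>k m. gam i k (e m)) (Epart c) (scaled (sc i) (row i d))) n =
    (\<Sum>k\<le>n. \<Sum>\<rho>\<in>r ` A0. gam i k \<rho> * ecoord c \<rho> (n - k) * (sc i k * Poly_Mapping.lookup d (i, k)))"
  unfolding lookup_act_Epart
  by (rule sum.cong [OF refl])
     (use sum.reindex_bij_betw [OF e] in \<open>simp\<close>)

lemma v_mem: "j \<in> {1..N} \<Longrightarrow> v j \<in> VV" and w_mem: "p \<in> {1..Q} \<Longrightarrow> w p \<in> WW"
  and e_mem: "m \<in> {1..M} \<Longrightarrow> e m \<in> r ` A0"
  using v w e by (auto simp: bij_betw_def)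

lemma mact_Umod:
  assumes c: "c \<in> free_on (Z \<times> {1..})" and d: "d \<in> free_on (Z \<times> {1..})" and p: "p \<in> {1..Q}"
  shows "Poly_Mapping.lookup (mact (Umod p) (Vpart c, Epart c) (Wpart d p)) n =
    sc (w p) n * conv Z (\<lambda>k. lam k (w p)) (Poly_Mapping.lookup c) (\<lambda>k. Poly_Mapping.lookup d (w p, k)) n"
proof -
  let ?i = "w p"
  have i: "?i \<in> WW" "?i \<in> Z" using w_mem [OF p] Z_split by auto
  show ?thesis
  proof (cases "?i \<in> AJ")
    case False
    then have i1: "?i \<in> A1" "\<nu> ?i = 0" using i by (auto simp: WW_def)
    have "(\<lambda>k m. if k = 1 then a ?i (e m) else 0) = (\<lambda>k m. gam ?i k (e m))"
      using i1 disj by (auto simp: gam_def fun_eq_iff)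
    then show ?thesis
      using False p conv_new_basis [OF c d i(2), of n]
      by (simp add: Umod_def W_mod_act Wpart_def lookup_act_gam mpart_def)
  next
    case True
    have \<nu>: "\<nu> ?i \<noteq> 0" "sc ?i 1 = 1 / \<nu> ?i" using True \<nu>J disj by (auto simp: sc_def)
    have g: "(\<lambda>k m. gam ?i 1 (e m)) = (\<lambda>k m. gam ?i k (e m))"
    proof (intro ext)
      fix k m show "gam ?i 1 (e m) = gam ?i k (e m)" using gam_constant [of ?i k "e m"] True by simp
    qed
    let ?s = "\<lambda>j. \<mu> ?i j * (sc j (n - 1) * Poly_Mapping.lookup c (j, n - 1)) * Poly_Mapping.lookup d (?i, 1)"
    have "Poly_Mapping.lookup (\<Sum>j\<in>{1..N}. bilin (\<lambda>k l. if l = 1 then Poly_Mapping.single (k + 1)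
          (if v j \<in> A1 then \<nu> ?i * \<mu> ?i (v j) else 0) else 0) (Vpart c j) (Wpart d p)) n =
        (\<Sum>j\<in>{1..N}. if v j \<in> A1 then ?s (v j) else 0)"
      unfolding lookup_sum
    proof (rule sum.cong [OF refl])
      fix j assume j: "j \<in> {1..N}"
      show "Poly_Mapping.lookup (bilin (\<lambda>k l. if l = 1 then Poly_Mapping.single (k + 1)
          (if v j \<in> A1 then \<nu> ?i * \<mu> ?i (v j) else 0) else 0) (Vpart c j) (Wpart d p)) n =
          (if v j \<in> A1 then ?s (v j) else 0)"
        unfolding lookup_bilin_shift using j p \<nu> free_on_lookup_0(1) [OF c, of "v j"]
        by (cases n) (simp_all add: Vpart_def Wpart_def)
    qed
    also have "\<dots> = (\<Sum>j\<in>VV. if j \<in> A1 then ?s j else 0)"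
      by (rule sum.reindex_bij_betw [OF v])
    also have "\<dots> = (\<Sum>j\<in>{j \<in> A1. \<nu> j \<noteq> 0}. ?s j)"
      using finite_A disj by (intro sum.mono_neutral_cong_right) (auto simp: VV_def)
    also have "\<dots> = mpart ?i c (\<lambda>k. Poly_Mapping.lookup d (?i, k)) n"
      using True by (simp add: mpart_def sum_distrib_right)
    finally show ?thesis
      using True p conv_new_basis [OF c d i(2), of n]
      by (simp add: Umod_def W'_mod_act lookup_add g) (simp add: Wpart_def lookup_act_gam)
  qed
qed

lemma mact_V_mod:
  assumes c: "c \<in> free_on (Z \<times> {1..})" and d: "d \<in> free_on (Z \<times> {1..})" and j: "j \<in> {1..N}"
  shows "Poly_Mapping.lookup (mact (V_mod (ups j)) (Epart c) (Vpart d j)) n =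
    sc (v j) n * conv Z (\<lambda>k. lam k (v j)) (Poly_Mapping.lookup c) (\<lambda>k. Poly_Mapping.lookup d (v j, k)) n"
proof -
  let ?i = "v j"
  have i: "?i \<in> VV" "?i \<in> Z" "?i \<notin> AJ" using v_mem [OF j] Z_split disj by (auto simp: VV_def)
  have g: "(\<lambda>k. ups j) = (\<lambda>k m. gam ?i k (e m))"
  proof (intro ext)
    fix k m show "ups j m = gam ?i k (e m)" using gam_constant [of ?i k "e m"] i by (simp add: ups_def)
  qed
  show ?thesis
    unfolding V_mod_act g using i(3) j conv_new_basis [OF c d i(2), of n]
    by (simp add: Vpart_def lookup_act_gam mpart_def)
qed

text \<open>Summed over a block, the product becomes the convolution of the two sequences of block
  sums. This is symmetric, so the quotient by the modules is abelian.\<close>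

lemma ecoord_bracket:
  assumes c: "c \<in> free_on (Z \<times> {1..})" and d: "d \<in> free_on (Z \<times> {1..})" and \<rho>: "\<rho> \<in> r ` A0"
  shows "ecoord (star lam c d - star lam d c) \<rho> n = 0"
proof -
  have fin: "finite Z" using finite_A by simp
  have half: "(\<Sum>j\<in>{j \<in> A0. r j = \<rho>}. sc j n * conv Z (\<lambda>k. lam k j) (Poly_Mapping.lookup c) (\<lambda>k. Poly_Mapping.lookup d (j, k)) n)
      = (\<Sum>k\<le>n. ecoord c \<rho> (n - k) * ecoord d \<rho> k)"
    if c: "c \<in> free_on (Z \<times> {1..})" and d: "d \<in> free_on (Z \<times> {1..})" for c d
  proof -
    have "(\<Sum>j\<in>{j \<in> A0. r j = \<rho>}. sc j n * conv Z (\<lambda>k. lam k j) (Poly_Mapping.lookup c) (\<lambda>k. Poly_Mapping.lookup d (j, k)) n)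
        = (\<Sum>j\<in>{j \<in> A0. r j = \<rho>}. \<Sum>k\<le>n. ecoord c \<rho> (n - k) * (l j * Poly_Mapping.lookup d (j, k)))"
    proof (rule sum.cong [OF refl])
      fix j assume j: "j \<in> {j \<in> A0. r j = \<rho>}"
      then have jZ: "j \<in> Z" "j \<in> A0" "j \<notin> AJ" using disj by auto
      have "(\<Sum>\<rho>'\<in>r ` A0. gam j k \<rho>' * ecoord c \<rho>' (n - k) * (sc j k * Poly_Mapping.lookup d (j, k))) =
          ecoord c \<rho> (n - k) * (l j * Poly_Mapping.lookup d (j, k))" for k
      proof -
        have "(\<Sum>\<rho>'\<in>r ` A0. gam j k \<rho>' * ecoord c \<rho>' (n - k) * (sc j k * Poly_Mapping.lookup d (j, k))) =
            (\<Sum>\<rho>'\<in>r ` A0. if \<rho>' = \<rho> then ecoord c \<rho>' (n - k) * (l j * Poly_Mapping.lookup d (j, k)) else 0)"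
          using j by (intro sum.cong refl) (auto simp: gam_def sc_def)
        then show ?thesis using \<rho> finite_A by simp
      qed
      then show "sc j n * conv Z (\<lambda>k. lam k j) (Poly_Mapping.lookup c) (\<lambda>k. Poly_Mapping.lookup d (j, k)) n =
          (\<Sum>k\<le>n. ecoord c \<rho> (n - k) * (l j * Poly_Mapping.lookup d (j, k)))"
        unfolding conv_new_basis [OF c d jZ(1)] using jZ(3) by (simp add: mpart_def)
    qed
    also have "\<dots> = (\<Sum>k\<le>n. ecoord c \<rho> (n - k) * ecoord d \<rho> k)"
      by (subst sum.swap) (simp add: ecoord_def [of d] sum_distrib_left)
    finally show ?thesis .
  qed
  have "ecoord (star lam c d - star lam d c) \<rho> n =
      (\<Sum>j\<in>{j \<in> A0. r j = \<rho>}. sc j n * conv Z (\<lambda>k. lam k j) (Poly_Mapping.lookup c) (\<lambda>k. Poly_Mapping.lookup d (j, k)) n) -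
      (\<Sum>j\<in>{j \<in> A0. r j = \<rho>}. sc j n * conv Z (\<lambda>k. lam k j) (Poly_Mapping.lookup d) (\<lambda>k. Poly_Mapping.lookup c (j, k)) n)"
    unfolding ecoord_def sum_subtractf [symmetric] lookup_lam_bracket [OF fin c d]
    by (intro sum.cong refl) (auto simp: sc_def algebra_simps)
  also have "\<dots> = (\<Sum>k\<le>n. ecoord c \<rho> (n - k) * ecoord d \<rho> k) - (\<Sum>k\<le>n. ecoord d \<rho> (n - k) * ecoord c \<rho> k)"
    by (simp only: half c d)
  also have "(\<Sum>k\<le>n. ecoord d \<rho> (n - k) * ecoord c \<rho> k) = (\<Sum>k\<le>n. ecoord c \<rho> (n - k) * ecoord d \<rho> k)"
    by (rule sum.reindex_bij_witness [of _ "\<lambda>k. n - k" "\<lambda>k. n - k"]) auto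
  finally show ?thesis by simp
qed

definition Phi :: "('i \<times> nat \<Rightarrow>\<^sub>0 'k) \<Rightarrow> (nat \<Rightarrow> nat \<Rightarrow>\<^sub>0 'k) \<times> 'k vg"
  where "Phi c = (Wpart c, (Vpart c, Epart c))"

lemma target_simps:
  "lcar target = {u. (\<forall>p\<in>{1..Q}. u p \<in> free_on {1..}) \<and> (\<forall>p. p \<notin> {1..Q} \<longrightarrow> u p = 0) \<and> finite {p. u p \<noteq> 0}} \<times>
    ({u. (\<forall>j\<in>{1..N}. u j \<in> free_on {1..}) \<and> (\<forall>j. j \<notin> {1..N} \<longrightarrow> u j = 0) \<and> finite {j. u j \<noteq> 0}} \<times>
      free_on ({1..M} \<times> {1..}))"
  "lscale target = (\<lambda>c (u, x). ((\<lambda>p. pm_scale c (u p)), case x of (u, x) \<Rightarrow> ((\<lambda>p. pm_scale c (u p)), pm_scale c x)))"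
  "lbr target (W, (V, E)) (W', (V', E')) =
    ((\<lambda>p. mact (Umod p) (V, E) (W' p)) - (\<lambda>p. mact (Umod p) (V', E') (W p)),
     ((\<lambda>j. mact (V_mod (ups j)) E (V' j)) - (\<lambda>j. mact (V_mod (ups j)) E' (V j)), 0))"
  by (auto simp: target_def semidirect_def direct_sum_module_def V_gab_def V_mod_def g_ab_def fun_eq_iff)

lemma scaled_row_free: "c \<in> free_on (Z \<times> {1..}) \<Longrightarrow> scaled s (row i c) \<in> free_on {1..}"
  by (auto simp: free_on_iff)

lemma ecoord_0: "c \<in> free_on (Z \<times> {1..}) \<Longrightarrow> ecoord c \<rho> 0 = 0"
  by (simp add: ecoord_def free_on_lookup_0(1))

lemma Phi_mem:
  assumes c: "c \<in> free_on (Z \<times> {1..})" shows "Phi c \<in> lcar target"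
proof -
  have "Epart c \<in> free_on ({1..M} \<times> {1..})"
  proof (rule free_onI_pair)
    fix m and n :: nat assume "(m, n) \<notin> {1..M} \<times> {1..}"
    then have "m \<notin> {1..M} \<or> n = 0" by auto
    then show "Poly_Mapping.lookup (Epart c) (m, n) = 0"
      using ecoord_0 [OF c] by (auto simp: lookup_Epart)
  qed
  moreover have "finite {p. Wpart c p \<noteq> 0}" "finite {j. Vpart c j \<noteq> 0}"
    by (rule finite_subset [of _ "{1..Q}"]; auto simp: Wpart_def)
       (rule finite_subset [of _ "{1..N}"]; auto simp: Vpart_def)
  ultimately show ?thesis
    using scaled_row_free [OF c] by (simp add: Phi_def target_simps Wpart_def Vpart_def)
qed

lemma Phi_bracket:
  assumes c: "c \<in> free_on (Z \<times> {1..})" and d: "d \<in> free_on (Z \<times> {1..})"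
  shows "Phi (star lam c d - star lam d c) = lbr target (Phi c) (Phi d)"
proof -
  let ?b = "star lam c d - star lam d c"
  have fin: "finite Z" using finite_A by simp
  have zero: "mact (Umod p) x 0 = 0" for p x
    by (cases x) (simp add: Umod_def W_mod_def W'_mod_def bilin_def)
  have "Wpart ?b = (\<lambda>p. mact (Umod p) (Vpart c, Epart c) (Wpart d p)) - (\<lambda>p. mact (Umod p) (Vpart d, Epart d) (Wpart c p))"
  proof
    fix p
    show "Wpart ?b p = ((\<lambda>p. mact (Umod p) (Vpart c, Epart c) (Wpart d p)) - (\<lambda>p. mact (Umod p) (Vpart d, Epart d) (Wpart c p))) p"
    proof (cases "p \<in> {1..Q}")
      case True
      have "Poly_Mapping.lookup (Wpart ?b p) n = Poly_Mapping.lookup (mact (Umod p) (Vpart c, Epart c) (Wpart d p)) n -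
          Poly_Mapping.lookup (mact (Umod p) (Vpart d, Epart d) (Wpart c p)) n" for n
        unfolding mact_Umod [OF c d True] mact_Umod [OF d c True] right_diff_distrib [symmetric]
          lookup_lam_bracket [OF fin c d, symmetric] using True by (simp add: Wpart_def)
      then show ?thesis by (intro poly_mapping_eqI) (simp add: lookup_minus)
    next
      case False
      then have "Wpart x p = 0" for x by (simp only: Wpart_def if_False)
      then show ?thesis by (simp add: zero)
    qed
  qed
  moreover have "Vpart ?b = (\<lambda>j. mact (V_mod (ups j)) (Epart c) (Vpart d j)) - (\<lambda>j. mact (V_mod (ups j)) (Epart d) (Vpart c j))"
  proof
    fix j
    show "Vpart ?b j = ((\<lambda>j. mact (V_mod (ups j)) (Epart c) (Vpart d j)) - (\<lambda>j. mact (V_mod (ups j)) (Epart d) (Vpart c j))) j"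
    proof (cases "j \<in> {1..N}")
      case True
      have "Poly_Mapping.lookup (Vpart ?b j) n = Poly_Mapping.lookup (mact (V_mod (ups j)) (Epart c) (Vpart d j)) n -
          Poly_Mapping.lookup (mact (V_mod (ups j)) (Epart d) (Vpart c j)) n" for n
        unfolding mact_V_mod [OF c d True] mact_V_mod [OF d c True] right_diff_distrib [symmetric]
          lookup_lam_bracket [OF fin c d, symmetric] using True by (simp add: Vpart_def)
      then show ?thesis by (intro poly_mapping_eqI) (simp add: lookup_minus)
    next
      case False
      then have "Vpart x j = 0" for x by (simp only: Vpart_def if_False)
      then show ?thesis by (simp add: V_mod_def bilin_def)
    qed
  qed
  moreover have "Epart ?b = 0"
    by (rule poly_mapping_eqI_pair) (simp add: lookup_Epart ecoord_bracket [OF c d e_mem])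
  ultimately show ?thesis by (simp add: Phi_def target_simps)
qed

text \<open>The coordinate change is triangular: outside \<open>R0\<close> the coordinates are only
  rescaled, and at a representative the block sum together with the other coordinates of the block
  determines the missing one.\<close>

lemma Phi_inj:
  assumes eq: "Phi c = Phi d" and c: "c \<in> free_on (Z \<times> {1..})" and d: "d \<in> free_on (Z \<times> {1..})"
  shows "c = d"
proof (rule poly_mapping_eqI_pair)
  fix i n
  have W: "Wpart c = Wpart d" and V: "Vpart c = Vpart d" and E: "Epart c = Epart d"
    using eq by (auto simp: Phi_def)
  have other: "Poly_Mapping.lookup c (i, n) = Poly_Mapping.lookup d (i, n)" if "i \<in> VV \<union> WW" for i n
  proof -
    have nz: "sc i n \<noteq> 0" using that Z_split by (intro sc_nonzero) auto
    from that show ?thesis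
    proof
      assume "i \<in> VV"
      then obtain j where j: "j \<in> {1..N}" "i = v j" using v unfolding bij_betw_def by blast
      have "Poly_Mapping.lookup (Vpart c j) n = Poly_Mapping.lookup (Vpart d j) n" by (simp add: V)
      then show ?thesis using j nz by (simp add: Vpart_def)
    next
      assume "i \<in> WW"
      then obtain j where j: "j \<in> {1..Q}" "i = w j" using w unfolding bij_betw_def by blast
      have "Poly_Mapping.lookup (Wpart c j) n = Poly_Mapping.lookup (Wpart d j) n" by (simp add: W)
      then show ?thesis using j nz by (simp add: Wpart_def)
    qed
  qed
  show "Poly_Mapping.lookup c (i, n) = Poly_Mapping.lookup d (i, n)"
  proof (cases "i \<in> R0")
    case True
    then have i: "i \<in> A0" "rep (r i) = i" using rep by (auto simp: R0_def)
    have "r i \<in> e ` {1..M}" using e i(1) by (simp add: bij_betw_def)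
    then obtain m where m: "m \<in> {1..M}" "e m = r i" by (metis imageE)
    have "Poly_Mapping.lookup (Epart c) (m, n) = Poly_Mapping.lookup (Epart d) (m, n)" by (simp add: E)
    then have ec: "ecoord c (r i) n = ecoord d (r i) n" using m by (simp add: lookup_Epart)
    let ?C = "{j \<in> A0. r j = r i}"
    have "(\<Sum>j\<in>?C - {i}. l j * Poly_Mapping.lookup c (j, n)) = (\<Sum>j\<in>?C - {i}. l j * Poly_Mapping.lookup d (j, n))"
    proof (rule sum.cong [OF refl])
      fix j assume j: "j \<in> ?C - {i}"
      then have "j \<notin> R0" using R0_class [OF i(1)] i(2) by auto
      then have "j \<in> VV \<union> WW" using j Z_split by auto
      then show "l j * Poly_Mapping.lookup c (j, n) = l j * Poly_Mapping.lookup d (j, n)" using other by simp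
    qed
    moreover have "finite ?C" "i \<in> ?C" using finite_A i by auto
    ultimately have "l i * Poly_Mapping.lookup c (i, n) = l i * Poly_Mapping.lookup d (i, n)"
      using ec unfolding ecoord_def by (simp add: sum.remove [of ?C i])
    then show ?thesis using l [OF i(1)] by simp
  next
    case False
    show ?thesis
    proof (cases "i \<in> Z")
      case True
      then show ?thesis using False Z_split(1) by (intro other) auto
    next
      case False
      then show ?thesis using free_on_lookup_0(2) [OF c] free_on_lookup_0(2) [OF d] by simp
    qed
  qed
qed

lemma Phi_surj:
  assumes T: "T \<in> lcar target"
  shows "\<exists>c\<in>free_on (Z \<times> {1..}). Phi c = T"
proof -
  obtain W V E where TT: "T = (W, (V, E))" by (cases T) auto
  have W: "\<And>p. p \<in> {1..Q} \<Longrightarrow> W p \<in> free_on {1..}" "\<And>p. p \<notin> {1..Q} \<Longrightarrow> W p = 0"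
    and V: "\<And>p. p \<in> {1..N} \<Longrightarrow> V p \<in> free_on {1..}" "\<And>p. p \<notin> {1..N} \<Longrightarrow> V p = 0"
    and E: "E \<in> free_on ({1..M} \<times> {1..})"
    using T by (auto simp: TT target_simps)
  define vi where "vi = inv_into {1..N} v"
  define wi where "wi = inv_into {1..Q} w"
  define ei where "ei = inv_into {1..M} e"
  have vi: "vi (v j) = j" if "j \<in> {1..N}" for j using v that by (simp add: vi_def bij_betw_def)
  have vi_mem: "vi i \<in> {1..N}" if "i \<in> VV" for i
    using v that unfolding vi_def bij_betw_def by (metis inv_into_into)
  have wi: "wi (w j) = j" if "j \<in> {1..Q}" for j using w that by (simp add: wi_def bij_betw_def)
  have wi_mem: "wi i \<in> {1..Q}" if "i \<in> WW" for i
    using w that unfolding wi_def bij_betw_def by (metis inv_into_into)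
  have ei: "ei (e j) = j" if "j \<in> {1..M}" for j using e that by (simp add: ei_def bij_betw_def)
  \<comment> \<open>The triangular system solved: at a representative, the other summands of the
    block, already scaled to values of \<open>V\<close>, are subtracted from the coordinate in
    \<open>E\<close>.\<close>
  define C where "C = (\<lambda>(i, k). if i \<in> VV then Poly_Mapping.lookup (V (vi i)) k / sc i k
    else if i \<in> WW then Poly_Mapping.lookup (W (wi i)) k / sc i k
    else if i \<in> R0 then (Poly_Mapping.lookup E (ei (r i), k) -
      (\<Sum>j\<in>{j \<in> A0. r j = r i} - {i}. Poly_Mapping.lookup (V (vi j)) k)) / l i else 0)"
  let ?K = "(\<Union>j\<in>{1..N}. Poly_Mapping.keys (V j)) \<union> (\<Union>p\<in>{1..Q}. Poly_Mapping.keys (W p)) \<union> snd ` Poly_Mapping.keys E"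
  have nonrep: "j \<in> VV" if "i \<in> R0" "j \<in> {j \<in> A0. r j = r i} - {i}" for i j
  proof -
    have "i \<in> A0" "rep (r i) = i" using that(1) rep by (auto simp: R0_def)
    then have "j \<notin> R0" using R0_class [of i] that(2) by auto
    then show ?thesis using that(2) by (auto simp: VV_def)
  qed
  have supp: "C (i, k) = 0" if "i \<notin> Z \<or> k \<notin> ?K" for i k
  proof (cases "i \<in> Z")
    case False
    then show ?thesis using Z_split by (auto simp: C_def)
  next
    case True
    with that have k: "k \<notin> ?K" by auto
    then have k1: "Poly_Mapping.lookup (V j) k = 0" if "j \<in> {1..N}" for j using that by (auto simp: in_keys_iff)
    have k2: "Poly_Mapping.lookup (W j) k = 0" if "j \<in> {1..Q}" for j using that k by (auto simp: in_keys_iff)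
    have k3: "Poly_Mapping.lookup E (m, k) = 0" for m
    proof (rule ccontr)
      assume "Poly_Mapping.lookup E (m, k) \<noteq> 0"
      then have "(m, k) \<in> Poly_Mapping.keys E" by (simp add: in_keys_iff)
      then have "k \<in> snd ` Poly_Mapping.keys E" by (metis imageI snd_conv)
      with k show False by blast
    qed
    have "(\<Sum>j\<in>{j \<in> A0. r j = r i} - {i}. Poly_Mapping.lookup (V (vi j)) k) = 0" if "i \<in> R0"
      using nonrep [OF that] vi_mem k1 by (intro sum.neutral) blast
    then show ?thesis using k1 [OF vi_mem] k2 [OF wi_mem] k3 by (auto simp: C_def)
  qed
  have "finite {p. C p \<noteq> 0}"
  proof (rule finite_subset)
    show "{p. C p \<noteq> 0} \<subseteq> Z \<times> ?K"
    proof
      fix p assume p: "p \<in> {p. C p \<noteq> 0}"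
      obtain i k where ik: "p = (i, k)" by (cases p)
      show "p \<in> Z \<times> ?K" using p supp [of i k] unfolding ik by blast
    qed
  qed (use finite_A in simp)
  define c where "c = Abs_poly_mapping C"
  have c: "Poly_Mapping.lookup c = C"
    unfolding c_def using \<open>finite {p. C p \<noteq> 0}\<close> by simp
  have C0: "C (i, 0) = 0" for i
  proof (rule supp)
    have "0 \<notin> Poly_Mapping.keys (V j)" if "j \<in> {1..N}" for j
      using keys_free_on [OF V(1) [OF that]] by auto
    moreover have "0 \<notin> Poly_Mapping.keys (W j)" if "j \<in> {1..Q}" for j
      using keys_free_on [OF W(1) [OF that]] by auto
    moreover have "0 \<notin> snd ` Poly_Mapping.keys E"
      using keys_free_on [OF E] by auto
    ultimately have "0 \<notin> ?K" by blast
    then show "i \<notin> Z \<or> 0 \<notin> ?K" by blast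
  qed
  have mem: "c \<in> free_on (Z \<times> {1..})"
  proof (rule free_onI_pair)
    fix i and k :: nat assume "(i, k) \<notin> Z \<times> {1..}"
    then have "i \<notin> Z \<or> k = 0" by auto
    then show "Poly_Mapping.lookup c (i, k) = 0" using C0 supp [of i k] unfolding c by blast
  qed
  have "Wpart c = W"
  proof
    fix p show "Wpart c p = W p"
    proof (cases "p \<in> {1..Q}")
      case True
      have "w p \<in> WW" "w p \<notin> VV" "sc (w p) k \<noteq> 0" for k
        using w_mem [OF True] Z_split sc_nonzero by auto
      then show ?thesis using True
        by (intro poly_mapping_eqI) (simp add: Wpart_def c C_def wi)
    next
      case False
      show ?thesis unfolding Wpart_def if_not_P [OF False] W(2) [OF False] ..
    qed
  qed
  moreover have "Vpart c = V"
  proof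
    fix p show "Vpart c p = V p"
    proof (cases "p \<in> {1..N}")
      case True
      have "v p \<in> VV" "sc (v p) k \<noteq> 0" for k
        using v_mem [OF True] Z_split sc_nonzero by auto
      then show ?thesis using True
        by (intro poly_mapping_eqI) (simp add: Vpart_def c C_def vi)
    next
      case False
      show ?thesis unfolding Vpart_def if_not_P [OF False] V(2) [OF False] ..
    qed
  qed
  moreover have "Epart c = E"
  proof (rule poly_mapping_eqI_pair)
    fix m k
    show "Poly_Mapping.lookup (Epart c) (m, k) = Poly_Mapping.lookup E (m, k)"
    proof (cases "m \<in> {1..M}")
      case True
      then obtain x where x: "x \<in> A0" "e m = r x" using e_mem by blast
      let ?i = "rep (r x)"
      have i: "?i \<in> A0" "r ?i = r x" "?i \<in> R0" using rep [OF x(1)] x(1) by (auto simp: R0_def)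
      let ?D = "{j \<in> A0. r j = r x}"
      have "ecoord c (e m) k = l ?i * C (?i, k) + (\<Sum>j\<in>?D - {?i}. l j * C (j, k))"
        unfolding ecoord_def x(2) c using i finite_A by (subst sum.remove [of _ ?i]) auto
      also have "(\<Sum>j\<in>?D - {?i}. l j * C (j, k)) = (\<Sum>j\<in>?D - {?i}. Poly_Mapping.lookup (V (vi j)) k)"
      proof (rule sum.cong [OF refl])
        fix j assume j: "j \<in> ?D - {?i}"
        then have "j \<in> VV" using nonrep [OF i(3), of j] i(2) by simp
        then show "l j * C (j, k) = Poly_Mapping.lookup (V (vi j)) k"
          using j l by (auto simp: C_def sc_def)
      qed
      also have "l ?i * C (?i, k) = Poly_Mapping.lookup E (m, k) - (\<Sum>j\<in>?D - {?i}. Poly_Mapping.lookup (V (vi j)) k)"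
        using i Z_split l [OF i(1)] ei [OF True] x(2) by (auto simp: C_def)
      finally show ?thesis using True by (simp add: lookup_Epart)
    next
      case False
      then have "(m, k) \<notin> {1..M} \<times> {1..}" by blast
      then have "Poly_Mapping.lookup E (m, k) = 0" using E unfolding free_on_iff by blast
      then show ?thesis unfolding lookup_Epart if_not_P [OF False] by simp
    qed
  qed
  ultimately show ?thesis using mem by (auto simp: Phi_def TT)
qed

lemma lie_bij_Phi: "lie_bij Phi (lam_lie Z lam) target"
  unfolding lie_bij_def lam_lie_simps
proof (intro conjI ballI allI)
  show "bij_betw Phi (free_on (Z \<times> {1..})) (lcar target)"
    unfolding bij_betw_def using Phi_inj Phi_mem Phi_surj by (auto intro!: inj_onI) (metis imageI)
  fix c d :: "'i \<times> nat \<Rightarrow>\<^sub>0 'k"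
  assume "c \<in> free_on (Z \<times> {1..})" "d \<in> free_on (Z \<times> {1..})"
  then show "Phi (star lam c d - star lam d c) = lbr target (Phi c) (Phi d)" by (rule Phi_bracket)
  have "ecoord (c + d) \<rho> n = ecoord c \<rho> n + ecoord d \<rho> n" for \<rho> n
    by (simp add: ecoord_def lookup_add algebra_simps sum.distrib)
  then have "Epart (c + d) = Epart c + Epart d"
    by (intro poly_mapping_eqI_pair) (simp add: lookup_Epart lookup_add)
  moreover have "Wpart (c + d) = Wpart c + Wpart d" "Vpart (c + d) = Vpart c + Vpart d"
    by (auto simp: fun_eq_iff Wpart_def Vpart_def lookup_add algebra_simps intro!: poly_mapping_eqI)
  ultimately show "Phi (c + d) = Phi c + Phi d" by (simp add: Phi_def)
next
  fix s and c :: "'i \<times> nat \<Rightarrow>\<^sub>0 'k"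
  have "ecoord (pm_scale s c) \<rho> n = s * ecoord c \<rho> n" for \<rho> n
    by (simp add: ecoord_def algebra_simps sum_distrib_left)
  then have "Epart (pm_scale s c) = pm_scale s (Epart c)"
    by (intro poly_mapping_eqI_pair) (simp add: lookup_Epart)
  moreover have "Wpart (pm_scale s c) = (\<lambda>p. pm_scale s (Wpart c p))"
    "Vpart (pm_scale s c) = (\<lambda>p. pm_scale s (Vpart c p))"
    by (auto simp: fun_eq_iff Wpart_def Vpart_def algebra_simps intro!: poly_mapping_eqI)
  ultimately show "Phi (pm_scale s c) = lscale target s (Phi c)" by (simp add: Phi_def target_simps)
qed

lemma vector_space_pointwise: "vector_space (\<lambda>c (u :: 'z \<Rightarrow> nat \<Rightarrow>\<^sub>0 'k) p. pm_scale c (u p))"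
  by unfold_locales (auto simp: fun_eq_iff pm_scale_add pm_scale_add_left pm_scale_pm_scale)

lemma subspace_pointwise:
  "module.subspace (\<lambda>c (u :: nat \<Rightarrow> nat \<Rightarrow>\<^sub>0 'k) p. pm_scale c (u p))
    {u. (\<forall>p\<in>P. u p \<in> free_on {1..}) \<and> (\<forall>p. p \<notin> P \<longrightarrow> u p = 0) \<and> finite {p. u p \<noteq> 0}}"
proof -
  interpret vector_space "\<lambda>c (u :: nat \<Rightarrow> nat \<Rightarrow>\<^sub>0 'k) p. pm_scale c (u p)" by (rule vector_space_pointwise)
  have "finite {p. u p + v p \<noteq> 0}" if "finite {p. u p \<noteq> 0}" "finite {p. v p \<noteq> 0}" for u v :: "nat \<Rightarrow> nat \<Rightarrow>\<^sub>0 'k"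
    by (rule finite_subset [of _ "{p. u p \<noteq> 0} \<union> {p. v p \<noteq> 0}"]) (use that in auto)
  moreover have "finite {p. pm_scale c (u p) \<noteq> 0}" if "finite {p. u p \<noteq> 0}" for c and u :: "nat \<Rightarrow> nat \<Rightarrow>\<^sub>0 'k"
    by (rule finite_subset [of _ "{p. u p \<noteq> 0}"]) (use that in auto)
  ultimately show ?thesis
    by (auto simp: subspace_def intro!: free_on_add free_on_scale)
qed

lemma lie_iso_target: "lie_iso (lam_lie Z lam) target"
proof (rule lie_iso_codomain)
  show "lie_algebra (lam_lie Z lam)" using finite_A module_constants by (intro lie_algebra_lam_lie) auto
  show "lie_bij Phi (lam_lie Z lam) target" by (rule lie_bij_Phi)
  show "vector_space (lscale target)"
    unfolding target_simps by (intro vector_space_prod_scale vector_space_pointwise vector_space_pm_scale)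
  show "module.subspace (lscale target) (lcar target)"
    unfolding target_simps
    by (intro subspace_prod_scale vector_space_prod_scale vector_space_pointwise vector_space_pm_scale
        subspace_pointwise subspace_free_on)
qed

text \<open>The compatibility required of W' comes from the definition of J_1: where \<mu> is
  nonzero, the vertex of \<open>A1\<close> has \<nu> = 1 and the same exponents, so both modules
  have the same weight.\<close>

lemma Umod_form:
  assumes "p \<in> {1..Q}"
  shows "(\<exists>\<nu>. Umod p = W_mod \<nu>) \<or> (\<exists>\<nu> \<mu>. (\<forall>i\<in>{1..M}. \<forall>j\<in>{1..N}. \<mu> j * (\<nu> i - ups j i) = 0) \<and> Umod p = W'_mod N \<nu> \<mu>)"
proof (cases "w p \<in> AJ")
  case False
  then show ?thesis by (auto simp: Umod_def)
next
  case True
  let ?\<mu> = "\<lambda>j. if v j \<in> A1 then \<nu> (w p) * \<mu> (w p) (v j) else 0"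
  have zero: "?\<mu> j * (gam (w p) 1 (e m) - ups j m) = 0" if m: "m \<in> {1..M}" for m j
  proof (cases "v j \<in> A1 \<and> \<mu> (w p) (v j) \<noteq> 0")
    case T: True
    obtain x where "x \<in> A0" "e m = r x" using e_mem [OF m] by blast
    then have "a (v j) (e m) = a (w p) (e m)" "\<nu> (v j) = 1" using \<mu> True T by auto
    then show ?thesis using T True disj by (auto simp: gam_def ups_def)
  qed auto
  have "Umod p = W'_mod N (\<lambda>m. gam (w p) 1 (e m)) ?\<mu>"
    using True assms by (simp only: Umod_def simp_thms if_True)
  moreover have "\<forall>i\<in>{1..M}. \<forall>j\<in>{1..N}. ?\<mu> j * (gam (w p) 1 (e i) - ups j i) = 0"
    using zero by (intro ballI)
  ultimately show ?thesis
    by (intro disjI2 exI [of _ "\<lambda>m. gam (w p) 1 (e m)"] exI [of _ ?\<mu>] conjI)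
qed

end

lemma abelian_form_lam_lie: "abelian_form (lam_lie Z lam)"
proof -
  have fin: "finite (r ` A0)" "finite VV" "finite WW" using finite_A by (auto simp: VV_def WW_def)
  obtain e where e: "bij_betw e {1..card (r ` A0)} (r ` A0)" using ex_bij_betw_nat_finite_1 [OF fin(1)] by blast
  obtain v where v: "bij_betw v {1..card VV} VV" using ex_bij_betw_nat_finite_1 [OF fin(2)] by blast
  obtain w where w: "bij_betw w {1..card WW} WW" using ex_bij_betw_nat_finite_1 [OF fin(3)] by blast
  show ?thesis
    unfolding abelian_form_def
    using Umod_form [OF e v w] lie_iso_target [OF e v w] unfolding target_def [OF e v w] by blast
qed

end

section \<open>Extension vertices\<close>

lemma affine_expand:
  fixes f :: "('i, 'k::field_char_0) mfps"
  assumes "finite I" "series_in I f" "mcoeff f {#} = 1" "\<And>m. 2 \<le> size m \<Longrightarrow> mcoeff f m = 0"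
  shows "f = 1 + (\<Sum>i\<in>I. mconst (mcoeff f {#i#}) * mvar i)"
proof (rule mfps_eqI)
  fix m
  have sum: "mcoeff (1 + (\<Sum>i\<in>I. mconst (mcoeff f {#i#}) * mvar i)) m =
      (if m = {#} then 1 else 0) + (\<Sum>i\<in>I. if m = {#i#} then mcoeff f {#i#} else 0)"
    by (simp add: mcoeff_one mcoeff_sum mcoeff_mvar if_distrib [of "(*) _"] cong: if_cong)
  have "size m = 0 \<or> size m = 1 \<or> 2 \<le> size m" by linarith
  then show "mcoeff f m = mcoeff (1 + (\<Sum>i\<in>I. mconst (mcoeff f {#i#}) * mvar i)) m"
  proof (elim disjE)
    assume "size m = 0"
    then show ?thesis using assms(3) unfolding sum by simp
  next
    assume "size m = 1"
    then obtain j where j: "m = {#j#}" using size_1_singleton_mset by blast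
    have "mcoeff f {#j#} = 0" if "j \<notin> I" using series_inD [OF assms(2), of "{#j#}"] that by auto
    then show ?thesis using assms(1) unfolding sum unfolding j by auto
  next
    assume 2: "2 \<le> size m"
    then have "m \<noteq> {#}" "m \<noteq> {#i#}" for i by auto
    then show ?thesis using assms(4) [OF 2] unfolding sum by simp
  qed
qed

lemma mderiv_nonzeroI: "mcoeff f m \<noteq> 0 \<Longrightarrow> j \<in># m \<Longrightarrow> mderiv j (f :: ('i, 'k::field_char_0) mfps) \<noteq> 0"
  by (auto simp: mderiv_eq_0_iff)

lemma mderiv_nonzeroE:
  assumes "mderiv j (f :: ('i, 'k::field_char_0) mfps) \<noteq> 0"
  obtains m where "mcoeff f m \<noteq> 0" "j \<in># m"
  using assms by (auto simp: mderiv_eq_0_iff)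

lemma series_in_mono: "series_in I f \<Longrightarrow> I \<subseteq> J \<Longrightarrow> series_in J f"
  unfolding series_in_def by blast

lemma nonconstantE:
  fixes f :: "('i, 'k::field_char_0) mfps"
  assumes "nonconstant f"
  obtains m where "m \<noteq> {#}" "mcoeff f m \<noteq> 0"
proof -
  have "\<exists>m. m \<noteq> {#} \<and> mcoeff f m \<noteq> 0"
  proof (rule ccontr)
    assume "\<not> ?thesis"
    then have "f = mconst (mcoeff f {#})" by (intro mfps_eqI) (auto simp: mcoeff_mconst)
    then show False using assms unfolding nonconstant_def by blast
  qed
  then show ?thesis using that by blast
qed

text \<open>The condition on the series in an extension, expressed without reference to a
  restriction. For a vertex on no cycle of a Hopf system it implies that the vertex is an extension
  vertex.\<close>

definition affine_vertex :: "('i \<Rightarrow> ('i, 'k::field_char_0) mfps) \<Rightarrow> 'i \<Rightarrow> bool"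
  where "affine_vertex F z \<longleftrightarrow> (\<forall>m. 2 \<le> size m \<longrightarrow> mcoeff (F z) m = 0) \<and>
    (\<forall>j k. mcoeff (F z) {#j#} \<noteq> 0 \<longrightarrow> mcoeff (F z) {#k#} \<noteq> 0 \<longrightarrow> F j = F k)"

definition hereditary :: "'i set \<Rightarrow> ('i \<Rightarrow> ('i, 'k::field_char_0) mfps) \<Rightarrow> 'i set \<Rightarrow> bool"
  where "hereditary I F S \<longleftrightarrow> S \<subseteq> I \<and> (\<forall>i\<in>S. series_in S (F i))"

lemma descendants_series_in:
  assumes "sdse I F" "i \<in> I"
  defines "J \<equiv> descendants I F i"
  shows "hereditary I F J" "series_in J (F i)" "J \<noteq> {}"
proof -
  have step: "series_in J (F k)" if "k = i \<or> k \<in> J" "k \<in> I" for k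
  proof (rule series_in_subset [of I])
    show "series_in I (F k)" using assms(1) that(2) by (rule sdseD(3))
    fix j assume "j \<in> I" "mderiv j (F k) \<noteq> 0"
    then have "(k, j) \<in> sdse_graph I F" using that(2) by (simp add: sdse_graph_def)
    then show "j \<in> J" using that(1) unfolding J_def descendants_def
      by (metis mem_Collect_eq trancl.simps)
  qed
  have sub: "J \<subseteq> I"
  proof
    fix j assume "j \<in> J"
    then have "(i, j) \<in> (sdse_graph I F)\<^sup>+" by (simp add: J_def descendants_def)
    then show "j \<in> I" by cases (auto simp: sdse_graph_def)
  qed
  show "hereditary I F J" unfolding hereditary_def using sub step by blast
  show i: "series_in J (F i)" using step assms(2) by blast
  obtain m where "m \<noteq> {#}" "mcoeff (F i) m \<noteq> 0" using sdseD(5) [OF assms(1,2)] by (rule nonconstantE)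
  then show "J \<noteq> {}" using series_inD [OF i] by fastforce
qed

text \<open>The descendants of \<open>z\<close> form a hereditary set, so the restrictions leave the
  series unchanged and the smaller system is again Hopf; that \<open>z\<close> lies on no cycle says
  that it is not among its descendants.\<close>

lemma affine_extension_vertex:
  assumes hopf: "hopf_sdse I F" and z: "z \<in> I" and affine: "affine_vertex F z"
    and acyclic: "(z, z) \<notin> (sdse_graph I F)\<^sup>+"
  shows "extension_vertex I F z"
proof -
  have sdse: "sdse I F" using hopf by (simp add: hopf_sdse_def)
  define J where "J = descendants I F z"
  have J: "hereditary I F J" "series_in J (F z)" "J \<noteq> {}"
    using descendants_series_in [OF sdse z] by (simp_all add: J_def)
  have sub: "J \<subseteq> I" and ser: "\<And>j. j \<in> J \<Longrightarrow> series_in J (F j)" using J(1) by (auto simp: hereditary_def)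
  have fin: "finite J" using sub sdseD(1) [OF sdse] finite_subset by blast
  have r1: "restrict_sdse J F j = F j" if "j \<in> J" for j
    by (rule restrict_sdse_eq) (rule ser [OF that])
  have r2: "restrict_sdse (insert z J) F j = F j" if "j \<in> insert z J" for j
  proof (rule restrict_sdse_eq)
    have "series_in J (F j)" using that J(2) ser by blast
    then show "series_in (insert z J) (F j)" by (rule series_in_mono) blast
  qed
  have "hopf_sdse J F" by (rule hopf_sdse_hereditary [OF hopf sub J(3) ser])
  then have "hopf_sdse J (restrict_sdse J F)" using hopf_sdse_cong [of J F "restrict_sdse J F"] r1 by simp
  moreover have "z \<notin> J" using acyclic by (simp add: J_def descendants_def)
  moreover have "sdse (insert z J) (restrict_sdse (insert z J) F)"
  proof -
    have "series_in (insert z J) (F i)" if "i \<in> insert z J" for i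
      using that J(2) ser series_in_mono [of J "F i" "insert z J"] by blast
    then have "sdse (insert z J) F"
      unfolding sdse_def using fin sdseD(4,5) [OF sdse] z sub by blast
    then show ?thesis using sdse_cong [of "insert z J" F] r2 by metis
  qed
  moreover have "\<forall>i\<in>J. restrict_sdse (insert z J) F i = restrict_sdse J F i" using r1 r2 by simp
  moreover have "\<exists>a. restrict_sdse (insert z J) F z = 1 + (\<Sum>i\<in>J. mconst (a i) * mvar i) \<and>
      (\<forall>i\<in>J. \<forall>j\<in>J. a i \<noteq> 0 \<and> a j \<noteq> 0 \<longrightarrow> restrict_sdse J F i = restrict_sdse J F j)"
  proof (intro exI conjI)
  show "restrict_sdse (insert z J) F z = 1 + (\<Sum>i\<in>J. mconst (mcoeff (F z) {#i#}) * mvar i)"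
    unfolding r2 [OF insertI1]
    by (rule affine_expand [OF fin J(2) sdseD(4) [OF sdse z]]) (use affine in \<open>simp add: affine_vertex_def\<close>)
  show "\<forall>i\<in>J. \<forall>j\<in>J. mcoeff (F z) {#i#} \<noteq> 0 \<and> mcoeff (F z) {#j#} \<noteq> 0 \<longrightarrow>
      restrict_sdse J F i = restrict_sdse J F j"
    using affine r1 by (simp add: affine_vertex_def)
  qed
  ultimately have "is_extension J (restrict_sdse J F) z (restrict_sdse (insert z J) F)"
    unfolding is_extension_def by blast
  then show ?thesis using z by (simp add: extension_vertex_def J_def)
qed

lemma extension_vertexD:
  assumes ext: "extension_vertex I F z" and sdse: "sdse I F"
  shows "(z, z) \<notin> (sdse_graph I F)\<^sup>+" "2 \<le> size m \<Longrightarrow> mcoeff (F z) m = 0"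
proof -
  define J where "J = descendants I F z"
  have z: "z \<in> I" and ext: "is_extension J (restrict_sdse J F) z (restrict_sdse (insert z J) F)"
    using ext by (auto simp: extension_vertex_def J_def Let_def)
  then have "z \<notin> J" by (simp add: is_extension_def)
  then show "(z, z) \<notin> (sdse_graph I F)\<^sup>+" by (simp add: J_def descendants_def)
  assume m: "2 \<le> size m"
  then have m1: "m \<noteq> {#}" "m \<noteq> {#i#}" for i by auto
  have "series_in (insert z J) (F z)"
    using descendants_series_in(2) [OF sdse z] by (rule series_in_mono) (auto simp: J_def)
  then have "restrict_sdse (insert z J) F z = F z" by (rule restrict_sdse_eq)
  then obtain a where "F z = 1 + (\<Sum>i\<in>J. mconst (a i) * mvar i)"
    using ext by (auto simp: is_extension_def)
  then show "mcoeff (F z) m = 0" using m1 by (simp add: mcoeff_one mcoeff_sum mcoeff_mvar)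
qed

section \<open>Dependence of the structure constants on the series\<close>

lemma lambda_cong:
  assumes "i \<in> I" "\<And>i. i \<in> I \<Longrightarrow> F i = F' i" "\<And>i. i \<in> I \<Longrightarrow> nx i = nx' i" "\<And>i. i \<in> I \<Longrightarrow> nx i \<in> I"
  shows "lambda F nx k i j = lambda F' nx' k i j"
proof -
  have w: "walk nx n i = walk nx' n i \<and> set (walk nx n i) \<subseteq> I" if "i \<in> I" for n i
    using that
  proof (induction n arbitrary: i)
    case (Suc n)
    have "nx i \<in> I" "nx i = nx' i" using assms(3,4) Suc.prems by auto
    then show ?case using Suc.IH [of "nx i"] by auto
  qed simp
  have c: "ladder_coeff F js i = ladder_coeff F' js i" if "i \<in> I" "set js \<subseteq> I" for js i
    using that assms(2) by (induction js arbitrary: i) auto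
  have g: "ladder_graft F js i j = ladder_graft F' js i j" if "i \<in> I" "set js \<subseteq> I" for js i
    using that assms(2) c by (induction js arbitrary: i) auto
  have "walk nx' (k - 1) i = walk nx (k - 1) i" "set (walk nx (k - 1) i) \<subseteq> I" using w [OF assms(1), of "k - 1"] by auto
  then show ?thesis
    unfolding lambda_def using c [OF assms(1)] g [OF assms(1)] by (simp only:)
qed

text \<open>Two vertices with the same series and the same next vertex have equal constants; from
  degree 2 on their ladders even coincide below the root.\<close>

lemma lambda_eq:
  assumes "F i = F i'" "nx i = nx i'"
  shows "lambda F nx k i j = lambda F nx k i' j"
proof -
  have "walk nx n i = walk nx n i'" for n using assms(2) by (cases n) auto
  moreover have "ladder_coeff F js i = ladder_coeff F js i'" for js using assms(1) by (cases js) auto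
  moreover have "ladder_graft F js i j = ladder_graft F js i' j" for js using assms(1) by (cases js) auto
  ultimately show ?thesis by (simp add: lambda_def)
qed

text \<open>A tree with root \<open>z\<close> can be grafted only on a vertex whose series contains
  the variable of \<open>z\<close>, and the ladder has no such vertex.\<close>

lemma lambda_zero:
  assumes "i \<in> I" "\<And>i. i \<in> I \<Longrightarrow> nx i \<in> I" "\<And>i. i \<in> I \<Longrightarrow> series_in J (F i)" "z \<notin> J"
  shows "lambda F nx k i z = 0"
proof -
  have w: "set (walk nx n i) \<subseteq> I" if "i \<in> I" for n i
    using that assms(2) by (induction n arbitrary: i) auto
  have "mcoeff (F i) m = 0" if "i \<in> I" "z \<in># m" for i m
    using series_inD [OF assms(3) [OF that(1)], of m] that(2) assms(4) by blast
  then have g: "ladder_graft F js i z = 0" if "i \<in> I" "set js \<subseteq> I" for js i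
    using that by (induction js arbitrary: i) auto
  show ?thesis using g [OF assms(1) w [OF assms(1)]] by (simp add: lambda_def)
qed

lemma module_constants_subset:
  "module_constants I l g \<Longrightarrow> S \<subseteq> I \<Longrightarrow> module_constants S l g"
  unfolding module_constants_def by blast

section \<open>Extended fundamental abelian systems\<close>

context fundamental_system
begin

lemma abelian_constants:
  assumes nx: "\<And>x. x \<in> Z \<Longrightarrow> nx x \<in> A0" "\<And>x. x \<in> Z \<Longrightarrow> taylor (F x) {#nx x#} \<noteq> 0"
  shows "abelian_constants A0 A1 AJ (lambda F nx) r l (\<lambda>i. \<nu> (r i))
    (\<lambda>i. if i \<in> A1 then a (r i) else b (r i)) (\<lambda>i j. a (r i) (r j) * l j)"
proof
  note sub = A_subset [OF nx]
  show "finite A0" "finite A1" "finite AJ" using finite_Z sub finite_subset by auto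
  show "A0 \<inter> A1 = {}" "A0 \<inter> AJ = {}" "A1 \<inter> AJ = {}" by (rule A_disjoint)+
  show "l j \<noteq> 0" if "j \<in> A0" for j using that sub l by auto
  have Z: "j \<in> Z" if "j \<in> A0 \<union> A1 \<union> AJ" for j using that Z_eq by auto
  show "lambda F nx k i j = (if j \<in> A0 \<and> r j = r i then l j else 0)"
    if "i \<in> A0" "j \<in> A0 \<union> A1 \<union> AJ" "0 < k" for i j k
    using lam_A0 [OF nx that(1) Z [OF that(2)] that(3)] that by (auto simp: A0_def A1_def AJ_def)
  show "lambda F nx 1 i j = (if j \<in> A0 then l j * (if i \<in> A1 then a (r i) else b (r i)) (r j) else 0)"
    if "i \<in> A1" "j \<in> A0 \<union> A1 \<union> AJ" for i j
    using lam_A1(1) [OF nx that(1) Z [OF that(2)]] that by simp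
  show "lambda F nx k i j = (if j \<in> A0 then \<nu> (r i) * l j * (if i \<in> A1 then a (r i) else b (r i)) (r j) else 0)"
    if "i \<in> A1" "j \<in> A0 \<union> A1 \<union> AJ" "2 \<le> k" for i j k
    using lam_A1(2) [OF nx that(1) Z [OF that(2)] that(3)] that by simp
  show "\<nu> (r i) \<noteq> 0" if "i \<in> AJ" for i using that \<nu>J by (auto simp: AJ_def)
  show "lambda F nx 1 i j = (if j \<in> A0 then l j * (if i \<in> A1 then a (r i) else b (r i)) (r j) / \<nu> (r i)
      else if j \<in> A1 then a (r i) (r j) * l j else 0)"
    if "i \<in> AJ" "j \<in> A0 \<union> A1 \<union> AJ" for i j
  proof -
    have "i \<notin> A1" using that A_disjoint by auto
    then show ?thesis using lam_AJ(1) [OF nx that(1) Z [OF that(2)]] by simp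
  qed
  show "lambda F nx k i j = (if j \<in> A0 then l j * (if i \<in> A1 then a (r i) else b (r i)) (r j) else 0)"
    if "i \<in> AJ" "j \<in> A0 \<union> A1 \<union> AJ" "2 \<le> k" for i j k
  proof -
    have "i \<notin> A1" using that A_disjoint by auto
    then show ?thesis using lam_AJ(2) [OF nx that(1) Z [OF that(2)] that(3)] by simp
  qed
  show "\<nu> (r j) = 1" if "i \<in> AJ" "j \<in> A1" "a (r i) (r j) * l j \<noteq> 0" for i j
    using that \<nu>_I1i [of "r i" "r j"] by (auto simp: AJ_def A1_def)
  show "(if j \<in> A1 then a (r j) else b (r j)) (r x) = (if i \<in> A1 then a (r i) else b (r i)) (r x)"
    if "i \<in> AJ" "j \<in> A1" "a (r i) (r j) * l j \<noteq> 0" "x \<in> A0" for i j x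
  proof -
    have "i \<notin> A1" using that A_disjoint by auto
    then show ?thesis using that b_eq [of "r i" "r j" "r x"] by (auto simp: AJ_def A1_def A0_def)
  qed
qed

text \<open>Vertices of \<open>A0\<close> lie on a cycle, hence are never extension
  vertices.\<close>

lemma A0_loop: "x \<in> A0 \<Longrightarrow> mderiv x (F x) \<noteq> 0"
proof -
  assume x: "x \<in> A0"
  then have "x \<in> Z" by (simp add: A0_def)
  then have "taylor (F x) {#x#} \<noteq> 0" using F0_taylor(1) [OF x] l by (simp del: taylor_eq_0_iff)
  then show ?thesis by (intro mderiv_nonzeroI [of _ "{#x#}"]) auto
qed

lemma mderiv_targets:
  assumes "mderiv j (F x) \<noteq> 0"
  shows "x \<in> A0 \<union> A1 \<Longrightarrow> j \<in> A0" "x \<in> AJ \<Longrightarrow> j \<in> A0 \<or> j \<in> A1 \<and> a (r x) (r j) \<noteq> 0"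
proof -
  obtain m where m: "mcoeff (F x) m \<noteq> 0" "j \<in># m" using assms by (rule mderiv_nonzeroE)
  then have ne: "m \<noteq> {#}" by auto
  show "j \<in> A0" if "x \<in> A0 \<union> A1"
    using that
  proof
    assume "x \<in> A0"
    from A0_support [OF this m(1) ne] m(2) show ?thesis by auto
  next
    assume "x \<in> A1"
    from A1_support [OF this m(1)] m(2) show ?thesis by auto
  qed
  show "j \<in> A0 \<or> j \<in> A1 \<and> a (r x) (r j) \<noteq> 0" if "x \<in> AJ"
    using AJ_support [OF that m(1)] m(2) by auto
qed

lemma A0_nonempty: "A0 \<noteq> {}"
proof -
  obtain p where "p \<in> I0" using I0_nonempty by blast
  then have "p \<in> r ` Z" using r by blast
  then show ?thesis using \<open>p \<in> I0\<close> by (auto simp: A0_def)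
qed

text \<open>Needed for the edges from \<open>AJ\<close> to \<open>A1\<close>. As \<nu> = 1 for
  \<open>y\<close>, vanishing second derivatives say that the products a_p a_q are 0 for distinct p,
  q and that a_p^2 = a_p. So exactly one exponent, at \<open>p0\<close>, is 1 and the others are 0;
  the product is 1 + h at \<open>p0\<close>, and the series of \<open>i\<close> is linear with all
  its variables belonging to vertices of one common series.\<close>

lemma spouse_affine:
  assumes i: "i \<in> AJ" and y: "y \<in> A1" "a (r i) (r y) \<noteq> 0"
    and affine: "\<And>m. 2 \<le> size m \<Longrightarrow> mcoeff (F y) m = 0"
  shows "affine_vertex F i"
proof -
  let ?a = "a (r y)"
  have ri: "r i \<in> J1" "i \<in> Z" and ry: "r y \<in> I1" using i y by (auto simp: AJ_def A1_def)
  have \<nu>y: "\<nu> (r y) = 1" using \<nu>_I1i [OF ri(1) ry y(2)] .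
  have b: "b (r i) p = ?a p" if "p \<in> I0" for p using b_eq [OF ri(1) ry y(2) that] by simp
  have rel: "?a p * ?a q = (if p = q then ?a p else 0)" if pq: "p \<in> I0" "q \<in> I0" for p q
  proof -
    have "p \<in> r ` Z" "q \<in> r ` Z" using pq unfolding r by auto
    then obtain P Q where PQ: "P \<in> A0" "r P = p" "Q \<in> A0" "r Q = q"
      using pq by (auto simp: A0_def)
    have "taylor (F y) {#P, Q#} = 0" using affine [of "{#P, Q#}"] by simp
    then show ?thesis
      using F1_taylor(2) [OF y(1) PQ(1) PQ(3)] PQ \<nu>y l [of P] l [of Q]
      by (auto simp: A0_def split: if_splits)
  qed
  obtain p0 where p0: "p0 \<in> I0" "?a p0 \<noteq> 0" using G1_nontrivial [OF ry] by blast
  \<comment> \<open>Put p = \<open>p0\<close> in the relations: the square gives the value 1, the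
    mixed products give 0 elsewhere.\<close>
  have ap: "?a p = (if p = p0 then 1 else 0)" if "p \<in> I0" for p
    using rel [OF p0(1) that] rel [OF p0(1) p0(1)] p0(2) by (auto split: if_splits)
  have binom1: "muni (fps_binomial (1 :: 'k)) p0 = 1 + mvar p0"
  proof (rule mfps_eqI)
    fix m
    have g: "(1 :: 'k) gchoose n = (if n \<le> 1 then 1 else 0)" for n
    proof -
      have "(1 :: 'k) gchoose n = of_nat (1 choose n)" using binomial_gbinomial [of 1 n, where 'a = 'k] by simp
      then show ?thesis by (cases "n = 0"; cases "n = 1") (auto simp: binomial_eq_0)
    qed
    show "mcoeff (muni (fps_binomial (1 :: 'k)) p0) m = mcoeff (1 + mvar p0) m"
    proof (cases "set_mset m \<subseteq> {p0} \<and> size m \<le> 1")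
      case True
      then have "m = {#} \<or> m = {#p0#}"
      proof (cases "size m = 0")
        case False
        then have "size m = 1" using True by linarith
        then obtain j where "m = {#j#}" using size_1_singleton_mset by blast
        then show ?thesis using True by simp
      qed simp
      then show ?thesis by (auto simp: mcoeff_muni g mcoeff_one mcoeff_mvar)
    next
      case False
      then have "m \<noteq> {#}" "m \<noteq> {#p0#}" by auto
      then show ?thesis using False by (auto simp: mcoeff_muni g mcoeff_one mcoeff_mvar)
    qed
  qed
  have prod: "(\<Prod>j\<in>I0. muni (fps_binomial (c j)) j) = 1 + mvar p0"
    if "\<And>j. j \<in> I0 \<Longrightarrow> c j = ?a j" for c
  proof -
    have one: "muni (fps_binomial 0) j = (1 :: ('i, 'k) mfps)" for j
    proof (rule mfps_eqI)
      fix m show "mcoeff (muni (fps_binomial 0) j) m = mcoeff (1 :: ('i, 'k) mfps) m"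
        using fps_binomial_0_nth [of "size m", where 'k = 'k]
        by (cases "m = {#}") (auto simp: mcoeff_muni mcoeff_one nonempty_has_size)
    qed
    have "(\<Prod>j\<in>I0. muni (fps_binomial (c j)) j) = (\<Prod>j\<in>I0. if j = p0 then 1 + mvar p0 else 1)"
      using that ap one binom1 by (intro prod.cong refl) auto
    then show ?thesis using p0(1) finite_index(1) by simp
  qed
  have Gy: "G (r y) = 1 + mvar p0"
  proof -
    have "mconst 1 = (1 :: ('i, 'k) mfps)" by (rule mfps_eqI) (simp add: mcoeff_mconst mcoeff_one)
    then show ?thesis using G1 [OF ry] \<nu>y prod [of "\<lambda>j. \<nu> (r y) * a (r y) j"] by simp
  qed
  have Gj: "G (r j) = 1 + mvar p0" if j: "mcoeff (F i) {#j#} \<noteq> 0" for j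
    using AJ_support [OF i j]
  proof
    assume "set_mset {#j#} \<subseteq> A0"
    then have jA: "j \<in> A0" by simp
    have "taylor (F i) {#j#} \<noteq> 0" using j by simp
    then have "b (r i) (r j) \<noteq> 0" unfolding FJ_taylor(1) [OF i jA] by auto
    moreover have "r j \<in> I0" using jA by (simp add: A0_def)
    ultimately have "r j = p0" using b ap by (auto split: if_splits)
    then show ?thesis using G0 [OF p0(1)] by simp
  next
    assume "\<exists>y\<in>A1. {#j#} = {#y#} \<and> a (r i) (r y) \<noteq> 0"
    then have "j \<in> A1" "a (r i) (r j) \<noteq> 0" by auto
    then show ?thesis using G_I1i [OF ri(1) _ _ ry y(2), of "r j"] Gy by (simp add: A1_def)
  qed
  show ?thesis
    unfolding affine_vertex_def
  proof (intro conjI allI impI)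
    fix m :: "'i multiset" assume m: "2 \<le> size m"
    show "mcoeff (F i) m = 0"
    proof (rule ccontr)
      assume nz: "mcoeff (F i) m \<noteq> 0"
      have "size (image_mset r m) \<noteq> 0" "size (image_mset r m) \<noteq> 1" using m by auto
      then have ne: "image_mset r m \<noteq> {#}" "image_mset r m \<noteq> {#j#}" for j by force+
      have "(\<Prod>j\<in>I0. muni (fps_binomial (b (r i) j)) j) = 1 + mvar p0" by (rule prod) (rule b)
      then have "taylor (\<Prod>j\<in>I0. muni (fps_binomial (b (r i) j)) j) (image_mset r m) = 0"
        using ne by (simp add: taylor_add taylor_one taylor_mvar del: taylor_eq_0_iff)
      then have "taylor (G (r i)) (image_mset r m) = 0"
        unfolding GJ_taylor_expand [OF ri(1) ne(1)] using ne by (simp del: taylor_eq_0_iff)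
      then show False using F_G_support [OF ri(2) nz] by simp
    qed
  next
    fix j k assume jk: "mcoeff (F i) {#j#} \<noteq> 0" "mcoeff (F i) {#k#} \<noteq> 0"
    have "j \<in> Z" "k \<in> Z" using F_support [OF ri(2)] jk by force+
    then show "F j = F k" using Gj jk by (intro F_eqI) simp_all
  qed
qed

end

section \<open>Extended systems together with a choice of ladders\<close>

lemma fundamental_systemI:
  fixes F :: "'i \<Rightarrow> ('i, 'k::field_char_0) mfps"
  assumes "fundamental_abelian Z F" "sdse Z F"
  shows "\<exists>I0 I1 J1 G r l \<nu> a. fundamental_system Z I0 I1 J1 G F r l \<nu> a"
proof -
  have fin: "finite Z" using assms(2) by (rule sdseD)
  obtain I0 I1 J1 :: "'i set" and G r l where fund: "basic_abelian I0 I1 J1 G \<and> r ` Z = I0 \<union> I1 \<union> J1 \<and>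
      (\<forall>x\<in>Z. l x \<noteq> 0) \<and> (\<forall>x\<in>Z. F x = change_of_variables l (dilate_sdse Z r G) x)"
    using conjunct2 [OF assms(1) [unfolded fundamental_abelian_def]] by (elim exE) (rule that)
  then have r: "r ` Z = I0 \<union> I1 \<union> J1" and l: "\<And>x. x \<in> Z \<Longrightarrow> l x \<noteq> 0"
    and F: "\<And>x. x \<in> Z \<Longrightarrow> F x = change_of_variables l (dilate_sdse Z r G) x"
    and basic: "basic_abelian I0 I1 J1 G"
    by simp_all
  have G: "sdse (I0 \<union> I1 \<union> J1) G" "I0 \<noteq> {}" "I0 \<inter> I1 = {}" "I0 \<inter> J1 = {}" "I1 \<inter> J1 = {}"
    using basic unfolding basic_abelian_def by blast+
  obtain \<nu> a where series: "(\<forall>i\<in>I0. G i = 1 + mvar i) \<and>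
      (\<forall>i\<in>I1. (\<nu> i \<noteq> 1 \<or> (\<exists>j\<in>I0. a i j \<noteq> 0)) \<and>
        G i = (if \<nu> i \<noteq> 0
          then mconst (1 / \<nu> i) * (\<Prod>j\<in>I0. muni (fps_binomial (\<nu> i * a i j)) j)
            + 1 - mconst (1 / \<nu> i)
          else 1 + (\<Sum>j\<in>I0. mconst (a i j) * muni (fps_ln 1) j))) \<and>
      (\<forall>i\<in>J1. \<nu> i \<noteq> 0 \<and>
        (let I1i = {j \<in> I1. a i j \<noteq> 0} in
          I1i \<noteq> {} \<and> (\<forall>j\<in>I1i. \<nu> j = 1) \<and> (\<forall>j\<in>I1i. \<forall>k\<in>I1i. G j = G k) \<and>
          (\<forall>s\<in>I1i. G i = mconst (1 / \<nu> i) * (\<Prod>j\<in>I0. muni (fps_binomial (a s j)) j)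
            + (\<Sum>j\<in>I1i. mconst (a i j) * mvar j) + 1 - mconst (1 / \<nu> i))))"
    using basic [unfolded basic_abelian_def, THEN conjunct2, THEN conjunct2, THEN conjunct2, THEN conjunct2, THEN conjunct2]
    by (elim exE) (rule that)
  note G0 = conjunct1 [OF series] and G1 = conjunct1 [OF conjunct2 [OF series]]
  note GJ' = conjunct2 [OF conjunct2 [OF series], unfolded Let_def]
  have "fundamental_system Z I0 I1 J1 G F r l \<nu> a"
  proof
    show "{j \<in> I1. a i j \<noteq> 0} \<noteq> {}" "\<nu> i \<noteq> 0" if "i \<in> J1" for i using GJ' that by blast+
    show "\<nu> j = 1" if "i \<in> J1" "j \<in> I1" "a i j \<noteq> 0" for i j using GJ' that by blast
    show "G j = G k" if "i \<in> J1" "j \<in> I1" "a i j \<noteq> 0" "k \<in> I1" "a i k \<noteq> 0" for i j k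
      using GJ' that by blast
    show "G i = mconst (1 / \<nu> i) * (\<Prod>j\<in>I0. muni (fps_binomial (a s j)) j)
            + (\<Sum>j\<in>{j \<in> I1. a i j \<noteq> 0}. mconst (a i j) * mvar j) + 1 - mconst (1 / \<nu> i)"
      if "i \<in> J1" "s \<in> I1" "a i s \<noteq> 0" for i s using GJ' that by blast
    show "G i = 1 + mvar i" if "i \<in> I0" for i using G0 that by blast
    show "G i = (if \<nu> i \<noteq> 0
          then mconst (1 / \<nu> i) * (\<Prod>j\<in>I0. muni (fps_binomial (\<nu> i * a i j)) j)
            + 1 - mconst (1 / \<nu> i)
          else 1 + (\<Sum>j\<in>I0. mconst (a i j) * muni (fps_ln 1) j))" if "i \<in> I1" for i
      using conjunct2 [OF bspec [OF G1 that]] .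
  qed (fact G r l F fin assms(2))+
  then show ?thesis by blast
qed

lemma fundamental_system_cong:
  assumes "fundamental_system Z I0 I1 J1 G F r l \<nu> a" "\<And>x. x \<in> Z \<Longrightarrow> F x = F' x"
  shows "fundamental_system Z I0 I1 J1 G F' r l \<nu> a"
proof -
  interpret fundamental_system Z I0 I1 J1 G F r l \<nu> a by fact
  have sdse: "sdse Z F'" using sdse_F sdse_cong [of Z F F'] assms(2) by simp
  have series: "F' x = change_of_variables l (dilate_sdse Z r G) x" if "x \<in> Z" for x
    using F [OF that] assms(2) [OF that] by simp
  show ?thesis
    by unfold_locales (fact sdse_G disjoint I0_nonempty G0 G1 \<nu>J I1i_nonempty \<nu>_I1i G_I1i GJ finite_Z r l series sdse)+
qed

text \<open>The datum \<open>nx\<close> of the ladders is chosen as a function of the series, so that vertices with the same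
  series have the same structure constants; this is what makes the constants of an extension
  define a module.\<close>

definition extended_system :: "'i set \<Rightarrow> ('i \<Rightarrow> ('i, 'k::field_char_0) mfps) \<Rightarrow> 'i set \<Rightarrow> ('i \<Rightarrow> 'i) \<Rightarrow> bool"
  where "extended_system I F Z nx \<longleftrightarrow> Z \<subseteq> I \<and>
    (\<exists>I0 I1 J1 G r l \<nu> a. fundamental_system Z I0 I1 J1 G F r l \<nu> a \<and> (\<forall>x\<in>Z. nx x \<in> Z \<and> r (nx x) \<in> I0)) \<and>
    (\<forall>i\<in>I. nx i \<in> I \<and> taylor (F i) {#nx i#} \<noteq> 0) \<and>
    (\<forall>i\<in>I. \<forall>j\<in>I. F i = F j \<longrightarrow> nx i = nx j) \<and>
    (\<forall>i\<in>I. module_constants I (lambda F nx) (\<lambda>k. lambda F nx k i)) \<and>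
    (\<forall>z\<in>I - Z. affine_vertex F z \<and> (z, z) \<notin> (sdse_graph I F)\<^sup>+)"

lemma extended_system_fundamental:
  assumes "fundamental_abelian Z F" "sdse Z F"
  shows "\<exists>nx. extended_system Z F Z nx"
proof -
  obtain I0 I1 J1 G r l \<nu> a where fs: "fundamental_system Z I0 I1 J1 G F r l \<nu> a"
    using fundamental_systemI [OF assms] by (elim exE) (rule that)
  interpret fundamental_system Z I0 I1 J1 G F r l \<nu> a by (rule fs)
  \<comment> \<open>The choice refers to \<open>x\<close> only through \<open>F x\<close>, so equal
    series get the same next vertex.\<close>
  define nx where "nx x = (SOME y. y \<in> A0 \<and> taylor (F x) {#y#} \<noteq> 0)" for x
  have nx: "nx x \<in> A0 \<and> taylor (F x) {#nx x#} \<noteq> 0" if "x \<in> Z" for x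
  proof -
    have "\<exists>y. y \<in> A0 \<and> taylor (F x) {#y#} \<noteq> 0" using exists_next [OF that] by metis
    then show ?thesis unfolding nx_def by (rule someI_ex)
  qed
  have nx1: "\<And>x. x \<in> Z \<Longrightarrow> nx x \<in> A0" "\<And>x. x \<in> Z \<Longrightarrow> taylor (F x) {#nx x#} \<noteq> 0"
    using nx by blast+
  interpret ac: abelian_constants A0 A1 AJ "lambda F nx" r l "\<lambda>i. \<nu> (r i)"
    "\<lambda>i. if i \<in> A1 then a (r i) else b (r i)" "\<lambda>i j. a (r i) (r j) * l j"
    using nx1 by (rule abelian_constants)
  have nx2: "nx x \<in> Z \<and> r (nx x) \<in> I0" if "x \<in> Z" for x using nx1(1) [OF that] by (simp add: A0_def)
  have "extended_system Z F Z nx"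
    unfolding extended_system_def
  proof (intro conjI ballI)
    show "\<exists>I0 I1 J1 G r l \<nu> a. fundamental_system Z I0 I1 J1 G F r l \<nu> a \<and> (\<forall>x\<in>Z. nx x \<in> Z \<and> r (nx x) \<in> I0)"
      using nx2 by (intro exI conjI) (rule fs, blast)
    show "F i = F j \<longrightarrow> nx i = nx j" for i j by (simp add: nx_def)
    show "module_constants Z (lambda F nx) (\<lambda>k. lambda F nx k i)" if "i \<in> Z" for i
      using ac.module_constants [of i] that Z_eq by simp
  qed (use nx1 nx2 in auto)
  then show ?thesis by (rule exI [of _ nx])
qed

text \<open>The new series is linear, so a ladder from \<open>z\<close> has the constants of its
  next vertex \<open>x\<close>, shifted by one degree. The module identity at \<open>z\<close> thus
  reduces to that at \<open>x\<close> for \<open>k \<ge> 2\<close>; for \<open>k = 1\<close> it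
  holds because all variables of the new series belong to vertices with the series of
  \<open>x\<close>. Constants with last index \<open>z\<close> vanish, as no edge ends
  there.\<close>

lemma extended_system_extension:
  assumes ext: "is_extension I F z F'" and sys: "extended_system I F Z nx"
  shows "\<exists>nx'. extended_system (insert z I) F' Z nx'"
proof -
  have hopf: "hopf_sdse I F" and z: "z \<notin> I" and sdse': "sdse (insert z I) F'"
    and F': "\<And>i. i \<in> I \<Longrightarrow> F' i = F i"
    and aff: "\<exists>\<alpha>. F' z = 1 + (\<Sum>i\<in>I. mconst (\<alpha> i) * mvar i) \<and>
         (\<forall>i\<in>I. \<forall>j\<in>I. \<alpha> i \<noteq> 0 \<and> \<alpha> j \<noteq> 0 \<longrightarrow> F i = F j)"
    using ext by (auto simp: is_extension_def)
  have sdse: "sdse I F" using hopf by (simp add: hopf_sdse_def)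
  have fin: "finite I" using sdse by (rule sdseD)
  obtain \<alpha> where \<alpha>: "F' z = 1 + (\<Sum>i\<in>I. mconst (\<alpha> i) * mvar i)"
    "\<And>i j. i \<in> I \<Longrightarrow> j \<in> I \<Longrightarrow> \<alpha> i \<noteq> 0 \<Longrightarrow> \<alpha> j \<noteq> 0 \<Longrightarrow> F i = F j"
    using aff by blast
  have Fz: "mcoeff (F' z) m = (if m = {#} then 1 else 0) + (\<Sum>i\<in>I. if m = {#i#} then \<alpha> i else 0)" for m
    unfolding \<alpha>(1) by (simp add: mcoeff_one mcoeff_sum mcoeff_mvar if_distrib [of "(*) _"] cong: if_cong)
  have Fz1: "mcoeff (F' z) {#j#} = (if j \<in> I then \<alpha> j else 0)" for j
    using fin unfolding Fz by simp
  have Fz2: "mcoeff (F' z) m = 0" if "2 \<le> size m" for m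
  proof -
    have "m \<noteq> {#}" "m \<noteq> {#i#}" for i using that by auto
    then show ?thesis unfolding Fz by simp
  qed
  have ser: "series_in I (F' i)" if "i \<in> insert z I" for i
  proof (cases "i = z")
    case True
    show ?thesis unfolding True series_in_def
    proof (intro allI impI)
      fix m assume nz: "mcoeff (F' z) m \<noteq> 0"
      then have "size m < 2" using Fz2 by (meson not_le)
      then have "size m = 0 \<or> size m = 1" by linarith
      then show "set_mset m \<subseteq> I"
      proof
        assume "size m = 1"
        then obtain j where "m = {#j#}" using size_1_singleton_mset by blast
        then show ?thesis using nz Fz1 [of j] by (auto split: if_splits)
      qed simp
    qed
  next
    case False
    then show ?thesis using that F' sdseD(3) [OF sdse] by auto
  qed
  have Z: "Z \<subseteq> I" using sys unfolding extended_system_def by (rule conjunct1)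
  have sys1: "\<forall>i\<in>I. nx i \<in> I \<and> taylor (F i) {#nx i#} \<noteq> 0" "\<forall>i\<in>I. \<forall>j\<in>I. F i = F j \<longrightarrow> nx i = nx j"
    "\<forall>i\<in>I. module_constants I (lambda F nx) (\<lambda>k. lambda F nx k i)"
    "\<forall>z\<in>I - Z. affine_vertex F z \<and> (z, z) \<notin> (sdse_graph I F)\<^sup>+"
    using sys unfolding extended_system_def by metis+
  have nx: "nx i \<in> I" "taylor (F i) {#nx i#} \<noteq> 0" if "i \<in> I" for i
    using sys1(1) that by blast+
  have nx_eq: "nx i = nx j" if "i \<in> I" "j \<in> I" "F i = F j" for i j
    using sys1(2) that by blast
  have M: "module_constants I (lambda F nx) (\<lambda>k. lambda F nx k i)" if "i \<in> I" for i
    using sys1(3) that by blast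
  have "\<exists>x\<in>I. \<alpha> x \<noteq> 0"
  proof -
    obtain m where "m \<noteq> {#}" "mcoeff (F' z) m \<noteq> 0"
      using sdseD(5) [OF sdse', of z] by (auto elim: nonconstantE)
    then have "(\<Sum>i\<in>I. if m = {#i#} then \<alpha> i else 0) \<noteq> 0" unfolding Fz by simp
    then show ?thesis by (rule sum.not_neutral_contains_not_neutral) (auto split: if_splits)
  qed
  then obtain x1 where x1: "x1 \<in> I" "\<alpha> x1 \<noteq> 0" by blast
  \<comment> \<open>If an old vertex already has the series of \<open>z\<close>, its next vertex
    must be used, to keep \<open>nx'\<close> a function of the series; otherwise any vertex with
    nonzero coefficient will do.\<close>
  define x where "x = (if \<exists>i\<in>I. F i = F' z then nx (SOME i. i \<in> I \<and> F i = F' z) else x1)"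
  have xi: "x = nx i" if "i \<in> I" "F i = F' z" for i
  proof -
    have "\<exists>i. i \<in> I \<and> F i = F' z" using that by blast
    then have "(SOME i. i \<in> I \<and> F i = F' z) \<in> I \<and> F (SOME i. i \<in> I \<and> F i = F' z) = F' z" by (rule someI_ex)
    then show ?thesis using that nx_eq unfolding x_def by (metis (mono_tags, lifting))
  qed
  have x: "x \<in> I" "\<alpha> x \<noteq> 0"
  proof -
    have "x \<in> I \<and> taylor (F' z) {#x#} \<noteq> 0"
    proof (cases "\<exists>i\<in>I. F i = F' z")
      case True
      then show ?thesis using xi nx by metis
    next
      case False
      then show ?thesis using x1 Fz1 [of x1] by (simp add: x_def)
    qed
    then show "x \<in> I" "\<alpha> x \<noteq> 0" using Fz1 [of x] by auto
  qed
  define nx' where "nx' = nx(z := x)"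
  have nx'I: "nx' i = nx i" if "i \<in> I" for i using that z by (auto simp: nx'_def)
  have nx'z: "nx' z = x" by (simp add: nx'_def)
  let ?I = "insert z I" and ?l = "lambda F nx" and ?l' = "lambda F' nx'"
  have nx': "nx' i \<in> I \<and> taylor (F' i) {#nx' i#} \<noteq> 0" if "i \<in> ?I" for i
    using that nx x Fz1 [of x] nx'I nx'z F' by auto
  have l'I: "?l' k i j = ?l k i j" if "i \<in> I" for k i j
    by (rule lambda_cong [of i I, symmetric]) (use that F' nx'I nx in auto)
  have l'zero: "?l' k i z = 0" if "i \<in> ?I" for k i
    by (rule lambda_zero [of i ?I _ I]) (use that nx' ser z in auto)
  have l'1: "?l' 1 z j = (if j \<in> I then \<alpha> j else 0)" for j
    by (simp add: lambda_1 Fz1 taylor_def)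
  have l'Suc: "?l' (Suc k) z j = ?l k x j" if "0 < k" for k j
  proof -
    have nzl: "ladder_coeff F' (walk nx' n y) y \<noteq> 0" if "y \<in> I" for n y
      using that
    proof (induction n arbitrary: y)
      case (Suc n)
      have "taylor (F' y) {#nx' y#} \<noteq> 0" "nx' y \<in> I" using nx' Suc.prems by auto
      then show ?case using Suc.IH by simp
    qed simp
    have "?l' (Suc k) z j = taylor (F' z) {#j, nx' z#} / taylor (F' z) {#nx' z#} + ?l' k (nx' z) j"
      using that nx' [of z] nzl by (intro lambda_Suc) auto
    then show ?thesis using Fz2 [of "{#j, x#}"] l'I [OF x(1)] by (simp add: nx'z taylor_def)
  qed
  have M': "module_constants ?I ?l' (\<lambda>k. ?l' k i)" if i: "i \<in> ?I" for i
    unfolding module_constants_def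
  proof (intro ballI allI impI)
    fix p q d e k assume p: "p \<in> ?I" and q: "q \<in> ?I" and pos: "0 < (d::nat)" "0 < (e::nat)" "0 < (k::nat)"
    show "?l' k i q * (?l' (k + e) i p - ?l' e q p) = ?l' k i p * (?l' (k + d) i q - ?l' d p q)"
    proof (cases "p = z \<or> q = z")
      case True
      then show ?thesis using l'zero [OF i] l'zero [OF p] l'zero [OF q] by auto
    next
      case False
      then have pq: "p \<in> I" "q \<in> I" using p q by auto
      show ?thesis
      proof (cases "i = z")
        case False
        then have "i \<in> I" using i by auto
        show ?thesis
            unfolding l'I [OF \<open>i \<in> I\<close>] l'I [OF pq(1)] l'I [OF pq(2)]
            by (rule M [OF \<open>i \<in> I\<close>, unfolded module_constants_def, rule_format, OF pq(1) pq(2) pos])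
      next
        case True
        consider "k = 1" | k' where "k = Suc k'" "0 < k'" using pos(3) by (cases k) (auto simp: One_nat_def)
        then show ?thesis
        proof cases
          case 1
          have eq: "?l n y y' = ?l n x y'" if "y \<in> I" "\<alpha> y \<noteq> 0" for n y y'
            using \<alpha>(2) [OF that(1) x(1) that(2) x(2)] nx_eq [OF that(1) x(1)] by (intro lambda_eq) auto
          \<comment> \<open>Either the coefficient of \<open>s\<close> is 0, or \<open>s\<close> has
            the series of \<open>x\<close> and hence the same constants, so that the difference
            vanishes.\<close>
          have zero: "?l' k i s * (?l' (k + n) i t - ?l' n s t) = 0" if "s \<in> I" "t \<in> I" "0 < n" for s t n
            using that eq [of s n t] l'1 [of s] l'Suc [of n t, unfolded Suc_eq_plus1_left] unfolding 1 True by (cases "\<alpha> s = 0") (auto simp: l'I)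
          show ?thesis using zero [OF pq(2,1) pos(2)] zero [OF pq pos(1)] by (simp only:)
        next
          case 2
          have "?l k' x q * (?l (k' + e) x p - ?l e q p) = ?l k' x p * (?l (k' + d) x q - ?l d p q)"
            by (rule M [OF x(1), unfolded module_constants_def, rule_format, OF pq(1) pq(2) pos(1,2) 2(2)])
          moreover have "?l' (k + n) z j = ?l (k' + n) x j" for n j
            using l'Suc [of "k' + n" j] 2 by simp
          moreover have "?l' k z j = ?l k' x j" for j using l'Suc [OF 2(2)] 2(1) by simp
          ultimately show ?thesis unfolding True l'I [OF pq(1)] l'I [OF pq(2)] by (simp only:)
        qed
      qed
    qed
  qed
  have graph_in: "j \<in> I" if "(i, j) \<in> sdse_graph ?I F'" for i j
  proof -
    have "i \<in> ?I" "mderiv j (F' i) \<noteq> 0" using that by (auto simp: sdse_graph_def)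
    then obtain m where "mcoeff (F' i) m \<noteq> 0" "j \<in># m" by (auto elim: mderiv_nonzeroE)
    then show ?thesis using series_inD [OF ser [OF \<open>i \<in> ?I\<close>]] by blast
  qed
  \<comment> \<open>No edge of the new graph ends at \<open>z\<close>, so a path starting in
    \<open>I\<close> stays there and is a path of the old graph.\<close>
  have path: "y \<in> I \<Longrightarrow> (y, w) \<in> (sdse_graph I F)\<^sup>+ \<and> w \<in> I" if "(y, w) \<in> (sdse_graph ?I F')\<^sup>+" for y w
    using that
  proof (induction rule: trancl_induct)
    case (base w)
    then show ?case using graph_in [OF base(1)] F' by (auto simp: sdse_graph_def)
  next
    case (step v w)
    then have v: "(y, v) \<in> (sdse_graph I F)\<^sup>+" "v \<in> I" by auto
    moreover have "w \<in> I" using graph_in [OF step(2)] .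
    ultimately have "(v, w) \<in> sdse_graph I F" using step(2) F' by (auto simp: sdse_graph_def)
    then show ?case using v \<open>w \<in> I\<close> by auto
  qed
  have "extended_system ?I F' Z nx'"
    unfolding extended_system_def
  proof (intro conjI ballI impI)
    show "Z \<subseteq> ?I" using Z by blast
    obtain I0 I1 J1 G r l \<nu> a where fs: "fundamental_system Z I0 I1 J1 G F r l \<nu> a"
      "\<forall>x\<in>Z. nx x \<in> Z \<and> r (nx x) \<in> I0"
      using sys [unfolded extended_system_def, THEN conjunct2, THEN conjunct1] by (elim exE conjE) (rule that)
    have "fundamental_system Z I0 I1 J1 G F' r l \<nu> a"
      by (rule fundamental_system_cong [OF fs(1)]) (use F' Z in auto)
    moreover have "\<forall>x\<in>Z. nx' x \<in> Z \<and> r (nx' x) \<in> I0" using fs(2) nx'I Z by (metis subsetD)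
    ultimately show "\<exists>I0 I1 J1 G r l \<nu> a. fundamental_system Z I0 I1 J1 G F' r l \<nu> a \<and>
        (\<forall>x\<in>Z. nx' x \<in> Z \<and> r (nx' x) \<in> I0)" by (intro exI conjI)
    show "nx' i \<in> ?I" "taylor (F' i) {#nx' i#} \<noteq> 0" if "i \<in> ?I" for i using nx' [OF that] by auto
    show "nx' i = nx' j" if "i \<in> ?I" "j \<in> ?I" "F' i = F' j" for i j
    proof -
      have "nx' k = x" if "k \<in> I" "F' k = F' z" for k
        using xi [OF that(1)] that(2) F' [OF that(1)] nx'I [OF that(1)] by simp
      moreover have "nx' i = nx' j" if "i \<in> I" "j \<in> I"
        using nx_eq [OF that] \<open>F' i = F' j\<close> F' [OF that(1)] F' [OF that(2)] nx'I [OF that(1)] nx'I [OF that(2)] by simp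
      ultimately show ?thesis using that nx'z by (metis insertE)
    qed
    show "module_constants ?I ?l' (\<lambda>k. ?l' k i)" if "i \<in> ?I" for i using M' [OF that] .
    show "affine_vertex F' y" if y: "y \<in> ?I - Z" for y
    proof (cases "y = z")
      case True
      have "j \<in> I \<and> \<alpha> j \<noteq> 0" if "mcoeff (F' z) {#j#} \<noteq> 0" for j
        using that unfolding Fz1 by (simp split: if_splits)
      then have "F' j = F' k" if "mcoeff (F' z) {#j#} \<noteq> 0" "mcoeff (F' z) {#k#} \<noteq> 0" for j k
        using \<alpha>(2) [of j k] F' [of j] F' [of k] that by metis
      then show ?thesis unfolding True affine_vertex_def using Fz2 by blast
    next
      case False
      then have yI: "y \<in> I" "y \<in> I - Z" using y by auto
      have av: "affine_vertex F y" using sys1(4) yI by blast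
      have jI: "j \<in> I" if "mcoeff (F y) {#j#} \<noteq> 0" for j
        using series_inD [OF sdseD(3) [OF sdse yI(1)] that] by simp
      have "F' j = F' k" if "mcoeff (F y) {#j#} \<noteq> 0" "mcoeff (F y) {#k#} \<noteq> 0" for j k
        using av that F' [OF jI [OF that(1)]] F' [OF jI [OF that(2)]] unfolding affine_vertex_def by metis
      then show ?thesis using av unfolding affine_vertex_def F' [OF yI(1)] by blast
    qed
    show "(y, y) \<notin> (sdse_graph ?I F')\<^sup>+" if y: "y \<in> ?I - Z" for y
    proof
      assume cyc: "(y, y) \<in> (sdse_graph ?I F')\<^sup>+"
      then have "y \<in> I" by cases (auto dest: graph_in)
      then have "(y, y) \<in> (sdse_graph I F)\<^sup>+" using path [OF cyc] by blast
      then show False using sys1(4) y \<open>y \<in> I\<close> by blast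
    qed
  qed
  then show ?thesis by (rule exI [of _ nx'])
qed

lemma extended_system_exists:
  assumes "extended_fundamental_abelian I F"
  shows "sdse I F \<Longrightarrow> \<exists>Z nx. extended_system I F Z nx"
  using assms
proof (induction rule: extended_fundamental_abelian.induct)
  case (fundamental I F)
  then show ?case using extended_system_fundamental by blast
next
  case (extension I F z F')
  then obtain Z nx where "extended_system I F Z nx" by (auto simp: is_extension_def hopf_sdse_def)
  from extended_system_extension [OF extension(2) this] show ?case by (rule exI [of _ Z])
qed

lemma extended_systemD:
  assumes "extended_system I F Z nx"
  shows "Z \<subseteq> I" "\<And>i. i \<in> I \<Longrightarrow> nx i \<in> I" "\<And>i. i \<in> I \<Longrightarrow> taylor (F i) {#nx i#} \<noteq> 0"
    "\<And>i. i \<in> I \<Longrightarrow> module_constants I (lambda F nx) (\<lambda>k. lambda F nx k i)"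
    "\<And>z. z \<in> I - Z \<Longrightarrow> affine_vertex F z" "\<And>z. z \<in> I - Z \<Longrightarrow> (z, z) \<notin> (sdse_graph I F)\<^sup>+"
  using assms unfolding extended_system_def by metis+

section \<open>Splitting off the extension vertices\<close>

lemma hereditary_subsystem_lie:
  assumes sys: "extended_system I F Z nx" and hopf: "hopf_sdse I F"
    and S: "hereditary I F S" "S \<noteq> {}"
  shows "lie_algebra (sdse_lie S F)" "\<exists>\<phi>. lie_bij \<phi> (sdse_lie S F) (lam_lie S (lambda F nx))"
    and "finite S" "i \<in> S \<Longrightarrow> nx i \<in> S" "i \<in> S \<Longrightarrow> module_constants S (lambda F nx) (\<lambda>k. lambda F nx k i)"
proof -
  have sub: "S \<subseteq> I" and ser: "\<And>i. i \<in> S \<Longrightarrow> series_in S (F i)" using S(1) by (auto simp: hereditary_def)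
  have h: "hopf_sdse S F" by (rule hopf_sdse_hereditary [OF hopf sub S(2) ser])
  have nx: "nx i \<in> S" "taylor (F i) {#nx i#} \<noteq> 0" if "i \<in> S" for i
  proof -
    show t: "taylor (F i) {#nx i#} \<noteq> 0" using extended_systemD(3) [OF sys] that sub by blast
    then have "mcoeff (F i) {#nx i#} \<noteq> 0" by simp
    from series_inD [OF ser [OF that] this] show "nx i \<in> S" by simp
  qed
  interpret walk_system S F nx
    using h nx by unfold_locales (auto simp: hopf_sdse_def hopf_subalgebra_on_def)
  have M: "module_constants S (lambda F nx) (\<lambda>k. lambda F nx k i)" if "i \<in> S" for i
    using module_constants_subset [OF extended_systemD(4) [OF sys] sub] that sub by blast
  show "lie_algebra (sdse_lie S F)" using M by (rule lie_algebra_sdse_lie)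
  show "\<exists>\<phi>. lie_bij \<phi> (sdse_lie S F) (lam_lie S (lambda F nx))" using lie_bij_from_form by (rule exI [of _ from_form])
  show "finite S" by (rule finite_I)
  show "nx i \<in> S" if "i \<in> S" using nx(1) [OF that] .
  show "module_constants S (lambda F nx) (\<lambda>k. lambda F nx k i)" if "i \<in> S" using M [OF that] .
qed

lemma acyclic_source:
  assumes "finite D" "D \<noteq> {}" "\<And>z. z \<in> D \<Longrightarrow> (z, z) \<notin> R\<^sup>+"
  shows "\<exists>z\<in>D. \<forall>y\<in>D. (y, z) \<notin> R"
proof -
  let ?R = "R \<inter> D \<times> D"
  have "finite ?R" using assms(1) by (auto intro: finite_subset [of _ "D \<times> D"])
  moreover have "acyclic ?R"
    unfolding acyclic_def
  proof (intro allI notI)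
    fix x assume x: "(x, x) \<in> ?R\<^sup>+"
    then have "x \<in> D" by cases auto
    moreover have "(x, x) \<in> R\<^sup>+" using x trancl_mono by blast
    ultimately show False using assms(3) by blast
  qed
  ultimately have "wf ?R" by (rule finite_acyclic_wf)
  moreover obtain x where "x \<in> D" using assms(2) by blast
  ultimately obtain z where "z \<in> D" "\<And>y. (y, z) \<in> ?R \<Longrightarrow> y \<notin> D" by (metis wfE_min)
  then show ?thesis by blast
qed

text \<open>The graph is acyclic on \<open>T - S\<close>, so some \<open>z\<close> in it receives no
  edge from \<open>T - S\<close>; it receives none from \<open>S\<close> either, as \<open>S\<close>
  is hereditary. Hence \<open>T - {z}\<close> is hereditary, and row \<open>z\<close> is the last
  ideal to be added.\<close>

lemma extension_chain:
  fixes F :: "'i \<Rightarrow> ('i, 'k::field_char_0) mfps"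
  assumes sys: "extended_system I F Z nx" and hopf: "hopf_sdse I F"
    and S: "hereditary I F S" "S \<noteq> {}" and acyclic: "\<forall>z\<in>I - S. (z, z) \<notin> (sdse_graph I F)\<^sup>+"
    and T: "hereditary I F T" "S \<subseteq> T"
  shows "\<exists>(m :: nat) (L :: nat \<Rightarrow> ('k, ('i, 'k) ck \<Rightarrow> 'k) lie)
            (V :: nat \<Rightarrow> ('k, ('i, 'k) ck \<Rightarrow> 'k, nat \<Rightarrow>\<^sub>0 'k) lmodule).
            L 0 = sdse_lie S F \<and>
            (\<forall>j\<in>{1..m}. lie_module (L (j - 1)) (V j) \<and> has_nat_basis (V j) \<and>
                        lie_iso (L j) (semidirect (V j) (L (j - 1)))) \<and>
            L m = sdse_lie T F"
  using T
proof (induction "card (T - S)" arbitrary: T)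
  case 0
  have "finite T" using hereditary_subsystem_lie(3) [OF sys hopf 0(2)] 0(3) S(2) by blast
  then have "T = S" using 0 by auto
  then show ?case by (intro exI [of _ "0::nat"] exI [of _ "\<lambda>_. sdse_lie S F"]) simp
next
  case (Suc n)
  have "T \<noteq> {}" using Suc.prems(2) S(2) by blast
  note T = hereditary_subsystem_lie [OF sys hopf Suc.prems(1) \<open>T \<noteq> {}\<close>]
  have TI: "T \<subseteq> I" and serT: "\<And>i. i \<in> T \<Longrightarrow> series_in T (F i)"
    using Suc.prems(1) by (auto simp: hereditary_def)
  have "finite (T - S)" using T(3) by simp
  moreover have "T - S \<noteq> {}" using Suc.hyps(2) by (metis Zero_not_Suc card.empty)
  moreover have "(y, y) \<notin> (sdse_graph I F)\<^sup>+" if "y \<in> T - S" for y using that TI acyclic by blast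
  ultimately have "\<exists>z\<in>T - S. \<forall>y\<in>T - S. (y, z) \<notin> sdse_graph I F" by (rule acyclic_source)
  then obtain z where z: "z \<in> T - S" and source: "\<And>y. y \<in> T - S \<Longrightarrow> (y, z) \<notin> sdse_graph I F"
    by blast
  let ?T = "T - {z}"
  have sub: "S \<subseteq> ?T" using Suc.prems(2) z by blast
  have serS: "\<And>i. i \<in> S \<Longrightarrow> series_in S (F i)" using S(1) by (auto simp: hereditary_def)
  have ser: "series_in ?T (F i)" if i: "i \<in> T" for i
  proof (cases "i \<in> S")
    case True
    show ?thesis by (rule series_in_mono [OF serS [OF True] sub])
  next
    case False
    show ?thesis
    proof (rule series_in_subset [OF serT [OF i]])
      fix k assume k: "k \<in> T" "mderiv k (F i) \<noteq> 0"
      have "(i, z) \<notin> sdse_graph I F" using source i False by blast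
      then have "k \<noteq> z" using k i TI by (auto simp: sdse_graph_def)
      then show "k \<in> ?T" using k(1) by blast
    qed
  qed
  have her: "hereditary I F ?T" using TI ser by (auto simp: hereditary_def)
  have "?T - S = (T - S) - {z}" by blast
  then have "n = card (?T - S)" using Suc.hyps(2) z T(3) by simp
  from Suc.hyps(1) [OF this her sub] obtain m :: nat
    and L :: "nat \<Rightarrow> ('k, ('i, 'k) ck \<Rightarrow> 'k) lie"
    and V :: "nat \<Rightarrow> ('k, ('i, 'k) ck \<Rightarrow> 'k, nat \<Rightarrow>\<^sub>0 'k) lmodule"
    where L0: "L 0 = sdse_lie S F" and step: "\<forall>j\<in>{1..m}. lie_module (L (j - 1)) (V j) \<and> has_nat_basis (V j) \<and>
                        lie_iso (L j) (semidirect (V j) (L (j - 1)))" and Lm: "L m = sdse_lie ?T F"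
    by (elim exE conjE) (rule that)
  have "?T \<noteq> {}" using sub S(2) by blast
  note T' = hereditary_subsystem_lie [OF sys hopf her \<open>?T \<noteq> {}\<close>]
  obtain \<phi> where \<phi>: "lie_bij \<phi> (sdse_lie ?T F) (lam_lie ?T (lambda F nx))" using T'(2) by blast
  have ins: "insert z ?T = T" using z by blast
  have zero: "lambda F nx k j z = 0" if "j \<in> T" for j k
    by (rule lambda_zero [of j T _ ?T]) (use that T(4) ser in auto)
  let ?V = "coord_module \<phi> (\<lambda>k. lambda F nx k z)"
  have "z \<notin> ?T" by blast
  note ext = lam_lie_insert [OF T'(1) \<phi> T'(3) \<open>z \<notin> ?T\<close>, unfolded ins, OF T(5) zero, simplified]
  obtain \<psi> where "lie_bij \<psi> (sdse_lie T F) (lam_lie T (lambda F nx))" using T(2) by blast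
  then have "lie_iso (sdse_lie T F) (lam_lie T (lambda F nx))"
    unfolding lie_iso_iff using T(1) lie_algebra_lam_lie [OF T(3) T(5)] by blast
  then have iso: "lie_iso (sdse_lie T F) (semidirect ?V (sdse_lie ?T F))" using ext(3) by (rule lie_iso_trans)
  let ?L = "L(Suc m := sdse_lie T F)" and ?V' = "V(Suc m := ?V)"
  have "lie_module (?L (j - 1)) (?V' j) \<and> has_nat_basis (?V' j) \<and>
      lie_iso (?L j) (semidirect (?V' j) (?L (j - 1)))" if j: "j \<in> {1..Suc m}" for j
  proof (cases "j = Suc m")
    case True
    then show ?thesis using ext(1,2) iso Lm by simp
  next
    case False
    then have "j \<in> {1..m}" "j - 1 \<noteq> Suc m" using j by auto
    then show ?thesis using step False by simp
  qed
  then show ?case using L0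
    by (intro exI [of _ "Suc m"] exI [of _ ?L] exI [of _ ?V'] conjI ballI) (assumption | simp)+
qed

lemma abelian_form_iso:
  assumes iso: "lie_iso L L'" and form: "abelian_form L'"
  shows "abelian_form L"
  using form [unfolded abelian_form_def]
proof (elim exE conjE)
  fix M N Q \<upsilon> U
  assume U: "\<forall>p\<in>{1..Q}. (\<exists>\<nu>. U p = W_mod \<nu>) \<or>
      (\<exists>\<nu> \<mu>. (\<forall>i\<in>{1..M}. \<forall>j\<in>{1..N}. \<mu> j * (\<nu> i - \<upsilon> j i) = 0) \<and> U p = W'_mod N \<nu> \<mu>)"
    and "lie_iso L' (semidirect (direct_sum_module {1..Q} U) (V_gab M N \<upsilon>))"
  then have "lie_iso L (semidirect (direct_sum_module {1..Q} U) (V_gab M N \<upsilon>))"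
    using lie_iso_trans [OF iso] by blast
  with U show ?thesis unfolding abelian_form_def
    by (intro exI [of _ M] exI [of _ N] exI [of _ Q] exI [of _ \<upsilon>] exI [of _ U] conjI)
qed

text \<open>A vertex added by an extension is affine and on no cycle, hence an extension vertex,
  which places \<open>I'\<close> inside the core \<open>Z\<close>; the loops put \<open>A0\<close>
  inside \<open>I'\<close>. The two may differ from \<open>I'\<close>, as \<open>A1\<close> and
  \<open>AJ\<close> can contain extension vertices. Closure under descendants then reduces to the
  edges from \<open>AJ\<close> to \<open>A1\<close>.\<close>

lemma nonextension_vertices_fundamental:
  assumes sys: "extended_system I F Z nx" and hopf: "hopf_sdse I F"
  defines "I' \<equiv> nonextension_vertices I F"
  shows "hereditary I F I'" "I' \<noteq> {}" "z \<in> I - I' \<Longrightarrow> (z, z) \<notin> (sdse_graph I F)\<^sup>+"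
    "abelian_form (sdse_lie I' F)"
proof -
  have sdse: "sdse I F" using hopf by (simp add: hopf_sdse_def)
  have ext: "extension_vertex I F z" if "z \<in> I - I'" for z
    using that by (simp add: I'_def nonextension_vertices_def)
  show "(z, z) \<notin> (sdse_graph I F)\<^sup>+" if "z \<in> I - I'"
    using extension_vertexD(1) [OF ext [OF that] sdse] .
  have ZI: "Z \<subseteq> I" by (rule extended_systemD [OF sys])
  have I'I: "I' \<subseteq> I" by (auto simp: I'_def nonextension_vertices_def)
  have I'Z: "I' \<subseteq> Z"
  proof
    fix z assume z: "z \<in> I'"
    show "z \<in> Z"
    proof (rule ccontr)
      assume "z \<notin> Z"
      then have zZ: "z \<in> I - Z" using z I'I by blast
      have "extension_vertex I F z"
        by (rule affine_extension_vertex [OF hopf _ extended_systemD(5,6) [OF sys zZ]]) (use zZ in blast)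
      then show False using z by (simp add: I'_def nonextension_vertices_def)
    qed
  qed
  obtain I0 I1 J1 G r l \<nu> a where fs: "fundamental_system Z I0 I1 J1 G F r l \<nu> a"
    and nxZ: "\<forall>x\<in>Z. nx x \<in> Z \<and> r (nx x) \<in> I0"
    using sys [unfolded extended_system_def, THEN conjunct2, THEN conjunct1] by (elim exE conjE) (rule that)
  interpret fundamental_system Z I0 I1 J1 G F r l \<nu> a by (rule fs)
  have A0I': "A0 \<subseteq> I'"
  proof
    fix x assume x: "x \<in> A0"
    then have xI: "x \<in> I" using ZI by (auto simp: A0_def)
    then have "(x, x) \<in> (sdse_graph I F)\<^sup>+" using A0_loop [OF x] by (intro r_into_trancl) (simp add: sdse_graph_def)
    then show "x \<in> I'" using ext extension_vertexD(1) [OF _ sdse] xI by blast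
  qed
  then show ne: "I' \<noteq> {}" using A0_nonempty by blast
  have target: "y \<in> A0 \<union> A1" if "x \<in> Z" "mderiv y (F x) \<noteq> 0" for x y
    using mderiv_targets [OF that(2)] that(1) Z_eq by blast
  have path: "y \<in> A0 \<union> A1" if "x \<in> Z" "(x, y) \<in> (sdse_graph I F)\<^sup>+" for x y
    using that(2)
  proof (induction rule: trancl_induct)
    case (base y)
    then show ?case using target [OF that(1)] by (simp add: sdse_graph_def)
  next
    case (step v w)
    then have "v \<in> Z" using Z_eq by blast
    then show ?case using target [of v w] step(2) by (simp add: sdse_graph_def)
  qed
  have closed: "j \<in> I'" if i: "i \<in> I'" and j: "j \<in> I" "mderiv j (F i) \<noteq> 0" for i j
  proof (cases "j \<in> A0")
    case True
    then show ?thesis using A0I' by blast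
  next
    case False
    have iZ: "i \<in> Z" using i I'Z by blast
    \<comment> \<open>Edges from \<open>A0\<close> and \<open>A1\<close> end in \<open>A0\<close>,
      so an edge that does not must lead from \<open>AJ\<close> to \<open>A1\<close>.\<close>
    then have iJ: "i \<in> AJ" using mderiv_targets(1) [OF j(2)] False Z_eq by blast
    then have jA: "j \<in> A1" "a (r i) (r j) \<noteq> 0" using mderiv_targets(2) [OF j(2)] False by blast+
    show ?thesis
    proof (rule ccontr)
      assume "j \<notin> I'"
      then have "extension_vertex I F j" using ext j(1) by blast
      then have "affine_vertex F i"
        using spouse_affine [OF iJ jA] extension_vertexD(2) [OF _ sdse] by blast
      \<comment> \<open>Every edge that starts in \<open>Z\<close> ends in \<open>A0\<close> or
        \<open>A1\<close>, so a vertex of \<open>AJ\<close> lies on no cycle.\<close>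
      moreover have "(i, i) \<notin> (sdse_graph I F)\<^sup>+" using path [OF iZ] iJ A_disjoint by blast
      ultimately have "extension_vertex I F i" using i I'I by (intro affine_extension_vertex [OF hopf]) auto
      then show False using i by (simp add: I'_def nonextension_vertices_def)
    qed
  qed
  show her: "hereditary I F I'"
    unfolding hereditary_def
  proof (intro conjI ballI)
    fix i assume i: "i \<in> I'"
    then have "series_in I (F i)" using sdseD(3) [OF sdse] I'I by blast
    then show "series_in I' (F i)" by (rule series_in_subset) (rule closed [OF i])
  qed (rule I'I)
  have nx0: "nx x \<in> A0" if "x \<in> Z" for x using nxZ that by (auto simp: A0_def)
  have nx1: "taylor (F x) {#nx x#} \<noteq> 0" if "x \<in> Z" for x
    using extended_systemD(3) [OF sys] that ZI by blast
  interpret ac: abelian_constants A0 A1 AJ "lambda F nx" r l "\<lambda>i. \<nu> (r i)"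
    "\<lambda>i. if i \<in> A1 then a (r i) else b (r i)" "\<lambda>i j. a (r i) (r j) * l j"
    using nx0 nx1 by (rule abelian_constants)
  interpret sub: abelian_constants A0 "A1 \<inter> I'" "AJ \<inter> I'" "lambda F nx" r l "\<lambda>i. \<nu> (r i)"
    "\<lambda>i. if i \<in> A1 then a (r i) else b (r i)" "\<lambda>i j. a (r i) (r j) * l j"
    by (rule ac.subset_constants) auto
  have "A0 \<union> A1 \<inter> I' \<union> AJ \<inter> I' = I'" using A0I' I'Z Z_eq by blast
  then have form: "abelian_form (lam_lie I' (lambda F nx))" using sub.abelian_form_lam_lie by simp
  note lie = hereditary_subsystem_lie [OF sys hopf her ne]
  have "lie_iso (sdse_lie I' F) (lam_lie I' (lambda F nx))"
    unfolding lie_iso_iff using lie(1,2) lie_algebra_lam_lie [OF lie(3) lie(5)] by blast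
  then show "abelian_form (sdse_lie I' F)" using form by (rule abelian_form_iso)
qed

theorem theorem70:
  fixes I :: "'i set" and F :: "'i \<Rightarrow> ('i, 'k::field_char_0) mfps"
  assumes "hopf_sdse I F"
    and "connected_sdse I F"
    and "extended_fundamental_abelian I F"
  shows "let I' = nonextension_vertices I F in
         (\<exists>(m :: nat) (L :: nat \<Rightarrow> ('k, ('i, 'k) ck \<Rightarrow> 'k) lie)
            (V :: nat \<Rightarrow> ('k, ('i, 'k) ck \<Rightarrow> 'k, nat \<Rightarrow>\<^sub>0 'k) lmodule).
            L 0 = sdse_lie I' (restrict_sdse I' F) \<and>
            (\<forall>j\<in>{1..m}. lie_module (L (j - 1)) (V j) \<and> has_nat_basis (V j) \<and>
                        lie_iso (L j) (semidirect (V j) (L (j - 1)))) \<and>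
            lie_iso (sdse_lie I F) (L m))
      \<and> abelian_form (sdse_lie I' (restrict_sdse I' F))
      \<and> (\<forall>(J :: 'j set) (G :: 'j \<Rightarrow> ('j, 'k) mfps).
            hopf_sdse J G \<and> extended_fundamental_abelian J G \<and> nonextension_vertices J G = J
            \<longrightarrow> abelian_form (sdse_lie J G))"
  unfolding Let_def
proof (intro conjI allI impI)
  let ?I = "nonextension_vertices I F"
  have sdse: "sdse I F" using assms(1) by (simp add: hopf_sdse_def)
  obtain Z nx where sys: "extended_system I F Z nx" using extended_system_exists [OF assms(3) sdse] by blast
  note nonext = nonextension_vertices_fundamental [OF sys assms(1)]
  have ser: "series_in ?I (F i)" if "i \<in> ?I" for i using nonext(1) that by (auto simp: hereditary_def)
  have eq: "sdse_lie ?I (restrict_sdse ?I F) = sdse_lie ?I F"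
    by (rule sdse_lie_cong, rule restrict_sdse_eq, rule ser)
  have I: "hereditary I F I" using sdseD(3) [OF sdse] by (auto simp: hereditary_def)
  have sub: "?I \<subseteq> I" by (auto simp: nonextension_vertices_def)
  have acyclic: "\<forall>z\<in>I - ?I. (z, z) \<notin> (sdse_graph I F)\<^sup>+" using nonext(3) by blast
  from extension_chain [OF sys assms(1) nonext(1,2) acyclic I sub] obtain m
    and L :: "nat \<Rightarrow> ('k, ('i, 'k) ck \<Rightarrow> 'k) lie"
    and V :: "nat \<Rightarrow> ('k, ('i, 'k) ck \<Rightarrow> 'k, nat \<Rightarrow>\<^sub>0 'k) lmodule"
    where L0: "L 0 = sdse_lie ?I F" and step: "\<forall>j\<in>{1..m}. lie_module (L (j - 1)) (V j) \<and> has_nat_basis (V j) \<and>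
                        lie_iso (L j) (semidirect (V j) (L (j - 1)))" and Lm: "L m = sdse_lie I F"
    by (elim exE conjE) (rule that)
  have "lie_iso (sdse_lie I F) (L m)"
    unfolding Lm by (rule lie_iso_refl, rule hereditary_subsystem_lie(1) [OF sys assms(1) I sdseD(2) [OF sdse]])
  then show "\<exists>(m :: nat) (L :: nat \<Rightarrow> ('k, ('i, 'k) ck \<Rightarrow> 'k) lie)
            (V :: nat \<Rightarrow> ('k, ('i, 'k) ck \<Rightarrow> 'k, nat \<Rightarrow>\<^sub>0 'k) lmodule).
            L 0 = sdse_lie ?I (restrict_sdse ?I F) \<and>
            (\<forall>j\<in>{1..m}. lie_module (L (j - 1)) (V j) \<and> has_nat_basis (V j) \<and>
                        lie_iso (L j) (semidirect (V j) (L (j - 1)))) \<and>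
            lie_iso (sdse_lie I F) (L m)"
    unfolding eq using L0 step by (intro exI [of _ m] exI [of _ L] exI [of _ V] conjI)
  show "abelian_form (sdse_lie ?I (restrict_sdse ?I F))" unfolding eq by (rule nonext(4))
next
  fix J :: "'j set" and G :: "'j \<Rightarrow> ('j, 'k) mfps"
  assume J: "hopf_sdse J G \<and> extended_fundamental_abelian J G \<and> nonextension_vertices J G = J"
  then have "sdse J G" by (simp add: hopf_sdse_def)
  then obtain Z nx where "extended_system J G Z nx" using extended_system_exists J by blast
  \<comment> \<open>The same description of the non-extension part, which is now the whole
    system.\<close>
  then have "abelian_form (sdse_lie (nonextension_vertices J G) G)"
    using J by (intro nonextension_vertices_fundamental(4)) auto
  then show "abelian_form (sdse_lie J G)" using J by simp
qed

end
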